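(* Assume (A1)–(A4). Fix $\varepsilon>0$, $\Gamma\succ0$ (of size $d_x\times d_x$), a probability density $\lambda\in C_c^\infty[B(\theta,\varepsilon)]$ and a positive semidefinite matrix $\Psi\succeq0$ of size $d_\theta\times d_\theta$. Then for every policy $\pi$, $$\sup_{\theta'\in B(\theta,\varepsilon)}R_T^\pi(\theta')\ \ge\ \sum_{k=1}^{\lfloor\sqrt{T-1}\rfloor}\big[\mathbf P^\pi_{\theta'\sim\lambda}(A_k^T)\big]^2\,\mathrm{tr}\Big(\big(\Gamma\otimes[R+B^\top(\theta)P(\theta)B(\theta)+O(\varepsilon)]\big)\big(\mathsf D_\theta\mathrm{vec}K(\theta)+O(\varepsilon)\big)\,M_{k,T}\,\big(\mathsf D_\theta\mathrm{vec}K(\theta)+O(\varepsilon)\big)^\top\Big)+O(1),$$ where $$M_{k,T}=\sqrt T\Big(\mathbf E^\pi_{\theta'\sim\lambda}\,\mathtt I^{(k+1)\lfloor\sqrt T\rfloor}(\theta')+\mathtt J(\lambda)+\Psi\Big)^{-1},\qquad A_k^T=\Big\{\sum_{t=k\lceil\sqrt T\rceil}^{(k+1)\lfloor\sqrt T\rfloor}x_tx_t^\top\succeq\sqrt T\,\Gamma\Big\}.$$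
   Context: Setting. $\Theta\subset\mathbb R^{d_\theta}$ is open and $\theta\in\Theta$ is fixed. The controlled process on $\mathbb R^{d_x}$ is $x_{t+1}=Ax_t+B(\theta)u_t+w_t$, $x_0=0$, with $u_t\in\mathbb R^{d_u}$, $A\in\mathbb R^{d_x\times d_x}$ known, $B(\theta)\in\mathbb R^{d_x\times d_u}$. A policy $\pi$ chooses each $u_t$ measurably with respect to the $\sigma$-field generated by $x_1,\dots,x_t$ and possible auxiliary randomization, without knowledge of $\theta$. $V_T^\pi(\theta)=\sum_{t=0}^{T-1}\mathbf E_\theta^\pi[x_t^\top Qx_t+u_t^\top Ru_t]$, and the regret is $R_T^\pi(\theta)=V_T^\pi(\theta)-V_T^*(\theta)$, where $V_T^*(\theta)$ is the optimal cost over horizon $T$ when $\theta$ is known. Assumptions. (A1) $\{w_t\}$ is i.i.d. with density $p\in C^1(\mathbb R^{d_x})$, zero mean, $\mathbf Ew_tw_t^\top=\Sigma_w$, and finite Fisher information $\mathtt J(p)$. (A2) $Q\succ0$, $R\succ0$. (A3) The system is stabilizable at $\theta$. (A4) $\mathrm{vec}\,B(\theta)=L\theta+\mathrm{vec}\,B_0$ with $L\in\mathbb R^{d_xd_u\times d_\theta}$, $B_0\in\mathbb R^{d_x\times d_u}$. $P(\theta)$ is the stabilizing solution of $P=Q+A^\top PA-A^\top PB(R+B^\top PB)^{-1}B^\top PA$ with $B=B(\theta)$, and $K(\theta)=-(R+B^\top PB)^{-1}B^\top PA$, so the optimal stationary policy is $u_t=K(\theta)x_t$. For a density $\lambda$ on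 $\mathbb R^d$, $\mathtt J(\lambda)=\int\nabla\log\lambda(z)[\nabla\log\lambda(z)]^\top\lambda(z)\,dz$. The Fisher information about the parameter in the observations $(x^{t+1},u^t)$ is $\mathtt I^t(\theta')=\mathbf E^\pi_{\theta'}\sum_{j=0}^tL^\top(u_ju_j^\top\otimes\mathtt J(p))L$. $\mathbf E^\pi_{\theta'\sim\lambda}$, $\mathbf P^\pi_{\theta'\sim\lambda}$ are expectation and probability when $\theta'$ is drawn from $\lambda$ and the system with parameter $\theta'$ is run under $\pi$. $O(\varepsilon)$ denotes matrices of norm at most a constant (independent of $T$) times $\varepsilon$; $O(1)$ is bounded in $T$. $\mathsf D_\theta$ is the Jacobian, $\otimes$ the Kronecker product, $\mathrm{vec}$ stacks columns, $\succeq$ is the positive semidefinite order, $B(\theta,\varepsilon)$ the ball of radius $\varepsilon$ about $\theta$, and $C_c^\infty[B(\theta,\varepsilon)]$ the smooth functions compactly supported in that ball. *)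

theory Defs
  imports "HOL-Probability.Probability"
begin

definition outer :: "real^'m \<Rightarrow> real^'n \<Rightarrow> real^'n^'m" where
  "outer x y = (\<chi> i j. x $ i * y $ j)"

text \<open>Column stacking: the entry in row \<open>i\<close> and column \<open>j\<close> gets the index \<open>(j, i)\<close>, the column
  being the major index. \<open>kron\<close> uses the same convention; see \<open>stack_cols_mult\<close>.\<close>

definition stack_cols :: "real^'n^'m \<Rightarrow> real^('n \<times> 'm)" where
  "stack_cols M = (\<chi> ji. M $ snd ji $ fst ji)"

definition kron :: "real^'n^'m \<Rightarrow> real^'q^'p \<Rightarrow> real^('n \<times> 'q)^('m \<times> 'p)" where
  "kron X Y = (\<chi> r c. X $ fst r $ fst c * Y $ snd r $ snd c)"

lemma stack_cols_mult:
  fixes X :: "real^'b^'a" and Y :: "real^'c^'b" and Z :: "real^'e^'c"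
  shows "stack_cols (X ** Y ** Z) = kron (transpose Z) X *v stack_cols Y"
proof -
  have "(\<Sum>c\<in>UNIV. (\<Sum>b\<in>UNIV. X $ i $ b * Y $ b $ c) * Z $ c $ j) =
      (\<Sum>q\<in>UNIV. Z $ fst q $ j * X $ i $ snd q * Y $ snd q $ fst q)" for i j
    by (simp add: sum_distrib_left sum_distrib_right sum.cartesian_product UNIV_Times_UNIV[symmetric]
        case_prod_unfold mult_ac del: UNIV_Times_UNIV)
  then show ?thesis
    by (simp add: vec_eq_iff stack_cols_def kron_def matrix_matrix_mult_def matrix_vector_mult_def
        transpose_def)
qed

definition psd :: "real^'n^'n \<Rightarrow> bool" where
  "psd M \<longleftrightarrow> transpose M = M \<and> (\<forall>x. 0 \<le> x \<bullet> (M *v x))"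

definition pos_def :: "real^'n^'n \<Rightarrow> bool" where
  "pos_def M \<longleftrightarrow> transpose M = M \<and> (\<forall>x. x \<noteq> 0 \<longrightarrow> 0 < x \<bullet> (M *v x))"

definition schur_stable :: "real^'n^'n \<Rightarrow> bool" where
  "schur_stable M \<longleftrightarrow>
     (\<forall>(c::complex) (v::complex^'n). v \<noteq> 0 \<and> (\<chi> i j. complex_of_real (M $ i $ j)) *v v = c *s v
        \<longrightarrow> cmod c < 1)"

definition gradient :: "(real^'n \<Rightarrow> real) \<Rightarrow> real^'n \<Rightarrow> real^'n" where
  "gradient f z = (\<chi> i. frechet_derivative f (at z) (axis i 1))"

primrec Ck :: "nat \<Rightarrow> (real^'n \<Rightarrow> real) \<Rightarrow> bool" where
  "Ck 0 f \<longleftrightarrow> continuous_on UNIV f"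
| "Ck (Suc k) f \<longleftrightarrow> (\<forall>z. f differentiable (at z)) \<and> (\<forall>i. Ck k (\<lambda>z. gradient f z $ i))"

definition Cc_infinity :: "(real^'n) set \<Rightarrow> (real^'n \<Rightarrow> real) \<Rightarrow> bool" where
  "Cc_infinity S f \<longleftrightarrow>
     (\<forall>k. Ck k f) \<and> compact (closure {z. f z \<noteq> 0}) \<and> closure {z. f z \<noteq> 0} \<subseteq> S"

definition prob_density :: "(real^'n \<Rightarrow> real) \<Rightarrow> bool" where
  "prob_density p \<longleftrightarrow> (\<forall>z. 0 \<le> p z) \<and> has_bochner_integral lborel p 1"

text \<open>Where the density vanishes the factor \<open>p z\<close> makes the integrand zero, whatever value the
  gradient of the logarithm has there.\<close>

definition fisher_integrand :: "(real^'n \<Rightarrow> real) \<Rightarrow> real^'n \<Rightarrow> real^'n^'n" where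
  "fisher_integrand p z =
     p z *\<^sub>R outer (gradient (\<lambda>y. ln (p y)) z) (gradient (\<lambda>y. ln (p y)) z)"

definition fisher :: "(real^'n \<Rightarrow> real) \<Rightarrow> real^'n^'n" where
  "fisher p = (LINT z|lborel. fisher_integrand p z)"

definition stabilizable :: "real^'x^'x \<Rightarrow> real^'u^'x \<Rightarrow> bool" where
  "stabilizable A B \<longleftrightarrow> (\<exists>F :: real^'x^'u. schur_stable (A + B ** F))"

definition input_weight :: "real^'u^'x \<Rightarrow> real^'u^'u \<Rightarrow> real^'x^'x \<Rightarrow> real^'u^'u" where
  "input_weight B R P = R + transpose B ** P ** B"

definition gain :: "real^'x^'x \<Rightarrow> real^'u^'x \<Rightarrow> real^'u^'u \<Rightarrow> real^'x^'x \<Rightarrow> real^'x^'u" where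
  "gain A B R P = - (matrix_inv (input_weight B R P) ** transpose B ** P ** A)"

definition stabilizing_solution ::
  "real^'x^'x \<Rightarrow> real^'u^'x \<Rightarrow> real^'x^'x \<Rightarrow> real^'u^'u \<Rightarrow> real^'x^'x \<Rightarrow> bool" where
  "stabilizing_solution A B Q R P \<longleftrightarrow>
     transpose P = P \<and> invertible (input_weight B R P) \<and>
     P = Q + transpose A ** P ** A
           - transpose A ** P ** B ** matrix_inv (input_weight B R P) ** transpose B ** P ** A \<and>
     schur_stable (A + B ** gain A B R P)"

definition riccati :: "real^'x^'x \<Rightarrow> real^'u^'x \<Rightarrow> real^'x^'x \<Rightarrow> real^'u^'u \<Rightarrow> real^'x^'x" where
  "riccati A B Q R = (THE P. stabilizing_solution A B Q R P)"

definition opt_gain :: "real^'x^'x \<Rightarrow> real^'u^'x \<Rightarrow> real^'x^'x \<Rightarrow> real^'u^'u \<Rightarrow> real^'x^'u" where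
  "opt_gain A B Q R = gain A B R (riccati A B Q R)"

text \<open>The auxiliary randomization is one random element with law \<open>N\<close>, drawn independently of the
  noise; it may itself be a sequence. The input at time \<open>t\<close> is a measurable function of
  \<open>x\<^sub>1, \<dots>, x\<^sub>t\<close>, passed as a function on \<open>{1..t}\<close>, and of this element.\<close>

type_synonym ('x, 'u, 'r) policy = "nat \<Rightarrow> (nat \<Rightarrow> real^'x) \<Rightarrow> 'r \<Rightarrow> real^'u"

definition is_policy :: "'r measure \<Rightarrow> ('x::finite, 'u::finite, 'r) policy \<Rightarrow> bool" where
  "is_policy N \<pi> \<longleftrightarrow>
     (\<forall>t. (\<lambda>(h, r). \<pi> t h r) \<in> borel_measurable (Pi\<^sub>M {1..t} (\<lambda>_. borel) \<Otimes>\<^sub>M N))"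

text \<open>\<open>traj \<dots> t\<close> carries the states up to time \<open>t\<close>; its values beyond \<open>t\<close> are never used.\<close>

primrec traj :: "real^'x^'x \<Rightarrow> real^'u^'x \<Rightarrow> ('x, 'u, 'r) policy \<Rightarrow> 'r \<times> (nat \<Rightarrow> real^'x)
    \<Rightarrow> nat \<Rightarrow> nat \<Rightarrow> real^'x" where
  "traj A B \<pi> \<omega> 0 = (\<lambda>_. 0)"
| "traj A B \<pi> \<omega> (Suc t) = (traj A B \<pi> \<omega> t)
     (Suc t := A *v traj A B \<pi> \<omega> t t
               + B *v \<pi> t (restrict (traj A B \<pi> \<omega> t) {1..t}) (fst \<omega>) + snd \<omega> t)"

definition state :: "real^'x^'x \<Rightarrow> real^'u^'x \<Rightarrow> ('x, 'u, 'r) policy \<Rightarrow> 'r \<times> (nat \<Rightarrow> real^'x)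
    \<Rightarrow> nat \<Rightarrow> real^'x" where
  "state A B \<pi> \<omega> t = traj A B \<pi> \<omega> t t"

definition control :: "real^'x^'x \<Rightarrow> real^'u^'x \<Rightarrow> ('x, 'u, 'r) policy \<Rightarrow> 'r \<times> (nat \<Rightarrow> real^'x)
    \<Rightarrow> nat \<Rightarrow> real^'u" where
  "control A B \<pi> \<omega> t = \<pi> t (restrict (state A B \<pi> \<omega>) {1..t}) (fst \<omega>)"

lemma traj_eq_state: "s \<le> t \<Longrightarrow> traj A B \<pi> \<omega> t s = state A B \<pi> \<omega> s"
proof (induction t)
  case (Suc t)
  then show ?case by (cases "s = Suc t") (auto simp: state_def)
qed (simp add: state_def)

lemma state_0: "state A B \<pi> \<omega> 0 = 0"
  by (simp add: state_def)

lemma state_Suc: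
  "state A B \<pi> \<omega> (Suc t) = A *v state A B \<pi> \<omega> t + B *v control A B \<pi> \<omega> t + snd \<omega> t"
proof -
  have "restrict (traj A B \<pi> \<omega> t) {1..t} = restrict (state A B \<pi> \<omega>) {1..t}"
    by (auto simp: restrict_def traj_eq_state)
  then show ?thesis
    by (simp add: state_def control_def)
qed

definition sample_space :: "'r measure \<Rightarrow> (real^'x \<Rightarrow> real) \<Rightarrow> ('r \<times> (nat \<Rightarrow> real^'x)) measure" where
  "sample_space N p = N \<Otimes>\<^sub>M Pi\<^sub>M UNIV (\<lambda>_. density lborel (\<lambda>z. ennreal (p z)))"

definition bayes_space :: "(real^'d \<Rightarrow> real) \<Rightarrow> 'r measure \<Rightarrow> (real^'x \<Rightarrow> real)
    \<Rightarrow> ((real^'d) \<times> 'r \<times> (nat \<Rightarrow> real^'x)) measure" where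
  "bayes_space \<mu> N p = density lborel (\<lambda>z. ennreal (\<mu> z)) \<Otimes>\<^sub>M sample_space N p"

text \<open>The cost of a policy may be infinite. The optimal cost is finite when \<open>p\<close> has second
  moments (zero input has finite cost), so the difference below is well defined.\<close>

definition cost :: "real^'x^'x \<Rightarrow> real^'u^'x \<Rightarrow> real^'x^'x \<Rightarrow> real^'u^'u \<Rightarrow> (real^'x \<Rightarrow> real)
    \<Rightarrow> 'r measure \<Rightarrow> nat \<Rightarrow> ('x, 'u, 'r) policy \<Rightarrow> ennreal" where
  "cost A B Q R p N T \<pi> =
     (\<Sum>t<T. \<integral>\<^sup>+\<omega>. ennreal (state A B \<pi> \<omega> t \<bullet> (Q *v state A B \<pi> \<omega> t)
                          + control A B \<pi> \<omega> t \<bullet> (R *v control A B \<pi> \<omega> t)) \<partial>sample_space N p)"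

definition opt_cost :: "real^'x^'x \<Rightarrow> real^'u^'x \<Rightarrow> real^'x^'x \<Rightarrow> real^'u^'u \<Rightarrow> (real^'x \<Rightarrow> real)
    \<Rightarrow> 'r measure \<Rightarrow> nat \<Rightarrow> ennreal" where
  "opt_cost A B Q R p N T = (INF \<pi>\<in>{\<pi>. is_policy N \<pi>}. cost A B Q R p N T \<pi>)"

definition regret :: "real^'x^'x \<Rightarrow> real^'u^'x \<Rightarrow> real^'x^'x \<Rightarrow> real^'u^'u \<Rightarrow> (real^'x \<Rightarrow> real)
    \<Rightarrow> 'r measure \<Rightarrow> nat \<Rightarrow> ('x, 'u, 'r) policy \<Rightarrow> ereal" where
  "regret A B Q R p N T \<pi> =
     enn2ereal (cost A B Q R p N T \<pi>) - enn2ereal (opt_cost A B Q R p N T)"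

definition info_integrand :: "real^'x^'x \<Rightarrow> real^'u^'x \<Rightarrow> real^'d^('u \<times> 'x) \<Rightarrow> (real^'x \<Rightarrow> real)
    \<Rightarrow> ('x, 'u, 'r) policy \<Rightarrow> nat \<Rightarrow> 'r \<times> (nat \<Rightarrow> real^'x) \<Rightarrow> real^'d^'d" where
  "info_integrand A B L p \<pi> t \<omega> =
     (\<Sum>j\<le>t. transpose L
        ** kron (outer (control A B \<pi> \<omega> j) (control A B \<pi> \<omega> j)) (fisher p) ** L)"

definition info :: "real^'x^'x \<Rightarrow> real^'u^'x \<Rightarrow> real^'d^('u \<times> 'x) \<Rightarrow> (real^'x \<Rightarrow> real)
    \<Rightarrow> 'r measure \<Rightarrow> ('x, 'u, 'r) policy \<Rightarrow> nat \<Rightarrow> real^'d^'d" where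
  "info A B L p N \<pi> t = (LINT \<omega>|sample_space N p. info_integrand A B L p \<pi> t \<omega>)"

definition bayes_info :: "real^'x^'x \<Rightarrow> (real^'d \<Rightarrow> real^'u^'x) \<Rightarrow> real^'d^('u \<times> 'x)
    \<Rightarrow> (real^'x \<Rightarrow> real) \<Rightarrow> 'r measure \<Rightarrow> ('x, 'u, 'r) policy \<Rightarrow> (real^'d \<Rightarrow> real) \<Rightarrow> nat
    \<Rightarrow> real^'d^'d" where
  "bayes_info A B L p N \<pi> \<mu> t =
     (LINT \<theta>|density lborel (\<lambda>z. ennreal (\<mu> z)). info A (B \<theta>) L p N \<pi> t)"

text \<open>This makes the Bochner integrals in \<open>bayes_info\<close> genuine: a divergent integral would be read
  as zero, that is, infinite information as none.\<close>

definition info_finite :: "real^'x^'x \<Rightarrow> (real^'d \<Rightarrow> real^'u^'x) \<Rightarrow> real^'d^('u \<times> 'x)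
    \<Rightarrow> (real^'x \<Rightarrow> real) \<Rightarrow> 'r measure \<Rightarrow> ('x, 'u, 'r) policy \<Rightarrow> (real^'d \<Rightarrow> real) \<Rightarrow> bool" where
  "info_finite A B L p N \<pi> \<mu> \<longleftrightarrow>
     (\<forall>t. integrable (bayes_space \<mu> N p) (\<lambda>(\<theta>, \<omega>). info_integrand A (B \<theta>) L p \<pi> t \<omega>))"

definition info_mat :: "real^'x^'x \<Rightarrow> (real^'d \<Rightarrow> real^'u^'x) \<Rightarrow> real^'d^('u \<times> 'x)
    \<Rightarrow> (real^'x \<Rightarrow> real) \<Rightarrow> 'r measure \<Rightarrow> ('x, 'u, 'r) policy \<Rightarrow> (real^'d \<Rightarrow> real) \<Rightarrow> real^'d^'d
    \<Rightarrow> nat \<Rightarrow> nat \<Rightarrow> real^'d^'d" where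
  "info_mat A B L p N \<pi> \<mu> \<Psi> k T =
     sqrt (real T) *\<^sub>R
       matrix_inv (bayes_info A B L p N \<pi> \<mu> ((k + 1) * nat \<lfloor>sqrt (real T)\<rfloor>) + fisher \<mu> + \<Psi>)"

definition excited :: "real^'x^'x \<Rightarrow> real^'u^'x \<Rightarrow> ('x, 'u, 'r) policy \<Rightarrow> real^'x^'x
    \<Rightarrow> nat \<Rightarrow> nat \<Rightarrow> 'r \<times> (nat \<Rightarrow> real^'x) \<Rightarrow> bool" where
  "excited A B \<pi> \<Gamma> k T \<omega> \<longleftrightarrow>
     psd ((\<Sum>t\<in>{k * nat \<lceil>sqrt (real T)\<rceil> .. (k + 1) * nat \<lfloor>sqrt (real T)\<rfloor>}.
              outer (state A B \<pi> \<omega> t) (state A B \<pi> \<omega> t)) - sqrt (real T) *\<^sub>R \<Gamma>)"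

definition excited_prob :: "real^'x^'x \<Rightarrow> (real^'d \<Rightarrow> real^'u^'x) \<Rightarrow> (real^'x \<Rightarrow> real)
    \<Rightarrow> 'r measure \<Rightarrow> ('x, 'u, 'r) policy \<Rightarrow> (real^'d \<Rightarrow> real) \<Rightarrow> real^'x^'x \<Rightarrow> nat \<Rightarrow> nat \<Rightarrow> real" where
  "excited_prob A B p N \<pi> \<mu> \<Gamma> k T =
     measure (bayes_space \<mu> N p)
       {(\<theta>, \<omega>) \<in> space (bayes_space \<mu> N p). excited A (B \<theta>) \<pi> \<Gamma> k T \<omega>}"

definition gain_jacobian :: "real^'x^'x \<Rightarrow> (real^'d \<Rightarrow> real^'u^'x) \<Rightarrow> real^'x^'x \<Rightarrow> real^'u^'u
    \<Rightarrow> real^'d \<Rightarrow> real^'d^('x \<times> 'u)" where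
  "gain_jacobian A B Q R \<theta> =
     matrix (frechet_derivative (\<lambda>\<theta>'. stack_cols (opt_gain A (B \<theta>') Q R)) (at \<theta>))"

end

theory Submission
  imports Defs "HOL-Computational_Algebra.Fundamental_Theorem_Algebra"
begin

text \<open>Let P, K and W = R + B^T P B denote the Riccati solution, the gain and the input weight
  at a parameter. Completing the square (\<open>completion_of_squares\<close>) shows that the stage
  cost is the drop of x^T P x, plus the noise contribution, plus (u - K x)^T W (u - K x). The
  stationary feedback started at 0 costs at most T times the noise contribution
  (\<open>opt_cost_le\<close>), so, up to the value of the terminal state, the regret dominates the
  accumulated distance of the inputs from K x. The terminal value is handled by stopping m steps
  early: the cost of those steps already pays for all but a fraction (1 - q)^m of the value at time
  T - m (\<open>balance_tail\<close>, \<open>balance_prefix\<close>). With m depending on \<epsilon>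
  but not on T, the errors before T - m sum to at most (1 + O(\<epsilon>)) times the regret plus a
  constant.

  The worst regret in the ball is bounded below by its average over the prior \<mu>. A policy that
  keeps u close to K x while the states are excited reveals K: regressing u on x estimates K from
  the observed path alone, and the estimation error weighted by \<Gamma> is at most the input error
  over the window divided by the excitation level (\<open>regression_bound\<close>). The Bayesian
  Cramer-Rao inequality of van Trees (\<open>van_trees\<close>), restricted to the excitation event,
  bounds the same estimation error from below. It rests on a density for the law of the path
  (\<open>path_law_fixed\<close>), integration by parts in the parameter, and the orthogonality of
  the noise scores (\<open>score_second_moment\<close>), which makes the second moment of the joint
  score equal to the prior information plus the information carried by the inputs.
  \<open>window_bound\<close> applies it to the scalar components of vec K that come from rank-one
  splittings of \<Gamma> and W and adds them up to a trace. The Jacobian enters through its mean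
  over the event, an O(\<epsilon>) perturbation of its value at \<theta>.

  Summation over the windows (\<open>windows_sum\<close>) has to cope with windows that share an
  endpoint or meet the discarded last steps. Those times are removed from the window. Excitation
  then survives at level (1 - \<epsilon>) sqrt T unless the removed states carry energy of order
  sqrt T, which Markov's inequality makes rare; the loss on the rare event is limited because every
  trace is O(\<epsilon>^2 sqrt T), the information of a prior on a ball of radius \<epsilon> being
  at least \<epsilon>^-2 (\<open>fisher_prior_ge\<close>). At most one window passes the horizon,
  and \<open>bad_window\<close> treats it separately.

  All constants have to be uniform near \<theta>. \<open>riccati_regularity\<close> supplies this:
  the stabilizing solution exists for nearby parameters by Brouwer's theorem, and differences of
  solutions solve Sylvester equations whose closed loops contract, which gives Lipschitz bounds and
  a Lipschitz derivative of the gain. Finally the factor 1 + O(\<epsilon>) in front of the regret is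
  divided out as a perturbation of W.\<close>

abbreviation qf :: "real^'n^'n \<Rightarrow> real^'n \<Rightarrow> real" where
  "qf M x \<equiv> x \<bullet> (M *v x)"

section \<open>Quadratic forms, coercivity and matrix inverses\<close>

lemma inner_transpose: "x \<bullet> (transpose M *v y) = (M *v x) \<bullet> y"
  for M :: "real^'n^'m"
  by (metis dot_lmul_matrix inner_commute vector_transpose_matrix transpose_transpose)

lemma inner_symmetric: "transpose M = M \<Longrightarrow> x \<bullet> (M *v y) = (M *v x) \<bullet> y"
  for M :: "real^'n^'n"
  by (metis inner_transpose)

lemma symmetric_iff_inner: "transpose M = M \<longleftrightarrow> (\<forall>x y. x \<bullet> (M *v y) = (M *v x) \<bullet> y)"
  for M :: "real^'n^'n"
proof
  assume "\<forall>x y. x \<bullet> (M *v y) = (M *v x) \<bullet> y"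
  then have "x \<bullet> (transpose M *v y) = x \<bullet> (M *v y)" for x y
    by (simp only: inner_transpose)
  then have "transpose M *v y = M *v y" for y
    using vector_eq_ldot by blast
  then show "transpose M = M"
    by (simp add: matrix_eq)
qed (simp add: inner_symmetric)

lemma norm_matrix_vector_le: "norm (M *v x) \<le> norm M * norm x"
  for M :: "real^'n^'m"
proof -
  have "norm (M *v x) = L2_set (\<lambda>i. \<bar>M $ i \<bullet> x\<bar>) UNIV"
    by (simp add: norm_vec_def matrix_vector_mult_def inner_vec_def mult.commute)
  also have "\<dots> \<le> L2_set (\<lambda>i. norm (M $ i) * norm x) UNIV"
    by (intro L2_set_mono) (auto simp: Cauchy_Schwarz_ineq2)
  also have "\<dots> = norm M * norm x"
    by (simp add: norm_vec_def[of M] L2_set_left_distrib)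
  finally show ?thesis .
qed

lemma bilin_le: "\<bar>x \<bullet> (M *v y)\<bar> \<le> norm M * norm x * norm y"
  for M :: "real^'n^'m"
proof -
  have "\<bar>x \<bullet> (M *v y)\<bar> \<le> norm x * norm (M *v y)"
    by (rule Cauchy_Schwarz_ineq2)
  also have "\<dots> \<le> norm x * (norm M * norm y)"
    by (intro mult_left_mono norm_matrix_vector_le) simp
  finally show ?thesis by (simp add: mult_ac)
qed

lemma qf_le: "qf M x \<le> norm M * (norm x)\<^sup>2"
  using bilin_le[of x M x] by (simp add: power2_eq_square mult.assoc)

lemma matrix_nth_eq_inner: "M $ i $ j = axis i 1 \<bullet> (M *v axis j 1)"
  for M :: "real^'n^'m"
  by (simp add: matrix_vector_mult_basis column_def inner_axis')

lemma norm_matrix_le: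
  fixes M :: "real^'n^'m"
  assumes "\<And>x y. \<bar>x \<bullet> (M *v y)\<bar> \<le> b * norm x * norm y"
  shows "norm M \<le> real CARD('m) * real CARD('n) * b"
proof -
  have b: "\<bar>M $ i $ j\<bar> \<le> b" for i j
    using assms[of "axis i 1" "axis j 1"] by (simp add: matrix_nth_eq_inner)
  have "norm (M $ i) \<le> real CARD('n) * b" for i
  proof -
    have "norm (M $ i) \<le> (\<Sum>j\<in>UNIV. \<bar>M $ i $ j\<bar>)"
      by (rule norm_le_l1_cart)
    also have "\<dots> \<le> (\<Sum>j\<in>(UNIV::'n set). b)" by (intro sum_mono b)
    finally show ?thesis by simp
  qed
  then have "(\<Sum>i\<in>UNIV. norm (M $ i)) \<le> (\<Sum>i\<in>(UNIV::'m set). real CARD('n) * b)"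
    by (intro sum_mono)
  moreover have "norm M \<le> (\<Sum>i\<in>UNIV. norm (M $ i))"
    by (simp add: norm_vec_def L2_set_le_sum)
  ultimately show ?thesis by (simp add: mult.assoc)
qed

lemma coercive_of_pos:
  fixes M :: "real^'n^'n"
  assumes "\<And>x. x \<noteq> 0 \<Longrightarrow> 0 < qf M x"
  obtains m where "0 < m" "\<And>x. m * (norm x)\<^sup>2 \<le> qf M x"
proof -
  let ?S = "sphere (0::real^'n) 1"
  have "continuous_on ?S (\<lambda>x. qf M x)"
    by (intro continuous_intros)
  moreover have "?S \<noteq> {}" by simp
  ultimately obtain z where z: "z \<in> ?S" "\<forall>y\<in>?S. qf M z \<le> qf M y"
    using continuous_attains_inf[of ?S "\<lambda>x. qf M x"] compact_sphere by blast
  have "z \<noteq> 0" using z by auto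
  have "qf M z * (norm x)\<^sup>2 \<le> qf M x" for x
  proof (cases "x = 0")
    case False
    let ?y = "x /\<^sub>R norm x"
    have "?y \<in> ?S" using False by simp
    then have "qf M z \<le> qf M ?y" using z(2) by blast
    also have "qf M ?y = qf M x / (norm x)\<^sup>2"
      by (simp add: matrix_vector_mult_scaleR power2_eq_square divide_inverse mult_ac)
    finally show ?thesis using False by (simp add: field_simps)
  qed simp
  then show ?thesis using that assms \<open>z \<noteq> 0\<close> by blast
qed

lemma coercive_of_pos_def:
  assumes "pos_def M"
  obtains m where "0 < m" "\<And>x. m * (norm x)\<^sup>2 \<le> qf M x"
  using assms coercive_of_pos unfolding pos_def_def by blast

lemma invertible_of_coercive:
  fixes M :: "real^'n^'n"
  assumes "0 < m" "\<And>x. m * (norm x)\<^sup>2 \<le> qf M x"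
  shows "invertible M"
proof -
  have "x = 0" if "M *v x = 0" for x
  proof -
    have "m * (norm x)\<^sup>2 \<le> 0" using assms(2)[of x] that by simp
    then show ?thesis using assms(1)
      by (smt (verit) mult_pos_pos norm_eq_zero zero_less_norm_iff zero_less_power)
  qed
  then show ?thesis
    using matrix_left_invertible_ker invertible_left_inverse by blast
qed

lemma
  fixes M :: "real^'n^'n"
  assumes "invertible M"
  shows matrix_inv_right_mult: "M ** matrix_inv M = mat 1"
    and matrix_inv_left_mult: "matrix_inv M ** M = mat 1"
proof -
  have "M ** matrix_inv M = mat 1 \<and> matrix_inv M ** M = mat 1"
    unfolding matrix_inv_def using assms unfolding invertible_def by (rule someI_ex)
  then show "M ** matrix_inv M = mat 1" "matrix_inv M ** M = mat 1" by auto
qed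

lemma
  fixes M :: "real^'n^'n"
  assumes "invertible M"
  shows matrix_inv_vec_right: "M *v (matrix_inv M *v x) = x"
    and matrix_inv_vec_left: "matrix_inv M *v (M *v x) = x"
  by (simp_all add: matrix_vector_mul_assoc matrix_inv_right_mult matrix_inv_left_mult assms)

text \<open>Cramer's formula for the inverse. Being rational in the entries it is Borel on all
  matrices (with entries 0 where the determinant vanishes), whereas \<open>matrix_inv\<close> is an
  arbitrary choice at singular matrices. The regression estimator needs an inverse that is
  measurable everywhere.\<close>

definition cramer_inv :: "real^'n^'n \<Rightarrow> real^'n^'n" where
  "cramer_inv M = (\<chi> k l. det (\<chi> i j. if j = k then axis l 1 $ i else M $ i $ j) / det M)"

lemma cramer_inv: "invertible M \<Longrightarrow> cramer_inv M = matrix_inv M"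
proof -
  assume M: "invertible M"
  then have d: "det M \<noteq> 0" by (simp add: invertible_det_nz)
  have "column l (matrix_inv M) = column l (cramer_inv M)" for l
  proof -
    have "M *v (matrix_inv M *v axis l 1) = axis l 1"
      by (rule matrix_inv_vec_right[OF M])
    then have "matrix_inv M *v axis l 1
        = (\<chi> k. det (\<chi> i j. if j = k then axis l 1 $ i else M $ i $ j) / det M)"
      using cramer[OF d] by blast
    then show ?thesis
      by (simp add: matrix_vector_mult_basis column_def cramer_inv_def vec_eq_iff)
  qed
  then show ?thesis by (simp add: column_def vec_eq_iff)
qed

lemma continuous_on_matrix_inv:
  fixes f :: "'a::topological_space \<Rightarrow> real^'n^'n"
  assumes "continuous_on S f" "\<And>x. x \<in> S \<Longrightarrow> invertible (f x)"
  shows "continuous_on S (\<lambda>x. matrix_inv (f x))"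
proof -
  have c: "continuous_on S (\<lambda>x. f x $ i $ j)" for i j
    using assms(1) by (intro continuous_intros)
  have "continuous_on S (\<lambda>x. if j = k then axis l 1 $ i else f x $ i $ j :: real)" for i j k l
    by (cases "j = k") (auto intro: continuous_intros c)
  then have "continuous_on S (\<lambda>x. cramer_inv (f x))"
    unfolding cramer_inv_def det_def using assms(2)
    by (intro continuous_intros continuous_on_vec_lambda c)
       (auto simp: invertible_det_nz det_def)
  then show ?thesis
    using assms(2) by (subst continuous_on_cong[OF refl, of _ _ "\<lambda>x. cramer_inv (f x)"]) (auto simp: cramer_inv)
qed

lemma borel_measurable_cramer_inv [measurable]: "cramer_inv \<in> borel_measurable borel"
proof -
  have [measurable]: "(\<lambda>M::real^'n^'n. M $ i $ j) \<in> borel_measurable borel" for i j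
    by (intro borel_measurable_continuous_onI continuous_intros)
  have [measurable]: "(\<lambda>M::real^'n^'n. if j = k then axis l 1 $ i else M $ i $ j :: real)
      \<in> borel_measurable borel" for i j k l
    by (cases "j = k") auto
  have *: "(\<lambda>M::real^'n^'n. cramer_inv M $ k $ l) \<in> borel_measurable borel" for k l
    unfolding cramer_inv_def det_def by simp
  have e: "M \<bullet> axis k (axis l 1) = M $ k $ l" for M :: "real^'n^'n" and k l
    by (simp add: inner_axis)
  show ?thesis
    by (rule borel_measurable_euclidean_space[THEN iffD2])
       (auto simp: Basis_vec_def e *)
qed

section \<open>Rank-one splittings of semidefinite matrices and traces of Kronecker products\<close>

lemma outer_mult_vec: "outer x y *v z = (y \<bullet> z) *\<^sub>R x"
  by (simp add: outer_def matrix_vector_mult_def inner_vec_def vec_eq_iff sum_distrib_left mult_ac)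

lemma qf_outer: "y \<bullet> (outer x x *v y) = (x \<bullet> y)\<^sup>2"
  by (simp add: outer_mult_vec power2_eq_square inner_commute)

lemma matrix_vector_mult_sum: "(\<Sum>i\<in>I. M i) *v x = (\<Sum>i\<in>I. M i *v x)"
  for x :: "real^'n"
  by (induction I rule: infinite_finite_induct) (simp_all add: matrix_vector_mult_add_rdistrib)

lemma transpose_outer: "transpose (outer x y) = outer y x"
  by (simp add: transpose_def outer_def vec_eq_iff mult.commute)

lemma qf_add:
  "qf M (x + y) = qf M x + qf M y + x \<bullet> (M *v y) + y \<bullet> (M *v x)"
  by (simp add: matrix_vector_right_distrib inner_add_left inner_add_right)

lemma qf_diff:
  "qf M (x - y) = qf M x + qf M y - x \<bullet> (M *v y) - y \<bullet> (M *v x)"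
  by (simp add: matrix_vector_mult_diff_distrib inner_diff_left inner_diff_right)

text \<open>Symmetric elimination, by induction on the number of nonzero diagonal entries.
  Subtracting the rank-one matrix built from a column with nonzero pivot leaves a semidefinite Schur
  complement; it kills the pivot and keeps the zero diagonal entries zero.\<close>

lemma psd_sum_outer_aux:
  fixes X :: "real^'n^'n"
  assumes "psd X"
  shows "\<exists>(f :: nat \<Rightarrow> real^'n) n. X = (\<Sum>i<n. outer (f i) (f i))"
  using assms
proof (induction "card {i. X $ i $ i \<noteq> 0}" arbitrary: X rule: less_induct)
  case less
  have sym: "x \<bullet> (X *v y) = (X *v x) \<bullet> y" for x y
    using less.prems by (intro inner_symmetric) (simp add: psd_def)
  have pos: "0 \<le> qf X x" for x using less.prems by (simp add: psd_def)
  show ?case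
  proof (cases "\<exists>i. X $ i $ i \<noteq> 0")
    case False
    have z: "X $ i $ j = 0" for i j
    proof -
      \<comment> \<open>With a zero diagonal the form at \<open>?x + ?c *\<^sub>R ?y\<close> is -2
        times the square of the entry, so nonnegativity forces the entry to vanish.\<close>
      let ?x = "axis i 1 :: real^'n" and ?y = "axis j 1 :: real^'n" and ?c = "- X $ i $ j"
      have e: "?x \<bullet> (X *v ?y) = X $ i $ j" "qf X ?x = 0" "qf X ?y = 0"
        using False matrix_nth_eq_inner[of X i j] matrix_nth_eq_inner[of X i i]
          matrix_nth_eq_inner[of X j j] by auto
      have "?y \<bullet> (X *v ?x) = X $ i $ j"
        unfolding sym[of ?y ?x] inner_commute[of "X *v ?y"] e(1)[symmetric] by (rule refl)
      then have "qf X (?x + ?c *\<^sub>R ?y) = 2 * ?c * X $ i $ j"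
        unfolding qf_add by (simp only: matrix_vector_mult_scaleR inner_scaleR_left inner_scaleR_right e)
      then have "0 \<le> - (X $ i $ j)\<^sup>2"
        using pos[of "?x + ?c *\<^sub>R ?y"] by (simp add: power2_eq_square)
      then show ?thesis by simp
    qed
    have "X = (\<Sum>i<0::nat. outer (0::real^'n) 0)" by (simp add: vec_eq_iff z)
    then show ?thesis by fast
  next
    case True
    then obtain i where i: "X $ i $ i \<noteq> 0" by blast
    let ?a = "X $ i $ i" and ?e = "axis i 1 :: real^'n"
    have apos: "?a > 0" using i pos[of ?e] by (simp add: matrix_nth_eq_inner)
    let ?c = "X *v ?e"
    define h where "h = ?c /\<^sub>R sqrt ?a"
    define Y where "Y = X - outer h h"
    have qY: "qf Y x = qf X x - (?c \<bullet> x)\<^sup>2 / ?a" for x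
      using apos by (simp add: Y_def matrix_vector_mult_diff_rdistrib inner_diff_right qf_outer h_def
          power_mult_distrib power_inverse field_simps)
    have "psd Y"
      unfolding psd_def
    proof
      show "transpose Y = Y"
        using less.prems transpose_outer[of h h]
        by (simp add: Y_def psd_def transpose_def vec_eq_iff)
      show "\<forall>x. 0 \<le> qf Y x"
      proof
        fix x
        \<comment> \<open>The minimiser of the form of X along the line through x in direction
          \<open>?e\<close>; the minimum is the form of Y, which is therefore nonnegative.\<close>
        let ?t = "- (?c \<bullet> x) / ?a"
        have "qf X (x + ?t *\<^sub>R ?e) = qf X x + 2 * ?t * (?c \<bullet> x) + ?t\<^sup>2 * ?a"
          using sym[of ?e x] sym[of x ?e]
          by (simp add: matrix_nth_eq_inner algebra_simps power2_eq_square inner_commute)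
        also have "\<dots> = qf Y x"
          using apos by (simp add: qY power2_eq_square field_simps)
        finally show "0 \<le> qf Y x" using pos by metis
      qed
    qed
    moreover have "card {j. Y $ j $ j \<noteq> 0} < card {j. X $ j $ j \<noteq> 0}"
    proof (rule psubset_card_mono)
      have "Y $ j $ j = 0" if "X $ j $ j = 0" for j
      proof -
        have "qf Y (axis j 1) \<le> 0"
          using that apos by (simp add: qY matrix_nth_eq_inner)
        moreover have "0 \<le> qf Y (axis j 1)" using \<open>psd Y\<close> by (simp add: psd_def)
        ultimately show ?thesis by (simp add: matrix_nth_eq_inner)
      qed
      moreover have "Y $ i $ i = 0"
      proof -
        have 1: "qf X ?e = ?a" "qf Y ?e = Y $ i $ i" by (simp_all only: matrix_nth_eq_inner)
        then have "?c \<bullet> ?e = ?a" by (simp only: inner_commute)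
        then show ?thesis using qY[of ?e] apos unfolding 1 by (simp add: power2_eq_square)
      qed
      ultimately show "{j. Y $ j $ j \<noteq> 0} \<subset> {j. X $ j $ j \<noteq> 0}"
        using i by blast
    qed simp
    ultimately obtain f n where f: "Y = (\<Sum>i<n::nat. outer (f i) (f i))"
      using less.hyps by blast
    let ?f = "f(n := h)"
    have "(\<Sum>i<Suc n. outer (?f i) (?f i)) = X"
      using f[symmetric] by (simp add: Y_def)
    then show ?thesis by metis
  qed
qed

lemma psd_eq_sum_outer:
  assumes "psd X"
  obtains f :: "nat \<Rightarrow> real^'n" and n where "X = (\<Sum>i<n. outer (f i) (f i))"
  using psd_sum_outer_aux[OF assms] by blast

text \<open>The stacked columns of the rank-one matrix h g^T, as \<open>stack_cols_outer\<close>
  states later; pairing it with a stacked gain K extracts the scalar h^T K g.\<close>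

definition tensor :: "real^'n \<Rightarrow> real^'m \<Rightarrow> real^('n \<times> 'm)" where
  "tensor g h = (\<chi> r. g $ fst r * h $ snd r)"

lemma kron_outer: "kron (outer g g) (outer h h) = outer (tensor g h) (tensor g h)"
  by (simp add: kron_def outer_def tensor_def vec_eq_iff mult_ac)

lemma kron_sum_left: "kron (\<Sum>i\<in>I. X i) Y = (\<Sum>i\<in>I. kron (X i) Y)"
  by (simp add: kron_def vec_eq_iff sum_distrib_right)

lemma kron_sum_right: "kron X (\<Sum>i\<in>I. Y i) = (\<Sum>i\<in>I. kron X (Y i))"
  by (simp add: kron_def vec_eq_iff sum_distrib_left)

lemma kron_scaleR_right: "kron X (c *\<^sub>R Y) = c *\<^sub>R kron X Y"
  by (simp add: kron_def vec_eq_iff)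

lemma inner_tensor_stack_cols: "tensor g h \<bullet> stack_cols K = h \<bullet> (K *v g)"
proof -
  have "tensor g h \<bullet> stack_cols K = (\<Sum>j\<in>UNIV. \<Sum>i\<in>UNIV. g $ j * h $ i * K $ i $ j)"
    by (simp add: tensor_def stack_cols_def inner_vec_def sum.cartesian_product
        UNIV_Times_UNIV[symmetric] case_prod_unfold del: UNIV_Times_UNIV)
  also have "\<dots> = (\<Sum>i\<in>UNIV. \<Sum>j\<in>UNIV. g $ j * h $ i * K $ i $ j)"
    by (rule sum.swap)
  also have "\<dots> = h \<bullet> (K *v g)"
    by (simp add: inner_vec_def matrix_vector_mult_def sum_distrib_left mult_ac)
  finally show ?thesis .
qed

lemma trace_outer_mult: "trace (outer c c ** M) = c \<bullet> (M *v c)"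
proof -
  have "trace (outer c c ** M) = (\<Sum>i\<in>UNIV. \<Sum>k\<in>UNIV. c $ i * (c $ k * M $ k $ i))"
    by (simp add: trace_def outer_def matrix_matrix_mult_def mult_ac)
  also have "\<dots> = (\<Sum>k\<in>UNIV. \<Sum>i\<in>UNIV. c $ i * (c $ k * M $ k $ i))"
    by (rule sum.swap)
  also have "\<dots> = c \<bullet> (M *v c)"
    by (simp add: inner_vec_def matrix_vector_mult_def sum_distrib_left mult_ac)
  finally show ?thesis .
qed

lemma trace_sum: "trace (\<Sum>i\<in>I. M i) = (\<Sum>i\<in>I. trace (M i))"
  by (simp add: trace_def) (rule sum.swap)

lemma matrix_mult_sum_left: "(\<Sum>i\<in>I. M i) ** N = (\<Sum>i\<in>I. M i ** N)"
  for N :: "real^'n^'m"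
  by (simp add: matrix_matrix_mult_def vec_eq_iff sum_distrib_right) (auto intro: sum.swap)

text \<open>The bridge between the matrix bound and scalar ones: once both Kronecker factors are
  split into rank-one terms, the trace is a sum of values of one quadratic form, each of which can
  be estimated by a scalar inequality.\<close>

lemma trace_kron:
  fixes G :: "real^'d^('n::finite \<times> 'm::finite)" and M :: "real^'d^'d"
  assumes "X = (\<Sum>i<a. outer (f i) (f i))" "Y = (\<Sum>j<b. outer (g j) (g j))"
  shows "trace (kron X Y ** G ** M ** transpose G) =
    (\<Sum>i<a. \<Sum>j<b. (transpose G *v tensor (f i) (g j)) \<bullet> (M *v (transpose G *v tensor (f i) (g j))))"
proof -
  have 1: "trace (outer c c ** G ** M ** transpose G) = (transpose G *v c) \<bullet> (M *v (transpose G *v c))" for c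
  proof -
    have "trace (outer c c ** G ** M ** transpose G) = trace (outer c c ** (G ** M ** transpose G))"
      by (simp add: matrix_mul_assoc)
    also have "\<dots> = c \<bullet> (G *v (M *v (transpose G *v c)))"
      unfolding trace_outer_mult by (simp only: matrix_vector_mul_assoc matrix_mul_assoc)
    also have "\<dots> = (transpose G *v c) \<bullet> (M *v (transpose G *v c))"
      using inner_transpose[of c "transpose G"] by (simp only: transpose_transpose)
    finally show ?thesis .
  qed
  have "kron X Y = (\<Sum>i<a. \<Sum>j<b. outer (tensor (f i) (g j)) (tensor (f i) (g j)))"
    unfolding assms kron_sum_left kron_sum_right kron_outer by (rule sum.swap)
  then show ?thesis
    by (simp only: matrix_mult_sum_left trace_sum 1)
qed

subsection \<open>Powers of Schur stable matrices\<close>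

text \<open>A polynomial annihilating the vector is split into linear factors; a factor whose root is not
  inside the unit disc is injective, and can be cancelled.\<close>

definition poly_apply :: "nat \<Rightarrow> complex poly \<Rightarrow> complex^'n^'n \<Rightarrow> complex^'n \<Rightarrow> complex^'n" where
  "poly_apply n f M v = (\<Sum>i<n. coeff f i *s (((*v) M ^^ i) v))"

lemma funpow_mv_commute: "((*v) M ^^ i) (M *v v) = M *v ((*v) M ^^ i) v"
  by (metis funpow_swap1)

lemma vec_scale_mult: "M *v (c *s v) = c *s (M *v v)"
  for c :: complex
  by (simp add: matrix_vector_mult_def vec_eq_iff sum_distrib_left mult_ac)

lemma mv_sum_right: "M *v (\<Sum>i\<in>I. v i) = (\<Sum>i\<in>I. M *v v i)"
  for M :: "'a::comm_ring_1^'n^'m"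
  by (induction I rule: infinite_finite_induct) (simp_all add: matrix_vector_right_distrib)

lemma funpow_mv_diff: "((*v) M ^^ i) (u - v) = ((*v) M ^^ i) u - ((*v) M ^^ i) v"
  for M :: "'a::comm_ring_1^'n^'n"
  by (induction i) (simp_all add: matrix_vector_mult_diff_distrib)

lemma funpow_mv_scale: "((*v) M ^^ i) (c *s v) = c *s ((*v) M ^^ i) v"
  for c :: complex and M :: "complex^'n^'n"
  by (induction i) (simp_all add: vec_scale_mult)

lemma poly_apply_extend:
  assumes "degree f < n" "n \<le> m"
  shows "poly_apply m f M v = poly_apply n f M v"
  unfolding poly_apply_def using assms
  by (intro sum.mono_neutral_right) (auto simp: coeff_eq_0 not_less)

lemma poly_apply_shift:
  assumes "degree g < n"
  shows "poly_apply (Suc n) ([:-c, 1:] * g) M v = poly_apply n g M (M *v v - c *s v)"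
proof -
  have c: "coeff ([:-c, 1:] * g) i = (case i of 0 \<Rightarrow> 0 | Suc j \<Rightarrow> coeff g j) - c * coeff g i" for i
    by (simp add: coeff_pCons split: nat.split)
  have "poly_apply (Suc n) ([:-c, 1:] * g) M v
      = (\<Sum>i<Suc n. (case i of 0 \<Rightarrow> 0 | Suc j \<Rightarrow> coeff g j) *s ((*v) M ^^ i) v)
        - (\<Sum>i<Suc n. (c * coeff g i) *s ((*v) M ^^ i) v)"
    unfolding poly_apply_def c by (simp add: vector_sub_rdistrib sum_subtractf)
  also have "(\<Sum>i<Suc n. (case i of 0 \<Rightarrow> 0 | Suc j \<Rightarrow> coeff g j) *s ((*v) M ^^ i) v)
      = (\<Sum>j<n. coeff g j *s ((*v) M ^^ Suc j) v)"
    by (subst sum.lessThan_Suc_shift) simp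
  also have "(\<Sum>i<Suc n. (c * coeff g i) *s ((*v) M ^^ i) v)
      = (\<Sum>i<n. (c * coeff g i) *s ((*v) M ^^ i) v)"
    using assms by (simp add: coeff_eq_0)
  also have "(\<Sum>j<n. coeff g j *s ((*v) M ^^ Suc j) v) - \<dots> = poly_apply n g M (M *v v - c *s v)"
    unfolding poly_apply_def
    by (simp add: sum_subtractf[symmetric] funpow_mv_diff funpow_mv_scale funpow_mv_commute
        vector_ssub_ldistrib mult.commute)
  finally show ?thesis .
qed

lemma poly_apply_commute:
  "poly_apply n g M (M *v v - c *s v) = M *v poly_apply n g M v - c *s poly_apply n g M v"
  by (simp add: poly_apply_def mv_sum_right vec_scale_mult funpow_mv_diff funpow_mv_scale
      funpow_mv_commute vec.scale_sum_right vector_ssub_ldistrib sum_subtractf mult.commute)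

lemma tendsto_zero_recursion:
  fixes a b :: "nat \<Rightarrow> real"
  assumes c: "0 \<le> c" "c < 1" and a: "\<And>k. 0 \<le> a k" and b: "b \<longlonglongrightarrow> 0"
    and rec: "\<And>k. a (Suc k) \<le> c * a k + b k"
  shows "a \<longlonglongrightarrow> 0"
proof (rule LIMSEQ_I)
  fix r :: real assume r: "0 < r"
  \<comment> \<open>Once the forcing is below this level, the recursion contracts towards values of
    at most r/2.\<close>
  obtain N where N: "\<And>k. k \<ge> N \<Longrightarrow> \<bar>b k\<bar> < r / 2 * (1 - c)"
    using LIMSEQ_D[OF b, of "r / 2 * (1 - c)"] r c by auto
  have bd: "a (N + j) \<le> c ^ j * a N + r / 2" for j
  proof (induction j)
    case 0
    then show ?case using r by simp
  next
    case (Suc j)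
    have "a (N + Suc j) \<le> c * a (N + j) + b (N + j)" using rec by simp
    also have "\<dots> \<le> c * (c ^ j * a N + r / 2) + r / 2 * (1 - c)"
      using N[of "N + j"] Suc c(1) by (intro add_mono mult_left_mono) auto
    finally show ?case by (simp add: field_simps)
  qed
  have "(\<lambda>j. c ^ j * a N) \<longlonglongrightarrow> 0"
    using c by (intro tendsto_mult_left_zero LIMSEQ_power_zero) auto
  then obtain J where J: "\<And>j. j \<ge> J \<Longrightarrow> \<bar>c ^ j * a N\<bar> < r / 2"
    using LIMSEQ_D[of "\<lambda>j. c ^ j * a N" 0 "r / 2"] r by auto
  have "norm (a k - 0) < r" if "k \<ge> N + J" for k
  proof -
    have "N + (k - N) = k" "J \<le> k - N" using that by auto
    then show ?thesis using bd[of "k - N"] J[of "k - N"] a[of k] by auto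
  qed
  then show "\<exists>no. \<forall>n\<ge>no. norm (a n - 0) < r" by blast
qed

lemma norm_scale_complex: "norm (c *s v) = cmod c * norm v" for v :: "complex^'n"
  by (simp add: norm_vec_def norm_mult L2_set_right_distrib)

lemma poly_apply_zero_tendsto:
  fixes M :: "complex^'n^'n"
  assumes M: "\<And>c v. v \<noteq> 0 \<Longrightarrow> M *v v = c *s v \<Longrightarrow> cmod c < 1"
    and "f \<noteq> 0" "degree f < n" "poly_apply n f M v = 0"
  shows "(\<lambda>k. ((*v) M ^^ k) v) \<longlonglongrightarrow> 0"
  using assms(2-)
proof (induction "degree f" arbitrary: f n v)
  case 0
  then obtain a where "f = [:a:]" by (metis degree_eq_zeroE)
  moreover have "poly_apply 1 f M v = 0"
    using 0 poly_apply_extend[of f 1 n M v] by simp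
  ultimately have "v = 0" using 0 by (simp add: poly_apply_def)
  moreover have "((*v) M ^^ k) 0 = 0" for k
    by (induction k) auto
  ultimately show ?case by simp
next
  case (Suc m)
  obtain c where "poly f c = 0"
    using fundamental_theorem_of_algebra[of f] Suc.hyps(2) constant_degree[of f] by auto
  then obtain g where g: "f = [:-c, 1:] * g" by (metis poly_eq_0_iff_dvd dvdE)
  have g0: "g \<noteq> 0" using Suc.prems g by auto
  then have dg: "degree g = m" using Suc.hyps(2) unfolding g by (subst (asm) degree_mult_eq) auto
  let ?y = "M *v v - c *s v"
  have "poly_apply (Suc (Suc m)) f M v = 0"
    using Suc.prems poly_apply_extend[of f "Suc (Suc m)" n M v] Suc.hyps(2) by simp
  then have y: "poly_apply (Suc m) g M ?y = 0"
    using poly_apply_shift[of g "Suc m" c M v] dg g by simp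
  have ylim: "(\<lambda>k. ((*v) M ^^ k) ?y) \<longlonglongrightarrow> 0"
    using Suc.hyps(1)[of g "Suc m" ?y] dg g0 y by simp
  \<comment> \<open>A root inside the unit disc turns the claim for v into a scalar recursion with
    ratio \<open>cmod c\<close> and vanishing forcing. Otherwise the remaining factor applied to v
    satisfies the eigenvector equation for c, so it must be zero and the root is cancelled.\<close>
  show ?case
  proof (cases "cmod c < 1")
    case True
    have rec: "norm (((*v) M ^^ Suc k) v) \<le> cmod c * norm (((*v) M ^^ k) v) + norm (((*v) M ^^ k) ?y)" for k
    proof -
      have "((*v) M ^^ Suc k) v = c *s ((*v) M ^^ k) v + ((*v) M ^^ k) ?y"
        by (simp add: funpow_mv_diff funpow_mv_scale funpow_mv_commute)
      then show ?thesis using norm_triangle_ineq norm_scale_complex by metis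
    qed
    have "(\<lambda>k. norm (((*v) M ^^ k) v)) \<longlonglongrightarrow> 0"
      by (rule tendsto_zero_recursion[OF norm_ge_zero True norm_ge_zero tendsto_norm_zero[OF ylim] rec])
    then show ?thesis by (rule tendsto_norm_zero_cancel)
  next
    case False
    have "M *v poly_apply (Suc m) g M v = c *s poly_apply (Suc m) g M v"
      using y poly_apply_commute[of "Suc m" g M v c] by simp
    then have "poly_apply (Suc m) g M v = 0" using M False by blast
    then show ?thesis using Suc.hyps(1)[of g "Suc m" v] dg g0 by simp
  qed
qed

text \<open>The first n + 1 iterates in dimension n either repeat, which gives a difference of two
  monomials, or are distinct and linearly dependent. Distinctness allows coefficients attached to
  vectors to be read as coefficients attached to exponents.\<close>

lemma ex_annihilating_poly:
  fixes M :: "complex^'n^'n"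
  obtains f n where "f \<noteq> 0" "degree f < n" "poly_apply n f M v = 0"
proof (cases "inj_on (\<lambda>i. ((*v) M ^^ i) v) {..CARD('n)}")
  case False
  then obtain i j where ij: "i < j" "((*v) M ^^ i) v = ((*v) M ^^ j) v"
    unfolding inj_on_def by (metis linorder_neqE_nat)
  let ?f = "monom 1 j - monom 1 i :: complex poly"
  have "coeff ?f j = 1" using ij by simp
  then have "?f \<noteq> 0" by (metis coeff_0 zero_neq_one)
  moreover have "degree ?f < Suc j"
    using ij degree_diff_le[of "monom 1 j" j "monom 1 i :: complex poly"] by (simp add: degree_monom_eq le_imp_less_Suc)
  moreover have "poly_apply (Suc j) ?f M v = 0"
  proof -
    have "poly_apply (Suc j) ?f M v = (\<Sum>k<Suc j. (if k = j then ((*v) M ^^ j) v else 0)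
        - (if k = i then ((*v) M ^^ i) v else 0))"
      unfolding poly_apply_def by (intro sum.cong refl) (auto simp: coeff_diff)
    also have "\<dots> = 0"
      unfolding sum_subtractf using ij by (simp add: sum.delta)
    finally show ?thesis .
  qed
  ultimately show ?thesis using that by blast
next
  case True
  let ?g = "\<lambda>i. ((*v) M ^^ i) v" and ?I = "{..CARD('n)}"
  have "card (?g ` ?I) = CARD('n) + 1" using card_image[OF True] by simp
  then have "card (?g ` ?I) > vec.dim (?g ` ?I)"
    using dim_subset_UNIV_cart_gen[of "?g ` ?I"] by linarith
  then have "vec.dependent (?g ` ?I)"
    using vec.dim_eq_card_independent[of "?g ` ?I"] by fastforce
  then obtain u where u: "\<exists>w\<in>?g ` ?I. u w \<noteq> 0" "(\<Sum>w\<in>?g ` ?I. u w *s w) = 0"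
    unfolding vec.dependent_finite[OF finite_imageI[OF finite_atMost]] by blast
  obtain i0 where i0: "i0 \<in> ?I" "u (?g i0) \<noteq> 0" using u(1) by blast
  let ?f = "(\<Sum>i\<in>?I. monom (u (?g i)) i)"
  have cf: "coeff ?f i = (if i \<in> ?I then u (?g i) else 0)" for i
    by (simp add: coeff_sum)
  have "?f \<noteq> 0" using i0 cf[of i0] by (metis coeff_0)
  moreover have "degree ?f < Suc CARD('n)"
    using degree_le[of "CARD('n)" ?f] cf by (simp add: le_imp_less_Suc)
  moreover have "poly_apply (Suc CARD('n)) ?f M v = 0"
  proof -
    have "poly_apply (Suc CARD('n)) ?f M v = (\<Sum>i\<in>?I. u (?g i) *s ?g i)"
      unfolding poly_apply_def lessThan_Suc_atMost cf by simp
    also have "\<dots> = (\<Sum>w\<in>?g ` ?I. u w *s w)"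
      by (simp add: sum.reindex[OF True])
    finally show ?thesis using u(2) by simp
  qed
  ultimately show ?thesis using that by blast
qed

lemma schur_stable_funpow_tendsto:
  fixes M :: "real^'n^'n"
  assumes "schur_stable M"
  shows "(\<lambda>k. ((*v) M ^^ k) x) \<longlonglongrightarrow> 0"
proof -
  define Mc :: "complex^'n^'n" where "Mc = (\<chi> i j. complex_of_real (M $ i $ j))"
  define c where "c = (\<lambda>x::real^'n. \<chi> i. complex_of_real (x $ i))"
  have Mc: "Mc *v c x = c (M *v x)" for x
    by (simp add: Mc_def c_def matrix_vector_mult_def vec_eq_iff)
  have pow: "((*v) Mc ^^ k) (c x) = c (((*v) M ^^ k) x)" for k
    by (induction k) (simp_all add: Mc)
  have nc: "norm (c x) = norm x" for x
    by (simp add: norm_vec_def c_def)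
  obtain f n where "f \<noteq> 0" "degree f < n" "poly_apply n f Mc (c x) = 0"
    by (rule ex_annihilating_poly)
  then have "(\<lambda>k. ((*v) Mc ^^ k) (c x)) \<longlonglongrightarrow> 0"
    using assms unfolding schur_stable_def Mc_def[symmetric]
    by (intro poly_apply_zero_tendsto[where M=Mc]) blast+
  then have "(\<lambda>k. norm (((*v) M ^^ k) x)) \<longlonglongrightarrow> 0"
    unfolding pow using tendsto_norm_zero nc by fastforce
  then show ?thesis by (rule tendsto_norm_zero_cancel)
qed

section \<open>Matrix operations as bounded bilinear maps\<close>

declare transpose_matrix_vector [simp del]

lemma minus_matrix_vector: "(- M) *v x = - (M *v x)" for M :: "real^'n^'m"
  by (simp add: matrix_vector_mult_def vec_eq_iff sum_negf)

lemma matrix_vector_minus: "M *v (- x) = - (M *v x)" for M :: "real^'n^'m"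
  by (simp add: matrix_vector_mult_def vec_eq_iff sum_negf)

lemma bounded_bilinear_matrix_vector: "bounded_bilinear ((*v) :: real^'n^'m \<Rightarrow> real^'n \<Rightarrow> real^'m)"
  by (intro bounded_bilinear.intro exI[of _ 1])
     (auto simp: matrix_vector_mult_add_rdistrib matrix_vector_right_distrib
       scaleR_matrix_vector_assoc[symmetric] matrix_vector_mult_scaleR norm_matrix_vector_le)

lemma bounded_bilinear_matrix_matrix:
  "bounded_bilinear ((**) :: real^'n^'m \<Rightarrow> real^'k^'n \<Rightarrow> real^'k^'m)"
proof (intro bounded_bilinear.intro exI[of _ "real CARD('m) * real CARD('k)"] allI)
  fix a :: "real^'n^'m" and b :: "real^'k^'n" and r :: real
  show "r *\<^sub>R a ** b = r *\<^sub>R (a ** b)" "a ** r *\<^sub>R b = r *\<^sub>R (a ** b)"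
    by (auto simp: matrix_matrix_mult_def vec_eq_iff sum_distrib_left mult_ac)
  have "\<bar>x \<bullet> ((a ** b) *v y)\<bar> \<le> (norm a * norm b) * norm x * norm y" for x y
  proof -
    have "\<bar>x \<bullet> (a *v (b *v y))\<bar> \<le> norm a * norm x * norm (b *v y)" by (rule bilin_le)
    also have "\<dots> \<le> norm a * norm x * (norm b * norm y)"
      by (intro mult_left_mono norm_matrix_vector_le) auto
    finally show ?thesis by (simp add: matrix_vector_mul_assoc mult_ac)
  qed
  from norm_matrix_le[OF this]
  show "norm (a ** b) \<le> norm a * norm b * (real CARD('m) * real CARD('k))"
    by (simp add: mult_ac)
qed (auto simp: matrix_matrix_mult_def vec_eq_iff sum.distrib algebra_simps)

lemma bounded_linear_transpose: "bounded_linear (transpose :: real^'n^'m \<Rightarrow> real^'m^'n)"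
  by (intro linear_conv_bounded_linear[THEN iffD1] linearI) (simp_all add: transpose_def vec_eq_iff)

lemmas continuous_matrix_intros =
  bounded_bilinear.continuous_on[OF bounded_bilinear_matrix_vector]
  bounded_bilinear.continuous_on[OF bounded_bilinear_matrix_matrix]
  bounded_linear.continuous_on[OF bounded_linear_transpose]

lemma norm_matrix_le_entries:
  fixes M :: "real^'n^'m"
  assumes "\<And>i j. \<bar>M $ i $ j\<bar> \<le> b"
  shows "norm M \<le> real CARD('m) * real CARD('n) * b"
proof -
  have "norm (M $ i) \<le> real CARD('n) * b" for i
  proof -
    have "norm (M $ i) \<le> (\<Sum>j\<in>UNIV. \<bar>M $ i $ j\<bar>)"
      by (rule norm_le_l1_cart)
    also have "\<dots> \<le> (\<Sum>j\<in>(UNIV::'n set). b)" by (intro sum_mono assms)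
    finally show ?thesis by simp
  qed
  then have "(\<Sum>i\<in>UNIV. norm (M $ i)) \<le> (\<Sum>i\<in>(UNIV::'m set). real CARD('n) * b)"
    by (intro sum_mono)
  moreover have "norm M \<le> (\<Sum>i\<in>UNIV. norm (M $ i))"
    by (simp add: norm_vec_def L2_set_le_sum)
  ultimately show ?thesis by (simp add: mult.assoc)
qed

text \<open>Polarisation: every entry is a quarter of the difference of two values of the form at
  vectors of norm at most 2.\<close>

lemma norm_le_of_qf:
  fixes P :: "real^'n^'n"
  assumes sym: "transpose P = P" and P: "\<And>z. 0 \<le> qf P z \<and> qf P z \<le> m * (norm z)\<^sup>2"
  shows "norm P \<le> real CARD('n) * real CARD('n) * m"
proof (rule norm_matrix_le_entries)
  fix i j
  let ?x = "axis i 1 :: real^'n" and ?y = "axis j 1 :: real^'n"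
  have m: "0 \<le> m" using P[of ?x] by simp
  have *: "0 \<le> qf P z \<and> qf P z \<le> 4 * m" if "norm z \<le> 2" for z
  proof -
    have "m * (norm z)\<^sup>2 \<le> m * 2\<^sup>2" using that m by (intro mult_left_mono power_mono) auto
    then show ?thesis using P[of z] by auto
  qed
  have "norm (?x + ?y) \<le> 2" "norm (?x - ?y) \<le> 2"
    using norm_triangle_ineq[of ?x ?y] norm_triangle_ineq4[of ?x ?y] by auto
  moreover have "4 * (?x \<bullet> (P *v ?y)) = qf P (?x + ?y) - qf P (?x - ?y)"
    using inner_symmetric[OF sym, of ?y ?x] unfolding qf_add qf_diff by (auto simp: inner_commute)
  ultimately show "\<bar>P $ i $ j\<bar> \<le> m"
    using *[of "?x + ?y"] *[of "?x - ?y"] unfolding matrix_nth_eq_inner by linarith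
qed

lemma closed_loop: "(A + B ** K) *v x = A *v x + B *v (K *v x)"
  by (simp add: matrix_vector_mult_add_rdistrib matrix_vector_mul_assoc)

subsection \<open>The Riccati equation\<close>

lemma gain_vec:
  "gain A B R P *v x = - (matrix_inv (input_weight B R P) *v (transpose B *v (P *v (A *v x))))"
  by (simp add: gain_def minus_matrix_vector matrix_vector_mul_assoc[symmetric])

lemma gain_mult:
  assumes "invertible (input_weight B R P)"
  shows "input_weight B R P *v (gain A B R P *v x) = - (transpose B *v (P *v (A *v x)))"
  by (simp add: gain_vec matrix_vector_minus matrix_inv_vec_right[OF assms])

lemma input_weight_inner:
  "u \<bullet> (input_weight B R P *v v) = u \<bullet> (R *v v) + (B *v u) \<bullet> (P *v (B *v v))"
  by (simp add: input_weight_def matrix_vector_mult_add_rdistrib inner_add_right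
      matrix_vector_mul_assoc[symmetric] inner_transpose)

lemma gain_inner:
  assumes "invertible (input_weight B R P)"
  shows "u \<bullet> (input_weight B R P *v (gain A B R P *v x)) = - ((B *v u) \<bullet> (P *v (A *v x)))"
  by (simp add: gain_mult[OF assms] inner_transpose)

definition ric :: "real^'x^'x \<Rightarrow> real^'u^'x \<Rightarrow> real^'x^'x \<Rightarrow> real^'u^'u \<Rightarrow> real^'x^'x \<Rightarrow> real^'x^'x" where
  "ric A B Q R P = Q + transpose A ** P ** A
     - transpose A ** P ** B ** matrix_inv (input_weight B R P) ** transpose B ** P ** A"

lemma ric_inner:
  "y \<bullet> (ric A B Q R P *v x) =
     y \<bullet> (Q *v x) + (A *v y) \<bullet> (P *v (A *v x)) + (A *v y) \<bullet> (P *v (B *v (gain A B R P *v x)))"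
  by (simp add: ric_def matrix_vector_mult_add_rdistrib matrix_vector_mult_diff_rdistrib
      matrix_vector_mul_assoc[symmetric] inner_add_right inner_diff_right inner_transpose
      gain_vec matrix_vector_minus)

text \<open>The identity behind the whole cost analysis: the excess of an arbitrary input over the
  minimising one is a square weighted by \<open>input_weight\<close>. It holds for any symmetric P
  with invertible weight, so it also describes one application of the Riccati map before a fixed
  point is known.\<close>

lemma completion_of_squares:
  fixes A P Q :: "real^'x^'x" and B :: "real^'u^'x"
  assumes "transpose P = P" "transpose R = R" "invertible (input_weight B R P)"
  defines "K \<equiv> gain A B R P"
  shows "qf P (A *v x + B *v u) + qf R u + qf Q x
    = qf (ric A B Q R P) x + qf (input_weight B R P) (u - K *v x)"
proof -
  let ?W = "input_weight B R P"
  note P = inner_symmetric[OF assms(1)] and R = inner_symmetric[OF assms(2)]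
  have W: "v \<bullet> (?W *v w) = w \<bullet> (?W *v v)" for v w
    unfolding input_weight_inner using P R by (metis inner_commute)
  note g = gain_inner[OF assms(3), of _ A, folded K_def]
  have 1: "(A *v x) \<bullet> (P *v (B *v v)) = (B *v v) \<bullet> (P *v (A *v x))" for v
    using P by (metis inner_commute)
  show ?thesis
    unfolding qf_add qf_diff ric_inner K_def[symmetric] W[of "K *v x" u] g 1
    by (simp add: input_weight_inner)
qed

lemma ric_symmetric:
  assumes "transpose P = P" "transpose R = R" "transpose Q = Q" "invertible (input_weight B R P)"
  shows "transpose (ric A B Q R P) = ric A B Q R P"
  unfolding symmetric_iff_inner
proof (intro allI)
  fix x y
  let ?K = "gain A B R P" and ?W = "input_weight B R P"
  note P = inner_symmetric[OF assms(1)] and R = inner_symmetric[OF assms(2)]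
    and Q = inner_symmetric[OF assms(3)]
  have W: "v \<bullet> (?W *v w) = w \<bullet> (?W *v v)" for v w
    unfolding input_weight_inner using P R by (metis inner_commute)
  have 1: "(A *v y) \<bullet> (P *v (B *v (?K *v x))) = - ((?K *v x) \<bullet> (?W *v (?K *v y)))" for x y
    unfolding gain_inner[OF assms(4)] using P[of "A *v y" "B *v (?K *v x)"] by (simp add: inner_commute)
  show "x \<bullet> (ric A B Q R P *v y) = (ric A B Q R P *v x) \<bullet> y"
    unfolding inner_commute[of "ric A B Q R P *v x"] ric_inner 1
    using W P Q by (metis inner_commute)
qed

text \<open>A quadratic Lyapunov function. If a + i b is a complex eigenvector, the sum of the forms
  at a and at b is multiplied by the squared modulus of the eigenvalue, because the cross terms
  cancel.\<close>

lemma schur_stableI: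
  fixes M P :: "real^'n^'n"
  assumes P: "\<And>x. x \<noteq> 0 \<Longrightarrow> 0 < qf P x" and dec: "\<And>x. x \<noteq> 0 \<Longrightarrow> qf P (M *v x) < qf P x"
  shows "schur_stable M"
  unfolding schur_stable_def
proof (intro allI impI; elim conjE)
  fix c :: complex and v :: "complex^'n"
  assume v: "v \<noteq> 0" and e: "(\<chi> i j. complex_of_real (M $ i $ j)) *v v = c *s v"
  define a b where "a = (\<chi> i. Re (v $ i))" and "b = (\<chi> i. Im (v $ i))"
  have e': "(\<Sum>j\<in>UNIV. complex_of_real (M $ i $ j) * v $ j) = c * v $ i" for i
    using e by (simp add: matrix_vector_mult_def vec_eq_iff)
  have Ma: "M *v a = Re c *\<^sub>R a - Im c *\<^sub>R b"
    using arg_cong[OF e', of Re] by (simp add: a_def b_def matrix_vector_mult_def vec_eq_iff)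
  have Mb: "M *v b = Re c *\<^sub>R b + Im c *\<^sub>R a"
    using arg_cong[OF e', of Im] by (simp add: a_def b_def matrix_vector_mult_def vec_eq_iff)
  have "a \<noteq> 0 \<or> b \<noteq> 0"
    using v by (auto simp: a_def b_def vec_eq_iff complex_eq_iff)
  then have lt: "qf P (M *v a) + qf P (M *v b) < qf P a + qf P b" and pos: "0 < qf P a + qf P b"
    using P[of a] P[of b] dec[of a] dec[of b] by (cases "a = 0"; cases "b = 0"; simp)+
  have "qf P (M *v a) + qf P (M *v b) = ((Re c)\<^sup>2 + (Im c)\<^sup>2) * (qf P a + qf P b)"
    unfolding Ma Mb qf_add qf_diff
    by (simp add: matrix_vector_mult_scaleR algebra_simps power2_eq_square)
  then have "(cmod c)\<^sup>2 * (qf P a + qf P b) < 1 * (qf P a + qf P b)"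
    using lt by (simp add: cmod_power2)
  then have "(cmod c)\<^sup>2 < 1\<^sup>2" using pos by (simp add: mult_less_cancel_right)
  then show "cmod c < 1" by (rule power2_less_imp_less) simp
qed

text \<open>Brouwer's theorem for the Riccati map on the compact convex set of symmetric P between 0
  and X. The image stays nonnegative, as the completed square at the optimal input shows, and stays
  below X, as comparison with the input F x and the hypothesis on X show. A fixed point dominates Q
  and is a Lyapunov function for its own closed loop, hence stabilizing.\<close>

lemma stabilizing_solution_exists:
  fixes A Q X :: "real^'x^'x" and R :: "real^'u^'u" and B :: "real^'u^'x"
  assumes Q: "pos_def Q" and R: "pos_def R" and X: "\<And>x. 0 \<le> qf X x"
    and super: "\<And>x. qf Q x + qf R (F *v x) + qf X (A *v x + B *v (F *v x)) \<le> qf X x"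
  obtains P where "stabilizing_solution A B Q R P" "\<And>x. qf Q x \<le> qf P x" "\<And>x. qf P x \<le> qf X x"
proof -
  let ?S = "{P. transpose P = P \<and> (\<forall>x. 0 \<le> qf P x) \<and> (\<forall>x. qf P x \<le> qf X x)}"
  obtain r where r: "0 < r" "\<And>u. r * (norm u)\<^sup>2 \<le> qf R u" using coercive_of_pos_def[OF R] by blast
  have symQ: "transpose Q = Q" and symR: "transpose R = R" using Q R by (auto simp: pos_def_def)
  have R0: "0 \<le> qf R u" for u using r(2)[of u] r(1) by (smt (verit) mult_nonneg_nonneg zero_le_power2)
  have Q0: "0 \<le> qf Q u" for u using Q by (cases "u = 0") (auto simp: pos_def_def less_imp_le)
  have W: "r * (norm u)\<^sup>2 \<le> qf (input_weight B R P) u" if "P \<in> ?S" for P u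
    using r(2)[of u] that by (simp add: input_weight_inner add_increasing2)
  have inv: "invertible (input_weight B R P)" if "P \<in> ?S" for P
    using invertible_of_coercive[OF r(1) W[OF that]] .
  have W0: "0 \<le> qf (input_weight B R P) u" if "P \<in> ?S" for P u
    using W[OF that, of u] r(1) by (smt (verit) mult_nonneg_nonneg zero_le_power2)
  have cs: "qf P (A *v x + B *v u) + qf R u + qf Q x
      = qf (ric A B Q R P) x + qf (input_weight B R P) (u - gain A B R P *v x)" if "P \<in> ?S" for P x u
    using that by (intro completion_of_squares symR inv) auto
  have clS: "closed ?S"
    by (intro closed_Collect_conj closed_Collect_all closed_Collect_le closed_Collect_eq
        continuous_matrix_intros continuous_intros)
  have "bounded ?S"
  proof (rule boundedI)
    fix P assume P: "P \<in> ?S"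
    then have "0 \<le> qf P z \<and> qf P z \<le> norm X * (norm z)\<^sup>2" for z
      using qf_le[of z X] by (auto intro: order_trans)
    with P show "norm P \<le> real CARD('x) * real CARD('x) * norm X"
      by (intro norm_le_of_qf) auto
  qed
  with clS have "compact ?S" by (simp add: compact_eq_bounded_closed)
  moreover have "convex ?S"
  proof (rule convexI)
    fix P P' and u v :: real
    assume *: "P \<in> ?S" "P' \<in> ?S" "0 \<le> u" "0 \<le> v" "u + v = 1"
    have q: "qf (u *\<^sub>R P + v *\<^sub>R P') x = u * qf P x + v * qf P' x" for x
      by (simp add: matrix_vector_mult_add_rdistrib scaleR_matrix_vector_assoc[symmetric] inner_add_right)
    have "u * qf P x + v * qf P' x \<le> qf X x" for x
      using * by (intro convex_bound_le) auto
    moreover have "transpose (u *\<^sub>R P + v *\<^sub>R P') = u *\<^sub>R P + v *\<^sub>R P'"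
    proof -
      have "transpose (u *\<^sub>R P + v *\<^sub>R P') = u *\<^sub>R transpose P + v *\<^sub>R transpose P'"
        by (simp add: transpose_def vec_eq_iff)
      then show ?thesis using * by simp
    qed
    ultimately show "u *\<^sub>R P + v *\<^sub>R P' \<in> ?S" using * by (auto simp: q)
  qed
  moreover have "(0::real^'x^'x) \<in> ?S" using X by (simp add: transpose_def vec_eq_iff)
  then have "?S \<noteq> {}" by blast
  moreover have "continuous_on ?S (ric A B Q R)"
    unfolding ric_def using inv
    by (intro continuous_matrix_intros continuous_intros continuous_on_matrix_inv)
       (auto simp: input_weight_def intro!: continuous_matrix_intros continuous_intros)
  moreover have "ric A B Q R \<in> ?S \<rightarrow> ?S"
  proof
    fix P assume P: "P \<in> ?S"
    have "0 \<le> qf (ric A B Q R P) x" for x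
    proof -
      let ?u = "gain A B R P *v x"
      have "0 \<le> qf P (A *v x + B *v ?u)" using P by blast
      moreover have "qf (input_weight B R P) (?u - ?u) = 0" by simp
      ultimately show ?thesis using cs[OF P, of x ?u] R0[of ?u] Q0[of x] by linarith
    qed
    moreover have "qf (ric A B Q R P) x \<le> qf X x" for x
    proof -
      have "qf P (A *v x + B *v (F *v x)) \<le> qf X (A *v x + B *v (F *v x))" using P by blast
      then show ?thesis
        using cs[OF P, of x "F *v x"] W0[OF P, of "F *v x - gain A B R P *v x"] super[of x] by linarith
    qed
    ultimately show "ric A B Q R P \<in> ?S"
      using ric_symmetric[OF _ symR symQ inv[OF P]] P by auto
  qed
  ultimately obtain P where P: "P \<in> ?S" and fp: "ric A B Q R P = P"
    using brouwer[of ?S "ric A B Q R"] by blast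
  let ?K = "gain A B R P"
  have e: "qf P (A *v x + B *v (?K *v x)) + qf R (?K *v x) + qf Q x = qf P x" for x
    using cs[OF P, of x "?K *v x"] by (simp add: fp)
  have QP: "qf Q x \<le> qf P x" for x
    using e[of x] R0[of "?K *v x"] P by (smt (verit) mem_Collect_eq)
  have posQ: "0 < qf Q x" if "x \<noteq> 0" for x using Q that by (simp add: pos_def_def)
  have "schur_stable (A + B ** ?K)"
  proof (rule schur_stableI[of P])
    fix x :: "real^'x" assume "x \<noteq> 0"
    then show "0 < qf P x" "qf P ((A + B ** ?K) *v x) < qf P x"
      using posQ[of x] QP[of x] e[of x] R0[of "?K *v x"] by (auto simp: closed_loop)
  qed
  then have "stabilizing_solution A B Q R P"
    unfolding stabilizing_solution_def using P inv[OF P] fp[unfolded ric_def] by auto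
  then show ?thesis using that QP P by blast
qed

lemma stabilizing_solution_ric: "stabilizing_solution A B Q R P \<Longrightarrow> ric A B Q R P = P"
  by (simp add: stabilizing_solution_def ric_def)

text \<open>The polarised Riccati equation with a free input u on the left: the first-order
  condition satisfied by K makes all terms in u cancel. This freedom is what permits two solutions
  to be compared.\<close>

lemma stabilizing_solution_inner:
  assumes P: "stabilizing_solution A B Q R P"
  defines "K \<equiv> gain A B R P"
  shows "y \<bullet> (P *v x) = y \<bullet> (Q *v x) + (A *v y + B *v u) \<bullet> (P *v (A *v x + B *v (K *v x)))
    + u \<bullet> (R *v (K *v x))"
proof -
  have "(B *v u) \<bullet> (P *v (B *v (K *v x))) + u \<bullet> (R *v (K *v x)) = - ((B *v u) \<bullet> (P *v (A *v x)))"
    using gain_inner[of B R P u A x] P by (simp add: input_weight_inner K_def stabilizing_solution_def)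
  moreover have "y \<bullet> (P *v x) = y \<bullet> (ric A B Q R P *v x)"
    by (simp add: stabilizing_solution_ric[OF P])
  ultimately show ?thesis
    unfolding ric_inner K_def by (simp add: matrix_vector_right_distrib inner_add_left inner_add_right)
qed

text \<open>Each solution's polarised equation is written with the feedback of the other one as the
  free input. Subtraction leaves a Sylvester equation for the difference, with one closed loop on
  each side and a forcing linear in the perturbation of B.\<close>

lemma riccati_difference:
  assumes P1: "stabilizing_solution A B1 Q R P1" and P2: "stabilizing_solution A B2 Q R P2"
    and Q: "transpose Q = Q" and R: "transpose R = R"
  defines "K1 \<equiv> gain A B1 R P1" and "K2 \<equiv> gain A B2 R P2"
  defines "C1 \<equiv> A + B1 ** K1" and "C2 \<equiv> A + B2 ** K2"
  shows "y \<bullet> ((P2 - P1) *v x) = (C2 *v y) \<bullet> ((P2 - P1) *v (C1 *v x))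
    + (C2 *v y) \<bullet> (P2 *v ((B2 - B1) *v (K1 *v x)))
    + ((B2 - B1) *v (K2 *v y)) \<bullet> (P1 *v (C1 *v x))"
proof -
  have s: "transpose P1 = P1" "transpose P2 = P2" using P1 P2 by (auto simp: stabilizing_solution_def)
  have 1: "y \<bullet> (P1 *v x) = y \<bullet> (Q *v x) + (A *v y + B1 *v (K2 *v y)) \<bullet> (P1 *v (C1 *v x))
      + (K2 *v y) \<bullet> (R *v (K1 *v x))"
    using stabilizing_solution_inner[OF P1, of y x "K2 *v y"] by (simp add: closed_loop C1_def K1_def)
  have "x \<bullet> (P2 *v y) = x \<bullet> (Q *v y) + (A *v x + B2 *v (K1 *v x)) \<bullet> (P2 *v (C2 *v y))
      + (K1 *v x) \<bullet> (R *v (K2 *v y))"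
    using stabilizing_solution_inner[OF P2, of x y "K1 *v x"] by (simp add: closed_loop C2_def K2_def)
  then have 2: "y \<bullet> (P2 *v x) = y \<bullet> (Q *v x) + (C2 *v y) \<bullet> (P2 *v (A *v x + B2 *v (K1 *v x)))
      + (K2 *v y) \<bullet> (R *v (K1 *v x))"
    using inner_symmetric[OF s(2)] inner_symmetric[OF Q] inner_symmetric[OF R] by (metis inner_commute)
  have 3: "A *v x + B2 *v (K1 *v x) = C1 *v x + (B2 - B1) *v (K1 *v x)"
    "A *v y + B1 *v (K2 *v y) = C2 *v y - (B2 - B1) *v (K2 *v y)"
    by (simp_all add: C1_def C2_def closed_loop matrix_vector_mult_diff_rdistrib)
  show ?thesis
    unfolding matrix_vector_mult_diff_rdistrib[of P2 P1] inner_diff_right 1 2 3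
    by (simp add: matrix_vector_right_distrib inner_add_right inner_diff_left)
qed

text \<open>Iterating the invariance drives both arguments to zero while the value stays the
  same.\<close>

lemma bilinear_invariant_zero:
  fixes Y :: "real^'n^'n"
  assumes inv: "\<And>x y. y \<bullet> (Y *v x) = (C2 *v y) \<bullet> (Y *v (C1 *v x))"
    and C1: "schur_stable C1" and C2: "schur_stable C2"
  shows "Y = 0"
proof -
  have "y \<bullet> (Y *v x) = 0" for x y
  proof -
    have e: "y \<bullet> (Y *v x) = (((*v) C2 ^^ k) y) \<bullet> (Y *v ((*v) C1 ^^ k) x)" for k
      by (induction k) (simp_all add: inv[symmetric])
    have "(\<lambda>k. (((*v) C2 ^^ k) y) \<bullet> (Y *v ((*v) C1 ^^ k) x)) \<longlonglongrightarrow> 0 \<bullet> (Y *v 0)"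
      by (intro tendsto_inner schur_stable_funpow_tendsto[OF C2]
          bounded_bilinear.tendsto[OF bounded_bilinear_matrix_vector] tendsto_const
          schur_stable_funpow_tendsto[OF C1])
    then show ?thesis unfolding e[symmetric] by (simp add: LIMSEQ_const_iff)
  qed
  then have "Y *v x = 0 *v x" for x by (metis inner_eq_zero_iff matrix_vector_mult_0)
  then show ?thesis by (simp add: matrix_eq)
qed

lemma stabilizing_solution_unique:
  assumes P1: "stabilizing_solution A B Q R P1" and P2: "stabilizing_solution A B Q R P2"
    and Q: "transpose Q = Q" and R: "transpose R = R"
  shows "P1 = P2"
proof -
  have "P2 - P1 = 0"
  proof (rule bilinear_invariant_zero)
    show "y \<bullet> ((P2 - P1) *v x) = ((A + B ** gain A B R P2) *v y) \<bullet> ((P2 - P1) *v ((A + B ** gain A B R P1) *v x))" for x y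
      using riccati_difference[OF P1 P2 Q R, of y x] by simp
  qed (use P1 P2 in \<open>auto simp: stabilizing_solution_def\<close>)
  then show ?thesis by simp
qed

lemma riccati_eqI:
  assumes "stabilizing_solution A B Q R P" "transpose Q = Q" "transpose R = R"
  shows "riccati A B Q R = P"
  unfolding riccati_def using assms stabilizing_solution_unique by (intro the_equality) blast+

text \<open>The Lyapunov operator is injective by \<open>bilinear_invariant_zero\<close>, hence onto
  in finite dimension. The solution is nonnegative because its form decreases along trajectories to
  the limit 0.\<close>

lemma lyapunov_solution:
  fixes M H :: "real^'n^'n"
  assumes M: "schur_stable M" and H: "\<And>x. 0 \<le> qf H x"
  obtains X where "\<And>x. 0 \<le> qf X x" "\<And>x. qf X x = qf H x + qf X (M *v x)"
proof -
  let ?f = "\<lambda>X. X - transpose M ** X ** M"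
  have lin: "linear ?f"
    by (intro linear_compose_sub linear_ident bounded_linear.linear[OF bounded_linear_compose[OF
          bounded_bilinear.bounded_linear_left[OF bounded_bilinear_matrix_matrix]
          bounded_bilinear.bounded_linear_right[OF bounded_bilinear_matrix_matrix]]])
  have f: "y \<bullet> (?f X *v x) = y \<bullet> (X *v x) - (M *v y) \<bullet> (X *v (M *v x))" for X x y
    by (simp add: matrix_vector_mult_diff_rdistrib inner_diff_right matrix_vector_mul_assoc[symmetric]
        inner_transpose)
  have "inj ?f"
    unfolding linear_injective_0[OF lin]
  proof (intro allI impI)
    fix X assume "?f X = 0"
    then have "y \<bullet> (X *v x) = (M *v y) \<bullet> (X *v (M *v x))" for x y
      using f[of y X x] by simp
    then show "X = 0" by (intro bilinear_invariant_zero[OF _ M M])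
  qed
  then have s: "surj ?f" using linear_injective_imp_surjective[OF lin] by blast
  obtain X where "H = ?f X" using surjD[OF s] by blast
  then have X: "?f X = H" by (rule sym)
  have e: "qf X x = qf H x + qf X (M *v x)" for x
    using f[of x X x] by (simp add: X)
  have "0 \<le> qf X x" for x
  proof -
    let ?x = "\<lambda>k. ((*v) M ^^ k) x"
    have le: "qf X (?x k) \<le> qf X x" for k
    proof (induction k)
      case (Suc k)
      have "qf X (?x (Suc k)) \<le> qf X (?x k)" using e[of "?x k"] H[of "?x k"] by simp
      with Suc show ?case by linarith
    qed simp
    have "(\<lambda>k. qf X (?x k)) \<longlonglongrightarrow> 0 \<bullet> (X *v 0)"
      by (intro tendsto_inner schur_stable_funpow_tendsto[OF M]
          bounded_bilinear.tendsto[OF bounded_bilinear_matrix_vector] tendsto_const)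
    then have lim: "(\<lambda>k. qf X (?x k)) \<longlonglongrightarrow> 0" by simp
    show ?thesis by (rule LIMSEQ_le_const2[OF lim]) (use le in blast)
  qed
  then show ?thesis using that e by blast
qed

text \<open>The infinite-horizon cost matrix of any stabilizing feedback F serves as the upper
  barrier X in \<open>stabilizing_solution_exists\<close>.\<close>

lemma stabilizing_solution_of_stabilizable:
  fixes A Q :: "real^'x^'x" and R :: "real^'u^'u" and B :: "real^'u^'x"
  assumes Q: "pos_def Q" and R: "pos_def R" and "stabilizable A B"
  obtains P where "stabilizing_solution A B Q R P" "\<And>x. qf Q x \<le> qf P x"
proof -
  obtain F :: "real^'x^'u" where F: "schur_stable (A + B ** F)" using assms by (auto simp: stabilizable_def)
  let ?H = "Q + transpose F ** R ** F"
  have H: "qf ?H x = qf Q x + qf R (F *v x)" for x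
    by (simp add: matrix_vector_mult_add_rdistrib inner_add_right matrix_vector_mul_assoc[symmetric] inner_transpose)
  have "0 \<le> qf Q x" "0 \<le> qf R u" for x u
    using Q R by (cases "x = 0"; cases "u = 0"; auto simp: pos_def_def less_imp_le)+
  then obtain X where X: "\<And>x. 0 \<le> qf X x" "\<And>x. qf X x = qf ?H x + qf X ((A + B ** F) *v x)"
    using lyapunov_solution[OF F, of ?H] H by (metis add_nonneg_nonneg)
  have "qf Q x + qf R (F *v x) + qf X (A *v x + B *v (F *v x)) \<le> qf X x" for x
    using X(2)[of x] unfolding H closed_loop[of A B F] by simp
  from stabilizing_solution_exists[OF Q R X(1) this] show ?thesis using that by blast
qed

subsection \<open>Functions with a quadratic Taylor remainder\<close>

text \<open>Boundedness is part of the notion so that products of such functions stay in the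
  class.\<close>

definition lip :: "'a::real_normed_vector set \<Rightarrow> ('a \<Rightarrow> 'b::real_normed_vector) \<Rightarrow> bool" where
  "lip S f \<longleftrightarrow> (\<exists>c\<ge>0. (\<forall>x\<in>S. norm (f x) \<le> c) \<and> (\<forall>x\<in>S. \<forall>y\<in>S. norm (f y - f x) \<le> c * norm (y - x)))"

text \<open>A uniform C^{1,1} condition phrased through the Taylor remainder instead of through
  regularity of f'. In this form it passes to products and inverses by elementary estimates, and it
  can be checked for a function defined only implicitly, such as the Riccati solution.\<close>

definition C11_deriv :: "'a::real_normed_vector set \<Rightarrow> ('a \<Rightarrow> 'b::real_normed_vector) \<Rightarrow> ('a \<Rightarrow> 'a \<Rightarrow> 'b) \<Rightarrow> bool" where
  "C11_deriv S f f' \<longleftrightarrow> (\<exists>c\<ge>0. \<forall>x\<in>S. norm (f x) \<le> c \<and> linear (f' x) \<and> (\<forall>h. norm (f' x h) \<le> c * norm h) \<and>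
     (\<forall>y\<in>S. norm (f y - f x - f' x (y - x)) \<le> c * (norm (y - x))\<^sup>2))"

definition C11 :: "'a::real_normed_vector set \<Rightarrow> ('a \<Rightarrow> 'b::real_normed_vector) \<Rightarrow> bool" where
  "C11 S f \<longleftrightarrow> (\<exists>f'. C11_deriv S f f')"

lemma lipI:
  assumes "\<And>x. x \<in> S \<Longrightarrow> norm (f x) \<le> a" "\<And>x y. x \<in> S \<Longrightarrow> y \<in> S \<Longrightarrow> norm (f y - f x) \<le> b * norm (y - x)"
  shows "lip S f"
  unfolding lip_def
proof (intro exI[of _ "max 0 (max a b)"] conjI ballI)
  fix x y assume *: "x \<in> S" "y \<in> S"
  have "b * norm (y - x) \<le> max 0 (max a b) * norm (y - x)" by (intro mult_right_mono) auto
  then show "norm (f y - f x) \<le> max 0 (max a b) * norm (y - x)" using assms(2)[OF *] by linarith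
qed (use assms(1) in \<open>auto simp: le_max_iff_disj\<close>)

lemma C11_derivI:
  assumes "\<And>x. x \<in> S \<Longrightarrow> norm (f x) \<le> a" "\<And>x. x \<in> S \<Longrightarrow> linear (f' x)"
    "\<And>x h. x \<in> S \<Longrightarrow> norm (f' x h) \<le> b * norm h"
    "\<And>x y. x \<in> S \<Longrightarrow> y \<in> S \<Longrightarrow> norm (f y - f x - f' x (y - x)) \<le> c * (norm (y - x))\<^sup>2"
  shows "C11_deriv S f f'"
  unfolding C11_deriv_def
proof (intro exI[of _ "max 0 (max a (max b c))"] conjI ballI allI)
  fix x y h :: 'a assume x: "x \<in> S"
  have "b * norm h \<le> max 0 (max a (max b c)) * norm h" by (intro mult_right_mono) auto
  then show "norm (f' x h) \<le> max 0 (max a (max b c)) * norm h" using assms(3)[OF x, of h] by linarith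
  assume y: "y \<in> S"
  have "c * (norm (y - x))\<^sup>2 \<le> max 0 (max a (max b c)) * (norm (y - x))\<^sup>2" by (intro mult_right_mono) auto
  then show "norm (f y - f x - f' x (y - x)) \<le> max 0 (max a (max b c)) * (norm (y - x))\<^sup>2"
    using assms(4)[OF x y] by linarith
qed (use assms in \<open>auto simp: le_max_iff_disj\<close>)

lemma lip_bilinear:
  assumes "bounded_bilinear pr" "lip S f" "lip S g"
  shows "lip S (\<lambda>x. pr (f x) (g x))"
proof -
  interpret bounded_bilinear pr by fact
  obtain K where K: "0 \<le> K" "\<And>a b. norm (pr a b) \<le> norm a * norm b * K" using nonneg_bounded by blast
  obtain a where a: "0 \<le> a" "\<And>x. x \<in> S \<Longrightarrow> norm (f x) \<le> a"
    "\<And>x y. x \<in> S \<Longrightarrow> y \<in> S \<Longrightarrow> norm (f y - f x) \<le> a * norm (y - x)" using assms(2) unfolding lip_def by blast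
  obtain b where b: "0 \<le> b" "\<And>x. x \<in> S \<Longrightarrow> norm (g x) \<le> b"
    "\<And>x y. x \<in> S \<Longrightarrow> y \<in> S \<Longrightarrow> norm (g y - g x) \<le> b * norm (y - x)" using assms(3) unfolding lip_def by blast
  show ?thesis
  proof (rule lipI[of _ _ "a * b * K" "2 * a * b * K"])
    fix x assume x: "x \<in> S"
    have "norm (pr (f x) (g x)) \<le> norm (f x) * norm (g x) * K" by (rule K)
    also have "\<dots> \<le> a * b * K" using a b x K by (intro mult_mono) auto
    finally show "norm (pr (f x) (g x)) \<le> a * b * K" .
    fix y assume y: "y \<in> S"
    have "pr (f y) (g y) - pr (f x) (g x) = pr (f y - f x) (g y) + pr (f x) (g y - g x)"
      by (simp add: diff_left diff_right)
    then have "norm (pr (f y) (g y) - pr (f x) (g x)) \<le> norm (pr (f y - f x) (g y)) + norm (pr (f x) (g y - g x))"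
      using norm_triangle_ineq by metis
    also have "\<dots> \<le> norm (f y - f x) * norm (g y) * K + norm (f x) * norm (g y - g x) * K"
      by (intro add_mono K)
    also have "\<dots> \<le> (a * norm (y - x)) * b * K + a * (b * norm (y - x)) * K"
      using a b x y K by (intro add_mono mult_mono) auto
    finally show "norm (pr (f y) (g y) - pr (f x) (g x)) \<le> 2 * a * b * K * norm (y - x)"
      by (simp add: algebra_simps)
  qed
qed

lemma lip_linear:
  assumes "bounded_linear l" "lip S f"
  shows "lip S (\<lambda>x. l (f x))"
proof -
  interpret bounded_linear l by fact
  obtain K where K: "0 \<le> K" "\<And>a. norm (l a) \<le> norm a * K" using nonneg_bounded by blast
  obtain a where a: "0 \<le> a" "\<And>x. x \<in> S \<Longrightarrow> norm (f x) \<le> a"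
    "\<And>x y. x \<in> S \<Longrightarrow> y \<in> S \<Longrightarrow> norm (f y - f x) \<le> a * norm (y - x)" using assms(2) unfolding lip_def by blast
  show ?thesis
  proof (rule lipI[of _ _ "a * K" "a * K"])
    fix x assume x: "x \<in> S"
    show "norm (l (f x)) \<le> a * K" using K(2)[of "f x"] mult_right_mono[OF a(2)[OF x] K(1)] by linarith
    fix y assume y: "y \<in> S"
    show "norm (l (f y) - l (f x)) \<le> a * K * norm (y - x)"
      using K(2)[of "f y - f x"] mult_right_mono[OF a(3)[OF x y] K(1)] by (simp add: diff mult_ac)
  qed
qed

lemma lip_const: "lip S (\<lambda>_. c)"
  by (rule lipI[of _ _ "norm c" 0]) auto

lemma lip_add:
  assumes "lip S f" "lip S g"
  shows "lip S (\<lambda>x. f x + g x)"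
proof -
  obtain a where a: "\<And>x. x \<in> S \<Longrightarrow> norm (f x) \<le> a"
    "\<And>x y. x \<in> S \<Longrightarrow> y \<in> S \<Longrightarrow> norm (f y - f x) \<le> a * norm (y - x)" using assms(1) unfolding lip_def by blast
  obtain b where b: "\<And>x. x \<in> S \<Longrightarrow> norm (g x) \<le> b"
    "\<And>x y. x \<in> S \<Longrightarrow> y \<in> S \<Longrightarrow> norm (g y - g x) \<le> b * norm (y - x)" using assms(2) unfolding lip_def by blast
  show ?thesis
  proof (rule lipI[of _ _ "a + b" "a + b"])
    show "norm (f x + g x) \<le> a + b" if "x \<in> S" for x
      using a(1) b(1) that by (intro norm_triangle_mono) auto
    show "norm (f y + g y - (f x + g x)) \<le> (a + b) * norm (y - x)" if "x \<in> S" "y \<in> S" for x y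
      using norm_triangle_ineq[of "f y - f x" "g y - g x"] a(2)[OF that] b(2)[OF that]
      by (simp add: algebra_simps)
  qed
qed

lemma C11_imp_lip:
  assumes "C11 S f" and diam: "\<And>x y. x \<in> S \<Longrightarrow> y \<in> S \<Longrightarrow> norm (y - x) \<le> 1"
  shows "lip S f"
proof -
  obtain c f' where c: "0 \<le> c" "\<And>x. x \<in> S \<Longrightarrow> norm (f x) \<le> c" "\<And>x h. x \<in> S \<Longrightarrow> norm (f' x h) \<le> c * norm h"
    "\<And>x y. x \<in> S \<Longrightarrow> y \<in> S \<Longrightarrow> norm (f y - f x - f' x (y - x)) \<le> c * (norm (y - x))\<^sup>2"
    using assms(1) unfolding C11_def C11_deriv_def by blast
  show ?thesis
  proof (rule lipI[of _ _ c "2 * c"])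
    fix x y assume xy: "x \<in> S" "y \<in> S"
    \<comment> \<open>On a set of diameter at most 1 the quadratic remainder is also a linear
      one.\<close>
    have "(norm (y - x))\<^sup>2 \<le> norm (y - x)"
      using diam[OF xy] by (simp add: power2_eq_square mult_left_le_one_le)
    then have "c * (norm (y - x))\<^sup>2 \<le> c * norm (y - x)" using c(1) by (rule mult_left_mono)
    then show "norm (f y - f x) \<le> 2 * c * norm (y - x)"
      using norm_triangle_ineq[of "f y - f x - f' x (y - x)" "f' x (y - x)"] c(3)[OF xy(1), of "y - x"] c(4)[OF xy]
      by (simp add: algebra_simps)
  qed (use c in auto)
qed

lemma C11_const: "C11 S (\<lambda>_. c)"
  unfolding C11_def
  by (intro exI, rule C11_derivI[of _ _ "norm c" "\<lambda>_ _. 0" 0 0]) (auto intro: linear_zero)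

lemma C11_add:
  assumes "C11 S f" "C11 S g"
  shows "C11 S (\<lambda>x. f x + g x)"
proof -
  obtain a f' where a: "\<And>x. x \<in> S \<Longrightarrow> norm (f x) \<le> a" "\<And>x. x \<in> S \<Longrightarrow> linear (f' x)"
    "\<And>x h. x \<in> S \<Longrightarrow> norm (f' x h) \<le> a * norm h"
    "\<And>x y. x \<in> S \<Longrightarrow> y \<in> S \<Longrightarrow> norm (f y - f x - f' x (y - x)) \<le> a * (norm (y - x))\<^sup>2"
    using assms(1) unfolding C11_def C11_deriv_def by blast
  obtain b g' where b: "\<And>x. x \<in> S \<Longrightarrow> norm (g x) \<le> b" "\<And>x. x \<in> S \<Longrightarrow> linear (g' x)"
    "\<And>x h. x \<in> S \<Longrightarrow> norm (g' x h) \<le> b * norm h"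
    "\<And>x y. x \<in> S \<Longrightarrow> y \<in> S \<Longrightarrow> norm (g y - g x - g' x (y - x)) \<le> b * (norm (y - x))\<^sup>2"
    using assms(2) unfolding C11_def C11_deriv_def by blast
  have "C11_deriv S (\<lambda>x. f x + g x) (\<lambda>x h. f' x h + g' x h)"
  proof (rule C11_derivI[of _ _ "a + b" _ "a + b" "a + b"])
    fix x assume x: "x \<in> S"
    show "norm (f x + g x) \<le> a + b" using a(1) b(1) x by (intro norm_triangle_mono) auto
    show "linear (\<lambda>h. f' x h + g' x h)" using a(2) b(2) x by (intro linear_compose_add)
    show "norm (f' x h + g' x h) \<le> (a + b) * norm h" for h
      using norm_triangle_ineq[of "f' x h" "g' x h"] a(3)[OF x, of h] b(3)[OF x, of h] by (simp add: algebra_simps)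
    fix y assume y: "y \<in> S"
    show "norm (f y + g y - (f x + g x) - (f' x (y - x) + g' x (y - x))) \<le> (a + b) * (norm (y - x))\<^sup>2"
      using norm_triangle_ineq[of "f y - f x - f' x (y - x)" "g y - g x - g' x (y - x)"] a(4)[OF x y] b(4)[OF x y]
      by (simp add: algebra_simps)
  qed
  then show ?thesis unfolding C11_def by blast
qed

lemma C11_linear:
  assumes "bounded_linear l" "C11 S f"
  shows "C11 S (\<lambda>x. l (f x))"
proof -
  interpret bounded_linear l by fact
  obtain K where K: "0 \<le> K" "\<And>a. norm (l a) \<le> norm a * K" using nonneg_bounded by blast
  obtain a f' where a: "\<And>x. x \<in> S \<Longrightarrow> norm (f x) \<le> a" "\<And>x. x \<in> S \<Longrightarrow> linear (f' x)"
    "\<And>x h. x \<in> S \<Longrightarrow> norm (f' x h) \<le> a * norm h"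
    "\<And>x y. x \<in> S \<Longrightarrow> y \<in> S \<Longrightarrow> norm (f y - f x - f' x (y - x)) \<le> a * (norm (y - x))\<^sup>2"
    using assms(2) unfolding C11_def C11_deriv_def by blast
  have *: "norm (l u) \<le> t * K" if "norm u \<le> t" for u t
    using K(2)[of u] mult_right_mono[OF that K(1)] by linarith
  have "C11_deriv S (\<lambda>x. l (f x)) (\<lambda>x h. l (f' x h))"
  proof (rule C11_derivI[of _ _ "a * K" _ "a * K" "a * K"])
    fix x assume x: "x \<in> S"
    show "norm (l (f x)) \<le> a * K" by (intro * a x)
    show "linear (\<lambda>h. l (f' x h))" using linear_compose[OF a(2)[OF x] linear] by (simp add: comp_def)
    show "norm (l (f' x h)) \<le> a * K * norm h" for h using *[OF a(3)[OF x, of h]] by (simp add: mult_ac)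
    fix y assume y: "y \<in> S"
    show "norm (l (f y) - l (f x) - l (f' x (y - x))) \<le> a * K * (norm (y - x))\<^sup>2"
      using *[OF a(4)[OF x y]] by (simp add: mult_ac diff)
  qed
  then show ?thesis unfolding C11_def by blast
qed

lemma C11_bilinear:
  assumes "bounded_bilinear pr" "C11 S f" "C11 S g" and diam: "\<And>x y. x \<in> S \<Longrightarrow> y \<in> S \<Longrightarrow> norm (y - x) \<le> 1"
  shows "C11 S (\<lambda>x. pr (f x) (g x))"
proof -
  interpret bounded_bilinear pr by fact
  obtain K where K: "0 \<le> K" "\<And>a b. norm (pr a b) \<le> norm a * norm b * K" using nonneg_bounded by blast
  obtain a f' where a: "0 \<le> a" "\<And>x. x \<in> S \<Longrightarrow> norm (f x) \<le> a" "\<And>x. x \<in> S \<Longrightarrow> linear (f' x)"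
    "\<And>x h. x \<in> S \<Longrightarrow> norm (f' x h) \<le> a * norm h"
    "\<And>x y. x \<in> S \<Longrightarrow> y \<in> S \<Longrightarrow> norm (f y - f x - f' x (y - x)) \<le> a * (norm (y - x))\<^sup>2"
    using assms(2) unfolding C11_def C11_deriv_def by blast
  obtain b g' where b: "0 \<le> b" "\<And>x. x \<in> S \<Longrightarrow> norm (g x) \<le> b" "\<And>x. x \<in> S \<Longrightarrow> linear (g' x)"
    "\<And>x h. x \<in> S \<Longrightarrow> norm (g' x h) \<le> b * norm h"
    "\<And>x y. x \<in> S \<Longrightarrow> y \<in> S \<Longrightarrow> norm (g y - g x - g' x (y - x)) \<le> b * (norm (y - x))\<^sup>2"
    using assms(3) unfolding C11_def C11_deriv_def by blast
  obtain d where d: "0 \<le> d" "\<And>x y. x \<in> S \<Longrightarrow> y \<in> S \<Longrightarrow> norm (g y - g x) \<le> d * norm (y - x)"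
    using C11_imp_lip[OF assms(3) diam] unfolding lip_def by blast
  have *: "norm (pr u v) \<le> s * t * K" if "norm u \<le> s" "norm v \<le> t" for u v s t
  proof -
    have "0 \<le> s" "0 \<le> t" using that norm_ge_zero order_trans by blast+
    then have "norm u * norm v * K \<le> s * t * K" using that K(1) by (intro mult_mono) auto
    then show ?thesis using K(2)[of u v] by linarith
  qed
  have "C11_deriv S (\<lambda>x. pr (f x) (g x)) (\<lambda>x h. pr (f' x h) (g x) + pr (f x) (g' x h))"
  proof (rule C11_derivI[of _ _ "a * b * K" _ "2 * a * b * K" "(2 * a * b + a * d) * K"])
    fix x assume x: "x \<in> S"
    show "norm (pr (f x) (g x)) \<le> a * b * K" by (intro * a b x)
    show "linear (\<lambda>h. pr (f' x h) (g x) + pr (f x) (g' x h))"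
      using linear_add[OF a(3)[OF x]] linear_add[OF b(3)[OF x]] linear_scale[OF a(3)[OF x]] linear_scale[OF b(3)[OF x]]
      by (intro linearI) (simp_all add: add_left add_right scaleR_left scaleR_right scaleR_add_right)
    show "norm (pr (f' x h) (g x) + pr (f x) (g' x h)) \<le> 2 * a * b * K * norm h" for h
      using norm_triangle_ineq[of "pr (f' x h) (g x)" "pr (f x) (g' x h)"]
        *[OF a(4)[OF x, of h] b(2)[OF x]] *[OF a(2)[OF x] b(4)[OF x, of h]] by (simp add: algebra_simps)
    fix y assume y: "y \<in> S"
    let ?h = "y - x"
    have "pr (f y) (g y) - pr (f x) (g x) - (pr (f' x ?h) (g x) + pr (f x) (g' x ?h))
       = pr (f y - f x - f' x ?h) (g y) + pr (f' x ?h) (g y - g x) + pr (f x) (g y - g x - g' x ?h)"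
      by (simp add: diff_left diff_right)
    then have "norm (pr (f y) (g y) - pr (f x) (g x) - (pr (f' x ?h) (g x) + pr (f x) (g' x ?h)))
      \<le> norm (pr (f y - f x - f' x ?h) (g y)) + norm (pr (f' x ?h) (g y - g x)) + norm (pr (f x) (g y - g x - g' x ?h))"
      by (metis norm_triangle_mono norm_triangle_ineq order_refl)
    also have "\<dots> \<le> (a * (norm ?h)\<^sup>2) * b * K + (a * norm ?h) * (d * norm ?h) * K + a * (b * (norm ?h)\<^sup>2) * K"
      by (intro add_mono *) (use a b d x y in auto)
    finally show "norm (pr (f y) (g y) - pr (f x) (g x) - (pr (f' x ?h) (g x) + pr (f x) (g' x ?h)))
      \<le> (2 * a * b + a * d) * K * (norm ?h)\<^sup>2"
      by (simp add: algebra_simps power2_eq_square)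
  qed
  then show ?thesis unfolding C11_def by blast
qed

lemma norm_mult_matrix_le: "norm (M ** N) \<le> real CARD('m) * real CARD('k) * (norm M * norm N)"
  for M :: "real^'n^'m" and N :: "real^'k^'n"
proof (rule norm_matrix_le)
  fix x :: "real^'m" and y :: "real^'k"
  have "\<bar>x \<bullet> (M *v (N *v y))\<bar> \<le> norm M * norm x * norm (N *v y)" by (rule bilin_le)
  also have "\<dots> \<le> norm M * norm x * (norm N * norm y)"
    by (intro mult_left_mono norm_matrix_vector_le) auto
  finally show "\<bar>x \<bullet> ((M ** N) *v y)\<bar> \<le> norm M * norm N * norm x * norm y"
    by (simp add: matrix_vector_mul_assoc mult_ac)
qed

lemma norm_matrix_inv_le:
  fixes M :: "real^'n^'n"
  assumes "0 < r" "\<And>u. r * (norm u)\<^sup>2 \<le> qf M u"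
  shows "norm (matrix_inv M) \<le> real CARD('n) * real CARD('n) * (1 / r)"
proof (rule norm_matrix_le)
  fix x y :: "real^'n"
  have inv: "invertible M" by (rule invertible_of_coercive[OF assms])
  let ?u = "matrix_inv M *v y"
  have "r * (norm ?u)\<^sup>2 \<le> ?u \<bullet> y" using assms(2)[of ?u] by (simp add: matrix_inv_vec_right[OF inv])
  also have "\<dots> \<le> norm ?u * norm y" by (rule norm_cauchy_schwarz)
  finally have "r * norm ?u \<le> norm y"
    by (cases "norm ?u = 0") (auto simp: power2_eq_square mult.left_commute mult_le_cancel_left_pos)
  then have "norm ?u \<le> 1 / r * norm y" using assms(1) by (simp add: field_simps)
  then have "norm x * norm ?u \<le> norm x * (1 / r * norm y)" by (intro mult_left_mono) auto
  then show "\<bar>x \<bullet> ?u\<bar> \<le> 1 / r * norm x * norm y"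
    using Cauchy_Schwarz_ineq2[of x ?u] by (simp add: mult_ac)
qed

text \<open>The resolvent identity.\<close>

lemma matrix_inv_diff:
  fixes M N :: "real^'n^'n"
  assumes "invertible M" "invertible N"
  shows "matrix_inv N - matrix_inv M = - (matrix_inv N ** (N - M) ** matrix_inv M)"
proof -
  have "(matrix_inv N - matrix_inv M) *v x = (- (matrix_inv N ** (N - M) ** matrix_inv M)) *v x" for x
    by (simp add: minus_matrix_vector matrix_vector_mul_assoc[symmetric] matrix_vector_mult_diff_rdistrib
        matrix_vector_mult_diff_distrib matrix_inv_vec_right[OF assms(1)] matrix_inv_vec_left[OF assms(2)])
  then show ?thesis by (simp add: matrix_eq)
qed

lemma lip_matrix_inv:
  fixes f :: "'a::real_normed_vector \<Rightarrow> real^'n^'n"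
  assumes f: "lip S f" and r: "0 < r" "\<And>x u. x \<in> S \<Longrightarrow> r * (norm u)\<^sup>2 \<le> qf (f x) u"
  shows "lip S (\<lambda>x. matrix_inv (f x))"
proof -
  obtain a where a: "0 \<le> a" "\<And>x y. x \<in> S \<Longrightarrow> y \<in> S \<Longrightarrow> norm (f y - f x) \<le> a * norm (y - x)"
    using f unfolding lip_def by blast
  let ?n = "real CARD('n) * real CARD('n)"
  let ?b = "?n * (1 / r)"
  have b: "norm (matrix_inv (f x)) \<le> ?b" if "x \<in> S" for x
    using norm_matrix_inv_le[OF r(1) r(2)[OF that]] .
  have b0: "0 \<le> ?b" using r(1) by simp
  have inv: "invertible (f x)" if "x \<in> S" for x using invertible_of_coercive[OF r(1) r(2)[OF that]] .
  show ?thesis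
  proof (rule lipI[where a="?b" and b="?n * (?n * (?b * a) * ?b)"])
    fix x y assume xy: "x \<in> S" "y \<in> S"
    have "norm (matrix_inv (f y) - matrix_inv (f x)) = norm (matrix_inv (f y) ** (f y - f x) ** matrix_inv (f x))"
      using xy by (simp add: matrix_inv_diff[OF inv inv])
    also have "\<dots> \<le> ?n * (norm (matrix_inv (f y) ** (f y - f x)) * norm (matrix_inv (f x)))"
      by (rule norm_mult_matrix_le)
    also have "\<dots> \<le> ?n * (?n * (norm (matrix_inv (f y)) * norm (f y - f x)) * ?b)"
      using b xy b0 by (intro mult_left_mono mult_mono norm_mult_matrix_le) auto
    also have "\<dots> \<le> ?n * (?n * (?b * (a * norm (y - x))) * ?b)"
      using b[OF xy(2)] a(2)[OF xy] b0 by (intro mult_left_mono mult_right_mono mult_mono) auto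
    finally show "norm (matrix_inv (f y) - matrix_inv (f x)) \<le> ?n * (?n * (?b * a) * ?b) * norm (y - x)"
      by (simp add: mult_ac)
  qed (rule b)
qed

lemma C11_matrix_inv:
  fixes f :: "'a::real_normed_vector \<Rightarrow> real^'n^'n"
  assumes f: "C11 S f" and diam: "\<And>x y. x \<in> S \<Longrightarrow> y \<in> S \<Longrightarrow> norm (y - x) \<le> 1"
    and r: "0 < r" "\<And>x u. x \<in> S \<Longrightarrow> r * (norm u)\<^sup>2 \<le> qf (f x) u"
  shows "C11 S (\<lambda>x. matrix_inv (f x))"
proof -
  have lf: "lip S f" by (rule C11_imp_lip[OF f diam])
  obtain a where a: "0 \<le> a" "\<And>x y. x \<in> S \<Longrightarrow> y \<in> S \<Longrightarrow> norm (f y - f x) \<le> a * norm (y - x)"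
    using lf unfolding lip_def by blast
  obtain b where b: "0 \<le> b" "\<And>x. x \<in> S \<Longrightarrow> norm (matrix_inv (f x)) \<le> b"
    "\<And>x y. x \<in> S \<Longrightarrow> y \<in> S \<Longrightarrow> norm (matrix_inv (f y) - matrix_inv (f x)) \<le> b * norm (y - x)"
    using lip_matrix_inv[OF lf r] unfolding lip_def by blast
  obtain c f' where c: "0 \<le> c" "\<And>x. x \<in> S \<Longrightarrow> linear (f' x)" "\<And>x h. x \<in> S \<Longrightarrow> norm (f' x h) \<le> c * norm h"
    "\<And>x y. x \<in> S \<Longrightarrow> y \<in> S \<Longrightarrow> norm (f y - f x - f' x (y - x)) \<le> c * (norm (y - x))\<^sup>2"
    using f unfolding C11_def C11_deriv_def by blast
  let ?n = "real CARD('n) * real CARD('n)"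
  have inv: "invertible (f x)" if "x \<in> S" for x using invertible_of_coercive[OF r(1) r(2)[OF that]] .
  have *: "norm (X ** Y ** Z) \<le> ?n * ?n * (s * t * u)"
    if "norm X \<le> s" "norm Y \<le> t" "norm Z \<le> u" for X Y Z :: "real^'n^'n" and s t u
  proof -
    have 0: "0 \<le> s" "0 \<le> t" "0 \<le> u" using that norm_ge_zero order_trans by blast+
    have "norm (X ** Y ** Z) \<le> ?n * (norm (X ** Y) * norm Z)" by (rule norm_mult_matrix_le)
    also have "\<dots> \<le> ?n * (?n * (norm X * norm Y) * u)"
      using that 0 by (intro mult_left_mono mult_mono norm_mult_matrix_le) auto
    also have "\<dots> \<le> ?n * (?n * (s * t) * u)"
      using that 0 by (intro mult_left_mono mult_right_mono mult_mono) auto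
    finally show ?thesis by (simp add: mult_ac)
  qed
  have "C11_deriv S (\<lambda>x. matrix_inv (f x)) (\<lambda>x h. - (matrix_inv (f x) ** f' x h ** matrix_inv (f x)))"
  proof (rule C11_derivI[where a=b and b="?n * ?n * (b * c * b)" and c="?n * ?n * (b * c * b) + ?n * ?n * (b * a * b)"])
    fix x assume x: "x \<in> S"
    show "norm (matrix_inv (f x)) \<le> b" by (rule b(2)[OF x])
    interpret m: bounded_bilinear "(**) :: real^'n^'n \<Rightarrow> real^'n^'n \<Rightarrow> _" by (rule bounded_bilinear_matrix_matrix)
    show "linear (\<lambda>h. - (matrix_inv (f x) ** f' x h ** matrix_inv (f x)))"
      using linear_add[OF c(2)[OF x]] linear_scale[OF c(2)[OF x]]
      by (intro linearI) (simp_all add: m.add_left m.add_right m.scaleR_left m.scaleR_right)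
    show "norm (- (matrix_inv (f x) ** f' x h ** matrix_inv (f x))) \<le> ?n * ?n * (b * c * b) * norm h" for h
      using *[OF b(2)[OF x] c(3)[OF x, of h] b(2)[OF x]] by (simp add: mult_ac)
    fix y assume y: "y \<in> S"
    let ?h = "y - x" and ?G = "matrix_inv (f x)" and ?H = "matrix_inv (f y)"
    \<comment> \<open>By the resolvent identity the remainder of the inverse consists of one term
      with the remainder of f and one term that is a product of two first-order differences.\<close>
    have "?H - ?G - - (?G ** f' x ?h ** ?G) = - (?G ** (f y - f x - f' x ?h) ** ?G) - (?H - ?G) ** (f y - f x) ** ?G"
    proof -
      have r: "- (X ** (d - D) ** X) - (Y - X) ** d ** X = X ** D ** X - Y ** d ** X" for X Y d D :: "real^'n^'n"
        by (simp add: m.diff_left m.diff_right)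
      show ?thesis unfolding r unfolding matrix_inv_diff[OF inv[OF x] inv[OF y]] by simp
    qed
    then have "norm (?H - ?G - - (?G ** f' x ?h ** ?G)) \<le> norm (?G ** (f y - f x - f' x ?h) ** ?G) + norm ((?H - ?G) ** (f y - f x) ** ?G)"
      using norm_triangle_ineq4 by (metis norm_minus_cancel)
    also have "\<dots> \<le> ?n * ?n * (b * (c * (norm ?h)\<^sup>2) * b) + ?n * ?n * ((b * norm ?h) * (a * norm ?h) * b)"
      by (intro add_mono *) (use a b c x y in auto)
    finally show "norm (?H - ?G - - (?G ** f' x ?h ** ?G)) \<le> (?n * ?n * (b * c * b) + ?n * ?n * (b * a * b)) * (norm ?h)\<^sup>2"
      by (simp add: algebra_simps power2_eq_square)
  qed
  then show ?thesis unfolding C11_def by blast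
qed

lemma C11_subset: "C11_deriv S f f' \<Longrightarrow> T \<subseteq> S \<Longrightarrow> C11_deriv T f f'"
  unfolding C11_deriv_def by blast

lemma C11_has_derivative:
  assumes f: "C11_deriv S f f'" and S: "open S" "x \<in> S"
  shows "(f has_derivative f' x) (at x)"
proof -
  obtain c where c: "0 \<le> c" "linear (f' x)" "\<And>h. norm (f' x h) \<le> c * norm h"
    "\<And>y. y \<in> S \<Longrightarrow> norm (f y - f x - f' x (y - x)) \<le> c * (norm (y - x))\<^sup>2"
    using f S(2) unfolding C11_deriv_def by blast
  have bl: "bounded_linear (f' x)"
    using c(2) c(3) by (intro bounded_linear_intro[of _ c])
      (auto simp: linear_add linear_scale mult.commute)
  have ev: "\<forall>\<^sub>F y in at x. norm (norm (f y - f x - f' x (y - x)) / norm (y - x)) \<le> c * norm (y - x)"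
  proof -
    have "\<forall>\<^sub>F y in at x. y \<in> S \<and> y \<noteq> x"
      using S eventually_at_topological by blast
    then show ?thesis
    proof (rule eventually_mono)
      fix y assume "y \<in> S \<and> y \<noteq> x"
      then show "norm (norm (f y - f x - f' x (y - x)) / norm (y - x)) \<le> c * norm (y - x)"
        using c(4)[of y] by (simp add: divide_le_eq power2_eq_square mult.assoc)
    qed
  qed
  have "((\<lambda>y. c * norm (y - x)) \<longlongrightarrow> c * norm (x - x)) (at x)"
    by (intro tendsto_intros)
  then have "((\<lambda>y. norm (f y - f x - f' x (y - x)) / norm (y - x)) \<longlongrightarrow> 0) (at x)"
    by (intro Lim_null_comparison[OF ev]) simp
  then show ?thesis
    unfolding has_derivative_iff_norm using bl by simp
qed

text \<open>The remainders at two points, taken towards a third one, compare the two derivatives.\<close>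

lemma C11_deriv_lipschitz:
  fixes f :: "'a::real_normed_vector \<Rightarrow> 'b::real_normed_vector"
  assumes f: "C11_deriv (ball z r) f f'"
  obtains c where "0 \<le> c" "\<And>x y h. x \<in> ball z (r / 4) \<Longrightarrow> y \<in> ball z (r / 4) \<Longrightarrow>
    norm (f' x h - f' y h) \<le> c * norm (x - y) * norm h"
proof -
  obtain c where c: "0 \<le> c" "\<And>x. x \<in> ball z r \<Longrightarrow> linear (f' x)"
    "\<And>x y. x \<in> ball z r \<Longrightarrow> y \<in> ball z r \<Longrightarrow> norm (f y - f x - f' x (y - x)) \<le> c * (norm (y - x))\<^sup>2"
    using f unfolding C11_deriv_def by blast
  have "norm (f' x h - f' y h) \<le> 6 * c * norm (x - y) * norm h"
    if x: "x \<in> ball z (r / 4)" and y: "y \<in> ball z (r / 4)" for x y h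
  proof (cases "h = 0 \<or> x = y")
    case True
    have r: "0 < r" using x by (simp add: dist_norm) (smt (verit) norm_ge_zero)
    then have "linear (f' x)" "linear (f' y)" using c(2) x y by auto
    then show ?thesis using True by (auto simp: linear_0)
  next
    case False
    let ?d = "norm (x - y)"
    define u where "u = (?d / norm h) *\<^sub>R h"
    have d0: "0 < ?d" using False by simp
    have nu: "norm u = ?d" using False by (simp add: u_def)
    let ?w = "x + u"
    have r: "0 < r" using x by (simp add: dist_norm) (smt (verit) norm_ge_zero)
    have dlt: "?d < r / 2"
      using x y norm_triangle_ineq4[of "x - z" "y - z"] by (simp add: dist_norm norm_minus_commute)
    have xb: "x \<in> ball z r" "y \<in> ball z r" using x y r by auto
    have wb: "?w \<in> ball z r"
      using x nu dlt norm_triangle_ineq[of "x - z" u] r by (simp add: dist_norm norm_minus_commute algebra_simps)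
    have lin: "linear (f' x)" "linear (f' y)" using c(2) xb by auto
    have "f' x u - f' y u = (f ?w - f y - f' y (?w - y)) - (f ?w - f x - f' x (?w - x)) - (f x - f y - f' y (x - y))"
    proof -
      have "f' y (?w - y) = f' y u + f' y (x - y)"
        using linear_add[OF lin(2), of u "x - y"] by (simp add: algebra_simps)
      then show ?thesis by simp
    qed
    then have "norm (f' x u - f' y u) \<le> norm (f ?w - f y - f' y (?w - y)) + norm (f ?w - f x - f' x (?w - x)) + norm (f x - f y - f' y (x - y))"
      by (smt (verit) norm_triangle_ineq4)
    also have "\<dots> \<le> c * (norm (?w - y))\<^sup>2 + c * (norm (?w - x))\<^sup>2 + c * (norm (x - y))\<^sup>2"
      by (intro add_mono c(3) xb wb)
    also have "\<dots> \<le> c * (2 * ?d)\<^sup>2 + c * ?d\<^sup>2 + c * ?d\<^sup>2"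
      using norm_triangle_ineq[of u "x - y"] nu c(1)
      by (intro add_mono mult_left_mono power_mono) (auto simp: algebra_simps)
    finally have "norm (f' x u - f' y u) \<le> 6 * c * ?d\<^sup>2" by (simp add: power2_eq_square)
    moreover have "f' x u - f' y u = (?d / norm h) *\<^sub>R (f' x h - f' y h)"
      by (simp add: u_def linear_scale[OF lin(1)] linear_scale[OF lin(2)] scaleR_diff_right)
    ultimately have "?d / norm h * norm (f' x h - f' y h) \<le> 6 * c * ?d\<^sup>2" by simp
    then show ?thesis using d0 False by (simp add: field_simps power2_eq_square)
  qed
  then show ?thesis using that[of "6 * c"] c(1) by auto
qed

section \<open>Dependence of the Riccati solution and of the gain on the parameter\<close>

text \<open>In the norms defined by P1 and P2 both closed loops shrink squared lengths by \<rho>, so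
  the Sylvester equation is solved by a geometric series. The resulting bound does not involve Y
  itself, which makes it a quantitative inverse.\<close>

lemma sylvester_bound:
  fixes Y P1 P2 C1 C2 :: "real^'n^'n"
  assumes q: "0 < q" "\<And>x. q * (norm x)\<^sup>2 \<le> qf P1 x" "\<And>x. q * (norm x)\<^sup>2 \<le> qf P2 x"
    and c: "\<And>x. qf P1 x \<le> c * (norm x)\<^sup>2" "\<And>x. qf P2 x \<le> c * (norm x)\<^sup>2"
    and con: "\<And>x. qf P1 (C1 *v x) \<le> \<rho> * qf P1 x" "\<And>x. qf P2 (C2 *v x) \<le> \<rho> * qf P2 x"
    and \<rho>: "0 \<le> \<rho>" "\<rho> < 1" and h: "0 \<le> h"
    and Y: "\<And>x y. \<bar>y \<bullet> (Y *v x) - (C2 *v y) \<bullet> (Y *v (C1 *v x))\<bar> \<le> h * norm y * norm x"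
  shows "\<bar>y \<bullet> (Y *v x)\<bar> \<le> h * (c / (q * (1 - \<rho>))) * norm y * norm x"
proof -
  let ?n1 = "\<lambda>x. sqrt (qf P1 x)" and ?n2 = "\<lambda>x. sqrt (qf P2 x)"
  have pos: "0 \<le> qf P1 x" "0 \<le> qf P2 x" for x
    using q(1) q(2,3)[of x] by (smt (verit) mult_nonneg_nonneg zero_le_power2)+
  have c0: "0 \<le> c"
  proof -
    have "0 \<le> c * (norm (axis undefined 1 :: real^'n))\<^sup>2" using c(1) pos(1) order_trans by blast
    then show ?thesis by simp
  qed
  have nn: "norm y * norm x \<le> ?n2 y * ?n1 x / q" for x y
  proof -
    have "sqrt q * norm y \<le> ?n2 y" "sqrt q * norm x \<le> ?n1 x"
      using real_sqrt_le_mono[OF q(3), of y] real_sqrt_le_mono[OF q(2), of x] by (simp_all add: real_sqrt_mult)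
    then have "(sqrt q * norm y) * (sqrt q * norm x) \<le> ?n2 y * ?n1 x"
      using q(1) pos by (intro mult_mono) auto
    moreover have "(sqrt q * norm y) * (sqrt q * norm x) = (sqrt q * sqrt q) * (norm y * norm x)"
      by (simp only: mult_ac)
    then have "(sqrt q * norm y) * (sqrt q * norm x) = q * (norm y * norm x)"
      using q(1) by simp
    ultimately have "q * (norm y * norm x) \<le> ?n2 y * ?n1 x" by simp
    then show ?thesis using q(1) by (simp add: pos_le_divide_eq mult.commute)
  qed
  have cn: "?n2 (C2 *v y) * ?n1 (C1 *v x) \<le> \<rho> * (?n2 y * ?n1 x)" for x y
  proof -
    have "?n2 (C2 *v y) \<le> sqrt \<rho> * ?n2 y" "?n1 (C1 *v x) \<le> sqrt \<rho> * ?n1 x"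
      using real_sqrt_le_mono[OF con(2), of y] real_sqrt_le_mono[OF con(1), of x] by (simp_all add: real_sqrt_mult)
    then have "?n2 (C2 *v y) * ?n1 (C1 *v x) \<le> (sqrt \<rho> * ?n2 y) * (sqrt \<rho> * ?n1 x)"
      using pos \<rho> by (intro mult_mono) auto
    also have "\<dots> = (sqrt \<rho> * sqrt \<rho>) * (?n2 y * ?n1 x)" by (simp only: mult_ac)
    also have "\<dots> = \<rho> * (?n2 y * ?n1 x)" using \<rho> by simp
    finally show ?thesis .
  qed
  have p2: "0 \<le> ?n2 y * ?n1 x" for x y using pos by simp
  \<comment> \<open>\<open>b\<close> starts the induction from the crude bound by
    \<open>norm Y\<close> and is multiplied by \<rho> at each step; \<open>g\<close> is the sum of
    the geometric series, the fixed point of \<open>g * \<rho> + h / q = g\<close>.\<close>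
  define b where "b = norm Y / q"
  define g where "g = h / q / (1 - \<rho>)"
  have b0: "0 \<le> b" and g0: "0 \<le> g" using q h \<rho> by (auto simp: b_def g_def)
  have bound: "\<bar>y \<bullet> (Y *v x)\<bar> \<le> (\<rho> ^ k * b + g) * (?n2 y * ?n1 x)" for k x y
  proof (induction k arbitrary: x y)
    case 0
    have "\<bar>y \<bullet> (Y *v x)\<bar> \<le> norm Y * (norm y * norm x)" using bilin_le[of y Y x] by (simp add: mult.assoc)
    also have "\<dots> \<le> norm Y * (?n2 y * ?n1 x / q)" by (intro mult_left_mono nn) auto
    also have "\<dots> \<le> (b + g) * (?n2 y * ?n1 x)" using mult_nonneg_nonneg[OF g0 p2[of y x]] by (simp add: b_def algebra_simps)
    finally show ?case by simp
  next
    case (Suc k)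
    have "\<bar>y \<bullet> (Y *v x)\<bar> \<le> \<bar>(C2 *v y) \<bullet> (Y *v (C1 *v x))\<bar> + h * (norm y * norm x)" using Y[of y x] by (simp add: mult.assoc)
    also have "\<dots> \<le> (\<rho> ^ k * b + g) * (?n2 (C2 *v y) * ?n1 (C1 *v x)) + h * (?n2 y * ?n1 x / q)"
      using h by (intro add_mono Suc mult_left_mono nn)
    also have "\<dots> \<le> (\<rho> ^ k * b + g) * (\<rho> * (?n2 y * ?n1 x)) + h * (?n2 y * ?n1 x / q)"
      using b0 g0 \<rho> by (intro add_right_mono mult_left_mono cn) auto
    also have "\<dots> = (\<rho> ^ Suc k * b + (g * \<rho> + h / q)) * (?n2 y * ?n1 x)" by (simp add: algebra_simps)
    also have "g * \<rho> + h / q = g" using \<rho> q by (simp add: g_def field_simps)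
    finally show ?case .
  qed
  have "(\<lambda>k. (\<rho> ^ k * b + g) * (?n2 y * ?n1 x)) \<longlonglongrightarrow> (0 * b + g) * (?n2 y * ?n1 x)"
    using \<rho> by (intro tendsto_intros LIMSEQ_power_zero) auto
  then have "\<bar>y \<bullet> (Y *v x)\<bar> \<le> (0 * b + g) * (?n2 y * ?n1 x)"
    by (rule LIMSEQ_le_const) (use bound in blast)
  also have "\<dots> \<le> g * ((sqrt c * norm y) * (sqrt c * norm x))"
    using g0 pos c0 real_sqrt_le_mono[OF c(2), of y] real_sqrt_le_mono[OF c(1), of x]
    by (simp only: mult_zero_left add_0_left, intro mult_left_mono mult_mono)
       (simp_all add: real_sqrt_mult)
  also have "\<dots> = g * c * norm y * norm x" using c0 by (simp add: algebra_simps)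
  also have "g * c = h * (c / (q * (1 - \<rho>)))" by (simp add: g_def)
  finally show ?thesis .
qed

lemma bilin_chain_le:
  "\<bar>(C *v y) \<bullet> (P *v (D *v (K *v x)))\<bar> \<le> norm C * norm P * norm D * norm K * norm y * norm x"
  for C :: "real^'a^'b" and P :: "real^'c^'b" and D :: "real^'e^'c" and K :: "real^'f^'e"
proof -
  have 1: "norm (D *v (K *v x)) \<le> norm D * (norm K * norm x)"
    by (rule order_trans[OF norm_matrix_vector_le]) (intro mult_left_mono norm_matrix_vector_le norm_ge_zero)
  have "\<bar>(C *v y) \<bullet> (P *v (D *v (K *v x)))\<bar> \<le> norm P * norm (C *v y) * norm (D *v (K *v x))" by (rule bilin_le)
  also have "\<dots> \<le> norm P * (norm C * norm y) * (norm D * (norm K * norm x))"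
    by (intro mult_mono 1 norm_matrix_vector_le order_refl) auto
  finally show ?thesis by (simp add: mult_ac)
qed

text \<open>For B near B \<theta> the feedback at \<theta> with barrier 2 P(\<theta>) still
  satisfies the inequality of \<open>stabilizing_solution_exists\<close>: doubling creates a slack
  of the size of Q, which absorbs the perturbation of B. Hence solutions exist on a ball with common
  bounds. \<open>riccati_difference\<close> and \<open>sylvester_bound\<close> give Lipschitz
  continuity. The derivative is defined as the solution of the linearised Sylvester equation, and
  the Taylor remainder solves a Sylvester equation with quadratic forcing. Regularity of the gain
  follows from the calculus of C11 functions.\<close>

lemma riccati_regularity:
  fixes A Q :: "real^'x^'x" and R :: "real^'u^'u" and B :: "real^'d \<Rightarrow> real^'u^'x"
  assumes Q: "pos_def Q" and R: "pos_def R" and stab: "stabilizable A (B \<theta>)"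
    and bl: "bounded_linear bl" "\<And>s t. B s - B t = bl (s - t)"
  obtains r c DK where "0 < r" "0 \<le> c"
    "\<And>t. t \<in> ball \<theta> r \<Longrightarrow> stabilizing_solution A (B t) Q R (riccati A (B t) Q R)"
    "\<And>t x. t \<in> ball \<theta> r \<Longrightarrow> qf Q x \<le> qf (riccati A (B t) Q R) x"
    "\<And>t x. t \<in> ball \<theta> r \<Longrightarrow> qf (riccati A (B t) Q R) x \<le> c * (norm x)\<^sup>2"
    "\<And>t. t \<in> ball \<theta> r \<Longrightarrow> norm (B t) \<le> c"
    "\<And>t. t \<in> ball \<theta> r \<Longrightarrow> norm (opt_gain A (B t) Q R) \<le> c"
    "\<And>s t. s \<in> ball \<theta> r \<Longrightarrow> t \<in> ball \<theta> r \<Longrightarrow> norm (riccati A (B t) Q R - riccati A (B s) Q R) \<le> c * norm (t - s)"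
    "\<And>s t. s \<in> ball \<theta> r \<Longrightarrow> t \<in> ball \<theta> r \<Longrightarrow>
      norm (input_weight (B t) R (riccati A (B t) Q R) - input_weight (B s) R (riccati A (B s) Q R)) \<le> c * norm (t - s)"
    "\<And>t. t \<in> ball \<theta> r \<Longrightarrow> ((\<lambda>t. opt_gain A (B t) Q R) has_derivative DK t) (at t)"
    "\<And>s t h. s \<in> ball \<theta> r \<Longrightarrow> t \<in> ball \<theta> r \<Longrightarrow> norm (DK s h - DK t h) \<le> c * norm (s - t) * norm h"
proof -
  interpret bl: bounded_linear bl by fact
  interpret mv: bounded_bilinear "(*v) :: real^'x^'x \<Rightarrow> _" by (rule bounded_bilinear_matrix_vector)
  have symQ: "transpose Q = Q" and symR: "transpose R = R" using Q R by (auto simp: pos_def_def)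
  obtain m where m: "0 < m" "\<And>x. m * (norm x)\<^sup>2 \<le> qf Q x" using coercive_of_pos_def[OF Q] by blast
  obtain rr where rr: "0 < rr" "\<And>u. rr * (norm u)\<^sup>2 \<le> qf R u" using coercive_of_pos_def[OF R] by blast
  have Q0: "0 \<le> qf Q x" for x using m(2)[of x] m(1) by (smt (verit) mult_nonneg_nonneg zero_le_power2)
  have R0: "0 \<le> qf R x" for x using rr(2)[of x] rr(1) by (smt (verit) mult_nonneg_nonneg zero_le_power2)
  obtain kb where kb: "0 \<le> kb" "\<And>h. norm (bl h) \<le> norm h * kb" using bl.nonneg_bounded by blast
  obtain P0 where P0: "stabilizing_solution A (B \<theta>) Q R P0" "\<And>x. qf Q x \<le> qf P0 x"
    using stabilizing_solution_of_stabilizable[OF Q R stab] by blast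
  have P00: "0 \<le> qf P0 x" for x using Q0 P0(2) order_trans by blast
  define K0 where "K0 = gain A (B \<theta>) R P0"
  define C0 where "C0 = A + B \<theta> ** K0"
  define n where "n = norm P0"
  define a where "a = norm C0"
  define D where "D = kb * norm K0"
  have D0: "0 \<le> D" and n0: "0 \<le> n" and a0: "0 \<le> a" using kb by (auto simp: D_def n_def a_def)
  define G where "G = 2 * n * (2 * a + 1) * D"
  have G0: "0 \<le> G" using D0 n0 a0 by (simp add: G_def)
  \<comment> \<open>Three requirements: parameters in the ball differ by at most 1; the perturbation
    of the closed loop, bounded per unit radius by \<open>D\<close>, has norm at most 1; and the
    induced change of the doubled value, bounded per unit radius by \<open>G\<close>, is at most the
    coercivity constant m of Q.\<close>
  define r where "r = min (1 / 2) (min (1 / (D + 1)) (m / (G + 1)))"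
  have r0: "0 < r" "r \<le> 1 / 2"
    using D0 G0 m(1) unfolding r_def by (simp, intro min.cobounded1)
  have rD: "r * D \<le> 1"
  proof -
    have "r * D \<le> 1 / (D + 1) * D" using D0 by (intro mult_right_mono) (auto simp: r_def)
    also have "\<dots> \<le> 1" using D0 by (simp add: field_simps)
    finally show ?thesis .
  qed
  have rG: "r * G \<le> m"
  proof -
    have "r * G \<le> m / (G + 1) * G" using G0 by (intro mult_right_mono) (auto simp: r_def)
    also have "\<dots> \<le> m" using G0 m(1) by (simp add: field_simps)
    finally show ?thesis .
  qed
  let ?S = "ball \<theta> r"
  have diam: "norm (t - s) \<le> 1" if "s \<in> ?S" "t \<in> ?S" for s t
    using that r0 norm_triangle_ineq4[of "t - \<theta>" "s - \<theta>"] by (simp add: dist_norm norm_minus_commute)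
  have e0: "qf P0 (C0 *v x) + qf R (K0 *v x) + qf Q x = qf P0 x" for x
    using stabilizing_solution_inner[OF P0(1), of x x "K0 *v x"] by (simp add: K0_def C0_def closed_loop)
  have super: "qf Q x + qf R (K0 *v x) + qf (2 *\<^sub>R P0) (A *v x + B t *v (K0 *v x)) \<le> qf (2 *\<^sub>R P0) x"
    if t: "t \<in> ?S" for t x
  proof -
    define z where "z = bl (t - \<theta>) *v (K0 *v x)"
    define d where "d = r * D"
    have d: "0 \<le> d" "d \<le> 1" using D0 r0 rD by (auto simp: d_def)
    have "norm (bl (t - \<theta>)) \<le> r * kb"
      using kb(2)[of "t - \<theta>"] t kb(1) mult_right_mono[of "norm (t - \<theta>)" r kb]
      by (simp add: dist_norm norm_minus_commute)
    then have "norm z \<le> (r * kb) * (norm K0 * norm x)"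
      unfolding z_def using kb(1) r0
      by (intro order_trans[OF norm_matrix_vector_le] mult_mono norm_matrix_vector_le) auto
    then have z: "norm z \<le> d * norm x" by (simp add: d_def D_def mult_ac)
    have Cx: "norm (C0 *v x) \<le> a * norm x" by (simp add: a_def norm_matrix_vector_le)
    have "B t = B \<theta> + bl (t - \<theta>)" using bl(2)[of t \<theta>] by (simp add: algebra_simps)
    then have eq: "A *v x + B t *v (K0 *v x) = C0 *v x + z"
      by (simp add: z_def C0_def matrix_vector_mul_assoc[symmetric] matrix_vector_mult_add_rdistrib)
    have "(C0 *v x) \<bullet> (P0 *v z) \<le> n * (a * norm x) * (d * norm x)"
      using order_trans[OF abs_ge_self bilin_le[of "C0 *v x" P0 z]] z Cx a0 n0
      by (smt (verit) mult_mono norm_ge_zero mult_nonneg_nonneg n_def)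
    moreover have "z \<bullet> (P0 *v (C0 *v x)) \<le> n * (d * norm x) * (a * norm x)"
      using order_trans[OF abs_ge_self bilin_le[of z P0 "C0 *v x"]] z Cx a0 n0 d
      by (smt (verit) mult_mono norm_ge_zero mult_nonneg_nonneg n_def)
    moreover have "qf P0 z \<le> n * (d * norm x) * (d * norm x)"
      using order_trans[OF abs_ge_self bilin_le[of z P0 z]] z n0 d
      by (smt (verit) mult_mono norm_ge_zero mult_nonneg_nonneg n_def)
    ultimately have "qf P0 (C0 *v x + z) \<le> qf P0 (C0 *v x) + n * (2 * a * d + d * d) * (norm x)\<^sup>2"
      unfolding qf_add by (simp add: algebra_simps power2_eq_square)
    also have "n * (2 * a * d + d * d) * (norm x)\<^sup>2 \<le> n * ((2 * a + 1) * d) * (norm x)\<^sup>2"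
      using d n0 mult_left_mono[OF d(2) d(1)] by (intro mult_right_mono mult_left_mono) (auto simp: algebra_simps)
    finally have "2 * qf P0 (C0 *v x + z) \<le> 2 * qf P0 (C0 *v x) + (r * G) * (norm x)\<^sup>2"
      by (simp add: d_def G_def algebra_simps)
    also have "(r * G) * (norm x)\<^sup>2 \<le> m * (norm x)\<^sup>2" using rG by (intro mult_right_mono) auto
    also have "\<dots> \<le> qf Q x" by (rule m)
    finally have "2 * qf P0 (C0 *v x + z) \<le> 2 * qf P0 (C0 *v x) + qf Q x" by simp
    then show ?thesis
      using e0[of x] R0[of "K0 *v x"] by (simp add: eq scaleR_matrix_vector_assoc[symmetric])
  qed
  define P where "P t = riccati A (B t) Q R" for t
  define K where "K t = gain A (B t) R (P t)" for t
  define C where "C t = A + B t ** K t" for t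
  define W where "W t = input_weight (B t) R (P t)" for t
  define c1 where "c1 = 2 * n"
  have P: "stabilizing_solution A (B t) Q R (P t)" "qf Q x \<le> qf (P t) x" "qf (P t) x \<le> c1 * (norm x)\<^sup>2"
    if t: "t \<in> ?S" for t x
  proof -
    have "\<exists>P'. stabilizing_solution A (B t) Q R P' \<and> (\<forall>x. qf Q x \<le> qf P' x) \<and> (\<forall>x. qf P' x \<le> qf (2 *\<^sub>R P0) x)"
    proof (rule stabilizing_solution_exists[OF Q R])
      show "0 \<le> qf (2 *\<^sub>R P0) x" for x using P00[of x] by (simp add: scaleR_matrix_vector_assoc[symmetric])
    qed (use super[OF t] in blast)+
    then obtain P' where P': "stabilizing_solution A (B t) Q R P'" "\<And>x. qf Q x \<le> qf P' x" "\<And>x. qf P' x \<le> qf (2 *\<^sub>R P0) x"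
      by blast
    have [simp]: "P t = P'" unfolding P_def by (rule riccati_eqI[OF P'(1) symQ symR])
    show "stabilizing_solution A (B t) Q R (P t)" "qf Q x \<le> qf (P t) x" using P' by auto
    have "qf P' x \<le> 2 * qf P0 x" using P'(3)[of x] by (simp add: scaleR_matrix_vector_assoc[symmetric])
    then show "qf (P t) x \<le> c1 * (norm x)\<^sup>2" using qf_le[of x P0] by (simp add: c1_def n_def)
  qed
  have mc: "m \<le> c1"
    using m(2)[of "axis undefined 1"] P(2,3)[of \<theta> "axis undefined 1"] r0 by simp
  then have c1: "0 < c1" using m(1) by linarith
  \<comment> \<open>Each closed-loop step reduces the value by at least the form of Q, which is at
    least m against an upper bound c1 for the value; so a fraction m / c1 is lost.\<close>
  define \<rho> where "\<rho> = 1 - m / c1"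
  have \<rho>: "0 \<le> \<rho>" "\<rho> < 1" using mc m(1) c1 by (auto simp: \<rho>_def)
  have sym: "transpose (P t) = P t" and inv: "invertible (W t)" and schur: "schur_stable (C t)" if "t \<in> ?S" for t
    using P(1)[OF that] by (auto simp: stabilizing_solution_def W_def C_def K_def)
  have Pm: "m * (norm x)\<^sup>2 \<le> qf (P t) x" if "t \<in> ?S" for t x using m(2) P(2)[OF that] order_trans by blast
  have P0': "0 \<le> qf (P t) x" if "t \<in> ?S" for t x using Q0 P(2)[OF that] order_trans by blast
  have ec: "qf (P t) (C t *v x) + qf R (K t *v x) + qf Q x = qf (P t) x" if "t \<in> ?S" for t x
    using stabilizing_solution_inner[OF P(1)[OF that], of x x "K t *v x"] by (simp add: K_def C_def closed_loop)
  have con: "qf (P t) (C t *v x) \<le> \<rho> * qf (P t) x" if t: "t \<in> ?S" for t x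
  proof -
    have "m / c1 * qf (P t) x \<le> m / c1 * (c1 * (norm x)\<^sup>2)"
      using m(1) c1 by (intro mult_left_mono P(3)[OF t]) auto
    also have "\<dots> = m * (norm x)\<^sup>2" using c1 by simp
    finally have "m / c1 * qf (P t) x \<le> qf Q x" using m(2)[of x] by linarith
    then show ?thesis using ec[OF t, of x] R0[of "K t *v x"] by (simp add: \<rho>_def algebra_simps)
  qed
  have Pn: "norm (P t) \<le> real CARD('x) * real CARD('x) * c1" if "t \<in> ?S" for t
    by (rule norm_le_of_qf[OF sym[OF that]]) (use P0'[OF that] P(3)[OF that] in blast)
  have Kn: "norm (K t) \<le> real CARD('u) * real CARD('x) * sqrt (c1 / rr)" if t: "t \<in> ?S" for t
  proof (rule norm_matrix_le)
    fix x :: "real^'u" and y :: "real^'x"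
    have "rr * (norm (K t *v y))\<^sup>2 \<le> c1 * (norm y)\<^sup>2"
      using rr(2)[of "K t *v y"] ec[OF t, of y] P0'[OF t, of "C t *v y"] Q0[of y] P(3)[OF t, of y] by linarith
    then have "(norm (K t *v y))\<^sup>2 \<le> (sqrt (c1 / rr) * norm y)\<^sup>2"
      using rr(1) c1 by (simp add: power_mult_distrib field_simps)
    then have "norm (K t *v y) \<le> sqrt (c1 / rr) * norm y"
      by (rule power2_le_imp_le) (use c1 rr(1) in simp)
    then have "norm x * norm (K t *v y) \<le> norm x * (sqrt (c1 / rr) * norm y)" by (intro mult_left_mono) auto
    then show "\<bar>x \<bullet> (K t *v y)\<bar> \<le> sqrt (c1 / rr) * norm x * norm y"
      using Cauchy_Schwarz_ineq2[of x "K t *v y"] by (simp add: mult_ac)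
  qed
  have Bn: "norm (B t) \<le> norm (B \<theta>) + kb" if t: "t \<in> ?S" for t
  proof -
    have "norm (bl (t - \<theta>)) \<le> 1 * kb"
      using kb(2)[of "t - \<theta>"] mult_right_mono[OF diam[of \<theta> t] kb(1)] t r0 by simp
    then show ?thesis using bl(2)[of t \<theta>] norm_triangle_ineq[of "B \<theta>" "bl (t - \<theta>)"]
      by (simp add: algebra_simps)
  qed
  have C11B: "C11 ?S B"
    unfolding C11_def
  proof (intro exI, rule C11_derivI[where f'="\<lambda>_. bl" and b=kb and c=0 and a="norm (B \<theta>) + kb"])
    show "linear bl" using bl.linear .
  qed (use Bn kb(2) bl(2) in \<open>auto simp: mult.commute\<close>)
  have lipB: "lip ?S B" by (rule C11_imp_lip[OF C11B diam])
  obtain cP cK where cP: "\<And>t. t \<in> ?S \<Longrightarrow> norm (P t) \<le> cP" and cK: "\<And>t. t \<in> ?S \<Longrightarrow> norm (K t) \<le> cK"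
    using Pn Kn by blast
  obtain cC where cC: "\<And>t. t \<in> ?S \<Longrightarrow> norm (C t) \<le> cC"
  proof
    fix t assume t: "t \<in> ?S"
    have "norm (B t ** K t) \<le> real CARD('x) * real CARD('x) * ((norm (B \<theta>) + kb) * cK)"
      using order_trans[OF norm_mult_matrix_le[of "B t" "K t"]] Bn[OF t] cK[OF t] kb(1)
      by (smt (verit) mult_left_mono mult_mono norm_ge_zero of_nat_0_le_iff zero_le_mult_iff)
    then show "norm (C t) \<le> norm A + real CARD('x) * real CARD('x) * ((norm (B \<theta>) + kb) * cK)"
      unfolding C_def using norm_triangle_ineq[of A "B t ** K t"] by linarith
  qed
  have c0: "0 \<le> cP" "0 \<le> cK" "0 \<le> cC"
    using cP[of \<theta>] cK[of \<theta>] cC[of \<theta>] r0 norm_ge_zero order_trans by (metis centre_in_ball)+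
  define cs where "cs = c1 / (m * (1 - \<rho>))"
  define nx where "nx = real CARD('x) * real CARD('x)"
  have cs0: "0 \<le> cs" using c1 m \<rho> by (simp add: cs_def)
  \<comment> \<open>One constant bounds the inverse of every Sylvester operator formed from two
    closed loops of the ball.\<close>
  have syl: "norm Y \<le> nx * (h * cs)"
    if "s \<in> ?S" "t \<in> ?S" "0 \<le> h"
      "\<And>x y. \<bar>y \<bullet> (Y *v x) - (C t *v y) \<bullet> (Y *v (C s *v x))\<bar> \<le> h * norm y * norm x" for Y s t h
    unfolding nx_def cs_def
    by (rule norm_matrix_le)
       (rule sylvester_bound[OF m(1) Pm[OF that(1)] Pm[OF that(2)] P(3)[OF that(1)] P(3)[OF that(2)]
         con[OF that(1)] con[OF that(2)] \<rho> that(3,4)])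
  have chain: "\<bar>(X1 *v y) \<bullet> (X2 *v (X3 *v (X4 *v x)))\<bar> \<le> (k1 * k2 * k3 * k4) * norm y * norm x"
    if "norm X1 \<le> k1" "norm X2 \<le> k2" "norm X3 \<le> k3" "norm X4 \<le> k4"
    for X1 :: "real^'x^'a" and X2 :: "real^'b^'a" and X3 :: "real^'e^'b" and X4 :: "real^'x^'e" and k1 k2 k3 k4 x y
  proof -
    have 0: "0 \<le> k1" "0 \<le> k2" "0 \<le> k3" "0 \<le> k4" using that norm_ge_zero order_trans by blast+
    have "norm X1 * norm X2 * norm X3 * norm X4 * norm y * norm x \<le> k1 * k2 * k3 * k4 * norm y * norm x"
      using that 0 by (intro mult_right_mono mult_mono) auto
    then show ?thesis using bilin_chain_le[of X1 y X2 X3 X4 x] by linarith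
  qed
  have diff: "y \<bullet> ((P t - P s) *v x) = (C t *v y) \<bullet> ((P t - P s) *v (C s *v x))
    + (C t *v y) \<bullet> (P t *v (bl (t - s) *v (K s *v x)))
    + (bl (t - s) *v (K t *v y)) \<bullet> (P s *v (C s *v x))" if "s \<in> ?S" "t \<in> ?S" for s t x y
    using riccati_difference[OF P(1)[OF that(1)] P(1)[OF that(2)] symQ symR, of y x]
    unfolding bl(2) C_def K_def .
  \<comment> \<open>Exchanges the two sides of the bilinear form, so that the estimate
    \<open>chain\<close> also covers terms with the perturbation of B on the left.\<close>
  have flip: "(bl h *v (X *v y)) \<bullet> (Y *v (Z *v x)) = (Z *v x) \<bullet> (transpose Y *v (bl h *v (X *v y)))"
    for h and X :: "real^'x^'u" and Y Z :: "real^'x^'x" and x y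
    by (simp add: inner_transpose inner_commute)
  have lipP: "lip ?S P"
  proof (rule lipI[where a=cP and b="nx * ((2 * (cC * cP * cK) * kb) * cs)"])
    fix s t assume st: "s \<in> ?S" "t \<in> ?S"
    have blst: "norm (bl (t - s)) \<le> norm (t - s) * kb" by (rule kb)
    have "norm (P t - P s) \<le> nx * ((2 * (cC * cP * cK) * (norm (t - s) * kb)) * cs)"
    proof (rule syl[OF st])
      fix x y
      have "\<bar>(C t *v y) \<bullet> (P t *v (bl (t - s) *v (K s *v x)))\<bar> \<le> (cC * cP * (norm (t - s) * kb) * cK) * norm y * norm x"
        by (intro chain cC cP cK st blst)
      moreover have "\<bar>(bl (t - s) *v (K t *v y)) \<bullet> (P s *v (C s *v x))\<bar> \<le> (cC * cP * (norm (t - s) * kb) * cK) * norm x * norm y"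
        unfolding flip sym[OF st(1)] by (intro chain cC cP cK st blst)
      ultimately show "\<bar>y \<bullet> ((P t - P s) *v x) - (C t *v y) \<bullet> ((P t - P s) *v (C s *v x))\<bar>
          \<le> 2 * (cC * cP * cK) * (norm (t - s) * kb) * norm y * norm x"
        unfolding diff[OF st, of y x] by (simp add: mult_ac)
    qed (use c0 kb(1) in auto)
    then show "norm (P t - P s) \<le> nx * ((2 * (cC * cP * cK) * kb) * cs) * norm (t - s)" by (simp add: mult_ac)
  qed (rule cP)
  note bm = bounded_bilinear_matrix_matrix
  note lips = lip_add lip_const lip_bilinear[OF bm] lip_linear[OF bounded_linear_transpose] lip_linear[OF bounded_linear_minus[OF bounded_linear_ident]]
  have Wc: "rr * (norm u)\<^sup>2 \<le> qf (W t) u" if "t \<in> ?S" for t u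
    using rr(2)[of u] P0'[OF that, of "B t *v u"] by (simp add: W_def input_weight_inner)
  have lipW: "lip ?S W" unfolding W_def input_weight_def by (intro lips lipB lipP)
  have Keq: "K = (\<lambda>t. - (matrix_inv (W t) ** transpose (B t) ** P t ** A))"
    by (simp add: fun_eq_iff K_def W_def gain_def)
  have lipK: "lip ?S K" unfolding Keq by (intro lips lipB lipP lip_matrix_inv[OF lipW rr(1) Wc])
  have lipC: "lip ?S C" unfolding C_def by (intro lips lipB lipK)
  define op where "op t X = X - transpose (C t) ** X ** C t" for t and X :: "real^'x^'x"
  have op: "y \<bullet> (op t X *v x) = y \<bullet> (X *v x) - (C t *v y) \<bullet> (X *v (C t *v x))" for t X x y
    by (simp add: op_def matrix_vector_mult_diff_rdistrib inner_diff_right matrix_vector_mul_assoc[symmetric] inner_transpose)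
  have linop: "linear (op t)" for t
    unfolding op_def[abs_def]
    by (intro linear_compose_sub linear_ident bounded_linear.linear[OF bounded_linear_compose[OF
          bounded_bilinear.bounded_linear_left[OF bm] bounded_bilinear.bounded_linear_right[OF bm]]])
  have "\<exists>g. linear g \<and> (\<forall>X. op t (g X) = X)" if t: "t \<in> ?S" for t
  proof -
    have "inj (op t)"
      unfolding linear_injective_0[OF linop]
    proof (intro allI impI)
      fix X assume "op t X = 0"
      then have "y \<bullet> (X *v x) = (C t *v y) \<bullet> (X *v (C t *v x))" for x y
        using op[of y t X x] by simp
      then show "X = 0" by (intro bilinear_invariant_zero[OF _ schur[OF t] schur[OF t]])
    qed
    then have "surj (op t)" using linear_injective_imp_surjective[OF linop] by blast
    from linear_surjective_right_inverse[OF linop this] show ?thesis by (auto simp: fun_eq_iff)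
  qed
  then obtain g where g: "\<And>t. t \<in> ?S \<Longrightarrow> linear (g t)" "\<And>t X. t \<in> ?S \<Longrightarrow> op t (g t X) = X" by metis
  \<comment> \<open>The forcing of the linearised equation in direction h; its solution
    \<open>Z\<close> below is the candidate for the derivative of P.\<close>
  define H where "H t h = transpose (C t) ** P t ** (bl h ** K t) + transpose (bl h ** K t) ** P t ** C t" for t h
  have H: "y \<bullet> (H t h *v x) = (C t *v y) \<bullet> (P t *v (bl h *v (K t *v x))) + (bl h *v (K t *v y)) \<bullet> (P t *v (C t *v x))" for t h x y
    by (simp add: H_def matrix_vector_mult_add_rdistrib inner_add_right matrix_vector_mul_assoc[symmetric] inner_transpose)
  define Z where "Z t h = g t (H t h)" for t h
  have Z: "y \<bullet> (Z t h *v x) - (C t *v y) \<bullet> (Z t h *v (C t *v x)) = y \<bullet> (H t h *v x)" if "t \<in> ?S" for t h x y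
    using op[of y t "Z t h" x] g(2)[OF that] by (simp add: Z_def)
  obtain lP where lP: "0 \<le> lP" "\<And>s t. s \<in> ?S \<Longrightarrow> t \<in> ?S \<Longrightarrow> norm (P t - P s) \<le> lP * norm (t - s)" using lipP unfolding lip_def by blast
  obtain lK where lK: "0 \<le> lK" "\<And>s t. s \<in> ?S \<Longrightarrow> t \<in> ?S \<Longrightarrow> norm (K t - K s) \<le> lK * norm (t - s)" using lipK unfolding lip_def by blast
  obtain lC where lC: "0 \<le> lC" "\<And>s t. s \<in> ?S \<Longrightarrow> t \<in> ?S \<Longrightarrow> norm (C t - C s) \<le> lC * norm (t - s)" using lipC unfolding lip_def by blast
  have C11P: "C11 ?S P"
    unfolding C11_def
  proof (intro exI, rule C11_derivI[where f'=Z and a=cP and b="nx * ((2 * (cC * cP * cK) * kb) * cs)"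
        and c="nx * ((lC * lP * cC + lC * cP * kb * cK + cC * lP * kb * cK + cC * cP * kb * lK) * cs)"])
    fix t assume t: "t \<in> ?S"
    have "linear (H t)"
    proof (rule linearI)
      interpret m1: bounded_bilinear "(**) :: real^'u^'x \<Rightarrow> real^'x^'u \<Rightarrow> _" by (rule bm)
      interpret m2: bounded_bilinear "(**) :: real^'x^'x \<Rightarrow> real^'x^'x \<Rightarrow> _" by (rule bm)
      interpret tr: bounded_linear "transpose :: real^'x^'x \<Rightarrow> _" by (rule bounded_linear_transpose)
      show "H t (h1 + h2) = H t h1 + H t h2" for h1 h2
        by (simp add: H_def bl.add m1.add_left m2.add_left m2.add_right tr.add)
      show "H t (k *\<^sub>R h) = k *\<^sub>R H t h" for k h
        by (simp add: H_def bl.scaleR m1.scaleR_left m2.scaleR_left m2.scaleR_right tr.scaleR scaleR_add_right)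
    qed
    from linear_compose[OF this g(1)[OF t]] show "linear (Z t)" by (simp add: Z_def[abs_def] comp_def)
    show "norm (Z t h) \<le> nx * ((2 * (cC * cP * cK) * kb) * cs) * norm h" for h
    proof -
      have "norm (Z t h) \<le> nx * ((2 * (cC * cP * cK) * (norm h * kb)) * cs)"
      proof (rule syl[OF t t])
        fix x y
        have "\<bar>(C t *v y) \<bullet> (P t *v (bl h *v (K t *v x)))\<bar> \<le> (cC * cP * (norm h * kb) * cK) * norm y * norm x"
          by (intro chain cC cP cK t kb)
        moreover have "\<bar>(bl h *v (K t *v y)) \<bullet> (P t *v (C t *v x))\<bar> \<le> (cC * cP * (norm h * kb) * cK) * norm x * norm y"
          unfolding flip sym[OF t] by (intro chain cC cP cK t kb)
        ultimately show "\<bar>y \<bullet> (Z t h *v x) - (C t *v y) \<bullet> (Z t h *v (C t *v x))\<bar>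
            \<le> 2 * (cC * cP * cK) * (norm h * kb) * norm y * norm x"
          unfolding Z[OF t] H by (simp add: mult_ac)
      qed (use c0 kb(1) in auto)
      then show ?thesis by (simp add: mult_ac)
    qed
    fix s assume s: "s \<in> ?S"
    let ?d = "norm (s - t)" and ?h = "s - t"
    define Y where "Y = P s - P t"
    have blst: "norm (bl ?h) \<le> ?d * kb" by (rule kb)
    have "norm (Y - Z t ?h) \<le> nx * (((lC * lP * cC + lC * cP * kb * cK + cC * lP * kb * cK + cC * cP * kb * lK) * ?d\<^sup>2) * cs)"
    proof (rule syl[OF t t])
      fix x y
      \<comment> \<open>The Taylor remainder of P satisfies the Sylvester equation at t with a
        forcing in which every term contains two factors of order
        \<open>norm (s - t)\<close>.\<close>
      have e: "y \<bullet> ((Y - Z t ?h) *v x) - (C t *v y) \<bullet> ((Y - Z t ?h) *v (C t *v x))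
        = ((C s - C t) *v y) \<bullet> (Y *v (C t *v (mat 1 *v x)))
        + ((C s - C t) *v y) \<bullet> (P s *v (bl ?h *v (K t *v x)))
        + (C t *v y) \<bullet> ((P s - P t) *v (bl ?h *v (K t *v x)))
        + (bl ?h *v ((K s - K t) *v y)) \<bullet> (P t *v (C t *v x))"
      proof -
        have "y \<bullet> (Y *v x) = (C s *v y) \<bullet> (Y *v (C t *v x))
          + (C s *v y) \<bullet> (P s *v (bl ?h *v (K t *v x)))
          + (bl ?h *v (K s *v y)) \<bullet> (P t *v (C t *v x))"
          unfolding Y_def by (rule diff[OF t s])
        moreover have "y \<bullet> (Z t ?h *v x) - (C t *v y) \<bullet> (Z t ?h *v (C t *v x))
          = (C t *v y) \<bullet> (P t *v (bl ?h *v (K t *v x))) + (bl ?h *v (K t *v y)) \<bullet> (P t *v (C t *v x))"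
          unfolding Z[OF t] H ..
        ultimately show ?thesis
          by (simp add: matrix_vector_mult_diff_rdistrib matrix_vector_mult_diff_distrib inner_diff_left inner_diff_right)
      qed
      have 1: "\<bar>((C s - C t) *v y) \<bullet> (Y *v (C t *v (mat 1 *v x)))\<bar> \<le> (lC * lP * cC * ?d\<^sup>2) * norm y * norm x"
      proof -
        have "\<bar>((C s - C t) *v y) \<bullet> (Y *v (C t *v x))\<bar> \<le> norm Y * norm ((C s - C t) *v y) * norm (C t *v x)" by (rule bilin_le)
        also have "\<dots> \<le> (lP * ?d) * ((lC * ?d) * norm y) * (cC * norm x)"
        proof (intro mult_mono)
          show "norm Y \<le> lP * ?d" unfolding Y_def by (rule lP(2)[OF t s])
          show "norm ((C s - C t) *v y) \<le> (lC * ?d) * norm y"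
            by (rule order_trans[OF norm_matrix_vector_le]) (intro mult_right_mono lC(2)[OF t s] norm_ge_zero)
          show "norm (C t *v x) \<le> cC * norm x"
            by (rule order_trans[OF norm_matrix_vector_le]) (intro mult_right_mono cC t norm_ge_zero)
        qed (use lP lC c0 in auto)
        finally show ?thesis by (simp add: mult_ac power2_eq_square)
      qed
      have 2: "\<bar>((C s - C t) *v y) \<bullet> (P s *v (bl ?h *v (K t *v x)))\<bar> \<le> ((lC * ?d) * cP * (?d * kb) * cK) * norm y * norm x"
        by (intro chain lC(2)[OF t s] cP s blst cK t)
      have 3: "\<bar>(C t *v y) \<bullet> ((P s - P t) *v (bl ?h *v (K t *v x)))\<bar> \<le> (cC * (lP * ?d) * (?d * kb) * cK) * norm y * norm x"
        by (intro chain cC t lP(2)[OF t s] blst cK)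
      have 4: "\<bar>(bl ?h *v ((K s - K t) *v y)) \<bullet> (P t *v (C t *v x))\<bar> \<le> (cC * cP * (?d * kb) * (lK * ?d)) * norm x * norm y"
        unfolding flip sym[OF t] by (intro chain cC t lK(2)[OF t s] blst cP)
      show "\<bar>y \<bullet> ((Y - Z t ?h) *v x) - (C t *v y) \<bullet> ((Y - Z t ?h) *v (C t *v x))\<bar>
        \<le> (lC * lP * cC + lC * cP * kb * cK + cC * lP * kb * cK + cC * cP * kb * lK) * ?d\<^sup>2 * norm y * norm x"
        unfolding e using 1 2 3 4 by (simp add: algebra_simps power2_eq_square)
    qed (use c0 kb(1) lC lP lK in auto)
    then show "norm (P s - P t - Z t (s - t))
      \<le> nx * ((lC * lP * cC + lC * cP * kb * cK + cC * lP * kb * cK + cC * cP * kb * lK) * cs) * ?d\<^sup>2"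
      by (simp add: Y_def mult_ac)
  qed (rule cP)
  note C11s = C11_add C11_const C11_bilinear[OF bm] C11_linear[OF bounded_linear_transpose] C11_linear[OF bounded_linear_minus[OF bounded_linear_ident]]
  have C11W: "C11 ?S W" unfolding W_def input_weight_def by (intro C11s C11B C11P diam)
  have "C11 ?S K" unfolding Keq by (intro C11s C11B C11P diam C11_matrix_inv[OF C11W diam rr(1) Wc])
  then obtain DK where DK: "C11_deriv ?S K DK" unfolding C11_def by blast
  obtain cD where cD: "0 \<le> cD" "\<And>x y h. x \<in> ball \<theta> (r / 4) \<Longrightarrow> y \<in> ball \<theta> (r / 4) \<Longrightarrow> norm (DK x h - DK y h) \<le> cD * norm (x - y) * norm h"
    using C11_deriv_lipschitz[OF DK] by blast
  obtain lW where lW: "0 \<le> lW" "\<And>s t. s \<in> ?S \<Longrightarrow> t \<in> ?S \<Longrightarrow> norm (W t - W s) \<le> lW * norm (t - s)" using lipW unfolding lip_def by blast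
  have KO: "K = (\<lambda>t. opt_gain A (B t) Q R)" by (simp add: fun_eq_iff K_def P_def opt_gain_def)
  \<comment> \<open>The radius shrinks to a quarter because \<open>C11_deriv_lipschitz\<close>
    controls the derivative only there.\<close>
  have sub: "t \<in> ?S" if "t \<in> ball \<theta> (r / 4)" for t using that r0 by auto
  let ?c = "max c1 (max (norm (B \<theta>) + kb) (max cK (max lP (max lW cD))))"
  have le: "x \<le> ?c * d" if "x \<le> e * d" "e \<le> ?c" "0 \<le> d" for x e d
    using mult_right_mono[OF that(2,3)] that(1) by linarith
  show ?thesis
  proof (rule that[of "r / 4" ?c DK])
    show "0 < r / 4" "0 \<le> ?c" using r0 c1 by auto
    fix s t x h assume t: "t \<in> ball \<theta> (r / 4)"
    note tS = sub[OF t]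
    show "stabilizing_solution A (B t) Q R (riccati A (B t) Q R)" "qf Q x \<le> qf (riccati A (B t) Q R) x"
      using P[OF tS] by (auto simp: P_def)
    show "qf (riccati A (B t) Q R) x \<le> ?c * (norm x)\<^sup>2"
      by (rule le[OF P(3)[OF tS, unfolded P_def]]) auto
    show "norm (B t) \<le> ?c" using Bn[OF tS] by linarith
    show "norm (opt_gain A (B t) Q R) \<le> ?c" using cK[OF tS] unfolding KO by linarith
    show "((\<lambda>t. opt_gain A (B t) Q R) has_derivative DK t) (at t)"
      unfolding KO[symmetric] by (rule C11_has_derivative[OF DK open_ball tS])
    assume s: "s \<in> ball \<theta> (r / 4)"
    show "norm (riccati A (B t) Q R - riccati A (B s) Q R) \<le> ?c * norm (t - s)"
      by (rule le[OF lP(2)[OF sub[OF s] tS, unfolded P_def]]) auto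
    show "norm (input_weight (B t) R (riccati A (B t) Q R) - input_weight (B s) R (riccati A (B s) Q R)) \<le> ?c * norm (t - s)"
      by (rule le[OF lW(2)[OF sub[OF s] tS, unfolded W_def P_def]]) auto
    show "norm (DK s h - DK t h) \<le> ?c * norm (s - t) * norm h"
    proof -
      have "cD * norm (s - t) * norm h \<le> ?c * norm (s - t) * norm h" by (intro mult_right_mono) auto
      then show ?thesis using cD(2)[OF s t, of h] by linarith
    qed
  qed
qed

subsection \<open>The controlled process\<close>

lemma borel_measurable_matrix_vector [measurable (raw)]:
  fixes f :: "'a \<Rightarrow> real^'n^'m"
  assumes "f \<in> borel_measurable M" "g \<in> borel_measurable M"
  shows "(\<lambda>x. f x *v g x) \<in> borel_measurable M"
  using assms
  by (rule borel_measurable_continuous_Pair)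
     (intro bounded_bilinear.continuous_on[OF bounded_bilinear_matrix_vector] continuous_intros)

lemma borel_measurable_matrix_matrix [measurable (raw)]:
  fixes f :: "'a \<Rightarrow> real^'n^'m" and g :: "'a \<Rightarrow> real^'k^'n"
  assumes "f \<in> borel_measurable M" "g \<in> borel_measurable M"
  shows "(\<lambda>x. f x ** g x) \<in> borel_measurable M"
  using assms
  by (rule borel_measurable_continuous_Pair)
     (intro bounded_bilinear.continuous_on[OF bounded_bilinear_matrix_matrix] continuous_intros)

lemma borel_measurable_transpose [measurable]:
  "(transpose :: real^'n^'m \<Rightarrow> _) \<in> borel_measurable borel"
  by (intro borel_measurable_continuous_onI linear_continuous_on bounded_linear_transpose)

lemma borel_measurable_outer [measurable (raw)]:
  fixes f :: "'a \<Rightarrow> real^'m" and g :: "'a \<Rightarrow> real^'n"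
  assumes "f \<in> borel_measurable M" "g \<in> borel_measurable M"
  shows "(\<lambda>x. outer (f x) (g x)) \<in> borel_measurable M"
  using assms
  by (rule borel_measurable_continuous_Pair)
     (simp add: outer_def, intro continuous_intros continuous_on_vec_lambda)

lemma state_cong:
  assumes "\<And>s. s < t \<Longrightarrow> w s = w' s"
  shows "s \<le> t \<Longrightarrow> state A B \<pi> (r, w) s = state A B \<pi> (r, w') s"
proof (induction s rule: less_induct)
  case (less s)
  show ?case
  proof (cases s)
    case 0
    then show ?thesis by (simp add: state_0)
  next
    case (Suc k)
    have "restrict (state A B \<pi> (r, w)) {1..k} = restrict (state A B \<pi> (r, w')) {1..k}"
      using less.IH less.prems Suc by (intro restrict_ext) auto
    then show ?thesis
      using less.IH[of k] less.prems Suc assms[of k] by (simp add: state_Suc control_def)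
  qed
qed

lemma control_cong:
  assumes "\<And>s. s < t \<Longrightarrow> w s = w' s" "s \<le> t"
  shows "control A B \<pi> (r, w) s = control A B \<pi> (r, w') s"
proof -
  have "restrict (state A B \<pi> (r, w)) {1..s} = restrict (state A B \<pi> (r, w')) {1..s}"
    using assms by (intro restrict_ext state_cong[where t=t]) auto
  then show ?thesis by (simp add: control_def)
qed

text \<open>B is kept as a function of the parameter, so that states and inputs are jointly
  measurable in parameter and sample point. The same facts then serve a fixed parameter and one
  drawn from a prior.\<close>

locale lq_model =
  fixes A :: "real^'x^'x" and B :: "real^'d \<Rightarrow> real^'u^'x" and p :: "real^'x \<Rightarrow> real"
    and N :: "'r measure" and \<pi> :: "('x, 'u, 'r) policy"
  assumes p_density: "prob_density p" and p_measurable [measurable]: "p \<in> borel_measurable borel"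
    and N: "prob_space N" and policy: "is_policy N \<pi>"
    and B_measurable [measurable]: "B \<in> borel_measurable borel"
    and p_mean: "has_bochner_integral lborel (\<lambda>z. p z *\<^sub>R z) 0"
    and p_second: "integrable lborel (\<lambda>z. p z * (norm z)\<^sup>2)"
begin

abbreviation nu :: "(real^'x) measure" where "nu \<equiv> density lborel (\<lambda>z. ennreal (p z))"
abbreviation Om :: "('r \<times> (nat \<Rightarrow> real^'x)) measure" where "Om \<equiv> sample_space N p"
abbreviation st where "st \<theta> \<omega> t \<equiv> state A (B \<theta>) \<pi> \<omega> t"
abbreviation ct where "ct \<theta> \<omega> t \<equiv> control A (B \<theta>) \<pi> \<omega> t"

lemma p_nonneg [simp]: "0 \<le> p z" using p_density by (simp add: prob_density_def)

lemma prob_space_nu: "prob_space nu"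
proof
  have "integral\<^sup>N lborel (\<lambda>z. ennreal (p z)) = ennreal 1"
    using p_density by (subst nn_integral_eq_integral)
      (auto simp: prob_density_def has_bochner_integral_iff)
  then show "emeasure nu (space nu) = 1"
    by (simp add: emeasure_density)
qed

sublocale nu: prob_space nu by (rule prob_space_nu)
sublocale N: prob_space N by (rule N)
sublocale PiN: product_prob_space "\<lambda>_::nat. nu" UNIV by unfold_locales

lemma prob_space_Om: "prob_space Om"
  unfolding sample_space_def
proof -
  interpret pair_prob_space N "Pi\<^sub>M UNIV (\<lambda>_::nat. nu)" ..
  show "prob_space (N \<Otimes>\<^sub>M Pi\<^sub>M UNIV (\<lambda>_::nat. nu))" by (rule prob_space_axioms)
qed

sublocale Om: prob_space Om by (rule prob_space_Om)

lemma sets_Om: "sets Om = sets (N \<Otimes>\<^sub>M Pi\<^sub>M UNIV (\<lambda>_::nat. borel))"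
  unfolding sample_space_def by (intro sets_pair_measure_cong sets_PiM_cong) auto

lemma noise_measurable [measurable]: "(\<lambda>\<omega>. snd \<omega> t) \<in> borel_measurable Om"
  unfolding measurable_cong_sets[OF sets_Om refl] by measurable

lemma fst_Om_measurable [measurable]: "fst \<in> measurable Om N"
  unfolding measurable_cong_sets[OF sets_Om refl] by measurable

lemma policy_measurable:
  assumes "\<And>s. s \<in> {1..t} \<Longrightarrow> (\<lambda>z. h z s) \<in> borel_measurable M" "r \<in> measurable M N"
  shows "(\<lambda>z. \<pi> t (restrict (h z) {1..t}) (r z)) \<in> borel_measurable M"
proof -
  have "(\<lambda>(h, r). \<pi> t h r) \<in> borel_measurable (Pi\<^sub>M {1..t} (\<lambda>_. borel) \<Otimes>\<^sub>M N)"
    using policy by (simp add: is_policy_def)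
  moreover have "(\<lambda>z. (\<lambda>s\<in>{1..t}. h z s, r z)) \<in> measurable M (Pi\<^sub>M {1..t} (\<lambda>_. borel) \<Otimes>\<^sub>M N)"
    using assms by (intro measurable_Pair measurable_restrict) auto
  ultimately show ?thesis using measurable_compose by fastforce
qed

lemma state_measurable_aux:
  "s \<le> t \<Longrightarrow> (\<lambda>z. st (fst z) (snd z) s) \<in> borel_measurable (borel \<Otimes>\<^sub>M Om)"
proof (induction s rule: less_induct)
  case (less s)
  show ?case
  proof (cases s)
    case 0
    then show ?thesis by (simp add: state_0)
  next
    case (Suc k)
    have [measurable]: "(\<lambda>z. st (fst z) (snd z) k) \<in> borel_measurable (borel \<Otimes>\<^sub>M Om)"
      using less.IH[of k] less.prems Suc by auto
    have [measurable]: "(\<lambda>z. ct (fst z) (snd z) k) \<in> borel_measurable (borel \<Otimes>\<^sub>M Om)"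
      unfolding control_def using less.IH less.prems Suc by (intro policy_measurable) auto
    show ?thesis unfolding Suc state_Suc by measurable
  qed
qed

lemma state_measurable [measurable]: "(\<lambda>z. st (fst z) (snd z) t) \<in> borel_measurable (borel \<Otimes>\<^sub>M Om)"
  by (rule state_measurable_aux[OF order_refl])

lemma control_measurable [measurable]: "(\<lambda>z. ct (fst z) (snd z) t) \<in> borel_measurable (borel \<Otimes>\<^sub>M Om)"
  unfolding control_def by (intro policy_measurable) auto

text \<open>Independence of the noise at time t from all other coordinates: it may be replaced by a
  fresh copy in any function whose first argument does not feel it. Since states and inputs at time
  t depend only on earlier noise, this plays the part of conditioning on the past.\<close>

lemma nn_integral_PiM_resample:
  assumes g [measurable]: "g \<in> borel_measurable (Pi\<^sub>M UNIV (\<lambda>_::nat. nu) \<Otimes>\<^sub>M nu)"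
    and inv: "\<And>w y y'. g (w(t := y'), y) = g (w, y)"
  shows "(\<integral>\<^sup>+w. g (w, w t) \<partial>Pi\<^sub>M UNIV (\<lambda>_. nu)) = (\<integral>\<^sup>+w. \<integral>\<^sup>+y. g (w, y) \<partial>nu \<partial>Pi\<^sub>M UNIV (\<lambda>_. nu))"
proof -
  let ?I = "UNIV - {t} :: nat set"
  let ?P = "Pi\<^sub>M UNIV (\<lambda>_::nat. nu)" and ?P' = "Pi\<^sub>M ?I (\<lambda>_::nat. nu)"
  interpret P': product_prob_space "\<lambda>_::nat. nu" ?I by unfold_locales
  interpret pr: pair_sigma_finite nu ?P' by unfold_locales
  have d: "distr (nu \<Otimes>\<^sub>M ?P') ?P (\<lambda>(x, X). X(t := x)) = ?P"
    using distr_pair_PiM_eq_PiM[of ?I "\<lambda>_. nu" t] prob_space_nu by (simp add: insert_absorb)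
  have m [measurable]: "(\<lambda>(x, X). X(t := x)) \<in> measurable (nu \<Otimes>\<^sub>M ?P') ?P"
  proof -
    have "(\<lambda>(x, X). X(t := x)) \<in> measurable (nu \<Otimes>\<^sub>M ?P') (Pi\<^sub>M (insert t ?I) (\<lambda>_. nu))"
      by measurable
    then show ?thesis by (simp add: insert_absorb)
  qed
  have int: "(\<integral>\<^sup>+w. h w \<partial>?P) = (\<integral>\<^sup>+x. \<integral>\<^sup>+X. h (X(t := x)) \<partial>?P' \<partial>nu)"
    if [measurable]: "h \<in> borel_measurable ?P" for h
  proof -
    have "(\<integral>\<^sup>+w. h w \<partial>?P) = (\<integral>\<^sup>+z. h ((\<lambda>(x, X). X(t := x)) z) \<partial>(nu \<Otimes>\<^sub>M ?P'))"
      by (subst d[symmetric], rule nn_integral_distr) auto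
    also have "\<dots> = (\<integral>\<^sup>+x. \<integral>\<^sup>+X. h (X(t := x)) \<partial>?P' \<partial>nu)"
      by (subst P'.nn_integral_fst[symmetric]) auto
    finally show ?thesis .
  qed
  have [measurable]: "(\<lambda>X. X(t := 0)) \<in> measurable ?P' ?P"
  proof -
    have "(\<lambda>X. X(t := 0)) \<in> measurable ?P' (Pi\<^sub>M (insert t ?I) (\<lambda>_. nu))"
      by (rule measurable_fun_upd[where J="?I"]) auto
    then show ?thesis by (simp add: insert_absorb)
  qed
  \<comment> \<open>The coordinate that g ignores is frozen at 0, which leaves a function of the
    other coordinates to which Fubini's theorem applies.\<close>
  have i: "g (X(t := x), y) = g (X(t := 0), y)" for X x y
    using inv[of "X(t := 0)" x y] by simp
  have "(\<integral>\<^sup>+w. g (w, w t) \<partial>?P) = (\<integral>\<^sup>+x. \<integral>\<^sup>+X. g (X(t := x), x) \<partial>?P' \<partial>nu)"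
    by (subst int) auto
  also have "\<dots> = (\<integral>\<^sup>+x. \<integral>\<^sup>+X. g (X(t := 0), x) \<partial>?P' \<partial>nu)"
    by (intro nn_integral_cong i)
  also have "\<dots> = (\<integral>\<^sup>+X. \<integral>\<^sup>+x. g (X(t := 0), x) \<partial>nu \<partial>?P')"
    by (rule pr.Fubini'[symmetric]) measurable
  also have "\<dots> = (\<integral>\<^sup>+x. \<integral>\<^sup>+X. \<integral>\<^sup>+y. g (X(t := 0), y) \<partial>nu \<partial>?P' \<partial>nu)"
    using nu.emeasure_space_1 by simp
  also have "\<dots> = (\<integral>\<^sup>+x. \<integral>\<^sup>+X. \<integral>\<^sup>+y. g (X(t := x), y) \<partial>nu \<partial>?P' \<partial>nu)"
    by (intro nn_integral_cong i[symmetric])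
  also have "\<dots> = (\<integral>\<^sup>+w. \<integral>\<^sup>+y. g (w, y) \<partial>nu \<partial>?P)"
    by (subst int) auto
  finally show ?thesis .
qed

lemma nn_integral_Om_noise:
  assumes g [measurable]: "g \<in> borel_measurable (Om \<Otimes>\<^sub>M nu)"
    and inv: "\<And>r w y y'. g ((r, w(t := y')), y) = g ((r, w), y)"
  shows "(\<integral>\<^sup>+\<omega>. g (\<omega>, snd \<omega> t) \<partial>Om) = (\<integral>\<^sup>+\<omega>. \<integral>\<^sup>+y. g (\<omega>, y) \<partial>nu \<partial>Om)"
proof -
  let ?P = "Pi\<^sub>M UNIV (\<lambda>_::nat. nu)"
  have [measurable]: "g \<in> borel_measurable ((N \<Otimes>\<^sub>M ?P) \<Otimes>\<^sub>M nu)"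
    using g by (simp add: sample_space_def)
  have "(\<integral>\<^sup>+\<omega>. g (\<omega>, snd \<omega> t) \<partial>Om) = (\<integral>\<^sup>+r. \<integral>\<^sup>+w. g ((r, w), w t) \<partial>?P \<partial>N)"
    unfolding sample_space_def by (subst PiN.nn_integral_fst[symmetric]) auto
  also have "\<dots> = (\<integral>\<^sup>+r. \<integral>\<^sup>+w. \<integral>\<^sup>+y. g ((r, w), y) \<partial>nu \<partial>?P \<partial>N)"
  proof (rule nn_integral_cong)
    fix r assume "r \<in> space N"
    then have "(\<lambda>z. g ((r, fst z), snd z)) \<in> borel_measurable (?P \<Otimes>\<^sub>M nu)" by measurable
    from nn_integral_PiM_resample[OF this, of t] inv
    show "(\<integral>\<^sup>+w. g ((r, w), w t) \<partial>?P) = (\<integral>\<^sup>+w. \<integral>\<^sup>+y. g ((r, w), y) \<partial>nu \<partial>?P)" by simp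
  qed
  also have "\<dots> = (\<integral>\<^sup>+\<omega>. \<integral>\<^sup>+y. g (\<omega>, y) \<partial>nu \<partial>Om)"
    unfolding sample_space_def by (subst PiN.nn_integral_fst[symmetric]) auto
  finally show ?thesis .
qed

lemma nn_integral_noise:
  assumes g [measurable]: "g \<in> borel_measurable ((D \<Otimes>\<^sub>M Om) \<Otimes>\<^sub>M nu)"
    and inv: "\<And>\<theta> r w y y'. g ((\<theta>, (r, w(t := y'))), y) = g ((\<theta>, (r, w)), y)"
  shows "(\<integral>\<^sup>+z. g (z, snd (snd z) t) \<partial>(D \<Otimes>\<^sub>M Om)) = (\<integral>\<^sup>+z. \<integral>\<^sup>+y. g (z, y) \<partial>nu \<partial>(D \<Otimes>\<^sub>M Om))"
proof -
  have "(\<lambda>z. snd (snd z) t) \<in> measurable (D \<Otimes>\<^sub>M Om) nu"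
    using measurable_compose[OF measurable_snd noise_measurable] by simp
  then have "(\<lambda>z. (z, snd (snd z) t)) \<in> measurable (D \<Otimes>\<^sub>M Om) ((D \<Otimes>\<^sub>M Om) \<Otimes>\<^sub>M nu)"
    by (intro measurable_Pair measurable_ident_sets[OF refl])
  from measurable_compose[OF this g]
  have [measurable]: "(\<lambda>z. g (z, snd (snd z) t)) \<in> borel_measurable (D \<Otimes>\<^sub>M Om)" by simp
  have "(\<integral>\<^sup>+z. g (z, snd (snd z) t) \<partial>(D \<Otimes>\<^sub>M Om)) = (\<integral>\<^sup>+\<theta>. \<integral>\<^sup>+\<omega>. g ((\<theta>, \<omega>), snd \<omega> t) \<partial>Om \<partial>D)"
    by (subst Om.nn_integral_fst[symmetric]) auto
  also have "\<dots> = (\<integral>\<^sup>+\<theta>. \<integral>\<^sup>+\<omega>. \<integral>\<^sup>+y. g ((\<theta>, \<omega>), y) \<partial>nu \<partial>Om \<partial>D)"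
  proof (rule nn_integral_cong)
    fix \<theta> assume "\<theta> \<in> space D"
    then have "(\<lambda>z. g ((\<theta>, fst z), snd z)) \<in> borel_measurable (Om \<Otimes>\<^sub>M nu)" by measurable
    from nn_integral_Om_noise[OF this, of t] inv
    show "(\<integral>\<^sup>+\<omega>. g ((\<theta>, \<omega>), snd \<omega> t) \<partial>Om) = (\<integral>\<^sup>+\<omega>. \<integral>\<^sup>+y. g ((\<theta>, \<omega>), y) \<partial>nu \<partial>Om)" by simp
  qed
  also have "\<dots> = (\<integral>\<^sup>+z. \<integral>\<^sup>+y. g (z, y) \<partial>nu \<partial>(D \<Otimes>\<^sub>M Om))"
    by (subst Om.nn_integral_fst[symmetric]) auto
  finally show ?thesis .
qed

text \<open>The mean of w^T P w, that is, the trace of P times the noise covariance.\<close>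

definition noise_cost :: "real^'x^'x \<Rightarrow> real" where
  "noise_cost P = (LINT y|lborel. p y * qf P y)"

lemma integrable_noise_qf: "integrable lborel (\<lambda>y. p y * qf P y)"
proof (rule Bochner_Integration.integrable_bound[OF integrable_mult_right[OF p_second, of "norm P"]])
  show "AE y in lborel. norm (p y * qf P y) \<le> norm (norm P * (p y * (norm y)\<^sup>2))"
  proof (intro always_eventually allI)
    fix y
    have "p y * \<bar>qf P y\<bar> \<le> p y * (norm P * norm y * norm y)" by (intro mult_left_mono bilin_le p_nonneg)
    then show "norm (p y * qf P y) \<le> norm (norm P * (p y * (norm y)\<^sup>2))"
      by (simp add: abs_mult power2_eq_square mult_ac)
  qed
qed measurable

lemma integrable_noise: "integrable lborel (\<lambda>y. p y *\<^sub>R y)" "(LINT y|lborel. p y *\<^sub>R y) = 0"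
  using p_mean by (auto simp: has_bochner_integral_iff)

lemma integrable_p: "integrable lborel p" "(LINT y|lborel. p y) = 1"
  using p_density by (auto simp: prob_density_def has_bochner_integral_iff)

lemma noise_cost_nonneg: "(\<And>x. 0 \<le> qf P x) \<Longrightarrow> 0 \<le> noise_cost P"
  unfolding noise_cost_def by (intro integral_nonneg_AE) auto

lemma noise_cost_le: "noise_cost P \<le> norm P * (LINT y|lborel. p y * (norm y)\<^sup>2)"
proof -
  have "noise_cost P \<le> (LINT y|lborel. norm P * (p y * (norm y)\<^sup>2))"
    unfolding noise_cost_def
    by (intro integral_mono integrable_noise_qf integrable_mult_right p_second)
       (metis mult.left_commute mult_left_mono p_nonneg qf_le)
  then show ?thesis by simp
qed

text \<open>The cross terms vanish because the noise has mean zero.\<close>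

lemma nn_integral_qf_shift:
  assumes P: "\<And>x. 0 \<le> qf P x"
  shows "(\<integral>\<^sup>+y. ennreal (qf P (z + y)) \<partial>nu) = ennreal (qf P z + noise_cost P)"
proof -
  have "has_bochner_integral lborel (\<lambda>y. p y * (qf P z) + ((transpose P *v z) \<bullet> (p y *\<^sub>R y) + (P *v z) \<bullet> (p y *\<^sub>R y) + p y * qf P y))
     (1 * qf P z + ((transpose P *v z) \<bullet> 0 + (P *v z) \<bullet> 0 + noise_cost P))"
    unfolding noise_cost_def using p_density
    by (intro has_bochner_integral_add has_bochner_integral_inner_right has_bochner_integral_mult_left p_mean
        has_bochner_integral_integrable integrable_noise_qf) (auto simp: prob_density_def)
  moreover have "p y * (qf P z) + ((transpose P *v z) \<bullet> (p y *\<^sub>R y) + (P *v z) \<bullet> (p y *\<^sub>R y) + p y * qf P y)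
      = p y * qf P (z + y)" for y
    using inner_transpose[of y P z] by (simp add: qf_add inner_commute algebra_simps)
  ultimately have *: "has_bochner_integral lborel (\<lambda>y. p y * qf P (z + y)) (qf P z + noise_cost P)" by simp
  have "(\<integral>\<^sup>+y. ennreal (qf P (z + y)) \<partial>nu) = (\<integral>\<^sup>+y. ennreal (p y * qf P (z + y)) \<partial>lborel)"
    using P by (subst nn_integral_density) (auto simp: ennreal_mult)
  also have "\<dots> = ennreal (qf P z + noise_cost P)"
    using * P by (subst nn_integral_eq_integral) (auto simp: has_bochner_integral_iff)
  finally show ?thesis .
qed

lemma nn_integral_qf_next:
  fixes P :: "real^'d \<Rightarrow> real^'x^'x"
  assumes D: "sets D = sets borel" and P [measurable]: "P \<in> borel_measurable borel" and P0: "\<And>\<theta> x. 0 \<le> qf (P \<theta>) x"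
  shows "(\<integral>\<^sup>+z. ennreal (qf (P (fst z)) (st (fst z) (snd z) (Suc t))) \<partial>(D \<Otimes>\<^sub>M Om))
    = (\<integral>\<^sup>+z. ennreal (qf (P (fst z)) (A *v st (fst z) (snd z) t + B (fst z) *v ct (fst z) (snd z) t)
        + noise_cost (P (fst z))) \<partial>(D \<Otimes>\<^sub>M Om))"
proof -
  have sets: "sets (D \<Otimes>\<^sub>M Om) = sets (borel \<Otimes>\<^sub>M Om)" by (intro sets_pair_measure_cong D refl)
  have [measurable]: "(\<lambda>z. st (fst z) (snd z) t) \<in> borel_measurable (D \<Otimes>\<^sub>M Om)"
    "(\<lambda>z. ct (fst z) (snd z) t) \<in> borel_measurable (D \<Otimes>\<^sub>M Om)"
    unfolding measurable_cong_sets[OF sets refl] by measurable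
  have [measurable]: "fst \<in> borel_measurable (D \<Otimes>\<^sub>M Om)" 
    unfolding measurable_cong_sets[OF sets refl] by measurable
  let ?m = "\<lambda>z. A *v st (fst z) (snd z) t + B (fst z) *v ct (fst z) (snd z) t"
  let ?g = "\<lambda>v. ennreal (qf (P (fst (fst v))) (?m (fst v) + snd v))"
  have "(\<integral>\<^sup>+z. ?g (z, snd (snd z) t) \<partial>(D \<Otimes>\<^sub>M Om)) = (\<integral>\<^sup>+z. \<integral>\<^sup>+y. ?g (z, y) \<partial>nu \<partial>(D \<Otimes>\<^sub>M Om))"
  proof (rule nn_integral_noise)
    show "?g \<in> borel_measurable ((D \<Otimes>\<^sub>M Om) \<Otimes>\<^sub>M nu)" by measurable
    fix \<theta> :: "real^'d" and r and w :: "nat \<Rightarrow> real^'x" and y y'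
    show "?g ((\<theta>, (r, w(t := y'))), y) = ?g ((\<theta>, (r, w)), y)"
      using state_cong[of t "w(t := y')" w t A "B \<theta>" \<pi> r] control_cong[of t "w(t := y')" w t A "B \<theta>" \<pi> r] by simp
  qed
  then show ?thesis
    by (simp add: state_Suc nn_integral_qf_shift[OF P0])
qed

end

subsection \<open>Integration by parts and Fisher information\<close>

text \<open>Derivatives are taken along a line in a fixed direction: the van Trees inequality is
  used one direction at a time, so one-variable calculus is enough.\<close>

abbreviation line_deriv :: "('a::real_normed_vector \<Rightarrow> real) \<Rightarrow> 'a \<Rightarrow> 'a \<Rightarrow> real \<Rightarrow> bool" where
  "line_deriv f v z D \<equiv> ((\<lambda>s. f (z + s *\<^sub>R v)) has_real_derivative D) (at 0)"

lemma line_deriv_at: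
  assumes "line_deriv f v (z + s *\<^sub>R v) D"
  shows "((\<lambda>s. f (z + s *\<^sub>R v)) has_real_derivative D) (at s)"
  using assms DERIV_shift[of "\<lambda>s. f (z + s *\<^sub>R v)" D 0 s]
  by (simp add: scaleR_add_left algebra_simps)

lemma line_deriv_mvt:
  assumes "\<And>z. line_deriv f v z (f' z)" "0 < h"
  obtains s where "0 < s" "s < h" "f (z + h *\<^sub>R v) - f z = h * f' (z + s *\<^sub>R v)"
  using MVT2[of 0 h "\<lambda>s. f (z + s *\<^sub>R v)" "\<lambda>s. f' (z + s *\<^sub>R v)"] assms(2) line_deriv_at[OF assms(1)]
  by auto

lemma line_deriv_zero_outside:
  assumes "line_deriv f v z D" "closed K" "\<And>z. z \<notin> K \<Longrightarrow> f z = 0" "z \<notin> K"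
  shows "D = 0"
proof -
  have o: "open ((\<lambda>s. z + s *\<^sub>R v) -` (- K))"
    using assms(2) by (intro open_vimage continuous_intros) auto
  have "((\<lambda>s. f (z + s *\<^sub>R v)) has_real_derivative 0) (at 0)"
    by (rule has_field_derivative_transform_within_open[OF DERIV_const o]) (use assms(3,4) in auto)
  then show ?thesis using assms(1) DERIV_unique by blast
qed

lemma integrable_compact_support:
  fixes f :: "'a::euclidean_space \<Rightarrow> real"
  assumes "continuous_on UNIV f" "compact K" "\<And>z. z \<notin> K \<Longrightarrow> f z = 0"
  shows "integrable lborel f"
proof -
  have "integrable lborel (\<lambda>x. indicator K x *\<^sub>R f x)"
    by (rule borel_integrable_compact[OF assms(2) continuous_on_subset[OF assms(1) subset_UNIV]])
  moreover have "(\<lambda>x. indicator K x *\<^sub>R f x) = f"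
    using assms(3) by (auto simp: fun_eq_iff indicator_def)
  ultimately show ?thesis by simp
qed

lemma
  fixes f :: "'a::euclidean_space \<Rightarrow> 'b::{banach, second_countable_topology}"
  assumes "integrable lborel f"
  shows integrable_lborel_shift: "integrable lborel (\<lambda>z. f (z + c))"
    and integral_lborel_shift: "(LINT z|lborel. f (z + c)) = (LINT z|lborel. f z)"
proof -
  have m: "f \<in> borel_measurable borel" using assms by auto
  have "integrable (distr lborel borel ((+) c)) f" unfolding lborel_distr_plus by (rule assms)
  then show "integrable lborel (\<lambda>z. f (z + c))"
    using m by (subst (asm) integrable_distr_eq) (auto simp: add.commute)
  have "(LINT z|lborel. f z) = (LINT z|distr lborel borel ((+) c). f z)" unfolding lborel_distr_plus ..
  also have "\<dots> = (LINT z|lborel. f (c + z))" using m by (subst integral_distr) auto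
  finally show "(LINT z|lborel. f (z + c)) = (LINT z|lborel. f z)" by (simp add: add.commute)
qed

lemma bounded_compact_support:
  fixes f :: "'a::euclidean_space \<Rightarrow> real"
  assumes "continuous_on UNIV f" "compact K" "\<And>z. z \<notin> K \<Longrightarrow> f z = 0"
  obtains M where "0 \<le> M" "\<And>z. \<bar>f z\<bar> \<le> M"
proof -
  have "compact (f ` K)" using assms by (intro compact_continuous_image continuous_on_subset[OF assms(1)]) auto
  then obtain M where M: "\<And>z. z \<in> K \<Longrightarrow> \<bar>f z\<bar> \<le> M" using compact_imp_bounded bounded_iff by (metis imageI real_norm_def)
  have "\<bar>f z\<bar> \<le> \<bar>M\<bar>" for z using M[of z] assms(3)[of z] by (cases "z \<in> K") auto
  then show ?thesis using that[of "\<bar>M\<bar>"] by auto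
qed

text \<open>Every difference quotient integrates to zero by translation invariance. The mean value
  theorem bounds the quotients by a constant on one large ball, outside which they vanish, and
  dominated convergence passes to the derivative.\<close>

lemma integral_line_deriv_zero:
  fixes f f' :: "'a::euclidean_space \<Rightarrow> real"
  assumes der: "\<And>z. line_deriv f v z (f' z)" and f: "continuous_on UNIV f" and f': "continuous_on UNIV f'"
    and K: "compact K" "\<And>z. z \<notin> K \<Longrightarrow> f z = 0"
  shows "(LINT z|lborel. f' z) = 0"
proof -
  have f'0: "f' z = 0" if "z \<notin> K" for z
    using line_deriv_zero_outside[OF der compact_imp_closed[OF K(1)] K(2) that] .
  obtain M where M: "0 \<le> M" "\<And>z. \<bar>f' z\<bar> \<le> M" using bounded_compact_support[OF f' K(1) f'0] by blast
  obtain R0 where R0: "\<And>z. z \<in> K \<Longrightarrow> norm z \<le> R0" using compact_imp_bounded[OF K(1)] by (auto simp: bounded_iff)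
  \<comment> \<open>Outside the ball of this radius neither z nor z shifted by at most one v lies in
    K.\<close>
  define R where "R = \<bar>R0\<bar> + norm v"
  define h where "h n = inverse (real (Suc n))" for n
  have h: "0 < h n" "h n \<le> 1" for n by (auto simp: h_def inverse_eq_divide)
  define F where "F n z = (f (z + h n *\<^sub>R v) - f z) / h n" for n z
  have intf: "integrable lborel f" by (rule integrable_compact_support[OF f K])
  have F0: "(LINT z|lborel. F n z) = 0" for n
    unfolding F_def using integrable_lborel_shift[OF intf, of "h n *\<^sub>R v"] integral_lborel_shift[OF intf, of "h n *\<^sub>R v"] intf by simp
  have Fb: "norm (F n z) \<le> M * indicator (cball 0 R) z" for n z
  proof (cases "z \<in> cball 0 R")
    case True
    obtain s where "0 < s" "s < h n" "f (z + h n *\<^sub>R v) - f z = h n * f' (z + s *\<^sub>R v)"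
      by (rule line_deriv_mvt[OF der h(1)[of n], of z])
    then have "F n z = f' (z + s *\<^sub>R v)" using h(1)[of n] by (simp add: F_def)
    then show ?thesis using True M by simp
  next
    case False
    then have "R < norm z" by simp
    have "norm (h n *\<^sub>R v) \<le> norm v" using h[of n] by (simp add: mult_left_le_one_le)
    moreover have "norm z \<le> norm (z + h n *\<^sub>R v) + norm (h n *\<^sub>R v)"
      using norm_triangle_ineq4[of "z + h n *\<^sub>R v" "h n *\<^sub>R v"] by simp
    ultimately have "R0 < norm z" "R0 < norm (z + h n *\<^sub>R v)"
      using \<open>R < norm z\<close> norm_ge_zero[of v] abs_ge_self[of R0] unfolding R_def by linarith+
    then have "z \<notin> K" "z + h n *\<^sub>R v \<notin> K" using R0 not_le by blast+
    then show ?thesis using K(2) M(1) by (simp add: F_def indicator_def)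
  qed
  have lim: "(\<lambda>n. F n z) \<longlonglongrightarrow> f' z" for z
  proof -
    have "((\<lambda>s. (f (z + (0 + s) *\<^sub>R v) - f (z + 0 *\<^sub>R v)) / s) \<longlongrightarrow> f' z) (at 0)"
      using DERIV_D[OF der] .
    moreover have "filterlim h (at 0) sequentially"
      unfolding h_def filterlim_at using LIMSEQ_inverse_real_of_nat by (auto simp del: of_nat_Suc)
    ultimately have "((\<lambda>n. (f (z + (0 + h n) *\<^sub>R v) - f (z + 0 *\<^sub>R v)) / h n) \<longlonglongrightarrow> f' z)"
      by (rule filterlim_compose)
    then show ?thesis by (simp add: F_def)
  qed
  have "(\<lambda>n. LINT z|lborel. F n z) \<longlonglongrightarrow> (LINT z|lborel. f' z)"
  proof (rule integral_dominated_convergence[where w="\<lambda>z. M * indicator (cball 0 R) z"])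
    show "f' \<in> borel_measurable lborel" using f' by (simp add: borel_measurable_continuous_onI)
    have "continuous_on UNIV (F n)" for n
      unfolding F_def using h[of n] by (intro continuous_intros continuous_on_compose2[OF f]) auto
    then show "F n \<in> borel_measurable lborel" for n by (simp add: borel_measurable_continuous_onI)
    show "integrable lborel (\<lambda>z. M * indicator (cball 0 R) z)"
      using emeasure_lborel_cball_finite by (intro integrable_mult_right) (auto simp: integrable_indicator_iff)
  qed (use lim Fb in auto)
  then show ?thesis by (simp add: F0 LIMSEQ_const_iff)
qed

text \<open>\<kappa> is regular only on U, but g vanishes off a compact subset K of U, so the
  products extend continuously by zero over the open cover of U and the complement of K. In the
  application c is the value of an estimator, constant in the parameter.\<close>

lemma integration_by_parts_line:
  fixes g g' \<kappa> \<kappa>' :: "'a::euclidean_space \<Rightarrow> real"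
  assumes U: "open U" and K: "compact K" "K \<subseteq> U" "\<And>z. z \<notin> K \<Longrightarrow> g z = 0"
    and g: "\<And>z. line_deriv g v z (g' z)" "continuous_on UNIV g" "continuous_on UNIV g'"
    and \<kappa>: "\<And>z. z \<in> U \<Longrightarrow> line_deriv \<kappa> v z (\<kappa>' z)" "continuous_on U \<kappa>" "continuous_on U \<kappa>'"
  shows "integrable lborel (\<lambda>z. (c - \<kappa> z) * g' z)" "integrable lborel (\<lambda>z. g z * \<kappa>' z)"
    "(LINT z|lborel. (c - \<kappa> z) * g' z) = (LINT z|lborel. g z * \<kappa>' z)"
proof -
  have g'0: "g' z = 0" if "z \<notin> K" for z
    using line_deriv_zero_outside[OF g(1) compact_imp_closed[OF K(1)] K(3) that] .
  have un: "U \<union> - K = UNIV" using K(2) by blast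
  have oK: "open (- K)" using compact_imp_closed[OF K(1)] by blast
  have cont: "continuous_on UNIV h" if "continuous_on U h" "\<And>z. z \<notin> K \<Longrightarrow> h z = 0" for h :: "'a \<Rightarrow> real"
  proof -
    have "continuous_on (- K) h" using that(2) by (subst continuous_on_cong[OF refl, of _ _ "\<lambda>_. 0"]) auto
    then have "continuous_on (U \<union> - K) h" by (intro continuous_on_open_Un U oK that(1))
    then show ?thesis by (simp add: un)
  qed
  have sub: "continuous_on U g" "continuous_on U g'" using g continuous_on_subset by blast+
  have 1: "continuous_on UNIV (\<lambda>z. (c - \<kappa> z) * g' z)"
    using g'0 by (intro cont continuous_intros \<kappa> sub) auto
  have 2: "continuous_on UNIV (\<lambda>z. g z * \<kappa>' z)"
    using K(3) by (intro cont continuous_intros \<kappa> sub) auto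
  have 3: "continuous_on UNIV (\<lambda>z. (c - \<kappa> z) * g z)"
    using K(3) by (intro cont continuous_intros \<kappa> sub) auto
  show i: "integrable lborel (\<lambda>z. (c - \<kappa> z) * g' z)" "integrable lborel (\<lambda>z. g z * \<kappa>' z)"
    using g'0 K(3) by (intro integrable_compact_support[OF 1 K(1)] integrable_compact_support[OF 2 K(1)]; simp)+
  have "(LINT z|lborel. (c - \<kappa> z) * g' z - g z * \<kappa>' z) = 0"
  proof (rule integral_line_deriv_zero[where f="\<lambda>z. (c - \<kappa> z) * g z" and v=v, OF _ 3 _ K(1)])
    show "continuous_on UNIV (\<lambda>z. (c - \<kappa> z) * g' z - g z * \<kappa>' z)" by (rule continuous_on_diff[OF 1 2])
    show "(c - \<kappa> z) * g z = 0" if "z \<notin> K" for z using K(3)[OF that] by simp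
    fix z
    show "line_deriv (\<lambda>z. (c - \<kappa> z) * g z) v z ((c - \<kappa> z) * g' z - g z * \<kappa>' z)"
    proof (cases "z \<in> U")
      case True
      show ?thesis by (rule DERIV_cong, (rule DERIV_mult DERIV_diff DERIV_const \<kappa>(1)[OF True] g(1))+) simp
    next
      case False
      then have z: "z \<notin> K" using K(2) by blast
      have o: "open ((\<lambda>s. z + s *\<^sub>R v) -` (- K))" by (rule open_vimage[OF oK]) (intro continuous_intros)
      have "((\<lambda>s. (c - \<kappa> (z + s *\<^sub>R v)) * g (z + s *\<^sub>R v)) has_real_derivative 0) (at 0)"
        by (rule has_field_derivative_transform_within_open[OF DERIV_const o]) (use K(3) z in auto)
      then show ?thesis using g'0[OF z] K(3)[OF z] by simp
    qed
  qed
  then show "(LINT z|lborel. (c - \<kappa> z) * g' z) = (LINT z|lborel. g z * \<kappa>' z)"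
    using i by simp
qed

lemma gradient_inner:
  assumes "f differentiable (at z)"
  shows "frechet_derivative f (at z) v = gradient f z \<bullet> v"
proof -
  have lin: "linear (frechet_derivative f (at z))" by (rule linear_frechet_derivative[OF assms])
  have "(\<Sum>i\<in>UNIV. v $ i *\<^sub>R axis i 1) = v"
    using basis_expansion[of v] by (simp add: scalar_mult_eq_scaleR)
  then have "frechet_derivative f (at z) v = frechet_derivative f (at z) (\<Sum>i\<in>UNIV. v $ i *\<^sub>R axis i 1)"
    by simp
  also have "\<dots> = gradient f z \<bullet> v"
    by (simp add: linear_sum[OF lin] linear_scale[OF lin] gradient_def inner_vec_def mult.commute)
  finally show ?thesis .
qed

lemma line_deriv_gradient:
  assumes "f differentiable (at z)"
  shows "line_deriv f v z (gradient f z \<bullet> v)"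
proof -
  have "(f has_derivative frechet_derivative f (at z)) (at (z + 0 *\<^sub>R v))"
    using assms frechet_derivative_works by auto
  moreover have "((\<lambda>s. z + s *\<^sub>R v) has_derivative (\<lambda>s. s *\<^sub>R v)) (at 0)"
    by (auto intro!: derivative_eq_intros)
  ultimately have "((\<lambda>s. f (z + s *\<^sub>R v)) has_derivative (\<lambda>s. frechet_derivative f (at z) (s *\<^sub>R v))) (at 0)"
    by (rule has_derivative_compose[rotated])
  then show ?thesis
    by (simp add: has_field_derivative_def gradient_inner[OF assms] mult_commute_abs)
qed

text \<open>The gradient of the logarithm of f, equal to 0 where f vanishes because the inverse of 0
  is 0.\<close>

definition score :: "(real^'n \<Rightarrow> real) \<Rightarrow> real^'n \<Rightarrow> real^'n" where
  "score f z = gradient f z /\<^sub>R f z"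

locale c1_density =
  fixes f :: "real^'n \<Rightarrow> real"
  assumes dens: "prob_density f" and C1: "Ck 1 f"
begin

lemma nonneg: "0 \<le> f z" using dens by (simp add: prob_density_def)

lemma differentiable: "f differentiable (at z)" using C1 by simp

lemma continuous_gradient: "continuous_on UNIV (gradient f)"
proof -
  have "continuous_on UNIV (\<lambda>z. \<chi> i. gradient f z $ i)"
    using C1 by (intro continuous_on_vec_lambda) simp
  then show ?thesis by simp
qed

lemma continuous_density: "continuous_on UNIV f"
  using differentiable differentiable_imp_continuous_on differentiable_on_def
  by (simp add: continuous_at_imp_continuous_on differentiable_imp_continuous_within)

lemma measurable_density [measurable]: "f \<in> borel_measurable borel"
  by (rule borel_measurable_continuous_onI[OF continuous_density])

lemma measurable_gradient [measurable]: "gradient f \<in> borel_measurable borel"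
  by (rule borel_measurable_continuous_onI[OF continuous_gradient])

lemma measurable_score [measurable]: "score f \<in> borel_measurable borel"
  unfolding score_def by measurable

lemma line_deriv: "line_deriv f v z (gradient f z \<bullet> v)"
  by (rule line_deriv_gradient[OF differentiable])

text \<open>A zero of a nonnegative function is a minimum. Hence \<open>score\<close> loses nothing
  at the zeros of f: multiplied by f it returns the gradient everywhere.\<close>

lemma gradient_zero: "f z = 0 \<Longrightarrow> gradient f z = 0"
proof -
  assume z: "f z = 0"
  have "gradient f z \<bullet> v = 0" for v
    by (rule DERIV_local_min[OF line_deriv[where v=v and z=z] zero_less_one]) (use z nonneg in auto)
  then show ?thesis by (metis inner_eq_zero_iff)
qed

lemma scale_score: "f z *\<^sub>R score f z = gradient f z"
  using gradient_zero[of z] by (cases "f z = 0") (auto simp: score_def)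

lemma fisher_integrand_eq: "fisher_integrand f z = f z *\<^sub>R outer (score f z) (score f z)"
proof (cases "f z = 0")
  case False
  then have pos: "0 < f z" using nonneg[of z] by simp
  have "gradient (\<lambda>y. ln (f y)) z = score f z"
  proof -
    have "((\<lambda>y. ln (f y)) has_derivative (\<lambda>h. frechet_derivative f (at z) h * inverse (f z))) (at z)"
      using has_derivative_ln[OF pos frechet_derivative_works[THEN iffD1, OF differentiable]] by (simp add: divide_inverse)
    from frechet_derivative_at[OF this, symmetric] show ?thesis
      by (simp add: gradient_def score_def vec_eq_iff mult.commute)
  qed
  then show ?thesis by (simp add: fisher_integrand_def)
qed (simp add: fisher_integrand_def)

lemma qf_fisher_integrand: "qf (fisher_integrand f z) v = f z * (score f z \<bullet> v)\<^sup>2"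
  by (simp add: fisher_integrand_eq scaleR_matrix_vector_assoc[symmetric] qf_outer)

lemma qf_integral:
  fixes M :: "'a \<Rightarrow> real^'m^'m"
  assumes "integrable X M"
  shows "integrable X (\<lambda>z. qf (M z) v)" "(LINT z|X. qf (M z) v) = qf (LINT z|X. M z) v"
proof -
  have bl: "bounded_linear (\<lambda>M. qf M v)"
    by (intro bounded_linear_compose[OF bounded_linear_inner_right]
        bounded_bilinear.bounded_linear_left[OF bounded_bilinear_matrix_vector])
  show "integrable X (\<lambda>z. qf (M z) v)" by (rule integrable_bounded_linear[OF bl assms])
  show "(LINT z|X. qf (M z) v) = qf (LINT z|X. M z) v" by (rule integral_bounded_linear[OF bl assms])
qed

end

locale fisher_density = c1_density +
  assumes integrable_fisher: "integrable lborel (fisher_integrand f)"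
begin

lemma integrable_score_sq: "integrable lborel (\<lambda>z. f z * (score f z \<bullet> v)\<^sup>2)"
  using qf_integral(1)[OF integrable_fisher, of v] by (simp add: qf_fisher_integrand)

lemma integral_score_sq: "(LINT z|lborel. f z * (score f z \<bullet> v)\<^sup>2) = qf (fisher f) v"
  using qf_integral(2)[OF integrable_fisher, of v] by (simp add: qf_fisher_integrand fisher_def)

lemma qf_fisher_nonneg: "0 \<le> qf (fisher f) v"
  unfolding integral_score_sq[symmetric] using nonneg by (intro integral_nonneg_AE) auto

lemma integrable_density: "integrable lborel f"
  using dens by (auto simp: prob_density_def has_bochner_integral_iff)

text \<open>The bound of |a| by 1 + a^2 turns finite Fisher information into integrability of the
  gradient.\<close>

lemma integrable_gradient: "integrable lborel (\<lambda>z. gradient f z \<bullet> v)"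
proof (rule Bochner_Integration.integrable_bound[OF Bochner_Integration.integrable_add[OF integrable_density integrable_score_sq[of v]]])
  show "AE z in lborel. norm (gradient f z \<bullet> v) \<le> norm (f z + f z * (score f z \<bullet> v)\<^sup>2)"
  proof (intro always_eventually allI)
    fix z
    let ?a = "score f z \<bullet> v"
    have "2 * \<bar>?a\<bar> * 1 \<le> \<bar>?a\<bar>\<^sup>2 + 1\<^sup>2" by (rule sum_squares_bound)
    then have "\<bar>?a\<bar> \<le> 1 + ?a\<^sup>2" using abs_ge_zero[of ?a] by simp
    then have "f z * \<bar>?a\<bar> \<le> f z * (1 + ?a\<^sup>2)" using nonneg by (rule mult_left_mono)
    moreover have "gradient f z \<bullet> v = f z * ?a" by (simp add: scale_score[symmetric])
    ultimately show "norm (gradient f z \<bullet> v) \<le> norm (f z + f z * ?a\<^sup>2)"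
      using nonneg[of z] by (simp add: abs_mult distrib_left)
  qed
qed measurable

text \<open>The support need not be compact here, so the gradient is averaged along the segment from
  z to z + v instead. By translation every point of the segment contributes the same integral over
  z, while for fixed z the average is f (z + v) - f z, which integrates to zero.\<close>

lemma integral_gradient: "(LINT z|lborel. gradient f z \<bullet> v) = 0"
proof -
  have psf: "pair_sigma_finite (lborel :: real measure) (lborel :: (real^'n) measure)"
    by (intro pair_sigma_finite.intro sigma_finite_lborel)
  let ?G = "\<lambda>(s::real) z. indicator {0..1} s * (gradient f (z + s *\<^sub>R v) \<bullet> v)"
  have cont: "continuous_on UNIV (\<lambda>x. gradient f (snd x + fst x *\<^sub>R v) \<bullet> v)"
    by (intro continuous_intros continuous_on_compose2[OF continuous_gradient]) auto
  have [measurable]: "(\<lambda>x. gradient f (snd x + fst x *\<^sub>R v) \<bullet> v) \<in> borel_measurable (borel \<Otimes>\<^sub>M borel)"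
    using borel_measurable_continuous_onI[OF cont] by (simp add: borel_prod)
  have intG: "(LINT z|lborel. gradient f (z + s *\<^sub>R v) \<bullet> v) = (LINT z|lborel. gradient f z \<bullet> v)" for s
    by (rule integral_lborel_shift[OF integrable_gradient])
  have intaG: "(LINT z|lborel. \<bar>gradient f (z + s *\<^sub>R v) \<bullet> v\<bar>) = (LINT z|lborel. \<bar>gradient f z \<bullet> v\<bar>)" for s
    using integral_lborel_shift[OF integrable_abs[OF integrable_gradient[of v]], of "s *\<^sub>R v"] .
  have int: "integrable (lborel \<Otimes>\<^sub>M lborel) (\<lambda>(s, z). ?G s z)"
  proof (rule pair_sigma_finite.Fubini_integrable[OF psf])
    show "(\<lambda>(s, z). ?G s z) \<in> borel_measurable (lborel \<Otimes>\<^sub>M lborel)"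
      by (simp add: case_prod_beta) measurable
    show "integrable lborel (\<lambda>s. LINT z|lborel. norm (case (s, z) of (s, z) \<Rightarrow> ?G s z))"
      by (simp add: abs_mult intaG)
    show "AE s in lborel. integrable lborel (\<lambda>z. case (s, z) of (s, z) \<Rightarrow> ?G s z)"
      using integrable_lborel_shift[OF integrable_gradient[of v]] by (intro always_eventually) auto
  qed
  have "(LINT s|lborel. LINT z|lborel. ?G s z) = (LINT z|lborel. LINT s|lborel. ?G s z)"
    using pair_sigma_finite.Fubini_integral[OF psf int] by simp
  moreover have "(LINT s|lborel. LINT z|lborel. ?G s z) = (LINT z|lborel. gradient f z \<bullet> v)"
    by (simp add: intG)
  moreover have "(LINT s|lborel. ?G s z) = f (z + v) - f z" for z
  proof -
    have "(LINT s|lborel. indicator {0..1} s *\<^sub>R (gradient f (z + s *\<^sub>R v) \<bullet> v)) = f (z + 1 *\<^sub>R v) - f (z + 0 *\<^sub>R v)"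
    proof (rule integral_FTC_atLeastAtMost)
      fix s :: real
      show "((\<lambda>s. f (z + s *\<^sub>R v)) has_vector_derivative gradient f (z + s *\<^sub>R v) \<bullet> v) (at s within {0..1})"
        using line_deriv_at[OF line_deriv, where z=z and s=s and v=v]
        by (simp add: has_real_derivative_iff_has_vector_derivative has_vector_derivative_at_within)
      show "continuous_on {0..1} (\<lambda>s. gradient f (z + s *\<^sub>R v) \<bullet> v)"
        by (intro continuous_intros continuous_on_compose2[OF continuous_gradient]) auto
    qed simp
    then show ?thesis by simp
  qed
  moreover have "(LINT z|lborel. f (z + v) - f z) = 0"
    using integrable_lborel_shift[OF integrable_density, of v] integral_lborel_shift[OF integrable_density, of v] integrable_density by simp
  ultimately show ?thesis by simp
qed

lemma integrable_score: "integrable lborel (\<lambda>z. f z * (score f z \<bullet> v))"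
  and integral_score: "(LINT z|lborel. f z * (score f z \<bullet> v)) = 0"
proof -
  have "f z * (score f z \<bullet> v) = gradient f z \<bullet> v" for z by (simp add: scale_score[symmetric])
  then show "integrable lborel (\<lambda>z. f z * (score f z \<bullet> v))" "(LINT z|lborel. f z * (score f z \<bullet> v)) = 0"
    using integrable_gradient[of v] integral_gradient[of v] by simp_all
qed

text \<open>The score has mean zero and second moment given by the Fisher information, so the mixed
  term disappears.\<close>

lemma nn_integral_score_shift:
  "(\<integral>\<^sup>+z. ennreal ((y - score f z \<bullet> b)\<^sup>2) \<partial>density lborel (\<lambda>z. ennreal (f z))) = ennreal (y\<^sup>2 + qf (fisher f) b)"
proof -
  have 1: "has_bochner_integral lborel f 1" using dens by (simp add: prob_density_def)
  have 2: "has_bochner_integral lborel (\<lambda>z. f z * (score f z \<bullet> b)) 0"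
    using integrable_score integral_score by (simp add: has_bochner_integral_iff)
  have 3: "has_bochner_integral lborel (\<lambda>z. f z * (score f z \<bullet> b)\<^sup>2) (qf (fisher f) b)"
    using integrable_score_sq integral_score_sq by (simp add: has_bochner_integral_iff)
  have "has_bochner_integral lborel (\<lambda>z. (y\<^sup>2) * f z - (2 * y) * (f z * (score f z \<bullet> b)) + f z * (score f z \<bullet> b)\<^sup>2)
    ((y\<^sup>2) * 1 - (2 * y) * 0 + qf (fisher f) b)"
    by (intro has_bochner_integral_add has_bochner_integral_diff has_bochner_integral_mult_right 1 2 3)
  moreover have "(y\<^sup>2) * f z - (2 * y) * (f z * (score f z \<bullet> b)) + f z * (score f z \<bullet> b)\<^sup>2 = f z * (y - score f z \<bullet> b)\<^sup>2" for z
    by (simp add: power2_eq_square algebra_simps)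
  ultimately have *: "has_bochner_integral lborel (\<lambda>z. f z * (y - score f z \<bullet> b)\<^sup>2) (y\<^sup>2 + qf (fisher f) b)" by simp
  have "(\<integral>\<^sup>+z. ennreal ((y - score f z \<bullet> b)\<^sup>2) \<partial>density lborel (\<lambda>z. ennreal (f z)))
      = (\<integral>\<^sup>+z. ennreal (f z * (y - score f z \<bullet> b)\<^sup>2) \<partial>lborel)"
    using nonneg by (subst nn_integral_density) (auto simp: ennreal_mult)
  also have "\<dots> = ennreal (y\<^sup>2 + qf (fisher f) b)"
    using * nonneg by (subst nn_integral_eq_integral) (auto simp: has_bochner_integral_iff)
  finally show ?thesis .
qed

end

text \<open>If a nonnegative function had too large a slope compared with its value, a bounded
  second derivative would let it become negative along the descent. For a smooth compactly supported
  density this bounds the squared gradient over the density, and so makes its Fisher information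
  finite.\<close>

lemma deriv_sq_le:
  assumes f: "\<And>z::real^'n. 0 \<le> f z" "\<And>z. line_deriv f v z (f' z)" "\<And>z. line_deriv f' v z (f'' z)"
    and M: "0 < M" "\<And>z. \<bar>f'' z\<bar> \<le> M"
  shows "(f' z)\<^sup>2 \<le> 4 * M * f z"
proof -
  have *: "a\<^sup>2 \<le> 4 * M * f z"
    if a: "0 < a" "\<And>z. line_deriv f v z (f' z)" "\<And>z. line_deriv f' v z (f'' z)" "\<And>z. \<bar>f'' z\<bar> \<le> M" "f' z = - a"
    for a v f' f''
  proof -
    \<comment> \<open>Over this length the slope stays at most -a/2, so f drops by at least a^2 / (4
      M).\<close>
    define h where "h = a / (2 * M)"
    have h: "0 < h" using a(1) M(1) by (simp add: h_def)
    obtain s where s: "0 < s" "s < h" "f (z + h *\<^sub>R v) - f z = h * f' (z + s *\<^sub>R v)"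
      by (rule line_deriv_mvt[OF a(2) h, of z])
    obtain s' where "0 < s'" "s' < s" and s': "f' (z + s *\<^sub>R v) - f' z = s * f'' (z + s' *\<^sub>R v)"
      by (rule line_deriv_mvt[OF a(3) s(1), of z])
    have "s * f'' (z + s' *\<^sub>R v) \<le> s * M"
      using s(1) abs_le_D1[OF a(4)[of "z + s' *\<^sub>R v"]] by (intro mult_left_mono) auto
    also have "s * M \<le> h * M" using s(2) M(1) by (intro mult_right_mono) auto
    finally have "s * f'' (z + s' *\<^sub>R v) \<le> h * M" .
    then have "f' (z + s *\<^sub>R v) \<le> - a + h * M" using s' a(5) by simp
    then have "h * f' (z + s *\<^sub>R v) \<le> h * (- a + h * M)" using h by (intro mult_left_mono) auto
    then have "0 \<le> f z + h * (- a + h * M)" using s(3) f(1)[of "z + h *\<^sub>R v"] by linarith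
    then show ?thesis using M(1) a(1) by (simp add: h_def field_simps power2_eq_square)
  qed
  have neg: "line_deriv f (- v) z (- f' z)" "line_deriv (\<lambda>z. - f' z) (- v) z (f'' z)" for z
    using DERIV_mirror[of "\<lambda>s. f (z + s *\<^sub>R v)" "f' z" 0]
      DERIV_minus[OF DERIV_mirror[THEN iffD1, of "\<lambda>s. f' (z + s *\<^sub>R v)" "f'' z" 0]] f(2,3)[of z] by simp_all
  consider "f' z = 0" | "0 < - f' z" | "0 < f' z" by linarith
  then show ?thesis
  proof cases
    case 1
    then show ?thesis using f(1)[of z] M(1) by simp
  next
    case 2
    then show ?thesis using *[of "- f' z" v f' f''] f M by simp
  next
    case 3
    then show ?thesis using *[of "f' z" "- v" "\<lambda>z. - f' z" f''] neg M by simp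
  qed
qed

text \<open>By \<open>deriv_sq_le\<close> along the coordinate axes every entry of the Fisher
  integrand is bounded on the compact support and zero off it.\<close>

lemma Cc_infinity_fisher_density:
  fixes f :: "real^'n \<Rightarrow> real"
  assumes "prob_density f" "Cc_infinity S f"
  shows "fisher_density f"
proof -
  have Ck: "Ck k f" for k using assms by (simp add: Cc_infinity_def)
  interpret c1_density f by unfold_locales (use assms Ck[of 1] in auto)
  let ?K = "closure {z. f z \<noteq> 0}"
  have K: "compact ?K" using assms by (simp add: Cc_infinity_def)
  have K0: "f z = 0" if "z \<notin> ?K" for z
  proof (rule ccontr)
    assume "f z \<noteq> 0"
    then have "z \<in> ?K" by (intro subsetD[OF closure_subset]) simp
    with that show False by contradiction
  qed
  let ?g = "\<lambda>i z. gradient f z $ i"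
  have g2: "\<And>z. ?g i differentiable (at z)" and g2c: "continuous_on UNIV (\<lambda>z. gradient (?g i) z $ j)" for i j
    using Ck[of 2] by (simp_all add: numeral_2_eq_2)
  have ld: "line_deriv f (axis i 1) z (?g i z)" for i z
    using line_deriv[where v="axis i 1" and z=z] by (simp add: inner_axis)
  have ld2: "line_deriv (?g i) (axis i 1) z (gradient (?g i) z $ i)" for i z
    using line_deriv_gradient[of "?g i" z "axis i 1", OF g2] by (simp add: inner_axis)
  have g0: "?g i z = 0" if "z \<notin> ?K" for i z
    using line_deriv_zero_outside[OF ld closed_closure K0 that] .
  have gg0: "gradient (?g i) z $ i = 0" if "z \<notin> ?K" for i z
    using line_deriv_zero_outside[OF ld2 closed_closure g0 that] .
  have "\<exists>M. \<forall>z. \<bar>gradient (?g i) z $ i\<bar> \<le> M" for i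
    using bounded_compact_support[OF g2c K gg0] by metis
  then obtain M' where M': "\<And>i z. \<bar>gradient (?g i) z $ i\<bar> \<le> M' i" by metis
  define M where "M = (\<Sum>i\<in>UNIV. \<bar>M' i\<bar>) + 1"
  have M: "0 < M" "\<bar>gradient (?g i) z $ i\<bar> \<le> M" for i z
  proof -
    have "\<bar>M' i\<bar> \<le> (\<Sum>i\<in>UNIV. \<bar>M' i\<bar>)" by (intro member_le_sum) auto
    then show "\<bar>gradient (?g i) z $ i\<bar> \<le> M" using M'[of i z] by (simp add: M_def)
    show "0 < M" by (simp add: M_def add_nonneg_pos sum_nonneg)
  qed
  have sq: "(?g i z)\<^sup>2 \<le> 4 * M * f z" for i z
    by (rule deriv_sq_le[OF nonneg ld ld2 M])
  have ent: "\<bar>fisher_integrand f z $ i $ j\<bar> \<le> 4 * M * indicator ?K z" for z i j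
  proof (cases "z \<in> ?K \<and> f z \<noteq> 0")
    case False
    then have "f z = 0" using K0 by blast
    then show ?thesis using M(1) by (simp add: fisher_integrand_def)
  next
    case True
    then have pos: "0 < f z" using nonneg[of z] by simp
    have "\<bar>?g i z * ?g j z\<bar> \<le> ((?g i z)\<^sup>2 + (?g j z)\<^sup>2) / 2"
      using sum_squares_bound[of "\<bar>?g i z\<bar>" "\<bar>?g j z\<bar>"] by (simp add: abs_mult)
    also have "\<dots> \<le> 4 * M * f z" using sq[of z i] sq[of z j] by simp
    finally have "\<bar>?g i z * ?g j z\<bar> / f z \<le> 4 * M" using pos by (simp add: divide_le_eq)
    moreover have "fisher_integrand f z $ i $ j = ?g i z * ?g j z / f z"
      using pos by (simp add: fisher_integrand_eq outer_def score_def field_simps)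
    ultimately show ?thesis using True pos by simp
  qed
  have "integrable lborel (fisher_integrand f)"
  proof (rule Bochner_Integration.integrable_bound)
    show "integrable lborel (\<lambda>z. real CARD('n) * real CARD('n) * (4 * M) * indicator ?K z)"
      using K emeasure_compact_finite[OF K]
      by (intro integrable_mult_right) (auto simp: integrable_indicator_iff)
    show "fisher_integrand f \<in> borel_measurable lborel"
      unfolding fisher_integrand_eq[abs_def] by measurable
    show "AE z in lborel. norm (fisher_integrand f z) \<le> norm (real CARD('n) * real CARD('n) * (4 * M) * indicator ?K z :: real)"
      using norm_matrix_le_entries[OF ent] M(1) by (intro always_eventually) (auto simp: mult_ac abs_mult)
  qed
  then show ?thesis by unfold_locales
qed

subsection \<open>Likelihood of the observed path and the van Trees inequality\<close>

lemma nn_integral_lborel_shift: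
  fixes f :: "'a::euclidean_space \<Rightarrow> ennreal"
  assumes [measurable]: "f \<in> borel_measurable borel"
  shows "(\<integral>\<^sup>+z. f (c + z) \<partial>lborel) = (\<integral>\<^sup>+z. f z \<partial>lborel)"
proof -
  have "(\<integral>\<^sup>+z. f z \<partial>lborel) = (\<integral>\<^sup>+z. f z \<partial>distr lborel borel ((+) c))" unfolding lborel_distr_plus ..
  also have "\<dots> = (\<integral>\<^sup>+z. f (c + z) \<partial>lborel)" by (subst nn_integral_distr) auto
  finally show ?thesis ..
qed

lemma integral_cauchy_schwarz:
  fixes X Y :: "'a \<Rightarrow> real"
  assumes "X \<in> borel_measurable M" "Y \<in> borel_measurable M"
    and X: "integrable M (\<lambda>z. (X z)\<^sup>2)" and Y: "integrable M (\<lambda>z. (Y z)\<^sup>2)"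
  shows "integrable M (\<lambda>z. X z * Y z)"
    and "(LINT z|M. X z * Y z)\<^sup>2 \<le> (LINT z|M. (X z)\<^sup>2) * (LINT z|M. (Y z)\<^sup>2)"
proof -
  note [measurable] = assms(1,2)
  show XY: "integrable M (\<lambda>z. X z * Y z)"
  proof (rule Bochner_Integration.integrable_bound[OF Bochner_Integration.integrable_add[OF X Y]])
    show "AE z in M. norm (X z * Y z) \<le> norm ((X z)\<^sup>2 + (Y z)\<^sup>2)"
    proof (intro always_eventually allI)
      fix z
      have "2 * (\<bar>X z\<bar> * \<bar>Y z\<bar>) \<le> (X z)\<^sup>2 + (Y z)\<^sup>2"
        using sum_squares_bound[of "\<bar>X z\<bar>" "\<bar>Y z\<bar>"] by (simp add: mult.assoc)
      moreover have "0 \<le> \<bar>X z\<bar> * \<bar>Y z\<bar>" by simp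
      ultimately show "norm (X z * Y z) \<le> norm ((X z)\<^sup>2 + (Y z)\<^sup>2)"
        unfolding real_norm_def abs_mult using abs_ge_self[of "(X z)\<^sup>2 + (Y z)\<^sup>2"] by linarith
    qed
  qed measurable
  let ?a = "LINT z|M. (X z)\<^sup>2" and ?b = "LINT z|M. X z * Y z" and ?c = "LINT z|M. (Y z)\<^sup>2"
  have q: "0 \<le> ?a - 2 * t * ?b + t\<^sup>2 * ?c" for t
  proof -
    have "0 \<le> (LINT z|M. (X z - t * Y z)\<^sup>2)" by (intro integral_nonneg_AE) auto
    also have "(\<lambda>z. (X z - t * Y z)\<^sup>2) = (\<lambda>z. (X z)\<^sup>2 - (2 * t) * (X z * Y z) + t\<^sup>2 * (Y z)\<^sup>2)"
      by (auto simp: fun_eq_iff power2_eq_square algebra_simps)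
    also have "(LINT z|M. (X z)\<^sup>2 - (2 * t) * (X z * Y z) + t\<^sup>2 * (Y z)\<^sup>2) = ?a - 2 * t * ?b + t\<^sup>2 * ?c"
      using X Y XY by simp
    finally show ?thesis .
  qed
  have c0: "0 \<le> ?c" by (intro integral_nonneg_AE) auto
  show "?b\<^sup>2 \<le> ?a * ?c"
  proof (cases "?c = 0")
    case True
    have "?b = 0"
    proof (rule ccontr)
      assume b: "?b \<noteq> 0"
      have "0 \<le> ?a - 2 * ((?a + 1) / (2 * ?b)) * ?b" using q[of "(?a + 1) / (2 * ?b)"] True by simp
      then show False using b by simp
    qed
    then show ?thesis using True by simp
  next
    case False
    with c0 have "0 < ?c" by linarith
    then show ?thesis using q[of "?b / ?c"] by (simp add: field_simps power2_eq_square)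
  qed
qed

context lq_model
begin

text \<open>The reference measure for an observed path, made of the randomization and the states
  x_1, ..., x_e. It does not depend on the parameter, and the law of the path has the density
  \<open>lik\<close> with respect to it.\<close>

abbreviation Pt :: "nat \<Rightarrow> ('r \<times> (nat \<Rightarrow> real^'x)) measure" where
  "Pt e \<equiv> N \<Otimes>\<^sub>M Pi\<^sub>M {1..e} (\<lambda>_. lborel)"

text \<open>This and the next three definitions recover from a path v the state, the input, the
  conditional mean of the next state, and the noise. Time 0 is special because the initial state is
  fixed and not part of the path.\<close>

definition px :: "nat \<Rightarrow> 'r \<times> (nat \<Rightarrow> real^'x) \<Rightarrow> real^'x" where
  "px j v = (if j = 0 then 0 else snd v j)"

definition pu :: "nat \<Rightarrow> 'r \<times> (nat \<Rightarrow> real^'x) \<Rightarrow> real^'u" where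
  "pu j v = \<pi> j (restrict (snd v) {1..j}) (fst v)"

definition pmean :: "real^'d \<Rightarrow> nat \<Rightarrow> 'r \<times> (nat \<Rightarrow> real^'x) \<Rightarrow> real^'x" where
  "pmean \<theta> j v = A *v px j v + B \<theta> *v pu j v"

definition pw :: "real^'d \<Rightarrow> nat \<Rightarrow> 'r \<times> (nat \<Rightarrow> real^'x) \<Rightarrow> real^'x" where
  "pw \<theta> j v = px (Suc j) v - pmean \<theta> j v"

definition lik :: "nat \<Rightarrow> real^'d \<Rightarrow> 'r \<times> (nat \<Rightarrow> real^'x) \<Rightarrow> real" where
  "lik e \<theta> v = (\<Prod>j<e. p (pw \<theta> j v))"

definition pm :: "nat \<Rightarrow> real^'d \<Rightarrow> 'r \<times> (nat \<Rightarrow> real^'x) \<Rightarrow> 'r \<times> (nat \<Rightarrow> real^'x)" where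
  "pm e \<theta> \<omega> = (fst \<omega>, restrict (st \<theta> \<omega>) {1..e})"

lemma px_pm: "j \<le> e \<Longrightarrow> px j (pm e \<theta> \<omega>) = st \<theta> \<omega> j"
  by (auto simp: px_def pm_def state_0)

lemma pu_pm: "j \<le> e \<Longrightarrow> pu j (pm e \<theta> \<omega>) = ct \<theta> \<omega> j"
proof -
  assume "j \<le> e"
  then have eq: "{1..e} \<inter> {1..j} = {1..j}" by auto
  show ?thesis unfolding pu_def pm_def control_def fst_conv snd_conv restrict_restrict eq ..
qed

lemma pw_pm: "j < e \<Longrightarrow> pw \<theta> j (pm e \<theta> \<omega>) = snd \<omega> j"
  by (simp add: pw_def pmean_def px_pm pu_pm state_Suc)

lemma lik_nonneg: "0 \<le> lik e \<theta> v"
  unfolding lik_def by (intro prod_nonneg) auto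

lemma px_measurable:
  assumes "j \<le> e" shows "px j \<in> borel_measurable (Pt e)"
proof (cases "j = 0")
  case False
  then have "(\<lambda>v. snd v j) \<in> borel_measurable (Pt e)"
    using assms by (intro measurable_compose[OF measurable_snd measurable_component_singleton[where M="\<lambda>_. lborel", simplified]]) auto
  then show ?thesis using False by (simp add: px_def[abs_def])
qed (simp add: px_def[abs_def])

lemma pu_measurable:
  assumes "j \<le> e" shows "pu j \<in> borel_measurable (Pt e)"
  unfolding pu_def[abs_def]
proof (rule policy_measurable)
  fix s assume "s \<in> {1..j}"
  then show "(\<lambda>v. snd v s) \<in> borel_measurable (Pt e)"
    using px_measurable[of s e] assms by (simp add: px_def[abs_def])
qed measurable

lemma pmean_measurable:
  assumes "j \<le> e" shows "(\<lambda>z. pmean (fst z) j (snd z)) \<in> borel_measurable (borel \<Otimes>\<^sub>M Pt e)"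
proof -
  note [measurable] = measurable_compose[OF measurable_snd px_measurable[OF assms]]
    measurable_compose[OF measurable_snd pu_measurable[OF assms]]
  show ?thesis unfolding pmean_def by measurable
qed

lemma pw_measurable:
  assumes "j < e" shows "(\<lambda>z. pw (fst z) j (snd z)) \<in> borel_measurable (borel \<Otimes>\<^sub>M Pt e)"
proof -
  have "Suc j \<le> e" "j \<le> e" using assms by auto
  note [measurable] = measurable_compose[OF measurable_snd px_measurable[OF this(1)]] pmean_measurable[OF this(2)]
  show ?thesis unfolding pw_def by measurable
qed

lemma lik_measurable:
  assumes "k \<le> e" shows "(\<lambda>z. lik k (fst z) (snd z)) \<in> borel_measurable (borel \<Otimes>\<^sub>M Pt e)"
  unfolding lik_def using assms
  by (intro borel_measurable_prod measurable_compose[OF pw_measurable p_measurable]) auto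

lemma pm_measurable: "(\<lambda>z. pm e (fst z) (snd z)) \<in> measurable (borel \<Otimes>\<^sub>M Om) (Pt e)"
  unfolding pm_def
  by (intro measurable_Pair measurable_restrict measurable_compose[OF measurable_snd fst_Om_measurable])
     (simp_all add: state_measurable)

lemma pm_measurable_fixed: "pm e \<theta> \<in> measurable Om (Pt e)"
  using measurable_compose[OF measurable_Pair1' pm_measurable, of \<theta> e] by simp

lemma sets_Pt_Suc: "Pi\<^sub>M {1..Suc e} (\<lambda>_. lborel :: (real^'x) measure) = Pi\<^sub>M (insert (Suc e) {1..e}) (\<lambda>_. lborel)"
  by (simp add: atLeastAtMostSuc_conv)

text \<open>Induction on the length. The next state is its conditional mean plus fresh noise, and
  after a shift of Lebesgue measure this contributes one factor of the density p. The inputs are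
  functions of the path and the randomization that do not involve the parameter, so they contribute
  no factor.\<close>

lemma path_law_fixed:
  assumes "f \<in> borel_measurable (Pt e)"
  shows "(\<integral>\<^sup>+\<omega>. f (pm e \<theta> \<omega>) \<partial>Om) = (\<integral>\<^sup>+v. ennreal (lik e \<theta> v) * f v \<partial>Pt e)"
  using assms
proof (induction e arbitrary: f)
  case 0
  note [measurable] = 0
  interpret P0: sigma_finite_measure "Pi\<^sub>M {} (\<lambda>_::nat. lborel :: (real^'x) measure)"
    unfolding PiM_empty by (rule sigma_finite_measure_count_space_finite) simp
  have m [measurable]: "(\<lambda>r. f (r, \<lambda>_. undefined)) \<in> borel_measurable N"
    using measurable_compose[OF measurable_Pair2'[of "\<lambda>_. undefined" "Pi\<^sub>M {1..0} (\<lambda>_. lborel)" N] 0] by simp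
  have "(\<integral>\<^sup>+\<omega>. f (pm 0 \<theta> \<omega>) \<partial>Om) = (\<integral>\<^sup>+\<omega>. f (fst \<omega>, \<lambda>_. undefined) \<partial>Om)"
    by (simp add: pm_def restrict_def)
  also have "\<dots> = (\<integral>\<^sup>+r. f (r, \<lambda>_. undefined) \<partial>N)"
    unfolding sample_space_def using PiN.emeasure_space_1
    by (subst PiN.nn_integral_fst[symmetric]) auto
  also have "\<dots> = (\<integral>\<^sup>+v. ennreal (lik 0 \<theta> v) * f v \<partial>Pt 0)"
    using 0 by (simp add: lik_def, subst P0.nn_integral_fst[symmetric])
       (auto simp: PiM_empty nn_integral_count_space_finite)
  finally show ?case .
next
  case (Suc e)
  let ?L = "Pi\<^sub>M {1..e} (\<lambda>_::nat. lborel :: (real^'x) measure)"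
  interpret ps: product_sigma_finite "\<lambda>_::nat. lborel :: (real^'x) measure" by unfold_locales
  interpret L: sigma_finite_measure ?L by (rule ps.sigma_finite) simp
  interpret L': sigma_finite_measure "Pi\<^sub>M {1..Suc e} (\<lambda>_::nat. lborel :: (real^'x) measure)" by (rule ps.sigma_finite) simp
  define up where "up = (\<lambda>v y. (fst v, (snd v)(Suc e := y)) :: 'r \<times> (nat \<Rightarrow> real^'x))"
  have up [measurable]: "(\<lambda>z. up (fst z) (snd z)) \<in> measurable (Pt e \<Otimes>\<^sub>M borel) (Pt (Suc e))"
  proof -
    have "(\<lambda>z. (snd (fst z))(Suc e := snd z)) \<in> measurable (Pt e \<Otimes>\<^sub>M borel) (Pi\<^sub>M (insert (Suc e) {1..e}) (\<lambda>_. lborel))"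
      by (rule measurable_fun_upd[where J="{1..e}"]) auto
    then show ?thesis unfolding up_def sets_Pt_Suc by (intro measurable_Pair) auto
  qed
  note [measurable] = Suc.prems
  define F where "F v = (\<integral>\<^sup>+y. ennreal (p (y - pmean \<theta> e v)) * f (up v y) \<partial>lborel)" for v
  have pmm [measurable]: "pmean \<theta> e \<in> borel_measurable (Pt e)"
    using measurable_compose[OF measurable_Pair1' pmean_measurable[OF order_refl], of \<theta> e] by simp
  have fup [measurable]: "(\<lambda>z. f (up (fst z) (snd z))) \<in> borel_measurable (Pt e \<Otimes>\<^sub>M borel)"
    by (rule measurable_compose[OF up Suc.prems])
  have F [measurable]: "F \<in> borel_measurable (Pt e)"
    unfolding F_def by measurable
  have fupv [measurable]: "(\<lambda>y. f (up v y)) \<in> borel_measurable borel" if "v \<in> space (Pt e)" for v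
    using measurable_compose[OF measurable_Pair1'[OF that] fup] by simp
  have inner: "(\<integral>\<^sup>+y. f (up v (pmean \<theta> e v + y)) \<partial>nu) = F v" if v: "v \<in> space (Pt e)" for v
  proof -
    have [measurable]: "(\<lambda>y. f (up v y)) \<in> borel_measurable borel" by (rule fupv[OF v])
    have "(\<integral>\<^sup>+y. f (up v (pmean \<theta> e v + y)) \<partial>nu)
        = (\<integral>\<^sup>+y. (\<lambda>y. ennreal (p (y - pmean \<theta> e v)) * f (up v y)) (pmean \<theta> e v + y) \<partial>lborel)"
      by (subst nn_integral_density) auto
    also have "\<dots> = F v" unfolding F_def by (rule nn_integral_lborel_shift) measurable
    finally show ?thesis .
  qed
  have pmS: "pm (Suc e) \<theta> \<omega> = up (pm e \<theta> \<omega>) (pmean \<theta> e (pm e \<theta> \<omega>) + snd \<omega> e)" for \<omega>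
  proof -
    have "pmean \<theta> e (pm e \<theta> \<omega>) = A *v st \<theta> \<omega> e + B \<theta> *v ct \<theta> \<omega> e"
      by (simp add: pmean_def px_pm pu_pm)
    then show ?thesis by (auto simp: pm_def up_def restrict_def fun_eq_iff state_Suc)
  qed
  note [measurable] = pm_measurable_fixed
  have "(\<integral>\<^sup>+\<omega>. f (pm (Suc e) \<theta> \<omega>) \<partial>Om)
      = (\<integral>\<^sup>+\<omega>. (\<lambda>z. f (up (pm e \<theta> (fst z)) (pmean \<theta> e (pm e \<theta> (fst z)) + snd z))) (\<omega>, snd \<omega> e) \<partial>Om)"
    by (simp add: pmS)
  also have "\<dots> = (\<integral>\<^sup>+\<omega>. \<integral>\<^sup>+y. f (up (pm e \<theta> \<omega>) (pmean \<theta> e (pm e \<theta> \<omega>) + y)) \<partial>nu \<partial>Om)"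
  proof (subst nn_integral_Om_noise)
    have "(\<lambda>z. (pm e \<theta> (fst z), pmean \<theta> e (pm e \<theta> (fst z)) + snd z)) \<in> measurable (Om \<Otimes>\<^sub>M nu) (Pt e \<Otimes>\<^sub>M borel)"
      by measurable
    from measurable_compose[OF this fup]
    show "(\<lambda>z. f (up (pm e \<theta> (fst z)) (pmean \<theta> e (pm e \<theta> (fst z)) + snd z))) \<in> borel_measurable (Om \<Otimes>\<^sub>M nu)" by simp
    fix r and w :: "nat \<Rightarrow> real^'x" and y y'
    have "restrict (st \<theta> (r, w(e := y'))) {1..e} = restrict (st \<theta> (r, w)) {1..e}"
      by (intro restrict_ext state_cong[where t=e]) auto
    then have "pm e \<theta> (r, w(e := y')) = pm e \<theta> (r, w)" by (simp add: pm_def)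
    then show "f (up (pm e \<theta> (fst ((r, w(e := y')), y))) (pmean \<theta> e (pm e \<theta> (fst ((r, w(e := y')), y))) + snd ((r, w(e := y')), y)))
      = f (up (pm e \<theta> (fst ((r, w), y))) (pmean \<theta> e (pm e \<theta> (fst ((r, w), y))) + snd ((r, w), y)))" by simp
  qed simp
  also have "\<dots> = (\<integral>\<^sup>+\<omega>. F (pm e \<theta> \<omega>) \<partial>Om)"
    using measurable_space[OF pm_measurable_fixed[of e \<theta>]] by (intro nn_integral_cong inner) auto
  also have "\<dots> = (\<integral>\<^sup>+v. ennreal (lik e \<theta> v) * F v \<partial>Pt e)" by (rule Suc.IH[OF F])
  also have "\<dots> = (\<integral>\<^sup>+v. \<integral>\<^sup>+y. ennreal (lik (Suc e) \<theta> (up v y)) * f (up v y) \<partial>lborel \<partial>Pt e)"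
  proof (rule nn_integral_cong)
    fix v assume v: "v \<in> space (Pt e)"
    have [measurable]: "(\<lambda>y. f (up v y)) \<in> borel_measurable borel" by (rule fupv[OF v])
    have l: "lik (Suc e) \<theta> (up v y) = lik e \<theta> v * p (y - pmean \<theta> e v)" for y
    proof -
      have px': "px j (up v y) = px j v" if "j \<le> e" for j using that by (auto simp: px_def up_def)
      have pu': "pu j (up v y) = pu j v" if "j \<le> e" for j
      proof -
        have "restrict ((snd v)(Suc e := y)) {1..j} = restrict (snd v) {1..j}" using that by (intro restrict_ext) auto
        then show ?thesis by (simp add: pu_def up_def)
      qed
      have "px (Suc e) (up v y) = y" by (simp add: px_def up_def)
      then show ?thesis
        unfolding lik_def by (simp add: pw_def pmean_def px' pu')
    qed
    have "ennreal (lik e \<theta> v) * F v = (\<integral>\<^sup>+y. ennreal (lik e \<theta> v) * (ennreal (p (y - pmean \<theta> e v)) * f (up v y)) \<partial>lborel)"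
      unfolding F_def by (rule nn_integral_cmult[symmetric]) measurable
    also have "\<dots> = (\<integral>\<^sup>+y. ennreal (lik (Suc e) \<theta> (up v y)) * f (up v y) \<partial>lborel)"
      by (intro nn_integral_cong) (simp add: l ennreal_mult lik_nonneg mult.assoc)
    finally show "ennreal (lik e \<theta> v) * F v = (\<integral>\<^sup>+y. ennreal (lik (Suc e) \<theta> (up v y)) * f (up v y) \<partial>lborel)" .
  qed
  also have "\<dots> = (\<integral>\<^sup>+v. ennreal (lik (Suc e) \<theta> v) * f v \<partial>Pt (Suc e))"
  proof -
    have lm [measurable]: "lik (Suc e) \<theta> \<in> borel_measurable (Pt (Suc e))"
      using measurable_compose[OF measurable_Pair1' lik_measurable[OF order_refl], of \<theta> "Suc e"] by simp
    define h where "h v = ennreal (lik (Suc e) \<theta> v) * f v" for v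
    have h [measurable]: "h \<in> borel_measurable (Pt (Suc e))" unfolding h_def by measurable
    have hup: "(\<lambda>z. h (up (fst z) (snd z))) \<in> borel_measurable (Pt e \<Otimes>\<^sub>M lborel)"
      using measurable_compose[OF up h] by simp
    have "(\<lambda>v. \<integral>\<^sup>+y. h (up v y) \<partial>lborel) \<in> borel_measurable (Pt e)"
      using lborel.borel_measurable_nn_integral_fst[OF hup] by simp
    then have "(\<integral>\<^sup>+v. \<integral>\<^sup>+y. h (up v y) \<partial>lborel \<partial>Pt e) = (\<integral>\<^sup>+r. \<integral>\<^sup>+X. \<integral>\<^sup>+y. h (r, X(Suc e := y)) \<partial>lborel \<partial>?L \<partial>N)"
      by (subst L.nn_integral_fst[symmetric]) (auto simp: up_def)
    also have "\<dots> = (\<integral>\<^sup>+r. \<integral>\<^sup>+X. h (r, X) \<partial>Pi\<^sub>M {1..Suc e} (\<lambda>_. lborel) \<partial>N)"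
    proof (rule nn_integral_cong)
      fix r assume r: "r \<in> space N"
      have "(\<lambda>X. h (r, X)) \<in> borel_measurable (Pi\<^sub>M (insert (Suc e) {1..e}) (\<lambda>_. lborel))"
        using measurable_compose[OF measurable_Pair1'[OF r] h] unfolding sets_Pt_Suc .
      then show "(\<integral>\<^sup>+X. \<integral>\<^sup>+y. h (r, X(Suc e := y)) \<partial>lborel \<partial>?L) = (\<integral>\<^sup>+X. h (r, X) \<partial>Pi\<^sub>M {1..Suc e} (\<lambda>_. lborel))"
        unfolding sets_Pt_Suc by (subst ps.product_nn_integral_insert) auto
    qed
    also have "\<dots> = (\<integral>\<^sup>+v. h v \<partial>Pt (Suc e))"
      by (rule L'.nn_integral_fst[OF h])
    finally show ?thesis unfolding h_def .
  qed
  finally show ?case .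
qed

end

declare One_nat_def [simp del]

section \<open>The model with a parameter drawn from the prior\<close>

text \<open>\<open>bl v\<close> is the derivative of B in the direction v; it is the same at every
  parameter because B is affine.\<close>

locale lq_bayes = lq_model A B p N \<pi> + noise: fisher_density p + prior: fisher_density \<mu>
  for A :: "real^'x^'x" and B :: "real^'d \<Rightarrow> real^'u^'x" and p :: "real^'x \<Rightarrow> real"
    and N :: "'r measure" and \<pi> :: "('x, 'u, 'r) policy" and \<mu> :: "real^'d \<Rightarrow> real" +
  fixes bl :: "real^'d \<Rightarrow> real^'u^'x"
  assumes bl: "bounded_linear bl" and B_affine: "\<And>s t. B s - B t = bl (s - t)"
begin

abbreviation D :: "(real^'d) measure" where "D \<equiv> density lborel (\<lambda>z. ennreal (\<mu> z))"
abbreviation BB :: "((real^'d) \<times> 'r \<times> (nat \<Rightarrow> real^'x)) measure" where "BB \<equiv> bayes_space \<mu> N p"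
abbreviation pth where "pth e z \<equiv> pm e (fst z) (snd z)"
abbreviation X where "X t z \<equiv> st (fst z) (snd z) t"
abbreviation Uc where "Uc t z \<equiv> ct (fst z) (snd z) t"

lemma BB_eq: "BB = D \<Otimes>\<^sub>M Om"
  by (simp add: bayes_space_def)

lemma sets_BB: "sets BB = sets (borel \<Otimes>\<^sub>M Om)"
  unfolding BB_eq by (intro sets_pair_measure_cong) auto

lemma measurable_BB: "measurable BB M = measurable (borel \<Otimes>\<^sub>M Om) M"
  by (rule measurable_cong_sets[OF sets_BB refl])

lemma prob_space_D: "prob_space D"
proof
  have "integral\<^sup>N lborel (\<lambda>z. ennreal (\<mu> z)) = ennreal 1"
    using prior.dens by (subst nn_integral_eq_integral) (auto simp: prob_density_def has_bochner_integral_iff)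
  then show "emeasure D (space D) = 1" by (simp add: emeasure_density)
qed

sublocale D: prob_space D by (rule prob_space_D)

lemma prob_space_BB: "prob_space BB"
  unfolding BB_eq
proof -
  interpret pair_prob_space D Om ..
  show "prob_space (D \<Otimes>\<^sub>M Om)" by (rule prob_space_axioms)
qed

sublocale BB: prob_space BB by (rule prob_space_BB)

lemma X_measurable [measurable]: "X t \<in> borel_measurable BB"
  unfolding measurable_BB by measurable

lemma Uc_measurable [measurable]: "Uc t \<in> borel_measurable BB"
  unfolding measurable_BB by measurable

lemma fst_BB_measurable [measurable]: "fst \<in> borel_measurable BB"
  unfolding measurable_BB by measurable

lemma noise_BB_measurable [measurable]: "(\<lambda>z. snd (snd z) t) \<in> borel_measurable BB"
  unfolding measurable_BB using measurable_compose[OF measurable_snd noise_measurable] by simp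

lemma pth_measurable: "pth e \<in> measurable BB (Pt e)"
  unfolding measurable_BB by (rule pm_measurable)

lemma bl_measurable [measurable]: "bl \<in> borel_measurable borel"
  by (intro borel_measurable_continuous_onI linear_continuous_on bl)

text \<open>The joint law of the parameter and the observed path.\<close>

lemma joint_law:
  "distr BB (borel \<Otimes>\<^sub>M Pt e) (\<lambda>z. (fst z, pth e z))
    = density (lborel \<Otimes>\<^sub>M Pt e) (\<lambda>z. ennreal (\<mu> (fst z) * lik e (fst z) (snd z)))"
proof (rule measure_eqI)
  interpret ps: product_sigma_finite "\<lambda>_::nat. lborel :: (real^'x) measure" by unfold_locales
  interpret L: sigma_finite_measure "Pi\<^sub>M {1..e} (\<lambda>_::nat. lborel :: (real^'x) measure)" by (rule ps.sigma_finite) simp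
  interpret NL: pair_sigma_finite N "Pi\<^sub>M {1..e} (\<lambda>_::nat. lborel :: (real^'x) measure)" ..
  have sets: "sets (lborel \<Otimes>\<^sub>M Pt e) = sets (borel \<Otimes>\<^sub>M Pt e)" by (intro sets_pair_measure_cong) auto
  show "sets (distr BB (borel \<Otimes>\<^sub>M Pt e) (\<lambda>z. (fst z, pth e z))) = sets (density (lborel \<Otimes>\<^sub>M Pt e) (\<lambda>z. ennreal (\<mu> (fst z) * lik e (fst z) (snd z))))"
    by (simp add: sets)
  have m [measurable]: "(\<lambda>z. (fst z, pth e z)) \<in> measurable BB (borel \<Otimes>\<^sub>M Pt e)"
    using pth_measurable by measurable
  have lm [measurable]: "(\<lambda>z. lik e (fst z) (snd z)) \<in> borel_measurable (lborel \<Otimes>\<^sub>M Pt e)"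
    unfolding measurable_cong_sets[OF sets refl] by (rule lik_measurable) simp
  fix S assume "S \<in> sets (distr BB (borel \<Otimes>\<^sub>M Pt e) (\<lambda>z. (fst z, pth e z)))"
  then have S: "S \<in> sets (borel \<Otimes>\<^sub>M Pt e)" by simp
  have S' [measurable]: "S \<in> sets (lborel \<Otimes>\<^sub>M Pt e)" unfolding sets by (rule S)
  have iS [measurable]: "indicator S \<in> borel_measurable (borel \<Otimes>\<^sub>M Pt e)" using S by simp
  have sec: "(\<lambda>v. indicator S (\<theta>, v)) \<in> borel_measurable (Pt e)" for \<theta>
    using measurable_compose[OF measurable_Pair1' iS, of \<theta>] by simp
  have lsec: "lik e \<theta> \<in> borel_measurable (Pt e)" for \<theta>
    using measurable_compose[OF measurable_Pair1' lik_measurable[OF order_refl], of \<theta> e] by simp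
  have "emeasure (distr BB (borel \<Otimes>\<^sub>M Pt e) (\<lambda>z. (fst z, pth e z))) S
      = (\<integral>\<^sup>+z. indicator S z \<partial>distr BB (borel \<Otimes>\<^sub>M Pt e) (\<lambda>z. (fst z, pth e z)))"
    using S by simp
  also have "\<dots> = (\<integral>\<^sup>+z. indicator S (fst z, pth e z) \<partial>BB)"
    by (subst nn_integral_distr) (auto simp: S)
  also have "\<dots> = (\<integral>\<^sup>+\<theta>. \<integral>\<^sup>+\<omega>. indicator S (\<theta>, pm e \<theta> \<omega>) \<partial>Om \<partial>D)"
  proof -
    have "(\<lambda>z. indicator S (fst z, pth e z)) \<in> borel_measurable (D \<Otimes>\<^sub>M Om)"
      using measurable_compose[OF m iS] unfolding BB_eq by simp
    from Om.nn_integral_fst[OF this] show ?thesis unfolding BB_eq by simp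
  qed
  also have "\<dots> = (\<integral>\<^sup>+\<theta>. \<integral>\<^sup>+v. ennreal (lik e \<theta> v) * indicator S (\<theta>, v) \<partial>Pt e \<partial>D)"
    by (intro nn_integral_cong path_law_fixed sec)
  also have "\<dots> = (\<integral>\<^sup>+\<theta>. ennreal (\<mu> \<theta>) * (\<integral>\<^sup>+v. ennreal (lik e \<theta> v) * indicator S (\<theta>, v) \<partial>Pt e) \<partial>lborel)"
    by (subst nn_integral_density) (auto intro!: NL.borel_measurable_nn_integral_fst)
  also have "\<dots> = (\<integral>\<^sup>+\<theta>. \<integral>\<^sup>+v. ennreal (\<mu> \<theta> * lik e \<theta> v) * indicator S (\<theta>, v) \<partial>Pt e \<partial>lborel)"
    using sec lsec prior.nonneg
    by (intro nn_integral_cong, subst nn_integral_cmult[symmetric]) (auto simp: ennreal_mult lik_nonneg mult.assoc)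
  also have "\<dots> = (\<integral>\<^sup>+z. ennreal (\<mu> (fst z) * lik e (fst z) (snd z)) * indicator S z \<partial>(lborel \<Otimes>\<^sub>M Pt e))"
    by (subst NL.nn_integral_fst[symmetric]) auto
  also have "\<dots> = emeasure (density (lborel \<Otimes>\<^sub>M Pt e) (\<lambda>z. ennreal (\<mu> (fst z) * lik e (fst z) (snd z)))) S"
    using S S' by (subst emeasure_density) auto
  finally show "emeasure (distr BB (borel \<Otimes>\<^sub>M Pt e) (\<lambda>z. (fst z, pth e z))) S = \<dots>" .
qed

text \<open>The derivative in direction v, with respect to the parameter, of the logarithm of the
  joint density of parameter and path.\<close>

definition scr :: "nat \<Rightarrow> real^'d \<Rightarrow> real^'d \<Rightarrow> 'r \<times> (nat \<Rightarrow> real^'x) \<Rightarrow> real" where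
  "scr e v \<theta> w = score \<mu> \<theta> \<bullet> v - (\<Sum>j<e. score p (pw \<theta> j w) \<bullet> (bl v *v pu j w))"

text \<open>The product rule for the derivative of \<open>lik\<close>, written without division, so
  that it is continuous in the parameter even where p vanishes.\<close>

primrec dlik :: "nat \<Rightarrow> real^'d \<Rightarrow> real^'d \<Rightarrow> 'r \<times> (nat \<Rightarrow> real^'x) \<Rightarrow> real" where
  "dlik 0 v \<theta> w = 0"
| "dlik (Suc e) v \<theta> w = dlik e v \<theta> w * p (pw \<theta> e w) + (gradient p (pw \<theta> e w) \<bullet> - (bl v *v pu e w)) * lik e \<theta> w"

lemma lik_Suc: "lik (Suc e) \<theta> w = lik e \<theta> w * p (pw \<theta> e w)"
  by (simp add: lik_def)

lemma dlik_eq: "dlik e v \<theta> w = - lik e \<theta> w * (\<Sum>j<e. score p (pw \<theta> j w) \<bullet> (bl v *v pu j w))"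
proof (induction e)
  case (Suc e)
  have "gradient p (pw \<theta> e w) \<bullet> (bl v *v pu e w) = p (pw \<theta> e w) * (score p (pw \<theta> e w) \<bullet> (bl v *v pu e w))"
    by (simp add: noise.scale_score[symmetric])
  then show ?case by (simp add: Suc lik_Suc algebra_simps)
qed simp

lemma pw_shift: "pw (\<theta> + s *\<^sub>R v) j w = pw \<theta> j w + s *\<^sub>R (- (bl v *v pu j w))"
proof -
  interpret bl: bounded_linear bl by (rule bl)
  have "B (\<theta> + s *\<^sub>R v) = B \<theta> + s *\<^sub>R bl v"
    using B_affine[of "\<theta> + s *\<^sub>R v" \<theta>] by (simp add: bl.scaleR algebra_simps)
  then show ?thesis
    by (simp add: pw_def pmean_def matrix_vector_mult_add_rdistrib scaleR_matrix_vector_assoc[symmetric])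
qed

lemma continuous_pw: "continuous_on UNIV (\<lambda>\<theta>. pw \<theta> j w)"
proof -
  interpret bl: bounded_linear bl by (rule bl)
  have Beq: "B 0 + bl \<theta> = B \<theta>" for \<theta> using B_affine[of \<theta> 0] by (simp add: algebra_simps)
  have "continuous_on UNIV (\<lambda>\<theta>. B 0 + bl \<theta>)" by (intro continuous_intros linear_continuous_on bl)
  then have "continuous_on UNIV B" by (simp only: Beq)
  then show ?thesis
    unfolding pw_def pmean_def by (intro continuous_intros continuous_matrix_intros)
qed

lemma continuous_lik: "continuous_on UNIV (\<lambda>\<theta>. lik e \<theta> w)"
  unfolding lik_def by (intro continuous_on_prod continuous_on_compose2[OF noise.continuous_density continuous_pw]) auto

lemma continuous_dlik: "continuous_on UNIV (\<lambda>\<theta>. dlik e v \<theta> w)"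
  by (induction e) (auto intro!: continuous_intros continuous_lik
      continuous_on_compose2[OF noise.continuous_density continuous_pw]
      continuous_on_compose2[OF noise.continuous_gradient continuous_pw])

lemma line_deriv_lik: "line_deriv (\<lambda>\<theta>. lik e \<theta> w) v \<theta> (dlik e v \<theta> w)"
proof (induction e)
  case 0
  then show ?case by (simp add: lik_def)
next
  case (Suc e)
  have "line_deriv (\<lambda>\<theta>. p (pw \<theta> e w)) v \<theta> (gradient p (pw \<theta> e w) \<bullet> - (bl v *v pu e w))"
    unfolding pw_shift by (rule noise.line_deriv)
  from DERIV_mult[OF Suc this] show ?case by (simp add: lik_Suc)
qed

text \<open>Integration by parts in the parameter for one fixed path. The joint density inherits the
  compact support of the prior, and its derivative is itself times \<open>scr\<close>.\<close>

lemma prior_path_parts: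
  fixes \<kappa> \<kappa>' :: "real^'d \<Rightarrow> real"
  assumes U: "open U" and K: "compact K" "K \<subseteq> U" "\<And>z. z \<notin> K \<Longrightarrow> \<mu> z = 0"
    and \<kappa>: "\<And>z. z \<in> U \<Longrightarrow> line_deriv \<kappa> v z (\<kappa>' z)" "continuous_on U \<kappa>" "continuous_on U \<kappa>'"
  shows "(LINT \<theta>|lborel. (\<mu> \<theta> * lik e \<theta> w) * ((c - \<kappa> \<theta>) * scr e v \<theta> w))
    = (LINT \<theta>|lborel. (\<mu> \<theta> * lik e \<theta> w) * \<kappa>' \<theta>)"
proof -
  let ?g = "\<lambda>\<theta>. \<mu> \<theta> * lik e \<theta> w"
  let ?g' = "\<lambda>\<theta>. (gradient \<mu> \<theta> \<bullet> v) * lik e \<theta> w + dlik e v \<theta> w * \<mu> \<theta>"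
  have e: "?g' \<theta> = ?g \<theta> * scr e v \<theta> w" for \<theta>
    by (simp add: dlik_eq scr_def prior.scale_score[symmetric] algebra_simps)
  have d: "line_deriv ?g v z (?g' z)" for z
    using DERIV_mult[OF prior.line_deriv line_deriv_lik] by simp
  have "(LINT z|lborel. (c - \<kappa> z) * ?g' z) = (LINT z|lborel. ?g z * \<kappa>' z)"
  proof (rule integration_by_parts_line(3)[OF U K(1,2) _ d _ _ \<kappa>])
    show "continuous_on UNIV ?g" by (intro continuous_intros prior.continuous_density continuous_lik)
    show "continuous_on UNIV ?g'"
      by (intro continuous_intros prior.continuous_density prior.continuous_gradient continuous_lik continuous_dlik)
  qed (use K(3) in auto)
  then show ?thesis unfolding e by (simp add: mult_ac)
qed

lemma scr_pth_eq: "e \<le> e' \<Longrightarrow> scr e v \<theta> (pm e' \<theta> \<omega>)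
    = score \<mu> \<theta> \<bullet> v - (\<Sum>j<e. score p (snd \<omega> j) \<bullet> (bl v *v ct \<theta> \<omega> j))"
  by (simp add: scr_def pw_pm pu_pm)

lemma scr_measurable: "(\<lambda>z. scr e v (fst z) (snd z)) \<in> borel_measurable (borel \<Otimes>\<^sub>M Pt e)"
proof -
  have [measurable]: "(\<lambda>z. pw (fst z) j (snd z)) \<in> borel_measurable (borel \<Otimes>\<^sub>M Pt e)" if "j < e" for j
    by (rule pw_measurable[OF that])
  have [measurable]: "(\<lambda>z. pu j (snd z)) \<in> borel_measurable (borel \<Otimes>\<^sub>M Pt e)" if "j < e" for j
    using that by (intro measurable_compose[OF measurable_snd pu_measurable]) auto
  have "(\<lambda>z. \<Sum>j<e. score p (pw (fst z) j (snd z)) \<bullet> (bl v *v pu j (snd z))) \<in> borel_measurable (borel \<Otimes>\<^sub>M Pt e)"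
    by (rule borel_measurable_sum) measurable
  then show ?thesis unfolding scr_def by measurable
qed

text \<open>The noise scores are martingale differences: given the past, the one at time e has mean
  zero and second moment equal to the Fisher form of p at \<open>bl v\<close> applied to the input.
  Hence second moments add, starting from the prior information at e = 0.\<close>

lemma score_second_moment:
  "(\<integral>\<^sup>+z. ennreal ((scr e v (fst z) (pth e z))\<^sup>2) \<partial>BB)
    = ennreal (qf (fisher \<mu>) v) + (\<Sum>j<e. \<integral>\<^sup>+z. ennreal (qf (fisher p) (bl v *v Uc j z)) \<partial>BB)"
proof -
  define Y where "Y e z = score \<mu> (fst z) \<bullet> v - (\<Sum>j<e. score p (snd (snd z) j) \<bullet> (bl v *v Uc j z))"
    for e and z :: "(real^'d) \<times> 'r \<times> (nat \<Rightarrow> real^'x)"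
  have Ym [measurable]: "Y e \<in> borel_measurable BB" for e
    unfolding Y_def[abs_def] by measurable
  have "(\<integral>\<^sup>+z. ennreal ((Y e z)\<^sup>2) \<partial>BB)
    = ennreal (qf (fisher \<mu>) v) + (\<Sum>j<e. \<integral>\<^sup>+z. ennreal (qf (fisher p) (bl v *v Uc j z)) \<partial>BB)"
  proof (induction e)
    case 0
    have "(\<integral>\<^sup>+z. ennreal ((Y 0 z)\<^sup>2) \<partial>BB) = (\<integral>\<^sup>+\<theta>. \<integral>\<^sup>+\<omega>. ennreal ((score \<mu> \<theta> \<bullet> v)\<^sup>2) \<partial>Om \<partial>D)"
      unfolding BB_eq Y_def by (subst Om.nn_integral_fst[symmetric]) auto
    also have "\<dots> = (\<integral>\<^sup>+\<theta>. ennreal ((0 - score \<mu> \<theta> \<bullet> v)\<^sup>2) \<partial>D)"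
      using Om.emeasure_space_1 by simp
    also have "\<dots> = ennreal (qf (fisher \<mu>) v)"
      by (subst prior.nn_integral_score_shift) simp
    finally show ?case by simp
  next
    case (Suc e)
    let ?b = "\<lambda>z. bl v *v Uc e z"
    let ?g = "\<lambda>u. ennreal ((Y e (fst u) - score p (snd u) \<bullet> ?b (fst u))\<^sup>2)"
    have "(\<integral>\<^sup>+z. ennreal ((Y (Suc e) z)\<^sup>2) \<partial>BB) = (\<integral>\<^sup>+z. ?g (z, snd (snd z) e) \<partial>BB)"
      by (simp add: Y_def algebra_simps)
    also have "\<dots> = (\<integral>\<^sup>+z. \<integral>\<^sup>+y. ?g (z, y) \<partial>nu \<partial>BB)"
      unfolding BB_eq
    proof (rule nn_integral_noise)
      show "?g \<in> borel_measurable ((D \<Otimes>\<^sub>M Om) \<Otimes>\<^sub>M nu)"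
        unfolding BB_eq[symmetric] by measurable
      fix \<theta> r and w :: "nat \<Rightarrow> real^'x" and y y'
      have "ct \<theta> (r, w(e := y')) j = ct \<theta> (r, w) j" if "j \<le> e" for j
        using that by (intro control_cong[where t=e]) auto
      then show "?g ((\<theta>, r, w(e := y')), y) = ?g ((\<theta>, r, w), y)"
        by (simp add: Y_def)
    qed
    also have "\<dots> = (\<integral>\<^sup>+z. ennreal ((Y e z)\<^sup>2) + ennreal (qf (fisher p) (?b z)) \<partial>BB)"
      by (simp add: noise.nn_integral_score_shift noise.qf_fisher_nonneg ennreal_plus)
    also have "\<dots> = (\<integral>\<^sup>+z. ennreal ((Y e z)\<^sup>2) \<partial>BB) + (\<integral>\<^sup>+z. ennreal (qf (fisher p) (?b z)) \<partial>BB)"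
      by (rule nn_integral_add) measurable
    finally show ?case by (simp add: Suc add.assoc)
  qed
  then show ?thesis by (simp add: scr_pth_eq Y_def)
qed

text \<open>S and the estimator kh depend on the path only. Integrating by parts in the parameter
  path by path therefore turns the mean of \<kappa>' over the event into the mean of (kh - \<kappa>)
  times the score over the same event, and the Cauchy-Schwarz inequality gives the claim. The event
  survives the argument because its indicator is constant in the parameter.\<close>

theorem van_trees:
  fixes \<kappa> \<kappa>' :: "real^'d \<Rightarrow> real"
  assumes U: "open U" and K: "compact K" "K \<subseteq> U" "\<And>z. z \<notin> K \<Longrightarrow> \<mu> z = 0"
    and \<kappa>: "\<And>z. z \<in> U \<Longrightarrow> line_deriv \<kappa> v z (\<kappa>' z)" "continuous_on U \<kappa>" "continuous_on U \<kappa>'"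
    and [measurable]: "\<kappa> \<in> borel_measurable borel" "\<kappa>' \<in> borel_measurable borel"
    and S: "S \<in> sets (Pt e)" and kh: "kh \<in> borel_measurable (Pt e)"
    and Z: "integrable BB (\<lambda>z. indicator S (pth e z) * (kh (pth e z) - \<kappa> (fst z))\<^sup>2)"
    and Z': "integrable BB (\<lambda>z. indicator S (pth e z) * \<kappa>' (fst z))"
    and J: "(\<integral>\<^sup>+z. ennreal ((scr e v (fst z) (pth e z))\<^sup>2) \<partial>BB) \<le> ennreal J" "0 \<le> J"
  shows "(LINT z|BB. indicator S (pth e z) * \<kappa>' (fst z))\<^sup>2
    \<le> (LINT z|BB. indicator S (pth e z) * (kh (pth e z) - \<kappa> (fst z))\<^sup>2) * J"
proof -
  interpret ps: product_sigma_finite "\<lambda>_::nat. lborel :: (real^'x) measure" by unfold_locales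
  interpret L: sigma_finite_measure "Pi\<^sub>M {1..e} (\<lambda>_::nat. lborel :: (real^'x) measure)" by (rule ps.sigma_finite) simp
  interpret NL: pair_sigma_finite N "Pi\<^sub>M {1..e} (\<lambda>_::nat. lborel :: (real^'x) measure)" ..
  interpret TP: pair_sigma_finite "lborel :: (real^'d) measure" "Pt e" ..
  note [measurable] = pth_measurable[of e] scr_measurable[of e v] S kh
  have sets: "sets (lborel \<Otimes>\<^sub>M Pt e) = sets (borel \<Otimes>\<^sub>M Pt e)" by (intro sets_pair_measure_cong) auto
  have m [measurable]: "(\<lambda>z. (fst z, pth e z)) \<in> measurable BB (borel \<Otimes>\<^sub>M Pt e)" by measurable
  have lm [measurable]: "(\<lambda>z. lik e (fst z) (snd z)) \<in> borel_measurable (lborel \<Otimes>\<^sub>M Pt e)"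
    unfolding measurable_cong_sets[OF sets refl] by (rule lik_measurable) simp
  have sm [measurable]: "(\<lambda>z. scr e v (fst z) (snd z)) \<in> borel_measurable (borel \<Otimes>\<^sub>M Pt e)" by (rule scr_measurable)
  have spm [measurable]: "(\<lambda>z. scr e v (fst z) (pth e z)) \<in> borel_measurable BB"
    using measurable_compose[OF m sm] by simp
  define F where "F z = indicator S (snd z) * ((kh (snd z) - \<kappa> (fst z)) * scr e v (fst z) (snd z))" for z
  define F' where "F' z = indicator S (snd z) * \<kappa>' (fst z)" for z :: "(real^'d) \<times> 'r \<times> (nat \<Rightarrow> real^'x)"
  have Fm [measurable]: "F \<in> borel_measurable (borel \<Otimes>\<^sub>M Pt e)" "F' \<in> borel_measurable (borel \<Otimes>\<^sub>M Pt e)"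
    unfolding F_def F'_def by measurable
  define Xf where "Xf z = indicator S (pth e z) * (kh (pth e z) - \<kappa> (fst z))" for z
  define Yf where "Yf z = scr e v (fst z) (pth e z)" for z
  have Xsq: "(Xf z)\<^sup>2 = indicator S (pth e z) * (kh (pth e z) - \<kappa> (fst z))\<^sup>2" for z
    by (simp add: Xf_def power_mult_distrib indicator_def)
  have mX [measurable]: "Xf \<in> borel_measurable BB" unfolding Xf_def by measurable
  have mY [measurable]: "Yf \<in> borel_measurable BB" unfolding Yf_def by (rule spm)
  have iX: "integrable BB (\<lambda>z. (Xf z)\<^sup>2)" using Z by (simp add: Xsq)
  have iY: "integrable BB (\<lambda>z. (Yf z)\<^sup>2)"
    using order_le_less_trans[OF J(1) ennreal_less_top] by (intro integrableI_nonneg) (auto simp: Yf_def)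
  have Y2: "(LINT z|BB. (Yf z)\<^sup>2) \<le> J"
    using J by (subst integral_eq_nn_integral) (auto simp: Yf_def enn2real_leI)
  note cs = integral_cauchy_schwarz[OF mX mY iX iY]
  have FXY: "F (fst z, pth e z) = Xf z * Yf z" for z by (simp add: F_def Xf_def Yf_def)
  \<comment> \<open>Expectations are rewritten with the parameter integral inside and the path
    outside, which is the order needed for \<open>prior_path_parts\<close>.\<close>
  have intD: "integrable (lborel \<Otimes>\<^sub>M Pt e) (\<lambda>z. (\<mu> (fst z) * lik e (fst z) (snd z)) * G z)"
    "(LINT z|BB. G (fst z, pth e z)) = (LINT w|Pt e. LINT \<theta>|lborel. (\<mu> \<theta> * lik e \<theta> w) * G (\<theta>, w))"
    if G: "G \<in> borel_measurable (borel \<Otimes>\<^sub>M Pt e)" and i: "integrable BB (\<lambda>z. G (fst z, pth e z))" for G :: "_ \<Rightarrow> real"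
  proof -
    have Gm [measurable]: "G \<in> borel_measurable (lborel \<Otimes>\<^sub>M Pt e)" using G unfolding measurable_cong_sets[OF sets refl] .
    have "integrable (distr BB (borel \<Otimes>\<^sub>M Pt e) (\<lambda>z. (fst z, pth e z))) G"
      using i G by (subst integrable_distr_eq) auto
    then show 1: "integrable (lborel \<Otimes>\<^sub>M Pt e) (\<lambda>z. (\<mu> (fst z) * lik e (fst z) (snd z)) * G z)"
      unfolding joint_law using prior.nonneg lik_nonneg by (subst (asm) integrable_density) auto
    have "(LINT z|BB. G (fst z, pth e z)) = (LINT z|distr BB (borel \<Otimes>\<^sub>M Pt e) (\<lambda>z. (fst z, pth e z)). G z)"
      using G by (subst integral_distr) auto
    also have "\<dots> = (LINT z|(lborel \<Otimes>\<^sub>M Pt e). (\<mu> (fst z) * lik e (fst z) (snd z)) * G z)"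
      unfolding joint_law using prior.nonneg lik_nonneg by (subst integral_density) auto
    also have "\<dots> = (LINT w|Pt e. LINT \<theta>|lborel. (\<mu> \<theta> * lik e \<theta> w) * G (\<theta>, w))"
    proof -
      have "integrable (lborel \<Otimes>\<^sub>M Pt e) (\<lambda>(\<theta>, w). (\<mu> \<theta> * lik e \<theta> w) * G (\<theta>, w))"
        using 1 by (simp add: case_prod_unfold)
      from TP.integral_snd[OF this] show ?thesis by (simp add: case_prod_unfold)
    qed
    finally show "(LINT z|BB. G (fst z, pth e z)) = (LINT w|Pt e. LINT \<theta>|lborel. (\<mu> \<theta> * lik e \<theta> w) * G (\<theta>, w))" .
  qed
  have "(LINT z|BB. Xf z * Yf z) = (LINT z|BB. F (fst z, pth e z))" by (simp add: FXY)
  also have "\<dots> = (LINT w|Pt e. LINT \<theta>|lborel. (\<mu> \<theta> * lik e \<theta> w) * F (\<theta>, w))"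
    by (rule intD(2)[OF Fm(1)]) (simp add: FXY cs(1))
  also have "\<dots> = (LINT w|Pt e. LINT \<theta>|lborel. (\<mu> \<theta> * lik e \<theta> w) * F' (\<theta>, w))"
  proof (rule Bochner_Integration.integral_cong[OF refl])
    fix w
    show "(LINT \<theta>|lborel. (\<mu> \<theta> * lik e \<theta> w) * F (\<theta>, w)) = (LINT \<theta>|lborel. (\<mu> \<theta> * lik e \<theta> w) * F' (\<theta>, w))"
      using prior_path_parts[OF U K \<kappa>, of e w "kh w"]
      by (cases "w \<in> S") (simp_all add: F_def F'_def)
  qed
  also have "\<dots> = (LINT z|BB. F' (fst z, pth e z))"
    using Z' by (intro intD(2)[OF Fm(2), symmetric]) (simp add: F'_def)
  finally have "(LINT z|BB. indicator S (pth e z) * \<kappa>' (fst z))\<^sup>2 = (LINT z|BB. Xf z * Yf z)\<^sup>2" by (simp add: F'_def)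
  also have "\<dots> \<le> (LINT z|BB. (Xf z)\<^sup>2) * (LINT z|BB. (Yf z)\<^sup>2)" by (rule cs(2))
  also have "\<dots> \<le> (LINT z|BB. (Xf z)\<^sup>2) * J"
    using Y2 by (intro mult_left_mono integral_nonneg_AE) auto
  finally show ?thesis by (simp add: Xsq)
qed

end

declare One_nat_def [simp del]

subsection \<open>Lower bound over a window of excitation\<close>

lemma stack_cols_outer: "stack_cols (outer a u) = tensor u a"
  by (simp add: stack_cols_def outer_def tensor_def vec_eq_iff mult.commute)

lemma matrix_mult_outer: "M ** outer a u = outer (M *v a) u"
  by (simp add: matrix_matrix_mult_def outer_def matrix_vector_mult_def vec_eq_iff sum_distrib_right mult.assoc)

text \<open>Identifies the Kronecker form in the definition of the information with the Fisher form
  of p at M u, which is what the noise scores produce.\<close>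

lemma qf_kron_outer:
  "stack_cols M \<bullet> (kron (outer u u) J *v stack_cols M) = qf J (M *v u)"
proof -
  have "kron (outer u u) J *v stack_cols M = stack_cols (J ** M ** outer u u)"
    using stack_cols_mult[of J M "outer u u"] by (simp add: transpose_outer)
  also have "\<dots> = tensor u (J *v (M *v u))"
    by (simp add: matrix_mult_outer stack_cols_outer matrix_vector_mul_assoc)
  finally show ?thesis
    by (simp add: inner_commute[of "stack_cols M"] inner_tensor_stack_cols) (rule inner_commute)
qed

text \<open>Least squares: the residual sum at k is the minimal one plus the Gram form of the
  distance from k to the regression coefficient, and the Gram matrix dominates l \<Gamma>. Applied
  with k a row of the gain, it says that inputs close to K x make K easy to estimate.\<close>

lemma regression_bound:
  fixes xs :: "'i \<Rightarrow> real^'x" and ys :: "'i \<Rightarrow> real" and \<Gamma> :: "real^'x^'x"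
  assumes fin: "finite I" and \<Gamma>: "pos_def \<Gamma>" and l: "0 < l"
    and psd: "psd ((\<Sum>t\<in>I. outer (xs t) (xs t)) - l *\<^sub>R \<Gamma>)"
  shows "l * qf \<Gamma> (cramer_inv (\<Sum>t\<in>I. outer (xs t) (xs t)) *v (\<Sum>t\<in>I. ys t *\<^sub>R xs t) - k)
    \<le> (\<Sum>t\<in>I. (ys t - k \<bullet> xs t)\<^sup>2)"
proof -
  let ?G = "\<Sum>t\<in>I. outer (xs t) (xs t)"
  let ?h = "cramer_inv ?G *v (\<Sum>t\<in>I. ys t *\<^sub>R xs t)"
  obtain m where m: "0 < m" "\<And>x. m * (norm x)\<^sup>2 \<le> qf \<Gamma> x" using coercive_of_pos_def[OF \<Gamma>] by blast
  have G: "l * qf \<Gamma> x \<le> qf ?G x" for x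
  proof -
    have "0 \<le> qf (?G - l *\<^sub>R \<Gamma>) x" using psd unfolding psd_def by blast
    then show ?thesis by (simp add: matrix_vector_mult_diff_rdistrib inner_diff_right scaleR_matrix_vector_assoc[symmetric])
  qed
  have "(l * m) * (norm x)\<^sup>2 \<le> qf ?G x" for x
    using G[of x] mult_left_mono[OF m(2)[of x] less_imp_le[OF l]] by (simp add: mult.assoc)
  then have inv: "invertible ?G" using l m(1) by (intro invertible_of_coercive[of "l * m"]) auto
  have Gh: "?G *v ?h = (\<Sum>t\<in>I. ys t *\<^sub>R xs t)"
    by (simp only: cramer_inv[OF inv] matrix_inv_vec_right[OF inv])
  have Gv: "?G *v v = (\<Sum>t\<in>I. (xs t \<bullet> v) *\<^sub>R xs t)" for v
    by (simp add: matrix_vector_mult_sum outer_mult_vec)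
  let ?d = "?h - k"
  have "(\<Sum>t\<in>I. (ys t - k \<bullet> xs t)\<^sup>2)
      = (\<Sum>t\<in>I. (ys t - ?h \<bullet> xs t)\<^sup>2 + 2 * ((ys t - ?h \<bullet> xs t) * (?d \<bullet> xs t)) + (?d \<bullet> xs t)\<^sup>2)"
    by (intro sum.cong refl) (simp add: inner_diff_left power2_eq_square algebra_simps)
  also have "\<dots> = (\<Sum>t\<in>I. (ys t - ?h \<bullet> xs t)\<^sup>2) + 2 * (\<Sum>t\<in>I. (ys t - ?h \<bullet> xs t) * (?d \<bullet> xs t)) + (\<Sum>t\<in>I. (?d \<bullet> xs t)\<^sup>2)"
    by (simp add: sum.distrib sum_distrib_left)
  also have "(\<Sum>t\<in>I. (ys t - ?h \<bullet> xs t) * (?d \<bullet> xs t)) = ?d \<bullet> ((\<Sum>t\<in>I. ys t *\<^sub>R xs t) - ?G *v ?h)"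
    unfolding Gv by (simp add: inner_sum_right inner_diff_right sum_subtractf[symmetric] algebra_simps inner_commute[of ?h])
  also have "\<dots> = 0" by (simp only: Gh diff_self inner_zero_right)
  also have "(\<Sum>t\<in>I. (?d \<bullet> xs t)\<^sup>2) = qf ?G ?d"
    unfolding Gv by (simp add: inner_sum_right power2_eq_square inner_commute)
  finally have "(\<Sum>t\<in>I. (ys t - k \<bullet> xs t)\<^sup>2) = (\<Sum>t\<in>I. (ys t - ?h \<bullet> xs t)\<^sup>2) + qf ?G ?d" by simp
  moreover have "0 \<le> (\<Sum>t\<in>I. (ys t - ?h \<bullet> xs t)\<^sup>2)" by (intro sum_nonneg) simp
  ultimately show ?thesis using G[of ?d] by linarith
qed

lemma qf_sum_outer: "X = (\<Sum>i<n. outer (f i) (f i)) \<Longrightarrow> qf X v = (\<Sum>i<n. (f i \<bullet> v)\<^sup>2)"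
  by (simp add: matrix_vector_mult_sum inner_sum_right qf_outer)

lemma closed_psd: "closed {M :: real^'n^'n. psd M}"
  unfolding psd_def
  by (intro closed_Collect_conj closed_Collect_all closed_Collect_le closed_Collect_eq
        continuous_matrix_intros continuous_intros)

locale lq_info = lq_bayes A B p N \<pi> \<mu> bl
  for A :: "real^'x^'x" and B :: "real^'d \<Rightarrow> real^'u^'x" and p :: "real^'x \<Rightarrow> real"
    and N :: "'r measure" and \<pi> :: "('x, 'u, 'r) policy" and \<mu> :: "real^'d \<Rightarrow> real" and bl +
  fixes L :: "real^'d^('u \<times> 'x)" and \<theta>0 :: "real^'d" and \<epsilon> :: real and Ks :: "(real^'d) set"
  assumes bl_L: "\<And>v. stack_cols (bl v) = L *v v"
    and info_fin: "info_finite A B L p N \<pi> \<mu>"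
    and eps_pos: "0 < \<epsilon>"
    and support: "compact Ks" "Ks \<subseteq> ball \<theta>0 \<epsilon>" "\<And>z. z \<notin> Ks \<Longrightarrow> \<mu> z = 0"
begin

lemma AE_ball: "AE z in BB. fst z \<in> ball \<theta>0 \<epsilon>"
proof -
  interpret DO: pair_sigma_finite D Om ..
  have "AE \<theta> in D. \<theta> \<in> ball \<theta>0 \<epsilon>"
  proof (subst AE_density, simp, intro always_eventually allI impI)
    fix \<theta> assume "0 < ennreal (\<mu> \<theta>)"
    then have "\<theta> \<in> Ks" using support(3)[of \<theta>] by (cases "\<theta> \<in> Ks") auto
    then show "\<theta> \<in> ball \<theta>0 \<epsilon>" using support(2) by (rule subsetD[rotated])
  qed
  moreover have "{z \<in> space (D \<Otimes>\<^sub>M Om). fst z \<in> ball \<theta>0 \<epsilon>} \<in> sets (D \<Otimes>\<^sub>M Om)"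
    using measurable_sets[OF measurable_fst, of "ball \<theta>0 \<epsilon>" D Om]
    by (simp add: vimage_def Int_def conj_commute del: mem_ball)
  ultimately show ?thesis
    unfolding BB_eq by (intro DO.AE_pair_measure) (auto simp del: mem_ball)
qed

lemma qf_info_integrand:
  "qf (info_integrand A (B \<theta>) L p \<pi> e \<omega>) v = (\<Sum>j\<le>e. qf (fisher p) (bl v *v ct \<theta> \<omega> j))"
proof -
  have "v \<bullet> ((transpose L ** kron (outer u u) (fisher p) ** L) *v v) = qf (fisher p) (bl v *v u)" for u
    using qf_kron_outer[of "bl v" u "fisher p"]
    by (simp add: matrix_vector_mul_assoc[symmetric] inner_transpose bl_L)
  then show ?thesis
    by (simp add: info_integrand_def matrix_vector_mult_sum inner_sum_right)
qed

abbreviation Ib where "Ib e \<equiv> bayes_info A B L p N \<pi> \<mu> e"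

lemma info_moment:
  "(\<Sum>j\<le>e. \<integral>\<^sup>+z. ennreal (qf (fisher p) (bl v *v Uc j z)) \<partial>BB) = ennreal (qf (Ib e) v)"
  "0 \<le> qf (Ib e) v"
proof -
  interpret DO: pair_sigma_finite D Om ..
  let ?f = "\<lambda>z. info_integrand A (B (fst z)) L p \<pi> e (snd z)"
  have i: "integrable BB ?f" using info_fin by (simp add: info_finite_def case_prod_unfold)
  then have i': "integrable (D \<Otimes>\<^sub>M Om) ?f" by (simp add: BB_eq)
  have "Ib e = (LINT \<theta>|D. LINT \<omega>|Om. ?f (\<theta>, \<omega>))" by (simp add: bayes_info_def info_def)
  also have "\<dots> = (LINT z|BB. ?f z)" using DO.integral_fst'[OF i'] by (simp add: BB_eq)
  finally have q: "qf (Ib e) v = (LINT z|BB. qf (?f z) v)" using noise.qf_integral(2)[OF i] by simp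
  have nn: "0 \<le> qf (?f z) v" for z
    unfolding qf_info_integrand by (intro sum_nonneg noise.qf_fisher_nonneg)
  show "0 \<le> qf (Ib e) v" unfolding q by (intro integral_nonneg_AE always_eventually allI nn)
  have "(\<Sum>j\<le>e. \<integral>\<^sup>+z. ennreal (qf (fisher p) (bl v *v Uc j z)) \<partial>BB) = (\<integral>\<^sup>+z. ennreal (qf (?f z) v) \<partial>BB)"
    unfolding qf_info_integrand
    by (subst nn_integral_sum[symmetric]) (auto simp: noise.qf_fisher_nonneg)
  also have "\<dots> = ennreal (qf (Ib e) v)"
    unfolding q by (rule nn_integral_eq_integral[OF noise.qf_integral(1)[OF i]]) (use nn in simp)
  finally show "(\<Sum>j\<le>e. \<integral>\<^sup>+z. ennreal (qf (fisher p) (bl v *v Uc j z)) \<partial>BB) = ennreal (qf (Ib e) v)" .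
qed

text \<open>The score of a path of length e involves the inputs at times below e, while
  \<open>Ib e'\<close> includes the input at e'. Hence the path may be one step longer than the
  index of the information.\<close>

lemma score_moment_le:
  assumes "e \<le> Suc e'"
  shows "(\<integral>\<^sup>+z. ennreal ((scr e v (fst z) (pth e z))\<^sup>2) \<partial>BB) \<le> ennreal (qf (fisher \<mu>) v + qf (Ib e') v)"
proof -
  have "(\<Sum>j<e. \<integral>\<^sup>+z. ennreal (qf (fisher p) (bl v *v Uc j z)) \<partial>BB)
      \<le> (\<Sum>j\<le>e'. \<integral>\<^sup>+z. ennreal (qf (fisher p) (bl v *v Uc j z)) \<partial>BB)"
    using assms by (intro sum_mono2) auto
  then show ?thesis
    unfolding score_second_moment info_moment(1)
    by (simp add: ennreal_plus[OF prior.qf_fisher_nonneg info_moment(2)])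
qed

text \<open>The van Trees inequality without observations: paths of length 0, the sure event, and
  the estimator 0 for the component of \<theta> - \<theta>0 along v, whose error on a ball of radius
  \<epsilon> is at most \<epsilon> times the norm of v. It makes the total information invertible
  and every trace term small.\<close>

lemma fisher_prior_ge: "(norm v)\<^sup>2 \<le> \<epsilon>\<^sup>2 * qf (fisher \<mu>) v"
proof -
  let ?\<kappa> = "\<lambda>\<theta>. v \<bullet> (\<theta> - \<theta>0)"
  have sp: "pth 0 z \<in> space (Pt 0)" if "z \<in> space BB" for z using measurable_space[OF pth_measurable that] .
  have sq: "AE z in BB. (?\<kappa> (fst z))\<^sup>2 \<le> (\<epsilon> * norm v)\<^sup>2"
    using AE_ball
  proof (rule AE_mp, intro always_eventually allI impI)
    fix z :: "(real^'d) \<times> 'r \<times> (nat \<Rightarrow> real^'x)" assume "fst z \<in> ball \<theta>0 \<epsilon>"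
    then have "norm v * norm (fst z - \<theta>0) \<le> norm v * \<epsilon>"
      by (intro mult_left_mono) (auto simp: dist_norm norm_minus_commute)
    then have "\<bar>?\<kappa> (fst z)\<bar> \<le> \<epsilon> * norm v"
      using Cauchy_Schwarz_ineq2[of v "fst z - \<theta>0"] by (simp add: mult.commute)
    then show "(?\<kappa> (fst z))\<^sup>2 \<le> (\<epsilon> * norm v)\<^sup>2" by (rule power2_le_iff_abs_le[THEN iffD2, rotated]) (use eps_pos in auto)
  qed
  have i: "integrable BB (\<lambda>z. (?\<kappa> (fst z))\<^sup>2)"
    by (rule BB.integrable_const_bound[of _ "(\<epsilon> * norm v)\<^sup>2"]) (use sq in auto)
  have "(LINT z|BB. indicator (space (Pt 0)) (pth 0 z) * (v \<bullet> v))\<^sup>2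
    \<le> (LINT z|BB. indicator (space (Pt 0)) (pth 0 z) * (0 - ?\<kappa> (fst z))\<^sup>2) * qf (fisher \<mu>) v"
  proof (rule van_trees[OF open_ball support])
    show "line_deriv ?\<kappa> v z (v \<bullet> v)" for z
      by (auto intro!: derivative_eq_intros simp: inner_add_right inner_diff_right)
    show "continuous_on (ball \<theta>0 \<epsilon>) ?\<kappa>" "continuous_on (ball \<theta>0 \<epsilon>) (\<lambda>_. v \<bullet> v)" by (intro continuous_intros)+
    show "space (Pt 0) \<in> sets (Pt 0)" by simp
    show "integrable BB (\<lambda>z. indicator (space (Pt 0)) (pth 0 z) * (0 - ?\<kappa> (fst z))\<^sup>2)"
      by (rule Bochner_Integration.integrable_cong[OF refl, THEN iffD2, OF _ i]) (use sp in simp)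
    have "integrable BB (\<lambda>z. v \<bullet> v)" by simp
    then show "integrable BB (\<lambda>z. indicator (space (Pt 0)) (pth 0 z) * (v \<bullet> v))"
      by (rule Bochner_Integration.integrable_cong[OF refl, THEN iffD2, rotated]) (use sp in simp)
    show "(\<integral>\<^sup>+z. ennreal ((scr 0 v (fst z) (pth 0 z))\<^sup>2) \<partial>BB) \<le> ennreal (qf (fisher \<mu>) v)"
      unfolding score_second_moment by simp
  qed (auto simp: prior.qf_fisher_nonneg)
  also have "(LINT z|BB. indicator (space (Pt 0)) (pth 0 z) * (v \<bullet> v)) = (LINT z|BB. v \<bullet> v)"
    by (intro Bochner_Integration.integral_cong refl) (use sp in simp)
  also have "(LINT z|BB. indicator (space (Pt 0)) (pth 0 z) * (0 - ?\<kappa> (fst z))\<^sup>2) = (LINT z|BB. (?\<kappa> (fst z))\<^sup>2)"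
    by (intro Bochner_Integration.integral_cong refl) (use sp in simp)
  also have "(LINT z|BB. v \<bullet> v) = (norm v)\<^sup>2" by (simp add: BB.prob_space power2_norm_eq_inner)
  finally have 1: "((norm v)\<^sup>2)\<^sup>2 \<le> (LINT z|BB. (?\<kappa> (fst z))\<^sup>2) * qf (fisher \<mu>) v" .
  have "(LINT z|BB. (?\<kappa> (fst z))\<^sup>2) \<le> (LINT z|BB. (\<epsilon> * norm v)\<^sup>2)"
    by (rule integral_mono_AE[OF i _ sq]) simp
  also have "\<dots> = \<epsilon>\<^sup>2 * (norm v)\<^sup>2" by (simp add: BB.prob_space power_mult_distrib)
  finally have "((norm v)\<^sup>2)\<^sup>2 \<le> (\<epsilon>\<^sup>2 * (norm v)\<^sup>2) * qf (fisher \<mu>) v"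
    using 1 mult_right_mono[OF _ prior.qf_fisher_nonneg] by (meson order_trans)
  then have le: "(norm v)\<^sup>2 * (norm v)\<^sup>2 \<le> (norm v)\<^sup>2 * (\<epsilon>\<^sup>2 * qf (fisher \<mu>) v)" by (simp add: power2_eq_square mult_ac)
  then show ?thesis
  proof (cases "v = 0")
    case False
    then show ?thesis by (intro mult_left_le_imp_le[OF le]) simp
  qed simp
qed

end

text \<open>\<open>Kf\<close> stands for the gain, \<open>Gj\<close> for its Jacobian and
  \<open>W\<close> for the input weight at the centre. Regularity is asked for on the ball only,
  where the prior lives; measurability is global so that expectations make sense.\<close>

locale lq_window = lq_info A B p N \<pi> \<mu> bl L \<theta>0 \<epsilon> Ks
  for A :: "real^'x^'x" and B :: "real^'d \<Rightarrow> real^'u^'x" and p :: "real^'x \<Rightarrow> real"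
    and N :: "'r measure" and \<pi> :: "('x, 'u, 'r) policy" and \<mu> :: "real^'d \<Rightarrow> real" and bl
    and L :: "real^'d^('u \<times> 'x)" and \<theta>0 :: "real^'d" and \<epsilon> :: real and Ks +
  fixes Kf :: "real^'d \<Rightarrow> real^'x^'u" and Gj :: "real^'d \<Rightarrow> real^'d^('x \<times> 'u)" and W :: "real^'u^'u"
    and \<Gamma> :: "real^'x^'x" and cD :: real
  assumes Kf_measurable [measurable]: "Kf \<in> borel_measurable borel"
    and Gj_measurable [measurable]: "Gj \<in> borel_measurable borel"
    and Kf_cont: "continuous_on (ball \<theta>0 \<epsilon>) Kf" and Gj_cont: "continuous_on (ball \<theta>0 \<epsilon>) Gj"
    and Kf_deriv: "\<And>\<theta> v c. \<theta> \<in> ball \<theta>0 \<epsilon> \<Longrightarrow> line_deriv (\<lambda>\<theta>. c \<bullet> stack_cols (Kf \<theta>)) v \<theta> (c \<bullet> (Gj \<theta> *v v))"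
    and Gj_lip: "\<And>\<theta>. \<theta> \<in> ball \<theta>0 \<epsilon> \<Longrightarrow> norm (Gj \<theta> - Gj \<theta>0) \<le> cD * \<epsilon>"
    and W: "pos_def W" and \<Gamma>: "pos_def \<Gamma>"
begin

definition er :: "nat \<Rightarrow> (real^'d) \<times> 'r \<times> (nat \<Rightarrow> real^'x) \<Rightarrow> real^'u" where
  "er t z = Uc t z - Kf (fst z) *v X t z"

lemma er_measurable [measurable]: "er t \<in> borel_measurable BB"
  unfolding er_def[abs_def] by measurable

lemma qf_W_nonneg: "0 \<le> qf W u"
  using W by (cases "u = 0") (auto simp: pos_def_def less_imp_le)

text \<open>Rank-one splittings of \<Gamma> and W reduce the input error over I to errors of scalar
  least-squares estimators of f_i^T K^T g_j. The van Trees inequality on the event S bounds each of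
  them below in terms of the mean Jacobian over S, and the pieces reassemble into the trace by
  \<open>trace_kron\<close>. The perturbation F is the deviation of that mean from the Jacobian at
  the centre; it depends on the event and thus on the window.\<close>

lemma window_bound:
  fixes I :: "nat set" and Nm :: "real^'d^'d"
  assumes I: "finite I" "I \<subseteq> {..e}" and l: "0 < l"
    and S: "S \<in> sets (Pt e)" and exc: "\<And>w. w \<in> S \<Longrightarrow> psd ((\<Sum>t\<in>I. outer (px t w) (px t w)) - l *\<^sub>R \<Gamma>)"
    and e': "e \<le> Suc e'"
    and Nm: "0 < m" "\<And>v. m * (norm v)\<^sup>2 \<le> qf Nm v"
      "\<And>v. qf (fisher \<mu>) v + qf (Ib e') v \<le> qf Nm v"
    and int: "\<And>t. t \<in> I \<Longrightarrow> integrable BB (\<lambda>z. qf W (er t z))"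
  shows "\<exists>F. norm F \<le> cD * \<epsilon> \<and>
    (measure BB {z \<in> space BB. pth e z \<in> S})\<^sup>2 * l *
      trace (kron \<Gamma> W ** (Gj \<theta>0 + F) ** matrix_inv Nm ** transpose (Gj \<theta>0 + F))
    \<le> (\<Sum>t\<in>I. LINT z|BB. qf W (er t z))"
proof -
  have pS: "{z \<in> space BB. pth e z \<in> S} \<in> sets BB"
    using measurable_sets[OF pth_measurable S] by (simp add: vimage_def Int_def conj_commute)
  let ?p = "measure BB {z \<in> space BB. pth e z \<in> S}"
  have rhs0: "0 \<le> (\<Sum>t\<in>I. LINT z|BB. qf W (er t z))"
    by (intro sum_nonneg integral_nonneg_AE always_eventually allI qf_W_nonneg)
  have cD0: "0 \<le> cD * \<epsilon>" using Gj_lip[of \<theta>0] eps_pos by simp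
  show ?thesis
  proof (cases "?p = 0")
    case True
    then show ?thesis using rhs0 cD0 by (intro exI[of _ 0]) simp
  next
    case False
    then have p0: "0 < ?p" by (simp add: zero_less_measure_iff)
    have iS [measurable]: "(\<lambda>z. indicator S (pth e z) :: real) \<in> borel_measurable BB"
      using measurable_compose[OF pth_measurable borel_measurable_indicator[OF S]] .
    have ip: "(LINT z|BB. indicator S (pth e z)) = ?p"
    proof -
      have "(LINT z|BB. indicator S (pth e z) :: real) = (LINT z|BB. indicator {z \<in> space BB. pth e z \<in> S} z)"
        by (intro Bochner_Integration.integral_cong refl) (auto simp: indicator_def)
      then show ?thesis by (simp add: sets.Int_space_eq2[OF pS] sets.Int_space_eq1[OF pS])
    qed
    have ind1: "integrable BB (\<lambda>z. indicator S (pth e z) :: real)"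
      by (rule BB.integrable_const_bound[of _ 1, OF _ iS]) (auto simp: indicator_def)
    have iHm: "(\<lambda>z. indicator S (pth e z) *\<^sub>R (Gj (fst z) - Gj \<theta>0)) \<in> borel_measurable BB" by measurable
    have iHb: "AE z in BB. norm (indicator S (pth e z) *\<^sub>R (Gj (fst z) - Gj \<theta>0)) \<le> indicator S (pth e z) * (cD * \<epsilon>)"
    proof (rule AE_mp[OF AE_ball], intro always_eventually allI impI)
      fix z :: "(real^'d) \<times> 'r \<times> (nat \<Rightarrow> real^'x)" assume "fst z \<in> ball \<theta>0 \<epsilon>"
      from Gj_lip[OF this] show "norm (indicator S (pth e z) *\<^sub>R (Gj (fst z) - Gj \<theta>0)) \<le> indicator S (pth e z) * (cD * \<epsilon>)"
        by (cases "pth e z \<in> S") simp_all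
    qed
    have iH: "integrable BB (\<lambda>z. indicator S (pth e z) *\<^sub>R (Gj (fst z) - Gj \<theta>0))"
    proof (rule Bochner_Integration.integrable_bound[OF integrable_mult_left[OF ind1, of "cD * \<epsilon>"] iHm])
      show "AE z in BB. norm (indicator S (pth e z) *\<^sub>R (Gj (fst z) - Gj \<theta>0)) \<le> norm (indicator S (pth e z) * (cD * \<epsilon>))"
        by (rule AE_mp[OF iHb]) (auto intro!: always_eventually)
    qed
    \<comment> \<open>Dividing H by the probability of S makes G the conditional mean of the
      Jacobian given S.\<close>
    define H where "H = (LINT z|BB. indicator S (pth e z) *\<^sub>R (Gj (fst z) - Gj \<theta>0))"
    define F where "F = H /\<^sub>R ?p"
    define G where "G = Gj \<theta>0 + F"
    have nF: "norm F \<le> cD * \<epsilon>"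
    proof -
      have "norm H \<le> (LINT z|BB. norm (indicator S (pth e z) *\<^sub>R (Gj (fst z) - Gj \<theta>0)))"
        unfolding H_def by (rule integral_norm_bound)
      also have "\<dots> \<le> (LINT z|BB. indicator S (pth e z) * (cD * \<epsilon>))"
        by (rule integral_mono_AE[OF integrable_norm[OF iH] integrable_mult_left[OF ind1] iHb])
      also have "\<dots> = ?p * (cD * \<epsilon>)" using ip by simp
      finally show ?thesis using p0 by (simp add: F_def field_simps)
    qed
    have Gint: "integrable BB (\<lambda>z. indicator S (pth e z) * (c \<bullet> (Gj (fst z) *v v)))"
      "(LINT z|BB. indicator S (pth e z) * (c \<bullet> (Gj (fst z) *v v))) = ?p * (c \<bullet> (G *v v))" for c v
    proof -
      have bl: "bounded_linear (\<lambda>M. c \<bullet> (M *v v))"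
        by (intro bounded_linear_compose[OF bounded_linear_inner_right]
          bounded_bilinear.bounded_linear_left[OF bounded_bilinear_matrix_vector])
      have eq: "indicator S (pth e z) * (c \<bullet> (Gj (fst z) *v v))
        = c \<bullet> ((indicator S (pth e z) *\<^sub>R (Gj (fst z) - Gj \<theta>0)) *v v) + indicator S (pth e z) * (c \<bullet> (Gj \<theta>0 *v v))" for z
        by (simp add: scaleR_matrix_vector_assoc[symmetric] matrix_vector_mult_diff_rdistrib inner_diff_right right_diff_distrib)
      have 1: "integrable BB (\<lambda>z. c \<bullet> ((indicator S (pth e z) *\<^sub>R (Gj (fst z) - Gj \<theta>0)) *v v))"
        by (rule integrable_bounded_linear[OF bl iH])
      show "integrable BB (\<lambda>z. indicator S (pth e z) * (c \<bullet> (Gj (fst z) *v v)))"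
        unfolding eq by (intro Bochner_Integration.integrable_add 1 integrable_mult_left ind1)
      have "(LINT z|BB. indicator S (pth e z) * (c \<bullet> (Gj (fst z) *v v))) = c \<bullet> (H *v v) + ?p * (c \<bullet> (Gj \<theta>0 *v v))"
        unfolding eq H_def using ind1 1 integral_bounded_linear[OF bl iH] ip
        by (subst Bochner_Integration.integral_add) auto
      also have "\<dots> = ?p * (c \<bullet> (G *v v))"
        using p0 by (simp add: G_def F_def matrix_vector_mult_add_rdistrib inner_add_right
            scaleR_matrix_vector_assoc[symmetric] distrib_left)
      finally show "(LINT z|BB. indicator S (pth e z) * (c \<bullet> (Gj (fst z) *v v))) = ?p * (c \<bullet> (G *v v))" .
    qed
    have psd: "psd M" if "pos_def M" for M :: "real^'n^'n"
      unfolding psd_def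
    proof (intro conjI allI)
      show "0 \<le> qf M x" for x using that by (cases "x = 0") (auto simp: pos_def_def less_imp_le)
    qed (use that in \<open>simp add: pos_def_def\<close>)
    obtain f and a :: nat where fa: "\<Gamma> = (\<Sum>i<a. outer (f i) (f i))" by (rule psd_eq_sum_outer[OF psd[OF \<Gamma>]])
    obtain g and b :: nat where gb: "W = (\<Sum>j<b. outer (g j) (g j))" by (rule psd_eq_sum_outer[OF psd[OF W]])
    \<comment> \<open>The least-squares estimate of f_i^T K^T g_j obtained by regressing the
      component of the inputs along g_j on the states; it uses the path alone.\<close>
    define kh where "kh i j w = f i \<bullet> (cramer_inv (\<Sum>t\<in>I. outer (px t w) (px t w)) *v (\<Sum>t\<in>I. (g j \<bullet> pu t w) *\<^sub>R px t w))"
      for i j :: nat and w :: "'r \<times> (nat \<Rightarrow> real^'x)"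
    have khm: "kh i j \<in> borel_measurable (Pt e)" for i j
    proof -
      have [measurable]: "(\<lambda>w. px t w) \<in> borel_measurable (Pt e)" "(\<lambda>w. pu t w) \<in> borel_measurable (Pt e)" if "t \<in> I" for t
        using I that by (auto intro!: px_measurable pu_measurable)
      have 1: "(\<lambda>w. \<Sum>t\<in>I. outer (px t w) (px t w)) \<in> borel_measurable (Pt e)"
        by (rule borel_measurable_sum) measurable
      have 2: "(\<lambda>w. \<Sum>t\<in>I. (g j \<bullet> pu t w) *\<^sub>R px t w) \<in> borel_measurable (Pt e)"
        by (rule borel_measurable_sum) measurable
      note [measurable] = measurable_compose[OF 1 borel_measurable_cramer_inv] 2
      show ?thesis unfolding kh_def[abs_def] by measurable
    qed
    define \<kappa> where "\<kappa> i j \<theta> = tensor (f i) (g j) \<bullet> stack_cols (Kf \<theta>)" for i j \<theta>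
    have \<kappa>_eq: "\<kappa> i j \<theta> = f i \<bullet> (transpose (Kf \<theta>) *v g j)" for i j \<theta>
      unfolding \<kappa>_def inner_tensor_stack_cols inner_transpose by (rule inner_commute)
    have [measurable]: "\<kappa> i j \<in> borel_measurable borel" for i j unfolding \<kappa>_eq[abs_def] by measurable
    have dom: "l * (\<Sum>i<a. \<Sum>j<b. indicator S (pth e z) * (kh i j (pth e z) - \<kappa> i j (fst z))\<^sup>2) \<le> (\<Sum>t\<in>I. qf W (er t z))" for z
    proof (cases "pth e z \<in> S")
      case False
      then show ?thesis using qf_W_nonneg by (simp add: sum_nonneg)
    next
      case True
      let ?w = "pth e z"
      have pxu: "px t ?w = X t z" "pu t ?w = Uc t z" if "t \<in> I" for t
        using I that by (auto simp: px_pm pu_pm)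
      have "l * (\<Sum>i<a. (kh i j ?w - \<kappa> i j (fst z))\<^sup>2) \<le> (\<Sum>t\<in>I. (g j \<bullet> er t z)\<^sup>2)" for j
      proof -
        let ?kk = "transpose (Kf (fst z)) *v g j"
        have "l * qf \<Gamma> (cramer_inv (\<Sum>t\<in>I. outer (px t ?w) (px t ?w)) *v (\<Sum>t\<in>I. (g j \<bullet> pu t ?w) *\<^sub>R px t ?w) - ?kk)
          \<le> (\<Sum>t\<in>I. (g j \<bullet> pu t ?w - ?kk \<bullet> px t ?w)\<^sup>2)"
          by (rule regression_bound[OF I(1) \<Gamma> l exc[OF True]])
        also have "\<dots> = (\<Sum>t\<in>I. (g j \<bullet> er t z)\<^sup>2)"
        proof (intro sum.cong refl)
          fix t assume "t \<in> I"
          then show "(g j \<bullet> pu t ?w - ?kk \<bullet> px t ?w)\<^sup>2 = (g j \<bullet> er t z)\<^sup>2"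
            using pxu inner_transpose[of "X t z" "Kf (fst z)" "g j"]
            by (simp add: er_def inner_diff_right inner_commute)
        qed
        finally show ?thesis
          unfolding qf_sum_outer[OF fa] by (simp add: kh_def \<kappa>_eq inner_diff_right)
      qed
      then have "(\<Sum>j<b. l * (\<Sum>i<a. (kh i j ?w - \<kappa> i j (fst z))\<^sup>2)) \<le> (\<Sum>j<b. \<Sum>t\<in>I. (g j \<bullet> er t z)\<^sup>2)"
        by (intro sum_mono)
      also have "\<dots> = (\<Sum>t\<in>I. qf W (er t z))"
        unfolding qf_sum_outer[OF gb] by (rule sum.swap)
      also have "(\<Sum>j<b. l * (\<Sum>i<a. (kh i j ?w - \<kappa> i j (fst z))\<^sup>2)) = l * (\<Sum>i<a. \<Sum>j<b. (kh i j ?w - \<kappa> i j (fst z))\<^sup>2)"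
        unfolding sum_distrib_left[symmetric] by (subst sum.swap) simp
      finally show ?thesis using True by simp
    qed
    define Q where "Q i j z = indicator S (pth e z) * (kh i j (pth e z) - \<kappa> i j (fst z))\<^sup>2"
      for i j and z :: "(real^'d) \<times> 'r \<times> (nat \<Rightarrow> real^'x)"
    have Q0: "0 \<le> Q i j z" for i j z by (simp add: Q_def)
    have iE: "integrable BB (\<lambda>z. \<Sum>t\<in>I. qf W (er t z))" by (intro Bochner_Integration.integrable_sum int)
    have iQ: "integrable BB (Q i j)" if "i < a" "j < b" for i j
    proof (rule Bochner_Integration.integrable_bound[OF integrable_mult_right[OF iE, of "1 / l"]])
      show "Q i j \<in> borel_measurable BB"
        using measurable_compose[OF pth_measurable khm[of i j]] unfolding Q_def[abs_def] by measurable
      show "AE z in BB. norm (Q i j z) \<le> norm (1 / l * (\<Sum>t\<in>I. qf W (er t z)))"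
      proof (intro always_eventually allI)
        fix z
        have "Q i j z \<le> (\<Sum>j<b. Q i j z)" using that Q0 by (intro member_le_sum) auto
        also have "\<dots> \<le> (\<Sum>i<a. \<Sum>j<b. Q i j z)" using that Q0 by (intro member_le_sum sum_nonneg) auto
        finally have "l * Q i j z \<le> l * (\<Sum>i<a. \<Sum>j<b. Q i j z)" using l by (intro mult_left_mono) auto
        then have "l * Q i j z \<le> (\<Sum>t\<in>I. qf W (er t z))" using dom[of z] by (simp add: Q_def)
        then have "Q i j z \<le> 1 / l * (\<Sum>t\<in>I. qf W (er t z))" using l by (simp add: field_simps)
        then show "norm (Q i j z) \<le> norm (1 / l * (\<Sum>t\<in>I. qf W (er t z)))"
          unfolding real_norm_def using Q0[of i j z] abs_ge_self[of "1 / l * (\<Sum>t\<in>I. qf W (er t z))"] by linarith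
      qed
    qed
    have inv: "invertible Nm" by (rule invertible_of_coercive[OF Nm(1,2)])
    have main: "?p\<^sup>2 * ((transpose G *v c) \<bullet> (matrix_inv Nm *v (transpose G *v c))) \<le> (LINT z|BB. Q i j z)"
      if ij: "i < a" "j < b" and c: "c = tensor (f i) (g j)" for i j c
    proof -
      \<comment> \<open>The optimal direction: with it both the mean of the directional derivative
        per unit probability and the information in direction v equal \<tau>, so van Trees gives the
        form of the inverse of Nm.\<close>
      define v where "v = matrix_inv Nm *v (transpose G *v c)"
      define \<tau> where "\<tau> = qf Nm v"
      have Nv: "Nm *v v = transpose G *v c" by (simp add: v_def matrix_inv_vec_right[OF inv])
      have \<tau>1: "(transpose G *v c) \<bullet> v = \<tau>" by (simp add: \<tau>_def Nv inner_commute)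
      have \<tau>2: "c \<bullet> (G *v v) = \<tau>"
        using inner_transpose[of v G c] by (simp add: \<tau>1[symmetric] inner_commute)
      have \<tau>0: "0 \<le> \<tau>" using Nm(1) Nm(2)[of v] unfolding \<tau>_def by (smt (verit) mult_nonneg_nonneg zero_le_power2)
      have "(LINT z|BB. indicator S (pth e z) * (c \<bullet> (Gj (fst z) *v v)))\<^sup>2
        \<le> (LINT z|BB. indicator S (pth e z) * (kh i j (pth e z) - \<kappa> i j (fst z))\<^sup>2) * \<tau>"
      proof (rule van_trees[OF open_ball support])
        show "line_deriv (\<kappa> i j) v z (c \<bullet> (Gj z *v v))" if "z \<in> ball \<theta>0 \<epsilon>" for z
          using Kf_deriv[OF that, of c v] by (simp add: \<kappa>_def c)
        show "continuous_on (ball \<theta>0 \<epsilon>) (\<kappa> i j)" unfolding \<kappa>_eq[abs_def]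
          by (intro continuous_intros continuous_matrix_intros Kf_cont)
        show "continuous_on (ball \<theta>0 \<epsilon>) (\<lambda>z. c \<bullet> (Gj z *v v))"
          by (intro continuous_intros continuous_matrix_intros Gj_cont)
        show "integrable BB (\<lambda>z. indicator S (pth e z) * (kh i j (pth e z) - \<kappa> i j (fst z))\<^sup>2)"
          using iQ[OF ij] by (simp add: Q_def[abs_def])
        show "(\<integral>\<^sup>+z. ennreal ((scr e v (fst z) (pth e z))\<^sup>2) \<partial>BB) \<le> ennreal \<tau>"
          using score_moment_le[OF e', of v] Nm(3)[of v] by (auto simp: \<tau>_def intro: order_trans ennreal_leI)
      qed (use S khm Gint(1) \<tau>0 in auto)
      then have "(?p * \<tau>)\<^sup>2 \<le> (LINT z|BB. Q i j z) * \<tau>" unfolding Gint(2) \<tau>2 Q_def .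
      then have "\<tau> * (?p\<^sup>2 * \<tau>) \<le> \<tau> * (LINT z|BB. Q i j z)" by (simp add: power2_eq_square mult_ac)
      moreover have "0 \<le> (LINT z|BB. Q i j z)" by (intro integral_nonneg_AE always_eventually allI Q0)
      ultimately have "?p\<^sup>2 * \<tau> \<le> (LINT z|BB. Q i j z)" using \<tau>0 by (cases "\<tau> = 0") (auto simp: mult_le_cancel_left)
      then show ?thesis using \<tau>1 by (simp add: v_def)
    qed
    have "?p\<^sup>2 * l * trace (kron \<Gamma> W ** G ** matrix_inv Nm ** transpose G)
      = l * (\<Sum>i<a. \<Sum>j<b. ?p\<^sup>2 * ((transpose G *v tensor (f i) (g j)) \<bullet> (matrix_inv Nm *v (transpose G *v tensor (f i) (g j)))))"
      unfolding trace_kron[OF fa gb] sum_distrib_left[symmetric] by simp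
    also have "\<dots> \<le> l * (\<Sum>i<a. \<Sum>j<b. LINT z|BB. Q i j z)"
      using l by (intro mult_left_mono sum_mono main) auto
    also have "\<dots> = l * (LINT z|BB. (\<Sum>i<a. \<Sum>j<b. Q i j z))"
    proof -
      have "(LINT z|BB. (\<Sum>i<a. \<Sum>j<b. Q i j z)) = (\<Sum>i<a. LINT z|BB. (\<Sum>j<b. Q i j z))"
        by (rule Bochner_Integration.integral_sum) (auto intro!: Bochner_Integration.integrable_sum iQ)
      also have "\<dots> = (\<Sum>i<a. \<Sum>j<b. LINT z|BB. Q i j z)"
        by (intro sum.cong refl Bochner_Integration.integral_sum) (use iQ in auto)
      finally show ?thesis by simp
    qed
    also have "\<dots> = (LINT z|BB. l * (\<Sum>i<a. \<Sum>j<b. Q i j z))" by simp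
    also have "\<dots> \<le> (LINT z|BB. (\<Sum>t\<in>I. qf W (er t z)))"
    proof (rule integral_mono)
      show "integrable BB (\<lambda>z. l * (\<Sum>i<a. \<Sum>j<b. Q i j z))"
        by (intro integrable_mult_right Bochner_Integration.integrable_sum iQ) auto
    qed (use iE dom in \<open>auto simp: Q_def\<close>)
    also have "\<dots> = (\<Sum>t\<in>I. LINT z|BB. qf W (er t z))" by (rule Bochner_Integration.integral_sum[OF int])
    finally show ?thesis using nF unfolding G_def by blast
  qed
qed

end

subsection \<open>Energy balance of the cost\<close>

text \<open>Abstract bookkeeping for expectations: v is the mean value of the state, e the mean
  input error, c the mean stage cost and \<tau> the noise contribution per step. The equation is the
  completed square in the mean. The inequalities say that the stage cost controls the current value,
  that the closed loop contracts up to the input error, and that the stage cost controls the next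
  value.\<close>

definition balance :: "real \<Rightarrow> real \<Rightarrow> real \<Rightarrow> real \<Rightarrow> real \<Rightarrow> nat \<Rightarrow> (nat \<Rightarrow> real) \<Rightarrow> (nat \<Rightarrow> real) \<Rightarrow> (nat \<Rightarrow> real) \<Rightarrow> bool" where
  "balance q r C C4 \<tau> T v e c \<longleftrightarrow> v 0 = 0 \<and> (\<forall>t. 0 \<le> v t \<and> 0 \<le> e t) \<and>
     (\<forall>t<T. c t = v t - v (Suc t) + \<tau> + e t \<and> q * v t \<le> c t \<and>
       v (Suc t) \<le> r * v t + C * e t + \<tau> \<and> v (Suc t) \<le> C4 * c t + \<tau>)"

primrec discounted :: "real \<Rightarrow> (nat \<Rightarrow> real) \<Rightarrow> nat \<Rightarrow> real" where
  "discounted r e 0 = 0"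
| "discounted r e (Suc t) = r * discounted r e t + e t"

lemma discounted_nonneg: "0 \<le> r \<Longrightarrow> (\<And>t. 0 \<le> e t) \<Longrightarrow> 0 \<le> discounted r e t"
  by (induction t) auto

lemma discounted_le_sum:
  assumes "0 \<le> r" "r \<le> 1" "\<And>t. 0 \<le> e t"
  shows "discounted r e t \<le> (\<Sum>s<t. e s)"
proof (induction t)
  case (Suc t)
  have "r * discounted r e t \<le> 1 * discounted r e t"
    using assms by (intro mult_right_mono discounted_nonneg) auto
  then show ?case using Suc by simp
qed simp

lemma sum_discounted_le:
  assumes "0 \<le> r" "r < 1" "\<And>t. 0 \<le> e t"
  shows "(\<Sum>t\<le>T. discounted r e t) \<le> (\<Sum>s<T. e s) / (1 - r)"
proof -
  have "(1 - r) * (\<Sum>t\<le>T. discounted r e t) + r * discounted r e T \<le> (\<Sum>s<T. e s)"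
    by (induction T) (simp_all add: algebra_simps)
  then have "(1 - r) * (\<Sum>t\<le>T. discounted r e t) \<le> (\<Sum>s<T. e s)"
    using mult_nonneg_nonneg[OF assms(1) discounted_nonneg[of r e T]] assms by simp
  then show ?thesis using assms by (simp add: field_simps)
qed

lemma balance_state_le:
  assumes b: "balance q r C C4 \<tau> T v e c" and r: "0 \<le> r" "r < 1" and "0 \<le> C" and \<tau>: "0 \<le> \<tau>" and "t \<le> T"
  shows "v t \<le> \<tau> / (1 - r) + C * discounted r e t"
  using assms(6)
proof (induction t)
  case 0
  then show ?case using b r \<tau> by (simp add: balance_def)
next
  case (Suc t)
  have "v (Suc t) \<le> r * v t + C * e t + \<tau>" using b Suc by (simp add: balance_def)
  also have "\<dots> \<le> r * (\<tau> / (1 - r) + C * discounted r e t) + C * e t + \<tau>"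
    using Suc r by (intro add_right_mono mult_left_mono) auto
  also have "\<dots> = \<tau> / (1 - r) + C * discounted r e (Suc t)" using r by (simp add: field_simps)
  finally show ?case .
qed

text \<open>The cost still to be paid from time \<open>s\<close> on is almost the value of the state at time \<open>s\<close>.\<close>

lemma balance_tail:
  assumes b: "balance q r C C4 \<tau> T v e c" and q: "0 \<le> q" "q \<le> 1" and \<tau>: "0 \<le> \<tau>" and "s \<le> T"
  shows "(1 - (1 - q) ^ (T - s)) * v s \<le> (\<Sum>t\<in>{s..<T}. c t)"
  using \<open>s \<le> T\<close>
proof (induction s rule: inc_induct)
  case base
  then show ?case by simp
next
  case (step s)
  let ?k = "(1 - q) ^ (T - Suc s)"
  have k: "0 \<le> ?k" "?k \<le> 1" using q by (auto intro: power_le_one)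
  have c: "v s - v (Suc s) \<le> c s" "q * v s \<le> c s"
    using b step(2) \<tau> by (auto simp: balance_def)
  have "(1 - ?k) * (v s - v (Suc s)) + ?k * (q * v s) \<le> (1 - ?k) * c s + ?k * c s"
    using c k by (intro add_mono mult_left_mono) auto
  then have "(1 - ?k) * (v s - v (Suc s)) + ?k * (q * v s) \<le> c s" by (simp add: algebra_simps)
  moreover have "T - s = Suc (T - Suc s)" using step(2) by simp
  moreover have "{s..<T} = insert s {Suc s..<T}" using step(2) by auto
  ultimately show ?case using step(3) by (simp add: algebra_simps)
qed

lemma balance_sum:
  assumes b: "balance q r C C4 \<tau> T v e c" and "s \<le> T"
  shows "(\<Sum>t<s. c t) = (\<Sum>t<s. e t) + real s * \<tau> - v s"
  using assms(2)
proof (induction s)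
  case 0
  then show ?case using b by (simp add: balance_def)
next
  case (Suc s)
  then have "c s = v s - v (Suc s) + \<tau> + e s" using b by (simp add: balance_def)
  then show ?case using Suc by (simp add: algebra_simps)
qed

text \<open>Telescoping bounds the errors by the excess cost plus the terminal value, which a policy
  could make large. Stopping at T - m, the cost of the remaining steps pays for the value there up
  to the fraction (1 - q)^m, and that value is itself bounded by a constant plus C times the
  accumulated errors. For (1 - q)^m C small the remainder is absorbed on the left.\<close>

lemma balance_prefix:
  assumes b: "balance q r C C4 \<tau> T v e c" and q: "0 \<le> q" "q \<le> 1" and r: "0 \<le> r" "r < 1" and C: "0 \<le> C"
    and \<tau>: "0 \<le> \<tau>" and cost: "(\<Sum>t<T. c t) \<le> \<rho> + real T * \<tau>" and m: "m \<le> T"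
  shows "(1 - (1 - q) ^ m * C) * (\<Sum>t<T - m. e t) \<le> \<rho> + real m * \<tau> + \<tau> / (1 - r)"
proof -
  let ?s = "T - m" and ?k = "(1 - q) ^ m"
  have k: "0 \<le> ?k" "?k \<le> 1" using q by (auto intro: power_le_one)
  have e0: "\<And>t. 0 \<le> e t" using b by (simp add: balance_def)
  have Tm: "T - ?s = m" using m by simp
  have sp: "(\<Sum>t<T. c t) = (\<Sum>t<?s. c t) + (\<Sum>t\<in>{?s..<T}. c t)"
    by (subst sum.union_disjoint[symmetric]) (auto intro!: sum.cong)
  have "(1 - ?k) * v ?s \<le> (\<Sum>t\<in>{?s..<T}. c t)" using balance_tail[OF b q \<tau>, of ?s] Tm by simp
  then have 1: "(\<Sum>t<?s. e t) \<le> \<rho> + real m * \<tau> + ?k * v ?s"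
    using cost sp balance_sum[OF b, of ?s] m by (simp add: algebra_simps of_nat_diff)
  have "v ?s \<le> \<tau> / (1 - r) + C * (\<Sum>t<?s. e t)"
    using balance_state_le[OF b r C \<tau>, of ?s] mult_left_mono[OF discounted_le_sum[of r e ?s] C] r e0 by simp
  then have "?k * v ?s \<le> ?k * (\<tau> / (1 - r) + C * (\<Sum>t<?s. e t))" using k by (intro mult_left_mono) auto
  also have "\<dots> \<le> \<tau> / (1 - r) + ?k * C * (\<Sum>t<?s. e t)"
    using k \<tau> r mult_right_mono[OF k(2), of "\<tau> / (1 - r)"] by (simp add: distrib_left)
  finally show ?thesis using 1 by (simp add: algebra_simps)
qed

text \<open>A cruder bound on all errors, with a constant free of T; it is enough for terms that
  carry an extra factor \<epsilon>. The prefix is handled with an m chosen once and for all. In the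
  last m steps each error is at most a multiple of the stage cost plus \<tau>, and the cost left for
  these steps is bounded by the budget and the value at T - m.\<close>

lemma balance_total:
  assumes q: "0 < q" "q \<le> 1" and r: "0 \<le> r" "r < 1" and C: "0 \<le> C" "0 \<le> C4" and \<tau>m: "0 \<le> \<tau>m"
  obtains C' where "0 \<le> C'" "\<And>T v e c \<tau> \<rho>. balance q r C C4 \<tau> T v e c \<Longrightarrow> 0 \<le> \<tau> \<Longrightarrow> \<tau> \<le> \<tau>m \<Longrightarrow> 0 \<le> \<rho> \<Longrightarrow>
    (\<Sum>t<T. c t) \<le> \<rho> + real T * \<tau> \<Longrightarrow> (\<Sum>t<T. e t) \<le> C' * (\<rho> + 1)"
proof -
  have "(\<lambda>m. (1 - q) ^ m * C) \<longlonglongrightarrow> 0 * C"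
    using q by (intro tendsto_intros LIMSEQ_power_zero) auto
  then have "eventually (\<lambda>m. (1 - q) ^ m * C < 1 / 2) sequentially"
    by (rule order_tendstoD) simp
  then obtain m where m: "(1 - q) ^ m * C < 1 / 2" by (auto simp: eventually_sequentially)
  define a where "a = real m * \<tau>m + \<tau>m / (1 - r)"
  have a0: "0 \<le> a" using \<tau>m r by (simp add: a_def)
  define C' where "C' = 2 * (1 + a) + (1 + C4) * (1 + 2 * a + C * (2 * (1 + a))) + a"
  have C'0: "0 \<le> C'" using a0 C by (simp add: C'_def)
  have "(\<Sum>t<T. e t) \<le> C' * (\<rho> + 1)"
    if b: "balance q r C C4 \<tau> T v e c" and \<tau>: "0 \<le> \<tau>" "\<tau> \<le> \<tau>m" and \<rho>: "0 \<le> \<rho>"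
      and cost: "(\<Sum>t<T. c t) \<le> \<rho> + real T * \<tau>" for T v e c \<tau> \<rho>
  proof -
    \<comment> \<open>Truncated subtraction: for m > T the prefix is empty and all steps count as
      last ones.\<close>
    let ?s = "T - m"
    have e0: "\<And>t. 0 \<le> e t" and v0: "\<And>t. 0 \<le> v t" using b by (auto simp: balance_def)
    have ta: "real m * \<tau> + \<tau> / (1 - r) \<le> a"
      unfolding a_def using \<tau> r by (intro add_mono mult_left_mono divide_right_mono) auto
    have t1: "\<tau> / (1 - r) \<le> a" "real m * \<tau> \<le> a" using ta \<tau> r by (smt (verit) divide_nonneg_nonneg mult_nonneg_nonneg of_nat_0_le_iff)+
    have pre: "(\<Sum>t<?s. e t) \<le> 2 * (\<rho> + a)"
    proof (cases "m \<le> T")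
      case True
      have "(1 / 2) * (\<Sum>t<?s. e t) \<le> (1 - (1 - q) ^ m * C) * (\<Sum>t<?s. e t)"
        using m e0 by (intro mult_right_mono sum_nonneg) auto
      also have "\<dots> \<le> \<rho> + real m * \<tau> + \<tau> / (1 - r)"
        by (rule balance_prefix[OF b _ _ r C(1) \<tau>(1) cost True]) (use q in auto)
      also have "\<dots> \<le> \<rho> + a" using ta by simp
      finally show ?thesis by simp
    next
      case False
      then show ?thesis using \<rho> a0 by simp
    qed
    have vs: "v ?s \<le> a + C * (2 * (\<rho> + a))"
    proof -
      have "v ?s \<le> \<tau> / (1 - r) + C * discounted r e ?s" by (rule balance_state_le[OF b r C(1) \<tau>(1)]) simp
      also have "\<dots> \<le> a + C * (2 * (\<rho> + a))"
        using t1 C discounted_le_sum[of r e ?s] r e0 pre by (intro add_mono mult_left_mono) (auto intro: order_trans)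
      finally show ?thesis .
    qed
    have sp: "(\<Sum>t<T. f t) = (\<Sum>t<?s. f t) + (\<Sum>t\<in>{?s..<T}. f t)" for f :: "nat \<Rightarrow> real"
      by (subst sum.union_disjoint[symmetric]) (auto intro!: sum.cong)
    have Tsm: "real T - real ?s \<le> real m" by (cases "m \<le> T") (auto simp: of_nat_diff)
    have "(\<Sum>t\<in>{?s..<T}. c t) \<le> \<rho> + (real T - real ?s) * \<tau> + v ?s"
      using cost sp[of c] balance_sum[OF b, of ?s] sum_nonneg[of "{..<?s}" e] e0 by (simp add: algebra_simps)
    also have "\<dots> \<le> \<rho> + a + (a + C * (2 * (\<rho> + a)))"
      using vs mult_right_mono[OF Tsm \<tau>(1)] t1 by linarith
    finally have ct: "(\<Sum>t\<in>{?s..<T}. c t) \<le> \<rho> + 2 * a + C * (2 * (\<rho> + a))" by simp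
    have "e t \<le> (1 + C4) * c t + \<tau>" if "t \<in> {?s..<T}" for t
    proof -
      have "t < T" using that by simp
      then have "c t = v t - v (Suc t) + \<tau> + e t" "v (Suc t) \<le> C4 * c t + \<tau>" using b by (auto simp: balance_def)
      then show ?thesis using v0[of t] \<tau> by (simp add: algebra_simps)
    qed
    then have "(\<Sum>t\<in>{?s..<T}. e t) \<le> (\<Sum>t\<in>{?s..<T}. (1 + C4) * c t + \<tau>)" by (rule sum_mono)
    also have "\<dots> = (1 + C4) * (\<Sum>t\<in>{?s..<T}. c t) + (real T - real ?s) * \<tau>"
      by (simp add: sum.distrib sum_distrib_left of_nat_diff)
    also have "\<dots> \<le> (1 + C4) * (\<rho> + 2 * a + C * (2 * (\<rho> + a))) + a"
      using ct C mult_right_mono[OF Tsm \<tau>(1)] t1 by (intro add_mono mult_left_mono) auto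
    finally have "(\<Sum>t<T. e t) \<le> 2 * (\<rho> + a) + ((1 + C4) * (\<rho> + 2 * a + C * (2 * (\<rho> + a))) + a)"
      using pre sp[of e] by linarith
    also have "\<dots> \<le> C' * (\<rho> + 1)"
    proof -
      have p: "0 \<le> a * \<rho>" "0 \<le> C * \<rho>" "0 \<le> C * (a * \<rho>)" "0 \<le> C * a"
        using a0 C \<rho> by simp_all
      have "2 * (\<rho> + a) \<le> 2 * (1 + a) * (\<rho> + 1)" using p a0 by (simp add: algebra_simps)
      moreover have "\<rho> + 2 * a + C * (2 * (\<rho> + a)) \<le> (1 + 2 * a + C * (2 * (1 + a))) * (\<rho> + 1)"
        using p C(1) by (simp add: algebra_simps)
      then have "(1 + C4) * (\<rho> + 2 * a + C * (2 * (\<rho> + a))) \<le> (1 + C4) * ((1 + 2 * a + C * (2 * (1 + a))) * (\<rho> + 1))"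
        using C(2) by (intro mult_left_mono) auto
      moreover have "a \<le> a * (\<rho> + 1)" using p by (simp add: algebra_simps)
      moreover have "C' * (\<rho> + 1) = 2 * (1 + a) * (\<rho> + 1) + (1 + C4) * ((1 + 2 * a + C * (2 * (1 + a))) * (\<rho> + 1)) + a * (\<rho> + 1)"
        by (simp only: C'_def distrib_right mult.assoc)
      ultimately show ?thesis by linarith
    qed
    finally show ?thesis .
  qed
  then show ?thesis using that C'0 by blast
qed

section \<open>Cost of the stationary feedback and of policies with bounded regret\<close>

context lq_model
begin

lemma linear_noise_cost: "linear noise_cost"
proof (rule linearI)
  fix P P' :: "real^'x^'x" and k :: real
  have "noise_cost (P + P') = (LINT y|lborel. p y * qf P y + p y * qf P' y)"
    by (simp add: noise_cost_def matrix_vector_mult_add_rdistrib inner_add_right distrib_left)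
  then show "noise_cost (P + P') = noise_cost P + noise_cost P'"
    by (simp add: integrable_noise_qf noise_cost_def)
  show "noise_cost (k *\<^sub>R P) = k *\<^sub>R noise_cost P"
    by (simp add: noise_cost_def scaleR_matrix_vector_assoc[symmetric] mult.left_commute)
qed

lemma noise_cost_measurable [measurable]: "noise_cost \<in> borel_measurable borel"
  by (intro borel_measurable_continuous_onI linear_continuous_on
      linear_conv_bounded_linear[THEN iffD1] linear_noise_cost)

lemma st_measurable_fixed: "(\<lambda>\<omega>. st \<theta> \<omega> t) \<in> borel_measurable Om" "(\<lambda>\<omega>. ct \<theta> \<omega> t) \<in> borel_measurable Om"
  using measurable_compose[OF measurable_Pair1'[of \<theta> borel Om] state_measurable[of t]]
    measurable_compose[OF measurable_Pair1'[of \<theta> borel Om] control_measurable[of t]] by simp_all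

text \<open>A fixed parameter is the degenerate prior \<open>return borel \<theta>\<close>.\<close>

lemma nn_integral_qf_next_fixed:
  assumes P: "\<And>x. 0 \<le> qf P x"
  shows "(\<integral>\<^sup>+\<omega>. ennreal (qf P (st \<theta> \<omega> (Suc t))) \<partial>Om)
    = (\<integral>\<^sup>+\<omega>. ennreal (qf P (A *v st \<theta> \<omega> t + B \<theta> *v ct \<theta> \<omega> t) + noise_cost P) \<partial>Om)"
proof -
  let ?D = "return borel \<theta>"
  have s: "sets (?D \<Otimes>\<^sub>M Om) = sets (borel \<Otimes>\<^sub>M Om)" by (intro sets_pair_measure_cong) auto
  have red: "(\<integral>\<^sup>+z. f z \<partial>(?D \<Otimes>\<^sub>M Om)) = (\<integral>\<^sup>+\<omega>. f (\<theta>, \<omega>) \<partial>Om)" if f: "f \<in> borel_measurable (borel \<Otimes>\<^sub>M Om)" for f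
  proof -
    have "f \<in> borel_measurable (?D \<Otimes>\<^sub>M Om)" using f unfolding measurable_cong_sets[OF s refl] .
    from Om.nn_integral_fst[OF this, symmetric]
    have "(\<integral>\<^sup>+z. f z \<partial>(?D \<Otimes>\<^sub>M Om)) = (\<integral>\<^sup>+\<theta>'. \<integral>\<^sup>+\<omega>. f (\<theta>', \<omega>) \<partial>Om \<partial>?D)" .
    also have "\<dots> = (\<integral>\<^sup>+\<omega>. f (\<theta>, \<omega>) \<partial>Om)"
      using Om.borel_measurable_nn_integral_fst[OF f] by (subst nn_integral_return) auto
    finally show ?thesis .
  qed
  have "(\<integral>\<^sup>+z. ennreal (qf P (st (fst z) (snd z) (Suc t))) \<partial>(?D \<Otimes>\<^sub>M Om))
    = (\<integral>\<^sup>+z. ennreal (qf P (A *v st (fst z) (snd z) t + B (fst z) *v ct (fst z) (snd z) t) + noise_cost P) \<partial>(?D \<Otimes>\<^sub>M Om))"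
    using nn_integral_qf_next[of ?D "\<lambda>_. P" t] P by simp
  moreover have "(\<lambda>z. ennreal (qf P (st (fst z) (snd z) (Suc t)))) \<in> borel_measurable (borel \<Otimes>\<^sub>M Om)"
    "(\<lambda>z. ennreal (qf P (A *v st (fst z) (snd z) t + B (fst z) *v ct (fst z) (snd z) t) + noise_cost P))
      \<in> borel_measurable (borel \<Otimes>\<^sub>M Om)" by measurable
  ultimately show ?thesis by (simp add: red)
qed

text \<open>With u = K x the completed square has no error term. Telescoping from the initial state
  0 leaves T times the noise contribution minus the terminal value.\<close>

lemma stationary_cost_le:
  assumes P: "\<And>x. 0 \<le> qf P x" and Q: "\<And>x. 0 \<le> qf Q x" and R: "\<And>u. 0 \<le> qf R u"
    and fb: "\<And>\<omega> t. ct \<theta> \<omega> t = K *v st \<theta> \<omega> t"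
    and id: "\<And>x. qf P (A *v x + B \<theta> *v (K *v x)) + qf R (K *v x) + qf Q x = qf P x"
  shows "cost A (B \<theta>) Q R p N T \<pi> \<le> ennreal (real T * noise_cost P)"
proof -
  note [measurable] = st_measurable_fixed
  have nc: "0 \<le> noise_cost P" by (rule noise_cost_nonneg[OF P])
  define V where "V t = (\<integral>\<^sup>+\<omega>. ennreal (qf P (st \<theta> \<omega> t)) \<partial>Om)" for t
  define Ct where "Ct t = (\<integral>\<^sup>+\<omega>. ennreal (qf Q (st \<theta> \<omega> t) + qf R (ct \<theta> \<omega> t)) \<partial>Om)" for t
  have step: "Ct t + V (Suc t) = V t + ennreal (noise_cost P)" for t
  proof -
    let ?n = "\<lambda>\<omega>. A *v st \<theta> \<omega> t + B \<theta> *v ct \<theta> \<omega> t"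
    have "Ct t + V (Suc t) = (\<integral>\<^sup>+\<omega>. ennreal (qf Q (st \<theta> \<omega> t) + qf R (ct \<theta> \<omega> t)) + ennreal (qf P (?n \<omega>) + noise_cost P) \<partial>Om)"
      unfolding Ct_def V_def nn_integral_qf_next_fixed[OF P] by (rule nn_integral_add[symmetric]) measurable
    also have "\<dots> = (\<integral>\<^sup>+\<omega>. ennreal (qf P (st \<theta> \<omega> t)) + ennreal (noise_cost P) \<partial>Om)"
    proof (rule nn_integral_cong)
      fix \<omega>
      show "ennreal (qf Q (st \<theta> \<omega> t) + qf R (ct \<theta> \<omega> t)) + ennreal (qf P (?n \<omega>) + noise_cost P)
          = ennreal (qf P (st \<theta> \<omega> t)) + ennreal (noise_cost P)"
        using id[of "st \<theta> \<omega> t"] P Q R nc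
        by (simp add: ennreal_plus[symmetric] fb add_ac del: ennreal_plus)
    qed
    also have "\<dots> = V t + (\<integral>\<^sup>+\<omega>. ennreal (noise_cost P) \<partial>Om)"
      unfolding V_def by (rule nn_integral_add) measurable
    finally show ?thesis using Om.emeasure_space_1 by simp
  qed
  have V0: "V 0 = 0" by (simp add: V_def state_0)
  have "(\<Sum>t<T. Ct t) + V T = ennreal (real T * noise_cost P)"
  proof (induction T)
    case (Suc T)
    have "(\<Sum>t<Suc T. Ct t) + V (Suc T) = (\<Sum>t<T. Ct t) + (Ct T + V (Suc T))" by (simp add: add_ac)
    also have "\<dots> = ((\<Sum>t<T. Ct t) + V T) + ennreal (noise_cost P)" by (simp add: step add_ac)
    also have "\<dots> = ennreal (real (Suc T) * noise_cost P)"
      unfolding Suc using nc by (simp add: ennreal_plus[symmetric] algebra_simps del: ennreal_plus)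
    finally show ?case .
  qed (simp add: V0)
  then have "(\<Sum>t<T. Ct t) \<le> ennreal (real T * noise_cost P)" by (metis le_iff_add)
  then show ?thesis by (simp add: cost_def Ct_def)
qed

lemma opt_cost_le:
  assumes P: "\<And>x. 0 \<le> qf P x" and Q: "\<And>x. 0 \<le> qf Q x" and R: "\<And>u. 0 \<le> qf R u"
    and id: "\<And>x. qf P (A *v x + B \<theta> *v (K *v x)) + qf R (K *v x) + qf Q x = qf P x"
  shows "opt_cost A (B \<theta>) Q R p N T \<le> ennreal (real T * noise_cost P)"
proof -
  define \<pi>' :: "('x, 'u, 'r) policy" where "\<pi>' t h r = (if t = 0 then 0 else K *v h t)" for t h r
  have pol: "is_policy N \<pi>'"
    unfolding is_policy_def
  proof
    fix t
    show "(\<lambda>(h, r). \<pi>' t h r) \<in> borel_measurable (Pi\<^sub>M {1..t} (\<lambda>_. borel) \<Otimes>\<^sub>M N)"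
    proof (cases "t = 0")
      case False
      then have t: "t \<in> {1..t}" by simp
      have "(\<lambda>z. fst z t) \<in> borel_measurable (Pi\<^sub>M {1..t} (\<lambda>_. borel) \<Otimes>\<^sub>M N)"
        by (rule measurable_compose[OF measurable_fst measurable_component_singleton[OF t]])
      then have "(\<lambda>z. K *v fst z t) \<in> borel_measurable (Pi\<^sub>M {1..t} (\<lambda>_. borel) \<Otimes>\<^sub>M N)" by measurable
      then show ?thesis using False by (simp add: \<pi>'_def case_prod_unfold)
    qed (simp add: \<pi>'_def)
  qed
  interpret m: lq_model A B p N \<pi>'
    by unfold_locales (use p_density p_measurable N pol B_measurable p_mean p_second in auto)
  have "control A (B \<theta>) \<pi>' \<omega> t = K *v state A (B \<theta>) \<pi>' \<omega> t" for \<omega> t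
    by (simp add: control_def \<pi>'_def state_0)
  from m.stationary_cost_le[OF P Q R this id, of T]
  have "cost A (B \<theta>) Q R p N T \<pi>' \<le> ennreal (real T * noise_cost P)" .
  with pol show ?thesis
    unfolding opt_cost_def by (intro INF_lower2[of \<pi>']) simp_all
qed

lemma cost_le_of_regret:
  assumes reg: "regret A (B \<theta>) Q R p N T \<pi> \<le> ereal \<rho>" and \<rho>: "0 \<le> \<rho>"
    and opt: "opt_cost A (B \<theta>) Q R p N T \<le> ennreal k" and k: "0 \<le> k"
  shows "cost A (B \<theta>) Q R p N T \<pi> \<le> ennreal (\<rho> + k)"
proof -
  let ?c = "cost A (B \<theta>) Q R p N T \<pi>" and ?o = "opt_cost A (B \<theta>) Q R p N T"
  have o: "enn2ereal ?o \<le> ereal k"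
    using opt k by (metis enn2ereal_ennreal less_eq_ennreal.rep_eq)
  then have fin: "\<bar>enn2ereal ?o\<bar> \<noteq> \<infinity>"
    using enn2ereal_nonneg[of ?o] by (cases "enn2ereal ?o") auto
  have "enn2ereal ?c \<le> ereal \<rho> + enn2ereal ?o"
    using reg fin unfolding regret_def by (simp add: ereal_minus_le_iff)
  also have "\<dots> \<le> ereal \<rho> + ereal k" by (intro add_left_mono o)
  finally have "enn2ereal ?c \<le> ereal (\<rho> + k)" by simp
  then show ?thesis using \<rho> k by (simp add: less_eq_ennreal.rep_eq del: ennreal_plus)
qed

end

lemma regret_nonneg: "is_policy N \<pi> \<Longrightarrow> 0 \<le> regret A B Q R p N T \<pi>"
  unfolding regret_def opt_cost_def
  by (intro ereal_diff_positive) (simp add: less_eq_ennreal.rep_eq[symmetric] INF_lower)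

section \<open>The energy balance averaged over the prior\<close>

text \<open>The constants are uniform over the ball. \<open>k\<close> compares the weight W at the
  centre with the weights at nearby parameters; it becomes 1 + O(\<epsilon>), so that replacing one
  by the other affects the regret only by such a factor.\<close>

locale lq_cost = lq_window A B p N \<pi> \<mu> bl L \<theta>0 \<epsilon> Ks Kf Gj W \<Gamma> cD
  for A :: "real^'x^'x" and B :: "real^'d \<Rightarrow> real^'u^'x" and p :: "real^'x \<Rightarrow> real"
    and N :: "'r measure" and \<pi> :: "('x, 'u, 'r) policy" and \<mu> :: "real^'d \<Rightarrow> real" and bl
    and L :: "real^'d^('u \<times> 'x)" and \<theta>0 :: "real^'d" and \<epsilon> :: real and Ks
    and Kf :: "real^'d \<Rightarrow> real^'x^'u" and Gj :: "real^'d \<Rightarrow> real^'d^('x \<times> 'u)" and W :: "real^'u^'u"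
    and \<Gamma> :: "real^'x^'x" and cD :: real +
  fixes Pf :: "real^'d \<Rightarrow> real^'x^'x" and Q :: "real^'x^'x" and R :: "real^'u^'u"
    and q r C C4 m0 k \<tau>m :: real
  assumes Pf_measurable [measurable]: "Pf \<in> borel_measurable borel"
    and Pf_nonneg: "\<And>\<theta> x. 0 \<le> qf (Pf \<theta>) x"
    and Q_nonneg: "\<And>x. 0 \<le> qf Q x" and R_nonneg: "\<And>u. 0 \<le> qf R u"
    and completion: "\<And>\<theta> x u. \<theta> \<in> ball \<theta>0 \<epsilon> \<Longrightarrow> qf (Pf \<theta>) (A *v x + B \<theta> *v u) + qf R u + qf Q x
      = qf (Pf \<theta>) x + qf (input_weight (B \<theta>) R (Pf \<theta>)) (u - Kf \<theta> *v x)"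
    and q_le: "\<And>\<theta> x. \<theta> \<in> ball \<theta>0 \<epsilon> \<Longrightarrow> q * qf (Pf \<theta>) x \<le> qf Q x"
    and contract: "\<And>\<theta> x u. \<theta> \<in> ball \<theta>0 \<epsilon> \<Longrightarrow> qf (Pf \<theta>) (A *v x + B \<theta> *v u)
      \<le> r * qf (Pf \<theta>) x + C * qf (input_weight (B \<theta>) R (Pf \<theta>)) (u - Kf \<theta> *v x)"
    and step_cost: "\<And>\<theta> x u. \<theta> \<in> ball \<theta>0 \<epsilon> \<Longrightarrow> qf (Pf \<theta>) (A *v x + B \<theta> *v u) \<le> C4 * (qf Q x + qf R u)"
    and Pf_lower: "\<And>\<theta> x. \<theta> \<in> ball \<theta>0 \<epsilon> \<Longrightarrow> m0 * (norm x)\<^sup>2 \<le> qf (Pf \<theta>) x"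
    and W_le: "\<And>\<theta> u. \<theta> \<in> ball \<theta>0 \<epsilon> \<Longrightarrow> qf W u \<le> k * qf (input_weight (B \<theta>) R (Pf \<theta>)) u"
    and nc_le: "\<And>\<theta>. \<theta> \<in> ball \<theta>0 \<epsilon> \<Longrightarrow> noise_cost (Pf \<theta>) \<le> \<tau>m"
    and cst_bounds: "0 < q" "q \<le> 1" "0 \<le> r" "r < 1" "0 \<le> C" "0 \<le> C4" "0 < m0" "0 \<le> k"
begin

abbreviation Wf where "Wf \<theta> \<equiv> input_weight (B \<theta>) R (Pf \<theta>)"

lemma Wf_nonneg: "0 \<le> qf (Wf \<theta>) u"
  unfolding input_weight_inner using R_nonneg Pf_nonneg by (intro add_nonneg_nonneg)

lemma Wf_measurable [measurable]: "(\<lambda>\<theta>. Wf \<theta>) \<in> borel_measurable borel"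
  unfolding input_weight_def by measurable

text \<open>The means are extended nonnegative numbers because finite moments are not assumed of the
  policy; they are derived from a finite cost. For this reason the balance \<open>energy\<close> is
  stated additively, without subtraction.\<close>

definition V where "V t = (\<integral>\<^sup>+z. ennreal (qf (Pf (fst z)) (X t z)) \<partial>BB)"
definition Ee where "Ee t = (\<integral>\<^sup>+z. ennreal (qf (Wf (fst z)) (er t z)) \<partial>BB)"
definition Ct where "Ct t = (\<integral>\<^sup>+z. ennreal (qf Q (X t z) + qf R (Uc t z)) \<partial>BB)"
definition tau where "tau = (LINT z|BB. noise_cost (Pf (fst z)))"

lemma AE_noise_cost: "AE z in BB. 0 \<le> noise_cost (Pf (fst z)) \<and> noise_cost (Pf (fst z)) \<le> \<tau>m"
  by (rule AE_mp[OF AE_ball]) (auto intro!: always_eventually noise_cost_nonneg Pf_nonneg nc_le simp del: mem_ball)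

lemma integrable_noise_cost: "integrable BB (\<lambda>z. noise_cost (Pf (fst z)))"
  by (rule BB.integrable_const_bound[of _ \<tau>m]) (use AE_noise_cost in auto)

lemma tau_bounds: "0 \<le> tau" "tau \<le> \<tau>m"
proof -
  show "0 \<le> tau" unfolding tau_def using AE_noise_cost by (intro integral_nonneg_AE) auto
  have "tau \<le> (LINT z|BB. \<tau>m)"
    unfolding tau_def using AE_noise_cost by (intro integral_mono_AE integrable_noise_cost) auto
  then show "tau \<le> \<tau>m" by (simp add: BB.prob_space)
qed

lemma nn_integral_noise_cost: "(\<integral>\<^sup>+z. ennreal (noise_cost (Pf (fst z))) \<partial>BB) = ennreal tau"
  unfolding tau_def using AE_noise_cost by (intro nn_integral_eq_integral integrable_noise_cost) auto

lemma V_Suc: "V (Suc t) = (\<integral>\<^sup>+z. ennreal (qf (Pf (fst z)) (A *v X t z + B (fst z) *v Uc t z)) \<partial>BB) + ennreal tau"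
proof -
  have "V (Suc t) = (\<integral>\<^sup>+z. ennreal (qf (Pf (fst z)) (A *v X t z + B (fst z) *v Uc t z) + noise_cost (Pf (fst z))) \<partial>BB)"
    unfolding V_def BB_eq by (rule nn_integral_qf_next) (auto simp: Pf_nonneg)
  also have "\<dots> = (\<integral>\<^sup>+z. ennreal (qf (Pf (fst z)) (A *v X t z + B (fst z) *v Uc t z)) + ennreal (noise_cost (Pf (fst z))) \<partial>BB)"
    by (intro nn_integral_cong ennreal_plus Pf_nonneg noise_cost_nonneg)
  also have "\<dots> = (\<integral>\<^sup>+z. ennreal (qf (Pf (fst z)) (A *v X t z + B (fst z) *v Uc t z)) \<partial>BB) + ennreal tau"
    unfolding nn_integral_noise_cost[symmetric] by (rule nn_integral_add) measurable
  finally show ?thesis .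
qed

lemma energy: "Ct t + V (Suc t) = V t + ennreal tau + Ee t"
proof -
  let ?n = "\<lambda>z. qf (Pf (fst z)) (A *v X t z + B (fst z) *v Uc t z)"
  have "Ct t + (\<integral>\<^sup>+z. ennreal (?n z) \<partial>BB) = (\<integral>\<^sup>+z. ennreal (qf Q (X t z) + qf R (Uc t z)) + ennreal (?n z) \<partial>BB)"
    unfolding Ct_def by (rule nn_integral_add[symmetric]) measurable
  also have "\<dots> = (\<integral>\<^sup>+z. ennreal (qf (Pf (fst z)) (X t z)) + ennreal (qf (Wf (fst z)) (er t z)) \<partial>BB)"
  proof (rule nn_integral_cong_AE, rule AE_mp[OF AE_ball], intro always_eventually allI impI)
    fix z :: "(real^'d) \<times> 'r \<times> (nat \<Rightarrow> real^'x)" assume "fst z \<in> ball \<theta>0 \<epsilon>"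
    from completion[OF this, of "X t z" "Uc t z"]
    show "ennreal (qf Q (X t z) + qf R (Uc t z)) + ennreal (?n z) = ennreal (qf (Pf (fst z)) (X t z)) + ennreal (qf (Wf (fst z)) (er t z))"
      using Q_nonneg R_nonneg Pf_nonneg Wf_nonneg
      by (simp add: ennreal_plus[symmetric] er_def add_ac del: ennreal_plus)
  qed
  also have "\<dots> = V t + Ee t"
    unfolding V_def Ee_def by (rule nn_integral_add) measurable
  finally show ?thesis unfolding V_Suc by (simp add: add_ac)
qed

lemma V_le_Ct: "ennreal q * V t \<le> Ct t"
  unfolding V_def Ct_def
proof (subst nn_integral_cmult[symmetric], measurable, rule nn_integral_mono_AE, rule AE_mp[OF AE_ball], intro always_eventually allI impI)
  fix z :: "(real^'d) \<times> 'r \<times> (nat \<Rightarrow> real^'x)" assume "fst z \<in> ball \<theta>0 \<epsilon>"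
  from q_le[OF this, of "X t z"]
  show "ennreal q * ennreal (qf (Pf (fst z)) (X t z)) \<le> ennreal (qf Q (X t z) + qf R (Uc t z))"
    using cst_bounds Pf_nonneg R_nonneg[of "Uc t z"] by (simp add: ennreal_mult[symmetric] ennreal_leI)
qed

lemma V_Suc_le_contract: "V (Suc t) \<le> ennreal r * V t + ennreal C * Ee t + ennreal tau"
proof -
  have "(\<integral>\<^sup>+z. ennreal (qf (Pf (fst z)) (A *v X t z + B (fst z) *v Uc t z)) \<partial>BB)
    \<le> (\<integral>\<^sup>+z. ennreal r * ennreal (qf (Pf (fst z)) (X t z)) + ennreal C * ennreal (qf (Wf (fst z)) (er t z)) \<partial>BB)"
  proof (rule nn_integral_mono_AE, rule AE_mp[OF AE_ball], intro always_eventually allI impI)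
    fix z :: "(real^'d) \<times> 'r \<times> (nat \<Rightarrow> real^'x)" assume "fst z \<in> ball \<theta>0 \<epsilon>"
    from contract[OF this, of "X t z" "Uc t z"]
    show "ennreal (qf (Pf (fst z)) (A *v X t z + B (fst z) *v Uc t z))
      \<le> ennreal r * ennreal (qf (Pf (fst z)) (X t z)) + ennreal C * ennreal (qf (Wf (fst z)) (er t z))"
      using cst_bounds Pf_nonneg Wf_nonneg
      by (simp add: ennreal_mult[symmetric] ennreal_plus[symmetric] er_def ennreal_leI del: ennreal_plus)
  qed
  also have "\<dots> = ennreal r * V t + ennreal C * Ee t"
    unfolding V_def Ee_def by (subst nn_integral_add) (auto simp: nn_integral_cmult)
  finally show ?thesis unfolding V_Suc by (rule add_right_mono)
qed

lemma V_Suc_le_cost: "V (Suc t) \<le> ennreal C4 * Ct t + ennreal tau"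
proof -
  have "(\<integral>\<^sup>+z. ennreal (qf (Pf (fst z)) (A *v X t z + B (fst z) *v Uc t z)) \<partial>BB)
    \<le> (\<integral>\<^sup>+z. ennreal C4 * ennreal (qf Q (X t z) + qf R (Uc t z)) \<partial>BB)"
  proof (rule nn_integral_mono_AE, rule AE_mp[OF AE_ball], intro always_eventually allI impI)
    fix z :: "(real^'d) \<times> 'r \<times> (nat \<Rightarrow> real^'x)" assume "fst z \<in> ball \<theta>0 \<epsilon>"
    from step_cost[OF this, of "X t z" "Uc t z"]
    show "ennreal (qf (Pf (fst z)) (A *v X t z + B (fst z) *v Uc t z)) \<le> ennreal C4 * ennreal (qf Q (X t z) + qf R (Uc t z))"
      using cst_bounds Q_nonneg R_nonneg by (simp add: ennreal_mult[symmetric] ennreal_leI del: ennreal_plus)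
  qed
  also have "\<dots> = ennreal C4 * Ct t"
    unfolding Ct_def by (rule nn_integral_cmult) measurable
  finally show ?thesis unfolding V_Suc by (rule add_right_mono)
qed

lemma sum_Ct_le:
  assumes cost: "\<And>\<theta>. \<theta> \<in> ball \<theta>0 \<epsilon> \<Longrightarrow> cost A (B \<theta>) Q R p N T \<pi> \<le> ennreal (\<rho> + real T * noise_cost (Pf \<theta>))"
    and \<rho>: "0 \<le> \<rho>"
  shows "(\<Sum>t<T. Ct t) \<le> ennreal (\<rho> + real T * tau)"
proof -
  let ?f = "\<lambda>t z. ennreal (qf Q (X t z) + qf R (Uc t z))"
  have fm: "?f t \<in> borel_measurable (D \<Otimes>\<^sub>M Om)" for t
    unfolding BB_eq[symmetric] by measurable
  have AED: "AE \<theta> in D. \<theta> \<in> ball \<theta>0 \<epsilon>"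
  proof (subst AE_density, simp, intro always_eventually allI impI)
    fix \<theta> assume "0 < ennreal (\<mu> \<theta>)"
    then have "\<theta> \<in> Ks" using support(3)[of \<theta>] by (cases "\<theta> \<in> Ks") auto
    then show "\<theta> \<in> ball \<theta>0 \<epsilon>" using support(2) by (rule subsetD[rotated])
  qed
  have "(\<Sum>t<T. Ct t) = (\<integral>\<^sup>+z. (\<Sum>t<T. ?f t z) \<partial>BB)"
    unfolding Ct_def by (rule nn_integral_sum[symmetric]) measurable
  also have "\<dots> = (\<integral>\<^sup>+\<theta>. \<integral>\<^sup>+\<omega>. (\<Sum>t<T. ?f t (\<theta>, \<omega>)) \<partial>Om \<partial>D)"
    unfolding BB_eq using fm by (intro Om.nn_integral_fst[symmetric] borel_measurable_sum)
  also have "\<dots> = (\<integral>\<^sup>+\<theta>. cost A (B \<theta>) Q R p N T \<pi> \<partial>D)"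
    unfolding cost_def using st_measurable_fixed
    by (intro nn_integral_cong) (subst nn_integral_sum, auto)
  also have "\<dots> \<le> (\<integral>\<^sup>+\<theta>. ennreal (\<rho> + real T * noise_cost (Pf \<theta>)) \<partial>D)"
    by (rule nn_integral_mono_AE, rule AE_mp[OF AED]) (auto intro!: always_eventually cost simp del: mem_ball)
  also have "\<dots> = (\<integral>\<^sup>+z. ennreal (\<rho> + real T * noise_cost (Pf (fst z))) \<partial>BB)"
    unfolding BB_eq using Om.emeasure_space_1 by (subst Om.nn_integral_fst[symmetric]) auto
  also have "\<dots> = ennreal (LINT z|BB. \<rho> + real T * noise_cost (Pf (fst z)))"
    using integrable_noise_cost \<rho> noise_cost_nonneg[OF Pf_nonneg] by (intro nn_integral_eq_integral) auto
  also have "(LINT z|BB. \<rho> + real T * noise_cost (Pf (fst z))) = \<rho> + real T * tau"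
    using integrable_noise_cost by (simp add: tau_def BB.prob_space)
  finally show ?thesis .
qed

text \<open>Finiteness propagates in this order: a finite total cost makes each \<open>Ct\<close>
  finite, \<open>V_Suc_le_cost\<close> then makes the next \<open>V\<close> finite, and
  \<open>energy\<close> makes \<open>Ee\<close> finite. After that everything is expressed by real
  sequences.\<close>

lemma bayes_balance:
  assumes cost: "\<And>\<theta>. \<theta> \<in> ball \<theta>0 \<epsilon> \<Longrightarrow> cost A (B \<theta>) Q R p N T \<pi> \<le> ennreal (\<rho> + real T * noise_cost (Pf \<theta>))"
    and \<rho>: "0 \<le> \<rho>"
  obtains v e c where "balance q r C C4 tau T v e c" "(\<Sum>t<T. c t) \<le> \<rho> + real T * tau"
    "\<And>t. t \<le> T \<Longrightarrow> V t = ennreal (v t)" "\<And>t. t < T \<Longrightarrow> Ee t = ennreal (e t)"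
proof -
  note tot = sum_Ct_le[OF cost \<rho>]
  have Cfin: "Ct t < \<infinity>" if "t < T" for t
  proof -
    have "Ct t \<le> (\<Sum>t<T. Ct t)" using that by (intro member_le_sum) auto
    also have "\<dots> < \<infinity>" using order_le_less_trans[OF tot ennreal_less_top] by simp
    finally show ?thesis .
  qed
  have V0: "V 0 = 0" by (simp add: V_def state_0)
  have Vfin: "V t < \<infinity>" if "t \<le> T" for t
  proof (cases t)
    case (Suc s)
    have "V (Suc s) \<le> ennreal C4 * Ct s + ennreal tau" by (rule V_Suc_le_cost)
    also have "\<dots> < \<infinity>" using Cfin[of s] that Suc by (simp add: ennreal_mult_less_top)
    finally show ?thesis using Suc by simp
  qed (simp add: V0)
  have Efin: "Ee t < \<infinity>" if "t < T" for t
  proof -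
    have "Ee t \<le> Ct t + V (Suc t)" unfolding energy by (simp add: add_increasing)
    also have "\<dots> < \<infinity>" using Cfin[OF that] Vfin[of "Suc t"] that by simp
    finally show ?thesis .
  qed
  define v where "v t = (if t \<le> T then enn2real (V t) else 0)" for t
  define e where "e t = (if t < T then enn2real (Ee t) else 0)" for t
  define c where "c t = enn2real (Ct t)" for t
  have v: "V t = ennreal (v t)" if "t \<le> T" for t using Vfin[OF that] that by (simp add: v_def)
  have e: "Ee t = ennreal (e t)" if "t < T" for t using Efin[OF that] that by (simp add: e_def)
  have c: "Ct t = ennreal (c t)" if "t < T" for t using Cfin[OF that] by (simp add: c_def)
  have nn: "0 \<le> v t" "0 \<le> e t" "0 \<le> c t" for t by (auto simp: v_def e_def c_def)
  have "balance q r C C4 tau T v e c"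
    unfolding balance_def
  proof (intro conjI allI impI)
    show "v 0 = 0" by (simp add: v_def V0)
    fix t assume t: "t < T"
    then have V1: "V t = ennreal (v t)" "V (Suc t) = ennreal (v (Suc t))" using v by auto
    note simps = ennreal_plus[symmetric] ennreal_mult[symmetric] nn tau_bounds cst_bounds
    have "c t + v (Suc t) = v t + tau + e t"
      using energy[of t] unfolding V1 e[OF t] c[OF t]
      by (simp add: simps less_imp_le del: ennreal_plus)
    then show "c t = v t - v (Suc t) + tau + e t" by simp
    show "q * v t \<le> c t"
      using V_le_Ct[of t] unfolding V1 c[OF t] by (simp add: simps less_imp_le del: ennreal_plus)
    show "v (Suc t) \<le> r * v t + C * e t + tau"
      using V_Suc_le_contract[of t] unfolding V1 e[OF t] by (simp add: simps del: ennreal_plus)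
    show "v (Suc t) \<le> C4 * c t + tau"
      using V_Suc_le_cost[of t] unfolding V1 c[OF t] by (simp add: simps del: ennreal_plus)
  qed (rule nn)+
  moreover have "(\<Sum>t<T. c t) \<le> \<rho> + real T * tau"
  proof -
    have "(\<Sum>t<T. Ct t) = ennreal (\<Sum>t<T. c t)" using c nn by (simp add: sum_ennreal)
    then show ?thesis using tot \<rho> tau_bounds by (simp del: ennreal_plus)
  qed
  ultimately show ?thesis using that v e by blast
qed

lemma AE_W_le: "AE z in BB. qf W (er t z) \<le> k * qf (Wf (fst z)) (er t z)"
  by (rule AE_mp[OF AE_ball]) (auto intro!: always_eventually W_le simp del: mem_ball)

lemma window_cost:
  assumes "Ee t = ennreal a" "0 \<le> a"
  shows "integrable BB (\<lambda>z. qf W (er t z))" "(LINT z|BB. qf W (er t z)) \<le> k * a"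
proof -
  have i: "integrable BB (\<lambda>z. qf (Wf (fst z)) (er t z))"
    using assms Wf_nonneg unfolding Ee_def by (intro integrableI_nonneg) auto
  have ie: "(LINT z|BB. qf (Wf (fst z)) (er t z)) = a"
    using assms Wf_nonneg unfolding Ee_def by (subst integral_eq_nn_integral) auto
  show i': "integrable BB (\<lambda>z. qf W (er t z))"
  proof (rule Bochner_Integration.integrable_bound[OF integrable_mult_right[OF i, of k]])
    show "AE z in BB. norm (qf W (er t z)) \<le> norm (k * qf (Wf (fst z)) (er t z))"
      by (rule AE_mp[OF AE_W_le[of t]]) (use qf_W_nonneg in \<open>auto intro!: always_eventually\<close>)
  qed measurable
  have "(LINT z|BB. qf W (er t z)) \<le> (LINT z|BB. k * qf (Wf (fst z)) (er t z))"
    by (rule integral_mono_AE[OF i' integrable_mult_right[OF i] AE_W_le])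
  then show "(LINT z|BB. qf W (er t z)) \<le> k * a" using ie by simp
qed

lemma second_moment_le:
  assumes "V t = ennreal a" "0 \<le> a"
  shows "integrable BB (\<lambda>z. (norm (X t z))\<^sup>2)" "(LINT z|BB. (norm (X t z))\<^sup>2) \<le> a / m0"
proof -
  have i: "integrable BB (\<lambda>z. qf (Pf (fst z)) (X t z))"
    using assms Pf_nonneg unfolding V_def by (intro integrableI_nonneg) auto
  have ie: "(LINT z|BB. qf (Pf (fst z)) (X t z)) = a"
    using assms Pf_nonneg unfolding V_def by (subst integral_eq_nn_integral) auto
  have le: "AE z in BB. (norm (X t z))\<^sup>2 \<le> 1 / m0 * qf (Pf (fst z)) (X t z)"
  proof (rule AE_mp[OF AE_ball], intro always_eventually allI impI)
    fix z :: "(real^'d) \<times> 'r \<times> (nat \<Rightarrow> real^'x)" assume "fst z \<in> ball \<theta>0 \<epsilon>"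
    from Pf_lower[OF this, of "X t z"] show "(norm (X t z))\<^sup>2 \<le> 1 / m0 * qf (Pf (fst z)) (X t z)"
      using cst_bounds by (simp add: field_simps)
  qed
  show i': "integrable BB (\<lambda>z. (norm (X t z))\<^sup>2)"
  proof (rule Bochner_Integration.integrable_bound[OF integrable_mult_right[OF i, of "1 / m0"]])
    show "AE z in BB. norm ((norm (X t z))\<^sup>2) \<le> norm (1 / m0 * qf (Pf (fst z)) (X t z))"
      by (rule AE_mp[OF le]) (use Pf_nonneg cst_bounds in \<open>auto intro!: always_eventually simp: abs_of_nonneg\<close>)
  qed measurable
  have "(LINT z|BB. (norm (X t z))\<^sup>2) \<le> (LINT z|BB. 1 / m0 * qf (Pf (fst z)) (X t z))"
    by (rule integral_mono_AE[OF i' integrable_mult_right[OF i] le])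
  then show "(LINT z|BB. (norm (X t z))\<^sup>2) \<le> a / m0" using ie by simp
qed

end

subsection \<open>Excitation events\<close>

text \<open>The two perturbations are treated differently. \<open>a\<close> is to be small of order
  1 / sqrt T, so its square can be summed over sqrt T windows even with the large Young factor 1 + 1
  / d; \<open>b\<close> is summable as it stands, and as P is at most 1 it may enter
  linearly.\<close>

lemma sq_split:
  fixes P x a b d :: real
  assumes P: "0 \<le> P" "P \<le> 1" "P \<le> x + a + b" and nn: "0 \<le> x" "0 \<le> a" "0 \<le> b" and d: "0 < d"
  shows "P\<^sup>2 \<le> (1 + d) * x\<^sup>2 + (1 + 1 / d) * a\<^sup>2 + 2 * b"
proof -
  have q: "(x + a)\<^sup>2 \<le> (1 + d) * x\<^sup>2 + (1 + 1 / d) * a\<^sup>2"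
  proof -
    have "0 \<le> (d * x - a)\<^sup>2 / d" using d by simp
    also have "\<dots> = d * x\<^sup>2 - 2 * x * a + a\<^sup>2 / d" using d by (simp add: power2_eq_square field_simps)
    finally show ?thesis by (simp add: power2_eq_square algebra_simps)
  qed
  have P1: "P\<^sup>2 \<le> P" using P by (simp add: power2_eq_square mult_left_le_one_le)
  show ?thesis
  proof (cases "P \<le> b")
    case True
    have "0 \<le> (1 + d) * x\<^sup>2 + (1 + 1 / d) * a\<^sup>2" using d by simp
    then show ?thesis using True P1 nn by linarith
  next
    case False
    define y where "y = P - b"
    have y: "0 \<le> y" "y \<le> x + a" "P = y + b" using False P by (auto simp: y_def)
    have "y\<^sup>2 \<le> (x + a)\<^sup>2" using y by (intro power_mono) auto
    moreover have "P\<^sup>2 = y\<^sup>2 + b * (P + y)" using y(3) by (simp add: power2_eq_square algebra_simps)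
    moreover have "b * (P + y) \<le> b * 2" using P nn y by (intro mult_left_mono) auto
    ultimately show ?thesis using q by linarith
  qed
qed

lemma trace_kron_bounds:
  fixes \<Gamma> :: "real^'x^'x" and W :: "real^'u^'u"
  assumes "psd \<Gamma>" "psd W"
  obtains tc where "0 \<le> tc"
    "\<And>(G :: real^'d^('x \<times> 'u)) M b. (\<And>v. 0 \<le> v \<bullet> (M *v v)) \<Longrightarrow> (\<And>v. v \<bullet> (M *v v) \<le> b * (norm v)\<^sup>2) \<Longrightarrow>
      0 \<le> trace (kron \<Gamma> W ** G ** M ** transpose G) \<and> trace (kron \<Gamma> W ** G ** M ** transpose G) \<le> tc * b * (norm G)\<^sup>2"
proof -
  obtain f and a :: nat where fa: "\<Gamma> = (\<Sum>i<a. outer (f i) (f i))" by (rule psd_eq_sum_outer[OF assms(1)])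
  obtain g and n :: nat where gb: "W = (\<Sum>j<n. outer (g j) (g j))" by (rule psd_eq_sum_outer[OF assms(2)])
  define tc where "tc = (\<Sum>i<a. \<Sum>j<n. (norm (tensor (f i) (g j)))\<^sup>2)"
  have "0 \<le> tc" unfolding tc_def by (intro sum_nonneg) auto
  moreover have "0 \<le> trace (kron \<Gamma> W ** G ** M ** transpose G) \<and> trace (kron \<Gamma> W ** G ** M ** transpose G) \<le> tc * b * (norm G)\<^sup>2"
    if M: "\<And>v. 0 \<le> v \<bullet> (M *v v)" "\<And>v. v \<bullet> (M *v v) \<le> b * (norm v)\<^sup>2" for G :: "real^'d^('x \<times> 'u)" and M b
  proof -
    have Gc: "norm (transpose G *v c) \<le> norm G * norm c" for c
    proof -
      let ?h = "transpose G *v c"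
      have "norm ?h * norm ?h = ?h \<bullet> ?h" by (metis power2_eq_square power2_norm_eq_inner)
      also have "\<dots> = c \<bullet> (G *v ?h)" using inner_transpose[of ?h G c] by (simp add: inner_commute)
      also have "\<dots> \<le> norm G * norm c * norm ?h" using abs_ge_self bilin_le order_trans by blast
      finally show ?thesis by (cases "norm ?h = 0") auto
    qed
    have b0: "0 \<le> b" using order_trans[OF M(1) M(2), of "axis undefined 1"] by simp
    have "0 \<le> trace (kron \<Gamma> W ** G ** M ** transpose G)"
      unfolding trace_kron[OF fa gb] by (intro sum_nonneg M(1))
    moreover have "trace (kron \<Gamma> W ** G ** M ** transpose G)
      \<le> (\<Sum>i<a. \<Sum>j<n. b * ((norm G)\<^sup>2 * (norm (tensor (f i) (g j)))\<^sup>2))"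
      unfolding trace_kron[OF fa gb]
    proof (intro sum_mono)
      fix i j
      let ?c = "tensor (f i) (g j)"
      have "(norm (transpose G *v ?c))\<^sup>2 \<le> (norm G * norm ?c)\<^sup>2" by (intro power_mono Gc) auto
      then have "b * (norm (transpose G *v ?c))\<^sup>2 \<le> b * ((norm G)\<^sup>2 * (norm ?c)\<^sup>2)"
        using b0 by (intro mult_left_mono) (auto simp: power_mult_distrib)
      then show "(transpose G *v ?c) \<bullet> (M *v (transpose G *v ?c)) \<le> b * ((norm G)\<^sup>2 * (norm ?c)\<^sup>2)"
        using M(2)[of "transpose G *v ?c"] by linarith
    qed
    moreover have "\<dots> = tc * b * (norm G)\<^sup>2"
      by (simp add: tc_def sum_distrib_left[symmetric] mult_ac)
    ultimately show ?thesis by simp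
  qed
  ultimately show ?thesis using that by blast
qed

text \<open>The part of the density above a high level M has mass below 1/4, and the part below M
  gives mass at most 1/4 to any ball of volume 1 / (4 M). The radius does not depend on the
  centre.\<close>

lemma anti_concentration:
  fixes p :: "real^'x \<Rightarrow> real"
  assumes p: "prob_density p" and [measurable]: "p \<in> borel_measurable borel"
  obtains a where "0 < a" "\<And>z. emeasure (density lborel (\<lambda>y. ennreal (p y))) {y. norm (z + y) < a} \<le> ennreal (1 / 2)"
proof -
  have p0: "0 \<le> p y" for y using p by (simp add: prob_density_def)
  have ip: "integrable lborel p" using p by (auto simp: prob_density_def has_bochner_integral_iff)
  let ?h = "\<lambda>n y. max 0 (p y - real n)"
  have "(\<lambda>n. LINT y|lborel. ?h n y) \<longlonglongrightarrow> (LINT y|(lborel :: (real^'x) measure). 0 :: real)"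
  proof (rule integral_dominated_convergence[where w=p])
    show "AE y in lborel. (\<lambda>n. ?h n y) \<longlonglongrightarrow> 0"
    proof (intro always_eventually allI)
      fix y
      obtain n0 where n0: "p y \<le> real n0" using real_arch_simple by blast
      have "eventually (\<lambda>n. ?h n y = 0) sequentially"
        using n0 by (intro eventually_sequentiallyI[of n0]) (auto simp: max_def)
      then show "(\<lambda>n. ?h n y) \<longlonglongrightarrow> 0" by (rule tendsto_eventually)
    qed
    show "AE y in lborel. norm (?h n y) \<le> p y" for n using p0 by (intro always_eventually) auto
  qed (use ip in auto)
  then have "eventually (\<lambda>n. (LINT y|lborel. ?h n y) < 1 / 4) sequentially"
    by (intro order_tendstoD(2)) auto
  then obtain n where n: "(LINT y|lborel. ?h n y) < 1 / 4" by (auto simp: eventually_sequentially)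
  have ih: "integrable lborel (?h n)"
    by (rule Bochner_Integration.integrable_bound[OF ip]) (use p0 in auto)
  define M where "M = real n + 1"
  define vb where "vb = unit_ball_vol (real DIM(real^'x))"
  have vb: "0 < vb" by (simp add: vb_def)
  \<comment> \<open>A radius of at most 1 lets its power in the volume formula be bounded by the
    radius itself.\<close>
  define a where "a = min 1 (1 / (4 * M * vb))"
  have M: "0 < M" by (simp add: M_def)
  have a: "0 < a" "a \<le> 1" "a \<le> 1 / (4 * M * vb)" using vb M by (auto simp: a_def)
  have "emeasure (density lborel (\<lambda>y. ennreal (p y))) {y. norm (z + y) < a} \<le> ennreal (1 / 2)" for z
  proof -
    have eq: "{y. norm (z + y) < a} = ball (- z) a"
      by (auto simp: dist_norm norm_minus_commute) (metis add.commute diff_minus_eq_add norm_minus_commute minus_diff_eq)+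
    have vol: "measure lborel (ball (- z) a) \<le> 1 / (4 * M)"
    proof -
      have "measure lborel (ball (- z) a) = vb * a ^ DIM(real^'x)" using a by (simp add: content_ball vb_def)
      also have "a ^ DIM(real^'x) \<le> a ^ 1" using a by (intro power_decreasing) (auto simp: One_nat_def Suc_le_eq)
      also have "vb * a ^ 1 \<le> vb * (1 / (4 * M * vb))" using a vb by (intro mult_left_mono) auto
      finally show ?thesis using vb M by (simp add: field_simps)
    qed
    have fin: "emeasure lborel (ball (- z) a) < \<infinity>" by (rule emeasure_lborel_ball_finite)
    have "emeasure (density lborel (\<lambda>y. ennreal (p y))) (ball (- z) a) = (\<integral>\<^sup>+y. ennreal (p y) * indicator (ball (- z) a) y \<partial>lborel)"
      by (rule emeasure_density) auto
    also have "\<dots> \<le> (\<integral>\<^sup>+y. ennreal (?h n y) + ennreal M * indicator (ball (- z) a) y \<partial>lborel)"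
    proof (rule nn_integral_mono)
      fix y
      have "p y \<le> ?h n y + M" by (simp add: M_def max_def)
      then have "ennreal (p y) \<le> ennreal (?h n y + M)" by (rule ennreal_leI)
      also have "\<dots> = ennreal (?h n y) + ennreal M" using M by (intro ennreal_plus) auto
      finally have "ennreal (p y) \<le> ennreal (?h n y) + ennreal M" .
      then show "ennreal (p y) * indicator (ball (- z) a) y \<le> ennreal (?h n y) + ennreal M * indicator (ball (- z) a) y"
        by (auto simp: indicator_def)
    qed
    also have "\<dots> = ennreal (LINT y|lborel. ?h n y) + ennreal M * emeasure lborel (ball (- z) a)"
    proof -
      have "(\<integral>\<^sup>+y. ennreal (?h n y) \<partial>lborel) = ennreal (LINT y|lborel. ?h n y)"
        by (rule nn_integral_eq_integral[OF ih]) simp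
      moreover have "(\<integral>\<^sup>+y. ennreal M * indicator (ball (- z) a) y \<partial>lborel) = ennreal M * emeasure lborel (ball (- z) a)"
        by (rule nn_integral_cmult_indicator) simp
      moreover have "(\<integral>\<^sup>+y. ennreal (?h n y) + ennreal M * indicator (ball (- z) a) y \<partial>lborel)
        = (\<integral>\<^sup>+y. ennreal (?h n y) \<partial>lborel) + (\<integral>\<^sup>+y. ennreal M * indicator (ball (- z) a) y \<partial>lborel)"
        by (intro nn_integral_add borel_measurable_times_ennreal borel_measurable_indicator) auto
      ultimately show ?thesis by simp
    qed
    also have "emeasure lborel (ball (- z) a) = ennreal (measure lborel (ball (- z) a))"
      using fin by (simp add: emeasure_eq_ennreal_measure)
    also have "ennreal (LINT y|lborel. ?h n y) + ennreal M * ennreal (measure lborel (ball (- z) a))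
      = ennreal ((LINT y|lborel. ?h n y) + M * measure lborel (ball (- z) a))"
      using M by (subst ennreal_plus) (auto simp: ennreal_mult intro!: integral_nonneg_AE)
    also have "\<dots> \<le> ennreal (1 / 2)"
    proof (rule ennreal_leI)
      have "M * measure lborel (ball (- z) a) \<le> M * (1 / (4 * M))" using M vol by (intro mult_left_mono) auto
      then show "(LINT y|lborel. ?h n y) + M * measure lborel (ball (- z) a) \<le> 1 / 2" using n M by simp
    qed
    finally show ?thesis unfolding eq .
  qed
  then show ?thesis using that a(1) by blast
qed

lemma sum_outer_symmetric: "transpose (\<Sum>t\<in>I. outer (x t) (x t)) = (\<Sum>t\<in>I. outer (x t) (x t))"
  by (simp add: transpose_def outer_def vec_eq_iff mult.commute)

lemma qf_sum_outer': "y \<bullet> ((\<Sum>t\<in>I. outer (x t) (x t)) *v y) = (\<Sum>t\<in>I. (x t \<bullet> y)\<^sup>2)"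
  by (simp add: matrix_vector_mult_sum inner_sum_right qf_outer)

lemma psd_excitation_iff:
  assumes "transpose \<Gamma> = \<Gamma>"
  shows "psd ((\<Sum>t\<in>I. outer (x t) (x t)) - l *\<^sub>R \<Gamma>) \<longleftrightarrow> (\<forall>y. l * qf \<Gamma> y \<le> (\<Sum>t\<in>I. (x t \<bullet> y)\<^sup>2))"
proof -
  have "transpose ((\<Sum>t\<in>I. outer (x t) (x t)) - l *\<^sub>R \<Gamma>) = (\<Sum>t\<in>I. outer (x t) (x t)) - l *\<^sub>R \<Gamma>"
    using sum_outer_symmetric[of x I] assms by (simp add: transpose_def vec_eq_iff)
  moreover have "y \<bullet> (((\<Sum>t\<in>I. outer (x t) (x t)) - l *\<^sub>R \<Gamma>) *v y) = (\<Sum>t\<in>I. (x t \<bullet> y)\<^sup>2) - l * qf \<Gamma> y" for y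
    by (simp add: matrix_vector_mult_diff_rdistrib inner_diff_right qf_sum_outer' scaleR_matrix_vector_assoc[symmetric])
  ultimately show ?thesis by (simp add: psd_def)
qed

text \<open>Discarding times whose states are small costs only a small part of the excitation level.\<close>

lemma psd_excitation_subset:
  fixes x :: "nat \<Rightarrow> real^'n"
  assumes \<Gamma>: "transpose \<Gamma> = \<Gamma>" and g: "\<And>y. g * (norm y)\<^sup>2 \<le> qf \<Gamma> y" and l: "0 \<le> l" and d: "0 \<le> d"
    and I: "finite I" "I = J \<union> Y" "J \<inter> Y = {}"
    and psd: "psd ((\<Sum>t\<in>I. outer (x t) (x t)) - l *\<^sub>R \<Gamma>)" and small: "(\<Sum>t\<in>Y. (norm (x t))\<^sup>2) \<le> d * g * l"
  shows "psd ((\<Sum>t\<in>J. outer (x t) (x t)) - ((1 - d) * l) *\<^sub>R \<Gamma>)"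
  unfolding psd_excitation_iff[OF \<Gamma>]
proof
  fix y
  have "l * qf \<Gamma> y \<le> (\<Sum>t\<in>I. (x t \<bullet> y)\<^sup>2)" using psd unfolding psd_excitation_iff[OF \<Gamma>] by blast
  also have "\<dots> = (\<Sum>t\<in>J. (x t \<bullet> y)\<^sup>2) + (\<Sum>t\<in>Y. (x t \<bullet> y)\<^sup>2)"
    unfolding I(2) using I by (intro sum.union_disjoint) auto
  also have "(\<Sum>t\<in>Y. (x t \<bullet> y)\<^sup>2) \<le> (\<Sum>t\<in>Y. (norm (x t))\<^sup>2 * (norm y)\<^sup>2)"
  proof (rule sum_mono)
    fix t
    have "\<bar>x t \<bullet> y\<bar>\<^sup>2 \<le> (norm (x t) * norm y)\<^sup>2" by (intro power_mono Cauchy_Schwarz_ineq2) auto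
    then show "(x t \<bullet> y)\<^sup>2 \<le> (norm (x t))\<^sup>2 * (norm y)\<^sup>2" by (simp add: power_mult_distrib)
  qed
  also have "\<dots> = (\<Sum>t\<in>Y. (norm (x t))\<^sup>2) * (norm y)\<^sup>2" by (simp add: sum_distrib_right)
  also have "\<dots> \<le> (d * g * l) * (norm y)\<^sup>2" by (intro mult_right_mono small) auto
  also have "\<dots> = d * l * (g * (norm y)\<^sup>2)" by simp
  also have "\<dots> \<le> d * l * qf \<Gamma> y" using d l g by (intro mult_left_mono) auto
  finally show "(1 - d) * l * qf \<Gamma> y \<le> (\<Sum>t\<in>J. (x t \<bullet> y)\<^sup>2)" by (simp add: algebra_simps)
qed

text \<open>In dimension one the matrices are numbers, so excitation is a matter of energy
  alone.\<close>

lemma psd_excitation_one_dim: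
  fixes x :: "nat \<Rightarrow> real^'n"
  assumes one: "CARD('n) = 1" and \<Gamma>: "transpose \<Gamma> = \<Gamma>" and l: "0 \<le> l"
    and large: "l * norm \<Gamma> \<le> (\<Sum>t\<in>I. (norm (x t))\<^sup>2)"
  shows "psd ((\<Sum>t\<in>I. outer (x t) (x t)) - l *\<^sub>R \<Gamma>)"
  unfolding psd_excitation_iff[OF \<Gamma>]
proof
  fix y
  obtain i where U: "(UNIV :: 'n set) = {i}" using one card_1_singletonE by blast
  have eq: "(x t \<bullet> y)\<^sup>2 = (norm (x t))\<^sup>2 * (norm y)\<^sup>2" for t
    unfolding power2_norm_eq_inner by (simp add: inner_vec_def U power2_eq_square)
  have "l * qf \<Gamma> y \<le> l * (norm \<Gamma> * (norm y)\<^sup>2)" using l by (intro mult_left_mono qf_le) auto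
  also have "\<dots> \<le> (\<Sum>t\<in>I. (norm (x t))\<^sup>2) * (norm y)\<^sup>2"
    using mult_right_mono[OF large, of "(norm y)\<^sup>2"] by (simp add: mult.assoc)
  finally show "l * qf \<Gamma> y \<le> (\<Sum>t\<in>I. (x t \<bullet> y)\<^sup>2)" by (simp add: eq sum_distrib_right)
qed

text \<open>In dimension at least two some nonzero vector is orthogonal to x; the rank-one form
  vanishes there while the form of \<Gamma> does not.\<close>

lemma not_psd_excitation_single:
  fixes x :: "real^'n"
  assumes two: "CARD('n) \<noteq> 1" and \<Gamma>: "pos_def \<Gamma>" and l: "0 < l"
  shows "\<not> psd (outer x x - l *\<^sub>R \<Gamma>)"
proof
  assume "psd (outer x x - l *\<^sub>R \<Gamma>)"
  then have "psd ((\<Sum>t\<in>{0::nat}. outer x x) - l *\<^sub>R \<Gamma>)" by simp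
  then have 1: "l * qf \<Gamma> y \<le> (x \<bullet> y)\<^sup>2" for y
    using \<Gamma> by (subst (asm) psd_excitation_iff[of \<Gamma> "\<lambda>_. x"]) (auto simp: pos_def_def)
  have "0 < CARD('n)" by simp
  then have "2 \<le> CARD('n)" using two by linarith
  then have "2 \<le> DIM(real^'n)" by simp
  then obtain y where y: "y \<noteq> 0" "orthogonal x y" by (rule orthogonal_to_vector_exists)
  have "0 < l * qf \<Gamma> y" using y \<Gamma> l by (simp add: pos_def_def)
  then show False using 1[of y] y by (simp add: orthogonal_def)
qed

context lq_bayes
begin

lemma excitation_set:
  assumes "I \<subseteq> {..e}"
  shows "{w \<in> space (Pt e). psd ((\<Sum>t\<in>I. outer (px t w) (px t w)) - M)} \<in> sets (Pt e)"
proof -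
  have "(\<lambda>w. outer (px t w) (px t w)) \<in> borel_measurable (Pt e)" if "t \<in> I" for t
    using that assms px_measurable[of t e] by (intro borel_measurable_outer) auto
  then have m: "(\<lambda>w. (\<Sum>t\<in>I. outer (px t w) (px t w)) - M) \<in> borel_measurable (Pt e)"
    by (intro borel_measurable_diff borel_measurable_sum) auto
  show ?thesis using measurable_sets[OF m borel_closed[OF closed_psd]]
    by (simp add: vimage_def Int_def conj_commute)
qed

lemma excitation_event: "{z \<in> space BB. psd ((\<Sum>t\<in>I. outer (X t z) (X t z)) - M)} \<in> sets BB"
proof -
  have m: "(\<lambda>z. (\<Sum>t\<in>I. outer (X t z) (X t z)) - M) \<in> borel_measurable BB"
    by (intro borel_measurable_diff borel_measurable_sum borel_measurable_outer X_measurable) auto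
  show ?thesis using measurable_sets[OF m borel_closed[OF closed_psd]]
    by (simp add: vimage_def Int_def conj_commute)
qed

lemma excitation_path_event:
  assumes "I \<subseteq> {..e}"
  shows "{z \<in> space BB. pth e z \<in> {w \<in> space (Pt e). psd ((\<Sum>t\<in>I. outer (px t w) (px t w)) - M)}}
    = {z \<in> space BB. psd ((\<Sum>t\<in>I. outer (X t z) (X t z)) - M)}"
proof -
  have "(\<Sum>t\<in>I. outer (px t (pth e z)) (px t (pth e z))) = (\<Sum>t\<in>I. outer (X t z) (X t z))" for z
    using assms by (intro sum.cong refl) (auto simp: px_pm)
  then show ?thesis using measurable_space[OF pth_measurable] by auto
qed

lemma prob_small_state_le:
  assumes a: "\<And>z. emeasure nu {y. norm (z + y) < a} \<le> ennreal (1 / 2)"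
  shows "measure BB {z \<in> space BB. norm (X (Suc t) z) < a} \<le> 1 / 2"
proof -
  let ?m = "\<lambda>z. A *v X t z + B (fst z) *v Uc t z"
  let ?g = "\<lambda>u. indicator {y. norm y < a} (?m (fst u) + snd u) :: ennreal"
  have [measurable]: "{y :: real^'x. norm y < a} \<in> sets borel" by measurable
  have "emeasure BB {z \<in> space BB. norm (X (Suc t) z) < a} = (\<integral>\<^sup>+z. indicator {z \<in> space BB. norm (X (Suc t) z) < a} z \<partial>BB)"
    by simp
  also have "\<dots> = (\<integral>\<^sup>+z. ?g (z, snd (snd z) t) \<partial>BB)"
    by (intro nn_integral_cong) (auto simp: indicator_def state_Suc)
  also have "\<dots> = (\<integral>\<^sup>+z. \<integral>\<^sup>+y. ?g (z, y) \<partial>nu \<partial>BB)"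
    unfolding BB_eq
  proof (rule nn_integral_noise)
    show "?g \<in> borel_measurable ((D \<Otimes>\<^sub>M Om) \<Otimes>\<^sub>M nu)" unfolding BB_eq[symmetric] by measurable
    fix \<theta> r and w :: "nat \<Rightarrow> real^'x" and y y'
    show "?g ((\<theta>, r, w(t := y')), y) = ?g ((\<theta>, r, w), y)"
      using state_cong[of t "w(t := y')" w t A "B \<theta>" \<pi> r] control_cong[of t "w(t := y')" w t A "B \<theta>" \<pi> r] by simp
  qed
  also have "\<dots> \<le> (\<integral>\<^sup>+z. ennreal (1 / 2) \<partial>BB)"
  proof (rule nn_integral_mono)
    fix z
    have "(\<integral>\<^sup>+y. ?g (z, y) \<partial>nu) = (\<integral>\<^sup>+y. indicator {y. norm (?m z + y) < a} y \<partial>nu)"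
      by (intro nn_integral_cong) (auto simp: indicator_def)
    also have "\<dots> = emeasure nu {y. norm (?m z + y) < a}"
      by (intro nn_integral_indicator) measurable
    also have "\<dots> \<le> ennreal (1 / 2)" by (rule a)
    finally show "(\<integral>\<^sup>+y. ?g (z, y) \<partial>nu) \<le> ennreal (1 / 2)" .
  qed
  also have "\<dots> = ennreal (1 / 2)" using BB.emeasure_space_1 by simp
  finally have "ennreal (measure BB {z \<in> space BB. norm (X (Suc t) z) < a}) \<le> ennreal (1 / 2)"
    by (simp only: BB.emeasure_eq_measure)
  then show ?thesis by (subst (asm) ennreal_le_iff) auto
qed

text \<open>Each state has norm at least a with probability at least 1/2, so the mean number of such
  times is at least n/2. Off the event their number is at most n/4 and on it at most n, which forces
  the probability to be at least 1/4.\<close>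

lemma prob_energy_ge:
  assumes a: "0 < a" "\<And>z. emeasure nu {y. norm (z + y) < a} \<le> ennreal (1 / 2)" and n: "0 < n"
  shows "1 / 4 \<le> measure BB {z \<in> space BB. a\<^sup>2 * (real n / 4) \<le> (\<Sum>t\<in>{1..n}. (norm (X t z))\<^sup>2)}"
proof -
  let ?E = "{z \<in> space BB. a\<^sup>2 * (real n / 4) \<le> (\<Sum>t\<in>{1..n}. (norm (X t z))\<^sup>2)}"
  let ?L = "\<lambda>t. {z \<in> space BB. a \<le> norm (X t z)}"
  have E: "?E \<in> sets BB" by measurable
  have L: "?L t \<in> sets BB" for t by measurable
  have pL: "1 / 2 \<le> measure BB (?L t)" if t: "t \<in> {1..n}" for t
  proof -
    obtain s where s: "t = Suc s" using t by (cases t) auto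
    have S: "{z \<in> space BB. norm (X t z) < a} \<in> sets BB" by measurable
    have "?L t = space BB - {z \<in> space BB. norm (X t z) < a}" by auto
    then have "measure BB (?L t) = 1 - measure BB {z \<in> space BB. norm (X t z) < a}"
      using BB.prob_compl[OF S] by simp
    then show ?thesis using prob_small_state_le[OF a(2), of s] s by simp
  qed
  have pt: "(\<Sum>t\<in>{1..n}. indicator (?L t) z) \<le> real n / 4 + real n * indicator ?E z" if z: "z \<in> space BB" for z
  proof (cases "z \<in> ?E")
    case True
    have "(\<Sum>t\<in>{1..n}. indicator (?L t) z) \<le> (\<Sum>t\<in>{1..n}. 1 :: real)" by (intro sum_mono) (auto simp: indicator_def)
    then show ?thesis using True by simp
  next
    case False
    then have lt: "(\<Sum>t\<in>{1..n}. (norm (X t z))\<^sup>2) < a\<^sup>2 * (real n / 4)" using z by auto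
    have "(\<Sum>t\<in>{1..n}. a\<^sup>2 * indicator (?L t) z) \<le> (\<Sum>t\<in>{1..n}. (norm (X t z))\<^sup>2)"
      using a(1) by (intro sum_mono) (auto simp: indicator_def intro!: power_mono)
    then have "a\<^sup>2 * (\<Sum>t\<in>{1..n}. indicator (?L t) z) \<le> a\<^sup>2 * (real n / 4)" using lt by (simp add: sum_distrib_left)
    then have "(\<Sum>t\<in>{1..n}. indicator (?L t) z) \<le> real n / 4" by (rule mult_left_le_imp_le) (use a(1) in simp)
    then show ?thesis using False by simp
  qed
  have i: "integrable BB (indicator S :: _ \<Rightarrow> real)" if "S \<in> sets BB" for S
    by (rule BB.integrable_const_bound[of _ 1]) (use that in \<open>auto simp: indicator_def intro!: borel_measurable_indicator\<close>)
  note iL = i[OF L] and iE = i[OF E]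
  have "real n / 2 \<le> (\<Sum>t\<in>{1..n}. measure BB (?L t))"
    using sum_mono[of "{1..n}" "\<lambda>_. 1 / 2" "\<lambda>t. measure BB (?L t)"] pL by simp
  also have "\<dots> = (LINT z|BB. (\<Sum>t\<in>{1..n}. indicator (?L t) z))"
    using iL by (subst Bochner_Integration.integral_sum) auto
  also have "\<dots> \<le> (LINT z|BB. real n / 4 + real n * indicator ?E z)"
    by (intro integral_mono Bochner_Integration.integrable_sum Bochner_Integration.integrable_add
        integrable_mult_right iL iE pt) simp_all
  also have "\<dots> = real n / 4 + real n * measure BB ?E"
    using E by (subst Bochner_Integration.integral_add[OF _ integrable_mult_right[OF iE]]) (simp_all add: BB.prob_space)
  finally have "real n * (1 / 4) \<le> real n * measure BB ?E" by (simp add: field_simps)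
  then show ?thesis by (rule mult_left_le_imp_le) (use n in simp)
qed

end

subsection \<open>Summing over the windows\<close>

lemma qf_matrix_inv_bounds:
  fixes M :: "real^'n^'n"
  assumes "0 < r" "\<And>u. r * (norm u)\<^sup>2 \<le> qf M u"
  shows "0 \<le> qf (matrix_inv M) y" "qf (matrix_inv M) y \<le> 1 / r * (norm y)\<^sup>2"
proof -
  have inv: "invertible M" by (rule invertible_of_coercive[OF assms])
  let ?u = "matrix_inv M *v y"
  have q: "r * (norm ?u)\<^sup>2 \<le> ?u \<bullet> y" using assms(2)[of ?u] by (simp add: matrix_inv_vec_right[OF inv])
  moreover have "0 \<le> r * (norm ?u)\<^sup>2" using assms(1) by simp
  ultimately show "0 \<le> qf (matrix_inv M) y" by (simp add: inner_commute)
  have c: "?u \<bullet> y \<le> norm ?u * norm y" by (rule norm_cauchy_schwarz)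
  have "r * (norm ?u)\<^sup>2 \<le> norm ?u * norm y" using q c by linarith
  then have "r * norm ?u \<le> norm y"
    by (cases "norm ?u = 0") (auto simp: power2_eq_square mult.left_commute mult_le_cancel_left_pos)
  then have "norm ?u \<le> 1 / r * norm y" using assms(1) by (simp add: field_simps)
  then have "norm ?u * norm y \<le> 1 / r * norm y * norm y" by (intro mult_right_mono) auto
  then show "qf (matrix_inv M) y \<le> 1 / r * (norm y)\<^sup>2"
    using c by (simp add: inner_commute power2_eq_square mult.assoc)
qed

lemma trace_scaleR: "trace (c *\<^sub>R M) = c * trace (M :: real^'n^'n)"
  by (simp add: trace_def sum_distrib_left)

lemma sum_disjoint_family_le:
  fixes f :: "'b \<Rightarrow> real"
  assumes "finite J" "finite U" "\<And>j. j \<in> J \<Longrightarrow> S j \<subseteq> U"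
    "\<And>i j. i \<in> J \<Longrightarrow> j \<in> J \<Longrightarrow> i \<noteq> j \<Longrightarrow> S i \<inter> S j = {}" "\<And>t. t \<in> U \<Longrightarrow> 0 \<le> f t"
  shows "(\<Sum>j\<in>J. \<Sum>t\<in>S j. f t) \<le> (\<Sum>t\<in>U. f t)"
proof -
  have "finite (S j)" if "j \<in> J" for j using finite_subset[OF assms(3)[OF that] assms(2)] .
  then have "(\<Sum>j\<in>J. \<Sum>t\<in>S j. f t) = (\<Sum>t\<in>(\<Union>j\<in>J. S j). f t)"
    using assms(1,4) by (intro sum.UNION_disjoint[symmetric]) auto
  also have "\<dots> \<le> (\<Sum>t\<in>U. f t)" using assms(2,3,5) by (intro sum_mono2) auto
  finally show ?thesis .
qed

text \<open>\<open>m\<close> is the number of discarded last steps, \<open>\<gamma>\<close> the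
  coercivity constant of \<Gamma>, \<open>tc\<close> and \<open>g0\<close> enter the crude trace
  bound, \<open>a\<close> is the radius from \<open>anti_concentration\<close>, \<open>Cs\<close>
  the constant from \<open>balance_total\<close>, and v, e, c are the real sequences from
  \<open>bayes_balance\<close> for the regret bound \<rho>.\<close>

locale lq_lower = lq_cost A B p N \<pi> \<mu> bl L \<theta>0 \<epsilon> Ks Kf Gj W \<Gamma> cD Pf Q R q r C C4 m0 k \<tau>m
  for A :: "real^'x^'x" and B :: "real^'d \<Rightarrow> real^'u^'x" and p :: "real^'x \<Rightarrow> real"
    and N :: "'r measure" and \<pi> :: "('x, 'u, 'r) policy" and \<mu> :: "real^'d \<Rightarrow> real" and bl
    and L :: "real^'d^('u \<times> 'x)" and \<theta>0 :: "real^'d" and \<epsilon> :: real and Ks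
    and Kf :: "real^'d \<Rightarrow> real^'x^'u" and Gj :: "real^'d \<Rightarrow> real^'d^('x \<times> 'u)" and W :: "real^'u^'u"
    and \<Gamma> :: "real^'x^'x" and cD :: real
    and Pf :: "real^'d \<Rightarrow> real^'x^'x" and Q :: "real^'x^'x" and R :: "real^'u^'u"
    and q r C C4 m0 k \<tau>m :: real +
  fixes \<Psi> :: "real^'d^'d" and tc g0 \<gamma> a Cs \<rho> :: real and m T :: nat and v e c :: "nat \<Rightarrow> real"
  assumes \<Psi>: "psd \<Psi>"
    and tc: "0 \<le> tc" "\<And>(G :: real^'d^('x \<times> 'u)) M b. (\<And>v. 0 \<le> v \<bullet> (M *v v)) \<Longrightarrow> (\<And>v. v \<bullet> (M *v v) \<le> b * (norm v)\<^sup>2) \<Longrightarrow>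
      0 \<le> trace (kron \<Gamma> W ** G ** M ** transpose G) \<and> trace (kron \<Gamma> W ** G ** M ** transpose G) \<le> tc * b * (norm G)\<^sup>2"
    and g0: "norm (Gj \<theta>0) \<le> g0" and eps: "\<epsilon> \<le> 1 / 2"
    and \<gamma>: "0 < \<gamma>" "\<And>y. \<gamma> * (norm y)\<^sup>2 \<le> qf \<Gamma> y"
    and m: "(1 - q) ^ m * C \<le> \<epsilon>"
    and a: "0 < a" "\<And>z. emeasure nu {y. norm (z + y) < a} \<le> ennreal (1 / 2)"
    and T: "1 \<le> T" and \<rho>: "0 \<le> \<rho>"
    and bal: "balance q r C C4 tau T v e c" and costs: "(\<Sum>t<T. c t) \<le> \<rho> + real T * tau"
    and V_eq: "\<And>t. t \<le> T \<Longrightarrow> V t = ennreal (v t)" and E_eq: "\<And>t. t < T \<Longrightarrow> Ee t = ennreal (e t)"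
    and Cs: "0 \<le> Cs" "(\<Sum>t<T. e t) \<le> Cs * (\<rho> + 1)"
begin

definition n0 where "n0 = nat \<lfloor>sqrt (real T)\<rfloor>"
definition n1 where "n1 = nat \<lceil>sqrt (real T)\<rceil>"
definition win where "win j = {j * n1..(j + 1) * n0}"
definition prb where "prb j = excited_prob A B p N \<pi> \<mu> \<Gamma> j T"
definition Nm where "Nm j = Ib ((j + 1) * n0) + fisher \<mu> + \<Psi>"
definition tr where "tr j F = trace (kron \<Gamma> W ** (Gj \<theta>0 + F) ** info_mat A B L p N \<pi> \<mu> \<Psi> j T ** transpose (Gj \<theta>0 + F))"
definition dsc where "dsc t = discounted r e t"
definition cM where "cM = tc * (g0 + cD)\<^sup>2"

lemma nn: "0 \<le> v t" "0 \<le> e t" using bal by (auto simp: balance_def)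
lemma dsc_nn: "0 \<le> dsc t" unfolding dsc_def using cst_bounds nn by (intro discounted_nonneg)

lemma n_bounds: "1 \<le> sqrt (real T)" "real n0 \<le> sqrt (real T)" "sqrt (real T) < real n0 + 1"
  "sqrt (real T) \<le> real n1" "n0 \<le> n1" "1 \<le> n0" "n1 \<le> n0 + 1"
proof -
  show 1: "1 \<le> sqrt (real T)" using T by simp
  have f: "1 \<le> \<lfloor>sqrt (real T)\<rfloor>" using 1 by (simp add: le_floor_iff)
  show "real n0 \<le> sqrt (real T)" "sqrt (real T) < real n0 + 1" using f by (auto simp: n0_def)
  show "sqrt (real T) \<le> real n1" unfolding n1_def by (rule real_nat_ceiling_ge)
  show "n0 \<le> n1" unfolding n0_def n1_def by (intro nat_mono floor_le_ceiling)
  show "1 \<le> n0" using f by (simp add: n0_def nat_le_iff le_nat_iff)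
  show "n1 \<le> n0 + 1" unfolding n0_def n1_def using f by linarith
qed

lemma excited_prob_eq:
  "prb j = measure BB {z \<in> space BB. psd ((\<Sum>t\<in>win j. outer (X t z) (X t z)) - sqrt (real T) *\<^sub>R \<Gamma>)}"
  unfolding prb_def excited_prob_def excited_def win_def n0_def n1_def by (intro arg_cong[where f="measure BB"]) auto

lemma prb_bounds: "0 \<le> prb j" "prb j \<le> 1" unfolding excited_prob_eq by auto

lemma Nm_ge: "qf (fisher \<mu>) y + qf (Ib ((j + 1) * n0)) y \<le> qf (Nm j) y"
  using \<Psi> by (simp add: Nm_def qf_add psd_def matrix_vector_mult_add_rdistrib inner_add_right)

lemma Nm_coercive: "1 / \<epsilon>\<^sup>2 * (norm y)\<^sup>2 \<le> qf (Nm j) y"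
proof -
  have "1 / \<epsilon>\<^sup>2 * (norm y)\<^sup>2 \<le> qf (fisher \<mu>) y"
    using fisher_prior_ge[of y] eps_pos by (simp add: field_simps)
  then show ?thesis using Nm_ge[where j=j and y=y] info_moment(2)[where e="(j + 1) * n0" and v=y] by linarith
qed

lemma tr_eq: "tr j F = sqrt (real T) * trace (kron \<Gamma> W ** (Gj \<theta>0 + F) ** matrix_inv (Nm j) ** transpose (Gj \<theta>0 + F))"
  unfolding tr_def info_mat_def Nm_def n0_def trace_scaleR[symmetric]
  by (simp add: matrix_scalar_ac scalar_matrix_assoc matrix_mul_assoc)

lemma cD_nonneg: "0 \<le> cD"
  using Gj_lip[of \<theta>0] eps_pos by (simp add: zero_le_mult_iff)

lemma cM_nonneg: "0 \<le> cM" using tc by (simp add: cM_def)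

text \<open>The prior information alone is at least \<epsilon>^-2, so a trace term is never larger
  than a multiple of \<epsilon>^2 sqrt T. This is the price paid on exceptional events.\<close>

lemma tr_bounds:
  assumes "norm F \<le> cD * \<epsilon>"
  shows "0 \<le> tr j F" "tr j F \<le> cM * \<epsilon>\<^sup>2 * sqrt (real T)"
proof -
  have e0: "0 < 1 / \<epsilon>\<^sup>2" using eps_pos by simp
  have b: "qf (matrix_inv (Nm j)) y \<le> \<epsilon>\<^sup>2 * (norm y)\<^sup>2" for y
    using qf_matrix_inv_bounds(2)[OF e0 Nm_coercive, where y=y] by simp
  note t = tc(2)[OF qf_matrix_inv_bounds(1)[OF e0 Nm_coercive] b, of "Gj \<theta>0 + F"]
  show "0 \<le> tr j F" unfolding tr_eq using t by (intro mult_nonneg_nonneg) auto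
  have "cD * \<epsilon> \<le> cD * 1" using cD_nonneg eps by (intro mult_left_mono) auto
  then have "norm (Gj \<theta>0 + F) \<le> g0 + cD" using assms g0 norm_triangle_ineq[of "Gj \<theta>0" F] by linarith
  then have "(norm (Gj \<theta>0 + F))\<^sup>2 \<le> (g0 + cD)\<^sup>2" by (intro power_mono) auto
  then have "tc * \<epsilon>\<^sup>2 * (norm (Gj \<theta>0 + F))\<^sup>2 \<le> tc * \<epsilon>\<^sup>2 * (g0 + cD)\<^sup>2" using tc(1) by (intro mult_left_mono) auto
  with t have "trace (kron \<Gamma> W ** (Gj \<theta>0 + F) ** matrix_inv (Nm j) ** transpose (Gj \<theta>0 + F)) \<le> cM * \<epsilon>\<^sup>2"
    by (simp add: cM_def mult_ac)
  from mult_left_mono[OF this, of "sqrt (real T)"] show "tr j F \<le> cM * \<epsilon>\<^sup>2 * sqrt (real T)"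
    unfolding tr_eq by (simp add: mult_ac)
qed

lemma error_bounds:
  assumes "t < T"
  shows "integrable BB (\<lambda>z. qf W (er t z))" "(LINT z|BB. qf W (er t z)) \<le> k * e t"
  using window_cost[OF E_eq[OF assms] nn(2)] by auto

text \<open>Removed are the left endpoint, the only time a window can share with an earlier one, and
  the last m steps, whose errors are not controlled with the sharp constant.\<close>

definition inner_times where "inner_times j = {t \<in> win j. t \<noteq> j * n1 \<and> t < T - m}"
definition edge_times where "edge_times j = win j - inner_times j"

lemma times: "finite (win j)" "win j = inner_times j \<union> edge_times j" "inner_times j \<inter> edge_times j = {}"
  "inner_times j \<subseteq> {..<T}" "inner_times j \<subseteq> {..(j + 1) * n0}"
  by (auto simp: inner_times_def edge_times_def win_def)

lemma card_edge_times:
  assumes "(j + 1) * n0 \<le> T"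
  shows "card (edge_times j) \<le> m + 2"
proof -
  \<comment> \<open>A window inside the horizon may still contain T itself, so up to m + 1 final
    times and the left endpoint are lost.\<close>
  have "edge_times j \<subseteq> insert (j * n1) {T - m..T}"
    using assms by (auto simp: edge_times_def inner_times_def win_def)
  then have "card (edge_times j) \<le> card (insert (j * n1) {T - m..T})" by (intro card_mono) auto
  also have "\<dots> \<le> Suc (card {T - m..T})" by (rule card_insert_le_m1) auto
  also have "\<dots> \<le> m + 2" by simp
  finally show ?thesis .
qed

lemma second_moment_bound:
  assumes "t \<le> T"
  shows "integrable BB (\<lambda>z. (norm (X t z))\<^sup>2)"
    "(LINT z|BB. (norm (X t z))\<^sup>2) \<le> (\<tau>m / (1 - r) + C * dsc t) / m0"
proof -
  note s = second_moment_le[OF V_eq[OF assms] nn(1)]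
  show "integrable BB (\<lambda>z. (norm (X t z))\<^sup>2)" by (rule s)
  have "v t \<le> tau / (1 - r) + C * dsc t"
    unfolding dsc_def using cst_bounds tau_bounds by (intro balance_state_le[OF bal]) (use assms in auto)
  also have "tau / (1 - r) \<le> \<tau>m / (1 - r)" using tau_bounds cst_bounds by (intro divide_right_mono) auto
  finally have "v t / m0 \<le> (\<tau>m / (1 - r) + C * dsc t) / m0" using cst_bounds by (intro divide_right_mono) auto
  then show "(LINT z|BB. (norm (X t z))\<^sup>2) \<le> (\<tau>m / (1 - r) + C * dsc t) / m0" using s(2) by linarith
qed

text \<open>The two parts of Markov's bound for the energy at the edge times. \<open>al\<close>
  comes from the stationary level of the second moment and is of order 1 / sqrt T for every window;
  \<open>be\<close> comes from past errors and is controlled only after summation over the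
  windows.\<close>

definition al where "al = real (m + 2) * (\<tau>m / (1 - r)) / (m0 * (\<epsilon> * \<gamma> * sqrt (real T)))"
definition be where "be j = C / (m0 * (\<epsilon> * \<gamma> * sqrt (real T))) * (\<Sum>t\<in>edge_times j. dsc t)"

lemma \<tau>m_nonneg: "0 \<le> \<tau>m" using tau_bounds by linarith

lemma edge_prob:
  assumes j: "(j + 1) * n0 \<le> T"
  shows "measure BB {z \<in> space BB. \<epsilon> * \<gamma> * sqrt (real T) \<le> (\<Sum>t\<in>edge_times j. (norm (X t z))\<^sup>2)} \<le> al + be j"
proof -
  let ?s = "\<epsilon> * \<gamma> * sqrt (real T)"
  have s: "0 < ?s" using eps_pos \<gamma> n_bounds(1) by simp
  have tT: "t \<le> T" if "t \<in> edge_times j" for t using that j by (auto simp: edge_times_def win_def)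
  have i: "integrable BB (\<lambda>z. (norm (X t z))\<^sup>2)" if "t \<in> edge_times j" for t using second_moment_bound(1)[OF tT[OF that]] .
  have "measure BB {z \<in> space BB. ?s \<le> (\<Sum>t\<in>edge_times j. (norm (X t z))\<^sup>2)} \<le> (LINT z|BB. (\<Sum>t\<in>edge_times j. (norm (X t z))\<^sup>2)) / ?s"
    using s i by (intro integral_Markov_inequality_measure[where A="{}"]) (auto intro!: Bochner_Integration.integrable_sum sum_nonneg)
  also have "\<dots> = (\<Sum>t\<in>edge_times j. LINT z|BB. (norm (X t z))\<^sup>2) / ?s"
    using i by (subst Bochner_Integration.integral_sum) auto
  also have "\<dots> \<le> (\<Sum>t\<in>edge_times j. (\<tau>m / (1 - r) + C * dsc t) / m0) / ?s"
    using s tT by (intro divide_right_mono sum_mono second_moment_bound(2)) auto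
  also have "\<dots> = (real (card (edge_times j)) * (\<tau>m / (1 - r)) + C * (\<Sum>t\<in>edge_times j. dsc t)) / m0 / ?s"
    by (simp add: sum_divide_distrib[symmetric] sum.distrib sum_distrib_left)
  also have "\<dots> \<le> (real (m + 2) * (\<tau>m / (1 - r)) + C * (\<Sum>t\<in>edge_times j. dsc t)) / m0 / ?s"
    using s cst_bounds \<tau>m_nonneg card_edge_times[OF j]
    by (intro divide_right_mono add_right_mono mult_right_mono) (auto simp del: of_nat_add)
  also have "\<dots> = al + be j" by (simp add: al_def be_def add_divide_distrib divide_simps)
  finally show ?thesis .
qed

text \<open>If the window is excited, then either the inner times alone are excited at level (1 -
  \<epsilon>) sqrt T, or the edge times carry energy at least \<epsilon> \<gamma> sqrt T.
  \<open>window_bound\<close> applies to the first event; the probability of the second is at most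
  \<open>al + be j\<close> and is paid for with the crude bound on the trace.
  \<open>sq_split\<close> separates the two inside the squared probability.\<close>

lemma good_window:
  assumes j: "(j + 1) * n0 \<le> T"
  shows "\<exists>F. norm F \<le> cD * \<epsilon> \<and> (prb j)\<^sup>2 * tr j F \<le> (1 + \<epsilon>) / (1 - \<epsilon>) * (k * (\<Sum>t\<in>inner_times j. e t))
    + (1 + 1 / \<epsilon>) * al\<^sup>2 * (cM * \<epsilon>\<^sup>2 * sqrt (real T)) + 2 * be j * (cM * \<epsilon>\<^sup>2 * sqrt (real T))"
proof -
  let ?n = "sqrt (real T)" and ?E = "(j + 1) * n0"
  let ?M = "((1 - \<epsilon>) * ?n) *\<^sub>R \<Gamma>"
  let ?S = "{w \<in> space (Pt ?E). psd ((\<Sum>t\<in>inner_times j. outer (px t w) (px t w)) - ?M)}"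
  let ?x = "measure BB {z \<in> space BB. psd ((\<Sum>t\<in>inner_times j. outer (X t z) (X t z)) - ?M)}"
  have n: "0 < ?n" using n_bounds(1) by linarith
  have l: "0 < (1 - \<epsilon>) * ?n" using n eps by (intro mult_pos_pos) auto
  have fin: "finite (inner_times j)" using times[of j] by (metis finite_Un)
  have ex: "\<exists>F. norm F \<le> cD * \<epsilon> \<and> (measure BB {z \<in> space BB. pth ?E z \<in> ?S})\<^sup>2 * ((1 - \<epsilon>) * ?n) *
      trace (kron \<Gamma> W ** (Gj \<theta>0 + F) ** matrix_inv (Nm j) ** transpose (Gj \<theta>0 + F))
    \<le> (\<Sum>t\<in>inner_times j. LINT z|BB. qf W (er t z))"
  proof (rule window_bound[where e'="(j + 1) * n0" and m="1 / \<epsilon>\<^sup>2"])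
    show "?S \<in> sets (Pt ?E)" by (rule excitation_set[OF times(5)])
    show "integrable BB (\<lambda>z. qf W (er t z))" if "t \<in> inner_times j" for t
      using that times(4) by (intro error_bounds(1)) auto
    show "1 / \<epsilon>\<^sup>2 * (norm y)\<^sup>2 \<le> qf (Nm j) y" for y by (rule Nm_coercive)
    show "0 < 1 / \<epsilon>\<^sup>2" using eps_pos by simp
  qed (use fin times(5) l Nm_ge in \<open>auto simp del: mult_Suc\<close>)
  obtain F where F: "norm F \<le> cD * \<epsilon>" and w: "?x\<^sup>2 * ((1 - \<epsilon>) * ?n) *
      trace (kron \<Gamma> W ** (Gj \<theta>0 + F) ** matrix_inv (Nm j) ** transpose (Gj \<theta>0 + F))
    \<le> (\<Sum>t\<in>inner_times j. LINT z|BB. qf W (er t z))"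
    using ex unfolding excitation_path_event[OF times(5)] by blast
  have "(1 - \<epsilon>) * (?x\<^sup>2 * tr j F) \<le> (\<Sum>t\<in>inner_times j. LINT z|BB. qf W (er t z))"
    using w by (simp add: tr_eq mult_ac)
  also have "\<dots> \<le> (\<Sum>t\<in>inner_times j. k * e t)" using times(4) by (intro sum_mono error_bounds(2)) auto
  finally have "(1 - \<epsilon>) * (?x\<^sup>2 * tr j F) \<le> k * (\<Sum>t\<in>inner_times j. e t)" by (simp add: sum_distrib_left)
  then have x: "?x\<^sup>2 * tr j F \<le> k * (\<Sum>t\<in>inner_times j. e t) / (1 - \<epsilon>)" using eps by (simp add: field_simps)
  let ?Z = "{z \<in> space BB. \<epsilon> * \<gamma> * ?n \<le> (\<Sum>t\<in>edge_times j. (norm (X t z))\<^sup>2)}"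
  have Z: "?Z \<in> sets BB" by measurable
  have \<Gamma>s: "transpose \<Gamma> = \<Gamma>" using \<Gamma> by (simp add: pos_def_def)
  have "prb j \<le> measure BB ({z \<in> space BB. psd ((\<Sum>t\<in>inner_times j. outer (X t z) (X t z)) - ?M)} \<union> ?Z)"
    unfolding excited_prob_eq
  proof (rule BB.finite_measure_mono)
    show "{z \<in> space BB. psd ((\<Sum>t\<in>win j. outer (X t z) (X t z)) - ?n *\<^sub>R \<Gamma>)}
      \<subseteq> {z \<in> space BB. psd ((\<Sum>t\<in>inner_times j. outer (X t z) (X t z)) - ?M)} \<union> ?Z"
    proof (rule subsetI, elim CollectE conjE)
      fix z assume z: "z \<in> space BB" "psd ((\<Sum>t\<in>win j. outer (X t z) (X t z)) - ?n *\<^sub>R \<Gamma>)"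
      show "z \<in> {z \<in> space BB. psd ((\<Sum>t\<in>inner_times j. outer (X t z) (X t z)) - ?M)} \<union> ?Z"
      proof (cases "z \<in> ?Z")
        case False
        then have "(\<Sum>t\<in>edge_times j. (norm (X t z))\<^sup>2) \<le> \<epsilon> * \<gamma> * ?n" using z by auto
        from psd_excitation_subset[OF \<Gamma>s \<gamma>(2) _ _ times(1-3) z(2) this] show ?thesis using z(1) n eps_pos by simp
      qed simp
    qed
  qed (intro sets.Un excitation_event Z)
  also have "\<dots> \<le> ?x + measure BB ?Z" by (intro measure_Un_le excitation_event Z)
  also have "\<dots> \<le> ?x + al + be j" using edge_prob[OF j] by simp
  finally have P: "prb j \<le> ?x + al + be j" .
  have al: "0 \<le> al" unfolding al_def using cst_bounds \<tau>m_nonneg eps_pos \<gamma> n by (intro divide_nonneg_nonneg mult_nonneg_nonneg) auto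
  have be: "0 \<le> be j" unfolding be_def using cst_bounds dsc_nn eps_pos \<gamma> n by (intro mult_nonneg_nonneg divide_nonneg_nonneg sum_nonneg) auto
  have t: "0 \<le> tr j F" "tr j F \<le> cM * \<epsilon>\<^sup>2 * ?n" using tr_bounds[OF F] by auto
  have "(prb j)\<^sup>2 * tr j F \<le> ((1 + \<epsilon>) * ?x\<^sup>2 + (1 + 1 / \<epsilon>) * al\<^sup>2 + 2 * be j) * tr j F"
    using P al be eps_pos t by (intro mult_right_mono sq_split prb_bounds) auto
  also have "\<dots> = (1 + \<epsilon>) * (?x\<^sup>2 * tr j F) + (1 + 1 / \<epsilon>) * al\<^sup>2 * tr j F + 2 * be j * tr j F"
    by (simp add: algebra_simps)
  also have "\<dots> \<le> (1 + \<epsilon>) * (k * (\<Sum>t\<in>inner_times j. e t) / (1 - \<epsilon>)) + (1 + 1 / \<epsilon>) * al\<^sup>2 * (cM * \<epsilon>\<^sup>2 * ?n) + 2 * be j * (cM * \<epsilon>\<^sup>2 * ?n)"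
    using x t be eps_pos by (intro add_mono mult_left_mono) auto
  finally show ?thesis using F by (intro exI[of _ F]) simp
qed

definition kmax where "kmax = nat \<lfloor>sqrt (real (T - 1))\<rfloor>"

text \<open>The last window can reach past the horizon; it is then a single time.\<close>

lemma last_window:
  assumes j: "j \<in> {1..kmax}" "\<not> (j + 1) * n0 \<le> T"
  shows "j = n0" "win j = {n0 * (n0 + 1)}" "2 \<le> T"
proof -
  have km: "real kmax \<le> sqrt (real (T - 1))" unfolding kmax_def by (rule of_nat_floor) simp
  have k2: "kmax * kmax \<le> T - 1"
  proof -
    have "real kmax * real kmax \<le> sqrt (real (T - 1)) * sqrt (real (T - 1))" using km by (intro mult_mono) auto
    then have "real (kmax * kmax) \<le> real (T - 1)" by simp
    then show ?thesis by (simp only: of_nat_le_iff)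
  qed
  have kn: "kmax \<le> n0" unfolding kmax_def n0_def by (intro nat_mono floor_mono) simp
  have n2: "n0 * n0 \<le> T"
  proof -
    have "real n0 * real n0 \<le> sqrt (real T) * sqrt (real T)" using n_bounds(2) by (intro mult_mono) auto
    then have "real (n0 * n0) \<le> real T" by simp
    then show ?thesis by (simp only: of_nat_le_iff)
  qed
  show jn: "j = n0"
  proof (rule ccontr)
    assume "j \<noteq> n0"
    then have "j + 1 \<le> n0" using j(1) kn by auto
    then have "(j + 1) * n0 \<le> n0 * n0" by (intro mult_right_mono) auto
    then show False using j(2) n2 by linarith
  qed
  then have "kmax = n0" using j(1) kn by auto
  then have lt: "n0 * n0 \<le> T - 1" using k2 by simp
  have "n0 * 1 \<le> n0 * n0" using n_bounds(6) by (intro mult_left_mono) auto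
  then show T2: "2 \<le> T" using lt n_bounds(6) by linarith
  have "n1 \<noteq> n0"
  proof
    assume "n1 = n0"
    then have "sqrt (real T) * sqrt (real T) \<le> real n0 * real n0" using n_bounds(4) by (intro mult_mono) auto
    then have "real T \<le> real (n0 * n0)" by simp
    then have "T \<le> n0 * n0" by (simp only: of_nat_le_iff)
    then show False using lt T2 by linarith
  qed
  then have "n1 = n0 + 1" using n_bounds(5,7) by linarith
  then show "win j = {n0 * (n0 + 1)}" unfolding win_def jn by (simp add: mult.commute)
qed

text \<open>The window beyond the horizon is a single time. In dimension at least two it is never
  excited. In dimension one the whole horizon replaces it: its energy is of order T with probability
  at least 1/4, and \<open>window_bound\<close> then shows that sqrt T times the trace is bounded by
  a multiple of \<rho> + 1.\<close>

lemma bad_window: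
  assumes j: "j \<in> {1..kmax}" "\<not> (j + 1) * n0 \<le> T"
  shows "\<exists>F. norm F \<le> cD * \<epsilon> \<and> (prb j)\<^sup>2 * tr j F \<le> 128 * (norm \<Gamma> + 1) * k * Cs / a\<^sup>2 * \<epsilon> * (\<rho> + 1) + cM"
proof (cases "CARD('x) = 1")
  case False
  have "\<not> psd (outer x x - sqrt (real T) *\<^sub>R \<Gamma>)" for x
    using n_bounds(1) by (intro not_psd_excitation_single[OF False \<Gamma>]) auto
  then have "prb j = 0" unfolding excited_prob_eq last_window(2)[OF j] by simp
  moreover have "0 \<le> 128 * (norm \<Gamma> + 1) * k * Cs / a\<^sup>2 * \<epsilon> * (\<rho> + 1) + cM"
    using cst_bounds Cs \<rho> cM_nonneg eps_pos by simp
  ultimately show ?thesis using cD_nonneg eps_pos by (intro exI[of _ 0]) simp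
next
  case True
  let ?n = "sqrt (real T)" and ?I = "{1..T - 1}" and ?G = "norm \<Gamma> + 1"
  \<comment> \<open>An excitation level of order T, calibrated so that the energy from
    \<open>prob_energy_ge\<close> reaches it; adding 1 keeps the divisor visibly positive.\<close>
  let ?l = "a\<^sup>2 * (real (T - 1) / 4) / ?G"
  let ?S = "{w \<in> space (Pt (T - 1)). psd ((\<Sum>t\<in>?I. outer (px t w) (px t w)) - ?l *\<^sub>R \<Gamma>)}"
  let ?x = "measure BB {z \<in> space BB. psd ((\<Sum>t\<in>?I. outer (X t z) (X t z)) - ?l *\<^sub>R \<Gamma>)}"
  have T2: "2 \<le> T" by (rule last_window(3)[OF j])
  have G: "0 < ?G" using norm_ge_zero[of \<Gamma>] by linarith
  have T1: "0 < real (T - 1)" "real T / 2 \<le> real (T - 1)" using T2 by auto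
  have l: "0 < ?l" using a(1) T1 G by simp
  have I: "finite ?I" "?I \<subseteq> {..T - 1}" by auto
  have \<Gamma>s: "transpose \<Gamma> = \<Gamma>" using \<Gamma> by (simp add: pos_def_def)
  \<comment> \<open>Because the window passes the horizon, the information index attached to it
    covers all inputs used by paths up to T - 1.\<close>
  have 1: "T - 1 \<le> Suc ((j + 1) * n0)" using j(2) by linarith
  have ex: "\<exists>F. norm F \<le> cD * \<epsilon> \<and> (measure BB {z \<in> space BB. pth (T - 1) z \<in> ?S})\<^sup>2 * ?l *
      trace (kron \<Gamma> W ** (Gj \<theta>0 + F) ** matrix_inv (Nm j) ** transpose (Gj \<theta>0 + F))
    \<le> (\<Sum>t\<in>?I. LINT z|BB. qf W (er t z))"
  proof (rule window_bound[OF I l excitation_set[OF I(2)] _ 1 _ Nm_coercive Nm_ge])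
    show "integrable BB (\<lambda>z. qf W (er t z))" if "t \<in> ?I" for t
      using that T2 by (intro error_bounds(1)) auto
    show "0 < 1 / \<epsilon>\<^sup>2" using eps_pos by simp
  qed simp
  obtain F where F: "norm F \<le> cD * \<epsilon>" and w: "?x\<^sup>2 * ?l *
      trace (kron \<Gamma> W ** (Gj \<theta>0 + F) ** matrix_inv (Nm j) ** transpose (Gj \<theta>0 + F))
    \<le> (\<Sum>t\<in>?I. LINT z|BB. qf W (er t z))" (is "_ * ?t \<le> _")
    using ex unfolding excitation_path_event[OF I(2)] by blast
  have trt: "tr j F = ?n * ?t" by (rule tr_eq)
  have t0: "0 \<le> ?t" using tr_bounds(1)[OF F, of j] n_bounds(1) unfolding trt by (simp add: zero_le_mult_iff)
  have x: "1 / 4 \<le> ?x"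
  proof -
    have "1 / 4 \<le> measure BB {z \<in> space BB. a\<^sup>2 * (real (T - 1) / 4) \<le> (\<Sum>t\<in>?I. (norm (X t z))\<^sup>2)}"
      by (rule prob_energy_ge[OF a]) (use T2 in simp)
    also have "\<dots> \<le> ?x"
    proof (rule BB.finite_measure_mono[OF _ excitation_event], rule subsetI, elim CollectE conjE)
      fix z assume z: "z \<in> space BB" "a\<^sup>2 * (real (T - 1) / 4) \<le> (\<Sum>t\<in>?I. (norm (X t z))\<^sup>2)"
      have "?l * norm \<Gamma> \<le> ?l * ?G" using l by (intro mult_left_mono) auto
      also have "\<dots> = a\<^sup>2 * (real (T - 1) / 4)" by (rule nonzero_eq_divide_eq[THEN iffD1, OF less_imp_neq[OF G, symmetric] refl])
      also note z(2)
      finally have "psd ((\<Sum>t\<in>?I. outer (X t z) (X t z)) - ?l *\<^sub>R \<Gamma>)"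
        by (rule psd_excitation_one_dim[OF True \<Gamma>s less_imp_le[OF l]])
      then show "z \<in> {z \<in> space BB. psd ((\<Sum>t\<in>?I. outer (X t z) (X t z)) - ?l *\<^sub>R \<Gamma>)}"
        using z(1) by blast
    qed
    finally show ?thesis .
  qed
  have "(1 / 4)\<^sup>2 * (?l * ?t) \<le> ?x\<^sup>2 * (?l * ?t)"
    using x l t0 by (intro mult_right_mono power_mono) auto
  also have "\<dots> \<le> (\<Sum>t\<in>?I. LINT z|BB. qf W (er t z))" using w by (simp add: mult.assoc)
  also have "\<dots> \<le> (\<Sum>t\<in>?I. k * e t)" using T2 by (intro sum_mono error_bounds(2)) auto
  also have "\<dots> \<le> (\<Sum>t<T. k * e t)" using cst_bounds nn T2 by (intro sum_mono2) auto
  also have "\<dots> = k * (\<Sum>t<T. e t)" by (simp add: sum_distrib_left)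
  also have "\<dots> \<le> k * (Cs * (\<rho> + 1))" using cst_bounds Cs by (intro mult_left_mono) auto
  finally have le: "(1 / 4)\<^sup>2 * (?l * ?t) \<le> k * (Cs * (\<rho> + 1))" .
  have "y \<le> 16 * x" if "(1 / 4)\<^sup>2 * y \<le> x" for x y :: real using that by (simp add: power2_eq_square)
  from this[OF le] have lt: "?l * ?t \<le> 16 * k * Cs * (\<rho> + 1)" by (simp only: mult.assoc)
  have "a\<^sup>2 / (8 * ?G) * ?n * tr j F = a\<^sup>2 * (real T / 2 / 4) / ?G * ?t"
    unfolding trt using G by (simp add: field_simps)
  also have "\<dots> \<le> ?l * ?t" using T1 G t0 by (intro mult_right_mono divide_right_mono mult_left_mono) auto
  also note lt
  finally have key: "?n * tr j F \<le> 128 * ?G * k * Cs / a\<^sup>2 * (\<rho> + 1)" using a(1) G by (simp add: field_simps)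
  have K: "0 \<le> 128 * ?G * k * Cs / a\<^sup>2 * (\<rho> + 1)" using cst_bounds Cs \<rho> by simp
  \<comment> \<open>If sqrt T is at least 1 / \<epsilon>, the gain of sqrt T in \<open>key\<close>
    is worth a factor \<epsilon>; otherwise the crude bound \<epsilon>^2 sqrt T is at most
    1.\<close>
  have "tr j F \<le> 128 * ?G * k * Cs / a\<^sup>2 * \<epsilon> * (\<rho> + 1) + cM"
  proof (cases "1 \<le> \<epsilon> * ?n")
    case True
    have "tr j F \<le> \<epsilon> * ?n * tr j F" using True mult_right_mono[OF True tr_bounds(1)[OF F, of j]] by simp
    also have "\<dots> \<le> \<epsilon> * (128 * ?G * k * Cs / a\<^sup>2 * (\<rho> + 1))" unfolding mult.assoc[of \<epsilon>]
      using eps_pos key by (intro mult_left_mono) auto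
    finally show ?thesis using cM_nonneg by (simp add: mult_ac)
  next
    case False
    have "tr j F \<le> cM * \<epsilon> * (\<epsilon> * ?n)" using tr_bounds(2)[OF F, of j] by (simp add: power2_eq_square mult_ac)
    also have "\<dots> \<le> cM * 1 * 1" using False cM_nonneg eps eps_pos by (intro mult_mono) auto
    finally show ?thesis using mult_nonneg_nonneg[OF K, of \<epsilon>] eps_pos by (simp add: mult_ac)
  qed
  moreover have "(prb j)\<^sup>2 * tr j F \<le> 1 * tr j F"
    using prb_bounds[of j] tr_bounds(1)[OF F, of j] by (intro mult_right_mono) (auto intro: power_le_one)
  ultimately show ?thesis using F by (intro exI[of _ F]) linarith
qed

text \<open>\<open>c1\<close> and \<open>c2\<close> may depend on \<epsilon> and m, since they enter
  the bounded remainder. \<open>K1\<close> multiplies \<epsilon> times the regret and therefore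
  contains neither m nor negative powers of \<epsilon>.\<close>

definition c1 where "c1 = real m * \<tau>m + \<tau>m / (1 - r)"
definition K1 where "K1 = 4 * C * cM * Cs / (m0 * \<gamma> * (1 - r)) + 128 * (norm \<Gamma> + 1) * k * Cs / a\<^sup>2"
definition c2 where "c2 = (1 + 1 / \<epsilon>) * (real (m + 2) * (\<tau>m / (1 - r)) / (m0 * \<gamma>))\<^sup>2 * cM + cM"

lemma prefix_le: "(\<Sum>t<T - m. e t) \<le> (\<rho> + c1) / (1 - \<epsilon>)"
proof (cases "m \<le> T")
  case True
  have "(1 - \<epsilon>) * (\<Sum>t<T - m. e t) \<le> (1 - (1 - q) ^ m * C) * (\<Sum>t<T - m. e t)"
    using m nn by (intro mult_right_mono sum_nonneg) auto
  also have "\<dots> \<le> \<rho> + real m * tau + tau / (1 - r)"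
    using cst_bounds tau_bounds by (intro balance_prefix[OF bal _ _ _ _ _ _ costs True]) auto
  also have "\<dots> \<le> \<rho> + c1" unfolding c1_def
    using tau_bounds cst_bounds mult_left_mono[of tau \<tau>m "real m"] divide_right_mono[of tau \<tau>m "1 - r"] by auto
  finally show ?thesis using eps by (simp add: field_simps)
next
  case False
  have "0 \<le> c1" using \<tau>m_nonneg cst_bounds by (simp add: c1_def)
  then show ?thesis using False \<rho> eps by simp
qed

text \<open>The inner times of different windows are disjoint and lie before T - m, so
  \<open>prefix_le\<close> bounds their errors together with the sharp factor. About sqrt T windows,
  each losing a multiple of the square of \<open>al\<close> times sqrt T, lose a bounded amount. The
  sum of \<open>be\<close> is bounded through the discounted errors, whose sum is at most a multiple
  of all errors, and it keeps a factor \<epsilon>.\<close>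

theorem windows_sum:
  "\<exists>F. (\<forall>j. norm (F j) \<le> cD * \<epsilon>) \<and>
    (\<Sum>j = 1..kmax. (prb j)\<^sup>2 * tr j (F j)) \<le> (1 + \<epsilon>) / (1 - \<epsilon>)\<^sup>2 * k * (\<rho> + c1) + K1 * \<epsilon> * (\<rho> + 1) + c2"
proof -
  let ?n = "sqrt (real T)" and ?J = "{1..kmax}"
  let ?H = "{j \<in> ?J. (j + 1) * n0 \<le> T}"
  let ?b = "128 * (norm \<Gamma> + 1) * k * Cs / a\<^sup>2 * \<epsilon> * (\<rho> + 1) + cM"
  define g where "g j = (1 + \<epsilon>) / (1 - \<epsilon>) * (k * (\<Sum>t\<in>inner_times j. e t))
    + (1 + 1 / \<epsilon>) * al\<^sup>2 * (cM * \<epsilon>\<^sup>2 * ?n) + 2 * be j * (cM * \<epsilon>\<^sup>2 * ?n)" for j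
  have n: "0 < ?n" using n_bounds(1) by linarith
  have "\<forall>j. \<exists>F. norm F \<le> cD * \<epsilon> \<and> (j \<in> ?J \<longrightarrow> (prb j)\<^sup>2 * tr j F \<le> (if (j + 1) * n0 \<le> T then g j else ?b))"
  proof
    fix j
    show "\<exists>F. norm F \<le> cD * \<epsilon> \<and> (j \<in> ?J \<longrightarrow> (prb j)\<^sup>2 * tr j F \<le> (if (j + 1) * n0 \<le> T then g j else ?b))"
    proof (cases "(j + 1) * n0 \<le> T")
      case True
      then show ?thesis using good_window[of j] unfolding g_def by auto
    next
      case False
      show ?thesis
      proof (cases "j \<in> ?J")
        case True
        then show ?thesis using bad_window[OF True False] False by auto
      next
        case False
        then show ?thesis using cD_nonneg eps_pos by (intro exI[of _ 0]) auto
      qed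
    qed
  qed
  then obtain F where F: "\<And>j. norm (F j) \<le> cD * \<epsilon>"
    "\<And>j. j \<in> ?J \<Longrightarrow> (prb j)\<^sup>2 * tr j (F j) \<le> (if (j + 1) * n0 \<le> T then g j else ?b)"
    by (auto simp: choice_iff)
  have b0: "0 \<le> ?b" using cst_bounds Cs \<rho> cM_nonneg eps_pos by simp
  have kn: "real kmax \<le> ?n"
  proof -
    have "real kmax \<le> sqrt (real (T - 1))" unfolding kmax_def by (rule of_nat_floor) simp
    also have "\<dots> \<le> ?n" by simp
    finally show ?thesis .
  qed
  have winlt: "t < j' * n1 \<or> t = j' * n1" if "t \<in> win j" "j < j'" for t j j'
  proof -
    have "t \<le> (j + 1) * n0" using that by (simp add: win_def)
    also have "\<dots> \<le> j' * n1" using that n_bounds(5) by (intro mult_mono) auto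
    finally show ?thesis by linarith
  qed
  have disj: "(win i - {i * n1}) \<inter> (win j - {j * n1}) = {}" if ij: "i \<noteq> j" for i j
  proof -
    have *: "(win i - {i * n1}) \<inter> (win j - {j * n1}) = {}" if "i < j" for i j
    proof (rule ccontr)
      assume "\<not> ?thesis"
      then obtain t where t: "t \<in> win i" "t \<in> win j" "t \<noteq> j * n1" by auto
      have "j * n1 \<le> t" using t(2) by (simp add: win_def)
      then show False using winlt[OF t(1) that] t(3) by linarith
    qed
    show ?thesis using *[of i j] *[of j i] ij by (cases "i < j") auto
  qed
  have s1: "(\<Sum>j\<in>?H. \<Sum>t\<in>inner_times j. e t) \<le> (\<rho> + c1) / (1 - \<epsilon>)"
  proof -
    have "(\<Sum>j\<in>?H. \<Sum>t\<in>inner_times j. e t) \<le> (\<Sum>t\<in>{..<T - m}. e t)"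
    proof (rule sum_disjoint_family_le)
      fix i j :: nat assume "i \<noteq> j"
      from disj[OF this] show "inner_times i \<inter> inner_times j = {}" unfolding inner_times_def by blast
    qed (auto simp: inner_times_def nn)
    then show ?thesis using prefix_le by linarith
  qed
  \<comment> \<open>Windows may overlap in a left endpoint, so the left endpoints and the rest of
    the windows are summed as two disjoint families; this causes the factor 2.\<close>
  have s2: "(\<Sum>j\<in>?H. \<Sum>t\<in>edge_times j. dsc t) \<le> 2 * (Cs * (\<rho> + 1) / (1 - r))"
  proof -
    let ?U = "{..T}"
    have n1: "n1 \<noteq> 0" using n_bounds(5,6) by linarith
    have "(\<Sum>j\<in>?H. \<Sum>t\<in>edge_times j. dsc t) \<le> (\<Sum>j\<in>?H. (\<Sum>t\<in>win j \<inter> {j * n1}. dsc t) + (\<Sum>t\<in>win j - {j * n1}. dsc t))"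
    proof (rule sum_mono)
      fix j
      have "(\<Sum>t\<in>edge_times j. dsc t) \<le> (\<Sum>t\<in>win j. dsc t)"
        using times(1)[of j] dsc_nn by (intro sum_mono2) (auto simp: edge_times_def)
      also have "\<dots> = (\<Sum>t\<in>win j \<inter> {j * n1}. dsc t) + (\<Sum>t\<in>win j - {j * n1}. dsc t)"
        by (rule sum.Int_Diff[OF times(1)])
      finally show "(\<Sum>t\<in>edge_times j. dsc t) \<le> (\<Sum>t\<in>win j \<inter> {j * n1}. dsc t) + (\<Sum>t\<in>win j - {j * n1}. dsc t)" .
    qed
    also have "\<dots> = (\<Sum>j\<in>?H. \<Sum>t\<in>win j \<inter> {j * n1}. dsc t) + (\<Sum>j\<in>?H. \<Sum>t\<in>win j - {j * n1}. dsc t)"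
      by (rule sum.distrib)
    also have "(\<Sum>j\<in>?H. \<Sum>t\<in>win j \<inter> {j * n1}. dsc t) \<le> (\<Sum>t\<in>?U. dsc t)"
      by (rule sum_disjoint_family_le) (use n1 dsc_nn in \<open>auto simp: win_def\<close>)
    also have "(\<Sum>j\<in>?H. \<Sum>t\<in>win j - {j * n1}. dsc t) \<le> (\<Sum>t\<in>?U. dsc t)"
    proof (rule sum_disjoint_family_le)
      fix i j :: nat assume "i \<noteq> j"
      from disj[OF this] show "(win i - {i * n1}) \<inter> (win j - {j * n1}) = {}" .
    qed (auto simp: win_def dsc_nn)
    finally have le: "(\<Sum>j\<in>?H. \<Sum>t\<in>edge_times j. dsc t) \<le> (\<Sum>t\<in>?U. dsc t) + (\<Sum>t\<in>?U. dsc t)" by simp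
    have "(\<Sum>t\<in>?U. dsc t) \<le> (\<Sum>s<T. e s) / (1 - r)"
      unfolding dsc_def using cst_bounds nn by (intro sum_discounted_le) auto
    also have "\<dots> \<le> Cs * (\<rho> + 1) / (1 - r)" using Cs cst_bounds by (intro divide_right_mono) auto
    finally show ?thesis using le by linarith
  qed
  have "(\<Sum>j\<in>?J. (prb j)\<^sup>2 * tr j (F j)) \<le> (\<Sum>j\<in>?J. (if (j + 1) * n0 \<le> T then g j else ?b))"
    by (intro sum_mono F(2))
  also have "\<dots> = (\<Sum>j\<in>?H. g j) + (\<Sum>j\<in>{j \<in> ?J. \<not> (j + 1) * n0 \<le> T}. ?b)"
    by (subst sum.If_cases) (auto simp: Int_def)
  \<comment> \<open>By \<open>last_window\<close> only the index n0 can pass the horizon.\<close>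
  also have "(\<Sum>j\<in>{j \<in> ?J. \<not> (j + 1) * n0 \<le> T}. ?b) \<le> (\<Sum>j\<in>{n0}. ?b)"
    using last_window(1) b0 by (intro sum_mono2) auto
  also have "(\<Sum>j\<in>?H. g j) = (1 + \<epsilon>) / (1 - \<epsilon>) * (k * (\<Sum>j\<in>?H. \<Sum>t\<in>inner_times j. e t))
      + real (card ?H) * ((1 + 1 / \<epsilon>) * al\<^sup>2 * (cM * \<epsilon>\<^sup>2 * ?n)) + (\<Sum>j\<in>?H. 2 * be j * (cM * \<epsilon>\<^sup>2 * ?n))"
    unfolding g_def sum.distrib by (simp add: sum_distrib_left)
  also have "(1 + \<epsilon>) / (1 - \<epsilon>) * (k * (\<Sum>j\<in>?H. \<Sum>t\<in>inner_times j. e t)) \<le> (1 + \<epsilon>) / (1 - \<epsilon>) * (k * ((\<rho> + c1) / (1 - \<epsilon>)))"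
    using s1 cst_bounds eps eps_pos by (intro mult_left_mono) auto
  also have "\<dots> = (1 + \<epsilon>) / (1 - \<epsilon>)\<^sup>2 * k * (\<rho> + c1)" by (simp add: power2_eq_square)
  also have "real (card ?H) * ((1 + 1 / \<epsilon>) * al\<^sup>2 * (cM * \<epsilon>\<^sup>2 * ?n)) \<le> ?n * ((1 + 1 / \<epsilon>) * al\<^sup>2 * (cM * \<epsilon>\<^sup>2 * ?n))"
  proof (rule mult_right_mono)
    have "card ?H \<le> card ?J" by (intro card_mono) auto
    then show "real (card ?H) \<le> ?n" using kn by simp
    show "0 \<le> (1 + 1 / \<epsilon>) * al\<^sup>2 * (cM * \<epsilon>\<^sup>2 * ?n)" using eps_pos cM_nonneg n by simp
  qed
  also have "\<dots> = (1 + 1 / \<epsilon>) * (real (m + 2) * (\<tau>m / (1 - r)) / (m0 * \<gamma>))\<^sup>2 * cM"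
  proof -
    \<comment> \<open>The powers of \<epsilon> and sqrt T hidden in \<open>al\<close> cancel exactly
      against the crude trace bound and the number of windows.\<close>
    have alg: "y * (w * (u / (x * y))\<^sup>2 * (d * x\<^sup>2 * y)) = w * u\<^sup>2 * d" if "0 < x" "0 < y" for y w u x d :: real
      using that by (simp add: field_simps power2_eq_square)
    have "al = real (m + 2) * (\<tau>m / (1 - r)) / (m0 * \<gamma>) / (\<epsilon> * ?n)"
      unfolding al_def by (simp add: mult_ac)
    then show ?thesis using alg[OF eps_pos n] by (simp only:)
  qed
  also have "(\<Sum>j\<in>?H. 2 * be j * (cM * \<epsilon>\<^sup>2 * ?n)) = 2 * C * cM / (m0 * \<gamma>) * \<epsilon> * (\<Sum>j\<in>?H. \<Sum>t\<in>edge_times j. dsc t)"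
    unfolding be_def sum_distrib_left[of _ _ ?H] using eps_pos n \<gamma>(1) cst_bounds
    by (intro sum.cong refl) (simp add: field_simps power2_eq_square)
  also have "\<dots> \<le> 2 * C * cM / (m0 * \<gamma>) * \<epsilon> * (2 * (Cs * (\<rho> + 1) / (1 - r)))"
    using s2 cM_nonneg cst_bounds \<gamma>(1) eps_pos by (intro mult_left_mono) auto
  finally have "(\<Sum>j\<in>?J. (prb j)\<^sup>2 * tr j (F j)) \<le> (1 + \<epsilon>) / (1 - \<epsilon>)\<^sup>2 * k * (\<rho> + c1)
      + (1 + 1 / \<epsilon>) * (real (m + 2) * (\<tau>m / (1 - r)) / (m0 * \<gamma>))\<^sup>2 * cM
      + 2 * C * cM / (m0 * \<gamma>) * \<epsilon> * (2 * (Cs * (\<rho> + 1) / (1 - r))) + ?b" by simp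
  also have "\<dots> = (1 + \<epsilon>) / (1 - \<epsilon>)\<^sup>2 * k * (\<rho> + c1) + K1 * \<epsilon> * (\<rho> + 1) + c2"
    by (simp add: K1_def c2_def algebra_simps)
  finally show ?thesis using F(1) by blast
qed

end

subsection \<open>Uniform estimates near the true parameter\<close>

lemma inner_stack_cols: "stack_cols M \<bullet> stack_cols N = M \<bullet> N"
proof -
  have "stack_cols M \<bullet> stack_cols N = (\<Sum>j\<in>UNIV. \<Sum>i\<in>UNIV. M $ i $ j * N $ i $ j)"
    by (simp add: stack_cols_def inner_vec_def sum.cartesian_product case_prod_unfold
        UNIV_Times_UNIV[symmetric] del: UNIV_Times_UNIV)
  also have "\<dots> = M \<bullet> N" by (subst sum.swap) (simp add: inner_vec_def)
  finally show ?thesis .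
qed

lemma linear_stack_cols: "linear stack_cols"
  by (intro linearI) (simp_all add: stack_cols_def vec_eq_iff)

lemma bounded_linear_stack_cols: "bounded_linear stack_cols"
  using linear_stack_cols linear_conv_bounded_linear by blast

lemma norm_stack_cols: "norm (stack_cols M) = norm M"
  by (simp add: norm_eq_sqrt_inner inner_stack_cols)

lemma stack_cols_eq_iff: "stack_cols M = stack_cols N \<longleftrightarrow> M = N"
  using norm_stack_cols[of "M - N"] linear_diff[OF linear_stack_cols, of M N] by auto

lemma qf_sum_young:
  fixes P :: "real^'n^'n"
  assumes P: "transpose P = P" "\<And>x. 0 \<le> qf P x" and \<eta>: "0 < \<eta>"
  shows "qf P (x + y) \<le> (1 + \<eta>) * qf P x + (1 + 1 / \<eta>) * qf P y"
proof -
  have s: "y \<bullet> (P *v x) = x \<bullet> (P *v y)" using inner_symmetric[OF P(1), of y x] by (simp add: inner_commute)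
  have "0 \<le> qf P (\<eta> *\<^sub>R x - y)" by (rule P(2))
  also have "\<dots> = \<eta> * (\<eta> * qf P x) + qf P y - 2 * \<eta> * (x \<bullet> (P *v y))"
    unfolding qf_diff by (simp add: matrix_vector_mult_scaleR s)
  finally have "2 * (x \<bullet> (P *v y)) \<le> \<eta> * qf P x + qf P y / \<eta>" using \<eta> by (simp add: field_simps)
  then show ?thesis unfolding qf_add s by (simp add: algebra_simps)
qed

lemma continuous_on_of_norm_bound:
  fixes f :: "'a::real_normed_vector \<Rightarrow> 'b::real_normed_vector"
  assumes "\<And>s t. s \<in> S \<Longrightarrow> t \<in> S \<Longrightarrow> norm (f t - f s) \<le> c * norm (t - s)" "0 \<le> c"
  shows "continuous_on S f"
proof -
  have "c-lipschitz_on S f" by (intro lipschitz_onI) (simp_all add: dist_norm assms)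
  then show ?thesis by (rule lipschitz_on_continuous_on)
qed

text \<open>Converts the regularity of the Riccati solution into the uniform quadratic inequalities
  required by the energy balance, and the derivative of the gain into a Jacobian matrix acting on
  stacked columns.\<close>

lemma quadratic_regularity:
  fixes A Q :: "real^'x^'x" and R :: "real^'u^'u" and B :: "real^'d \<Rightarrow> real^'u^'x"
  assumes Q: "pos_def Q" and R: "pos_def R" and stab: "stabilizable A (B \<theta>)"
    and bl: "bounded_linear bl" "\<And>s t. B s - B t = bl (s - t)"
  defines "P \<equiv> \<lambda>t. riccati A (B t) Q R"
  defines "W \<equiv> \<lambda>t. input_weight (B t) R (P t)" and "K \<equiv> \<lambda>t. opt_gain A (B t) Q R"
  obtains e0 q r C C4 m0 c cD Gj where
    "0 < e0" "0 < q" "q \<le> 1" "0 \<le> r" "r < 1" "0 \<le> C" "0 \<le> C4" "0 < m0" "0 \<le> c" "0 \<le> cD"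
    "pos_def (W \<theta>)"
    "\<And>t. t \<in> ball \<theta> e0 \<Longrightarrow> norm (P t) \<le> c"
    "\<And>t x. t \<in> ball \<theta> e0 \<Longrightarrow> 0 \<le> qf (P t) x"
    "\<And>t x u. t \<in> ball \<theta> e0 \<Longrightarrow> qf (P t) (A *v x + B t *v u) + qf R u + qf Q x = qf (P t) x + qf (W t) (u - K t *v x)"
    "\<And>t x. t \<in> ball \<theta> e0 \<Longrightarrow> q * qf (P t) x \<le> qf Q x"
    "\<And>t x u. t \<in> ball \<theta> e0 \<Longrightarrow> qf (P t) (A *v x + B t *v u) \<le> r * qf (P t) x + C * qf (W t) (u - K t *v x)"
    "\<And>t x u. t \<in> ball \<theta> e0 \<Longrightarrow> qf (P t) (A *v x + B t *v u) \<le> C4 * (qf Q x + qf R u)"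
    "\<And>t x. t \<in> ball \<theta> e0 \<Longrightarrow> m0 * (norm x)\<^sup>2 \<le> qf (P t) x"
    "\<And>t u. t \<in> ball \<theta> e0 \<Longrightarrow> qf (W \<theta>) u \<le> (1 + c * norm (t - \<theta>)) * qf (W t) u"
    "continuous_on (ball \<theta> e0) P" "continuous_on (ball \<theta> e0) K" "continuous_on (ball \<theta> e0) Gj"
    "\<And>t. t \<in> ball \<theta> e0 \<Longrightarrow> norm (Gj t - Gj \<theta>) \<le> cD * norm (t - \<theta>)"
    "\<And>t. t \<in> ball \<theta> e0 \<Longrightarrow> ((\<lambda>t. stack_cols (K t)) has_derivative (\<lambda>h. Gj t *v h)) (at t)"
proof -
  obtain e0 c DK where reg: "0 < e0" "0 \<le> c"
    "\<And>t. t \<in> ball \<theta> e0 \<Longrightarrow> stabilizing_solution A (B t) Q R (P t)"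
    "\<And>t x. t \<in> ball \<theta> e0 \<Longrightarrow> qf Q x \<le> qf (P t) x"
    "\<And>t x. t \<in> ball \<theta> e0 \<Longrightarrow> qf (P t) x \<le> c * (norm x)\<^sup>2"
    "\<And>t. t \<in> ball \<theta> e0 \<Longrightarrow> norm (B t) \<le> c"
    "\<And>t. t \<in> ball \<theta> e0 \<Longrightarrow> norm (K t) \<le> c"
    "\<And>s t. s \<in> ball \<theta> e0 \<Longrightarrow> t \<in> ball \<theta> e0 \<Longrightarrow> norm (P t - P s) \<le> c * norm (t - s)"
    "\<And>s t. s \<in> ball \<theta> e0 \<Longrightarrow> t \<in> ball \<theta> e0 \<Longrightarrow> norm (W t - W s) \<le> c * norm (t - s)"
    "\<And>t. t \<in> ball \<theta> e0 \<Longrightarrow> (K has_derivative DK t) (at t)"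
    "\<And>s t h. s \<in> ball \<theta> e0 \<Longrightarrow> t \<in> ball \<theta> e0 \<Longrightarrow> norm (DK s h - DK t h) \<le> c * norm (s - t) * norm h"
    unfolding P_def W_def K_def by (rule riccati_regularity[OF Q R stab bl]) blast
  obtain mQ where mQ: "0 < mQ" "\<And>x. mQ * (norm x)\<^sup>2 \<le> qf Q x" using coercive_of_pos_def[OF Q] by blast
  obtain mR where mR: "0 < mR" "\<And>u. mR * (norm u)\<^sup>2 \<le> qf R u" using coercive_of_pos_def[OF R] by blast
  have Q0: "0 \<le> qf Q x" for x using mQ(2)[of x] mult_nonneg_nonneg[OF less_imp_le[OF mQ(1)], of "(norm x)\<^sup>2"] by simp
  have R0: "0 \<le> qf R u" for u using mR(2)[of u] mult_nonneg_nonneg[OF less_imp_le[OF mR(1)], of "(norm u)\<^sup>2"] by simp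
  have Rs: "transpose R = R" using R by (simp add: pos_def_def)
  have \<theta>: "\<theta> \<in> ball \<theta> e0" using reg(1) by simp
  have Ps: "transpose (P t) = P t" and Pi: "invertible (W t)" if "t \<in> ball \<theta> e0" for t
    using reg(3)[OF that] by (auto simp: stabilizing_solution_def W_def)
  have P0: "0 \<le> qf (P t) x" if "t \<in> ball \<theta> e0" for t x using Q0[of x] reg(4)[OF that, of x] by linarith
  have WR: "qf (W t) u = qf R u + qf (P t) (B t *v u)" for t u unfolding W_def by (rule input_weight_inner)
  have W_ge: "qf R u \<le> qf (W t) u" "qf (P t) (B t *v u) \<le> qf (W t) u" if "t \<in> ball \<theta> e0" for t u
    unfolding WR using R0[of u] P0[OF that, of "B t *v u"] by auto
  \<comment> \<open>Q is at least mQ and P at most c, so q P is below Q; adding 1 to c guards the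
    division, and the cap 1/2 keeps q below 1.\<close>
  define q where "q = min (1 / 2) (mQ / (c + 1))"
  have q: "0 < q" "q \<le> 1" "q * (c + 1) \<le> mQ"
  proof -
    show "0 < q" "q \<le> 1" using mQ(1) reg(2) by (auto simp: q_def)
    have "q \<le> mQ / (c + 1)" by (simp add: q_def)
    then show "q * (c + 1) \<le> mQ" using reg(2) by (simp add: pos_le_divide_eq)
  qed
  have comp: "qf (P t) (A *v x + B t *v u) + qf R u + qf Q x = qf (P t) x + qf (W t) (u - K t *v x)"
    if "t \<in> ball \<theta> e0" for t x u
    using completion_of_squares[OF Ps[OF that] Rs Pi[OF that, unfolded W_def], of A x u Q]
    unfolding stabilizing_solution_ric[OF reg(3)[OF that]] by (simp add: W_def K_def opt_gain_def P_def)
  have qP: "q * qf (P t) x \<le> qf Q x" if "t \<in> ball \<theta> e0" for t x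
  proof -
    have "q * qf (P t) x \<le> q * (c * (norm x)\<^sup>2)" using q by (intro mult_left_mono reg(5)[OF that]) auto
    also have "\<dots> \<le> mQ * (norm x)\<^sup>2" using q(1,3) mult_right_mono[of "q * c" mQ "(norm x)\<^sup>2"] by (simp add: algebra_simps)
    also have "\<dots> \<le> qf Q x" by (rule mQ(2))
    finally show ?thesis .
  qed
  \<comment> \<open>The optimal input reduces the value by the factor 1 - q. Young's inequality with
    weight q for the deviation from it costs a factor 1 + q, and the product 1 - q^2 is still below
    1.\<close>
  have contr: "qf (P t) (A *v x + B t *v u) \<le> (1 - q\<^sup>2) * qf (P t) x + (1 + 1 / q) * qf (W t) (u - K t *v x)"
    if t: "t \<in> ball \<theta> e0" for t x u
  proof -
    let ?y = "A *v x + B t *v (K t *v x)" and ?e = "u - K t *v x"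
    have eq: "A *v x + B t *v u = ?y + B t *v ?e" by (simp add: matrix_vector_mult_diff_distrib)
    have "qf (P t) ?y \<le> (1 - q) * qf (P t) x"
      using comp[OF t, of x "K t *v x"] R0[of "K t *v x"] qP[OF t, of x] by (simp add: algebra_simps)
    then have "(1 + q) * qf (P t) ?y \<le> (1 + q) * ((1 - q) * qf (P t) x)" using q by (intro mult_left_mono) auto
    also have "\<dots> = (1 - q\<^sup>2) * qf (P t) x" by (simp add: power2_eq_square algebra_simps)
    finally have 1: "(1 + q) * qf (P t) ?y \<le> (1 - q\<^sup>2) * qf (P t) x" .
    have "(1 + 1 / q) * qf (P t) (B t *v ?e) \<le> (1 + 1 / q) * qf (W t) ?e" using q by (intro mult_left_mono W_ge t) auto
    with 1 show ?thesis unfolding eq using qf_sum_young[OF Ps[OF t] P0[OF t] q(1), of ?y "B t *v ?e"] by linarith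
  qed
  define C4 where "C4 = 2 * c * (norm A)\<^sup>2 / mQ + 2 * c * c\<^sup>2 / mR"
  have C4: "0 \<le> C4" using reg(2) mQ mR by (simp add: C4_def)
  have step: "qf (P t) (A *v x + B t *v u) \<le> C4 * (qf Q x + qf R u)" if t: "t \<in> ball \<theta> e0" for t x u
  proof -
    have "qf (P t) (A *v x) \<le> c * (norm (A *v x))\<^sup>2" by (rule reg(5)[OF t])
    also have "\<dots> \<le> c * (norm A * norm x)\<^sup>2" using reg(2) by (intro mult_left_mono power_mono norm_matrix_vector_le) auto
    also have "\<dots> = c * (norm A)\<^sup>2 / mQ * (mQ * (norm x)\<^sup>2)" using mQ(1) by (simp add: power_mult_distrib)
    also have "\<dots> \<le> c * (norm A)\<^sup>2 / mQ * qf Q x" using reg(2) mQ by (intro mult_left_mono) auto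
    finally have 1: "qf (P t) (A *v x) \<le> c * (norm A)\<^sup>2 / mQ * qf Q x" .
    have "norm (B t *v u) \<le> c * norm u"
      using norm_matrix_vector_le[of "B t" u] mult_right_mono[OF reg(6)[OF t], of "norm u"] by simp
    then have "(norm (B t *v u))\<^sup>2 \<le> (c * norm u)\<^sup>2" by (intro power_mono) auto
    then have "c * (norm (B t *v u))\<^sup>2 \<le> c * (c * norm u)\<^sup>2" using reg(2) by (intro mult_left_mono) auto
    then have "qf (P t) (B t *v u) \<le> c * (c * norm u)\<^sup>2" using reg(5)[OF t, of "B t *v u"] by linarith
    also have "\<dots> = c * c\<^sup>2 / mR * (mR * (norm u)\<^sup>2)" using mR(1) by (simp add: power_mult_distrib)
    also have "\<dots> \<le> c * c\<^sup>2 / mR * qf R u" using reg(2) mR by (intro mult_left_mono) auto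
    finally have 2: "qf (P t) (B t *v u) \<le> c * c\<^sup>2 / mR * qf R u" .
    have "C4 * (qf Q x + qf R u) = 2 * (c * (norm A)\<^sup>2 / mQ * qf Q x) + 2 * (c * c\<^sup>2 / mR * qf R u)
        + (2 * c * (norm A)\<^sup>2 / mQ * qf R u + 2 * c * c\<^sup>2 / mR * qf Q x)"
      by (simp add: C4_def algebra_simps add_divide_distrib)
    moreover have "0 \<le> 2 * c * (norm A)\<^sup>2 / mQ * qf R u + 2 * c * c\<^sup>2 / mR * qf Q x"
      using reg(2) mQ(1) mR(1) Q0[of x] R0[of u] by (intro add_nonneg_nonneg mult_nonneg_nonneg) auto
    ultimately show ?thesis using qf_sum_young[OF Ps[OF t] P0[OF t], of 1 "A *v x" "B t *v u"] 1 2 by simp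
  qed
  \<comment> \<open>One constant for both the norm of P and the relative variation of the input
    weight, the latter measured against the coercivity mR of R.\<close>
  define c' where "c' = norm (P \<theta>) + c * e0 + c / mR"
  have c': "0 \<le> c'" "c / mR \<le> c'" "norm (P \<theta>) + c * e0 \<le> c'" using reg(1,2) mR(1) by (auto simp: c'_def)
  have nP: "norm (P t) \<le> c'" if t: "t \<in> ball \<theta> e0" for t
  proof -
    have "norm (P t) \<le> norm (P \<theta>) + norm (P t - P \<theta>)" using norm_triangle_ineq[of "P \<theta>" "P t - P \<theta>"] by simp
    also have "norm (P t - P \<theta>) \<le> c * norm (t - \<theta>)" by (rule reg(8)[OF \<theta> t])
    also have "\<dots> \<le> c * e0" using t reg(2) by (intro mult_left_mono) (auto simp: dist_norm norm_minus_commute)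
    finally show ?thesis using c'(3) by linarith
  qed
  have Wle: "qf (W \<theta>) u \<le> (1 + c' * norm (t - \<theta>)) * qf (W t) u" if t: "t \<in> ball \<theta> e0" for t u
  proof -
    have "qf (W \<theta>) u = qf (W t) u + qf (W \<theta> - W t) u"
      by (simp add: matrix_vector_mult_diff_rdistrib inner_diff_right)
    also have "qf (W \<theta> - W t) u \<le> norm (W \<theta> - W t) * (norm u)\<^sup>2" by (rule qf_le)
    also have "\<dots> \<le> c * norm (t - \<theta>) * (norm u)\<^sup>2"
      using reg(9)[OF \<theta> t] by (intro mult_right_mono) (auto simp: norm_minus_commute)
    also have "\<dots> = c / mR * norm (t - \<theta>) * (mR * (norm u)\<^sup>2)" using mR(1) by simp
    also have "\<dots> \<le> c / mR * norm (t - \<theta>) * qf (W t) u"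
      using reg(2) mR W_ge(1)[OF t, of u] by (intro mult_left_mono order_trans[OF mR(2)]) auto
    also have "\<dots> \<le> c' * norm (t - \<theta>) * qf (W t) u"
      using c'(2) R0[of u] W_ge(1)[OF t, of u] by (intro mult_right_mono) auto
    finally show ?thesis by (simp add: algebra_simps)
  qed
  define Gj where "Gj t = matrix (\<lambda>h. stack_cols (DK t h))" for t
  have lin: "linear (\<lambda>h. stack_cols (DK t h))" if "t \<in> ball \<theta> e0" for t
    using linear_compose[OF has_derivative_linear[OF reg(10)[OF that]] linear_stack_cols] by (simp add: o_def)
  have Gv: "Gj t *v h = stack_cols (DK t h)" if "t \<in> ball \<theta> e0" for t h
    unfolding Gj_def by (rule matrix_works[OF linear_matrix_vector_mul_eq[THEN iffD2, OF lin[OF that]]])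
  define cD where "cD = real CARD('x \<times> 'u) * real CARD('d) * c"
  have cD: "0 \<le> cD" using reg(2) by (simp add: cD_def)
  have Glip: "norm (Gj t - Gj s) \<le> cD * norm (t - s)" if st: "s \<in> ball \<theta> e0" "t \<in> ball \<theta> e0" for s t
  proof -
    have "norm (Gj t - Gj s) \<le> real CARD('x \<times> 'u) * real CARD('d) * (c * norm (t - s))"
    proof (rule norm_matrix_le)
      fix x h
      have "(Gj t - Gj s) *v h = stack_cols (DK t h - DK s h)"
        by (simp add: matrix_vector_mult_diff_rdistrib Gv[OF st(1)] Gv[OF st(2)] linear_diff[OF linear_stack_cols])
      then have "\<bar>x \<bullet> ((Gj t - Gj s) *v h)\<bar> \<le> norm x * norm (DK t h - DK s h)"
        using Cauchy_Schwarz_ineq2[of x "(Gj t - Gj s) *v h"] by (simp add: norm_stack_cols)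
      also have "\<dots> \<le> norm x * (c * norm (t - s) * norm h)" by (intro mult_left_mono reg(11) st) auto
      finally show "\<bar>x \<bullet> ((Gj t - Gj s) *v h)\<bar> \<le> c * norm (t - s) * norm x * norm h" by (simp add: mult_ac)
    qed
    then show ?thesis by (simp add: cD_def mult.assoc)
  qed
  have Ws: "pos_def (W \<theta>)"
    unfolding pos_def_def
  proof (intro conjI allI impI)
    have "u \<bullet> (W \<theta> *v w) = (W \<theta> *v u) \<bullet> w" for u w
      unfolding inner_commute[of "W \<theta> *v u"] unfolding W_def input_weight_inner
      using inner_symmetric[OF Rs, of u w] inner_symmetric[OF Ps[OF \<theta>], of "B \<theta> *v u" "B \<theta> *v w"] by (simp add: inner_commute)
    then show "transpose (W \<theta>) = W \<theta>" unfolding symmetric_iff_inner by blast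
    fix u :: "real^'u" assume "u \<noteq> 0"
    then have "0 < qf R u" using R by (simp add: pos_def_def)
    then show "0 < qf (W \<theta>) u" using W_ge(1)[OF \<theta>, of u] by linarith
  qed
  show thesis
  proof (rule that[of e0 q "1 - q\<^sup>2" "1 + 1 / q" C4 mQ c' cD Gj])
    show "0 \<le> 1 - q\<^sup>2" "1 - q\<^sup>2 < 1" using q by (auto simp: power_le_one)
    show "0 \<le> 1 + 1 / q" using q by simp
    show "mQ * (norm x)\<^sup>2 \<le> qf (P t) x" if "t \<in> ball \<theta> e0" for t x
      using mQ(2)[of x] reg(4)[OF that, of x] by linarith
    show "continuous_on (ball \<theta> e0) P" using reg(8,2) by (rule continuous_on_of_norm_bound)
    show "continuous_on (ball \<theta> e0) K"
      using reg(10) by (intro continuous_at_imp_continuous_on ballI) (metis has_derivative_continuous)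
    show "continuous_on (ball \<theta> e0) Gj" using Glip cD by (rule continuous_on_of_norm_bound)
    show "((\<lambda>t. stack_cols (K t)) has_derivative (\<lambda>h. Gj t *v h)) (at t)" if "t \<in> ball \<theta> e0" for t
      unfolding Gv[OF that] by (rule bounded_linear.has_derivative[OF bounded_linear_stack_cols reg(10)[OF that]])
    show "norm (Gj t - Gj \<theta>) \<le> cD * norm (t - \<theta>)" if "t \<in> ball \<theta> e0" for t by (rule Glip[OF \<theta> that])
  qed (fact reg(1) q(1,2) C4 mQ(1) c'(1) cD Ws nP P0 comp qP contr step Wle)+
qed

subsection \<open>The lower bound\<close>

lemma prob_density_second_moment:
  assumes "has_bochner_integral lborel (\<lambda>z. p z *\<^sub>R outer z z) (\<Sigma> :: real^'x^'x)"
  shows "integrable lborel (\<lambda>z. p z * (norm z)\<^sup>2)"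
proof -
  have "integrable lborel (\<lambda>z. p z *\<^sub>R outer z z)" using assms by (simp add: has_bochner_integral_iff)
  then have "integrable lborel (\<lambda>z. (p z *\<^sub>R outer z z) $ i $ i)" for i
    by (intro integrable_bounded_linear[OF bounded_linear_vec_nth])
  then have "integrable lborel (\<lambda>z. \<Sum>i\<in>UNIV. (p z *\<^sub>R outer z z) $ i $ i)" by simp
  moreover have "(\<Sum>i\<in>UNIV. (p z *\<^sub>R outer z z) $ i $ i) = p z * (norm z)\<^sup>2" for z
    unfolding power2_norm_eq_inner by (simp add: outer_def inner_vec_def sum_distrib_left)
  ultimately show ?thesis by simp
qed

text \<open>The difference (1 + 12 \<epsilon>) (1 - \<epsilon>)^2 - (1 + \<epsilon>) equals
  \<epsilon> (9 - 23 \<epsilon> + 12 \<epsilon>^2), and the bracket is 12 (1/2 - \<epsilon>)^2 + 6 -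
  11 \<epsilon>, positive for \<epsilon> up to 1/2. The coefficient 7 is 1 + 6, the mixed term 12 c
  \<epsilon>^2 being at most 6 c \<epsilon>.\<close>

lemma rate_coefficient_le:
  fixes \<epsilon> c :: real
  assumes "0 < \<epsilon>" "\<epsilon> \<le> 1 / 2" "0 \<le> c"
  shows "(1 + \<epsilon>) / (1 - \<epsilon>)\<^sup>2 * (1 + c * \<epsilon>) \<le> 1 + (12 + 7 * c) * \<epsilon>"
proof -
  have "0 \<le> 12 * (1 / 2 - \<epsilon>)\<^sup>2" by simp
  then have "0 \<le> 9 - 23 * \<epsilon> + 12 * \<epsilon>\<^sup>2" using assms by (simp add: power2_eq_square algebra_simps)
  then have "0 \<le> \<epsilon> * (9 - 23 * \<epsilon> + 12 * \<epsilon>\<^sup>2)" using assms by simp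
  then have "1 + \<epsilon> \<le> (1 + 12 * \<epsilon>) * (1 - \<epsilon>)\<^sup>2" by (simp add: power2_eq_square algebra_simps)
  then have "(1 + \<epsilon>) / (1 - \<epsilon>)\<^sup>2 \<le> 1 + 12 * \<epsilon>" using assms by (simp add: pos_divide_le_eq)
  then have "(1 + \<epsilon>) / (1 - \<epsilon>)\<^sup>2 * (1 + c * \<epsilon>) \<le> (1 + 12 * \<epsilon>) * (1 + c * \<epsilon>)"
    using assms by (intro mult_right_mono) auto
  also have "\<dots> \<le> 1 + (12 + 7 * c) * \<epsilon>"
  proof -
    have "(c * \<epsilon>) * (12 * \<epsilon>) \<le> (c * \<epsilon>) * 6" using assms by (intro mult_left_mono) auto
    then show ?thesis by (simp add: algebra_simps)
  qed
  finally show ?thesis .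
qed

text \<open>The order of the quantifiers matters: e1, K and cD are fixed by the system alone, c may
  depend on \<epsilon> and the prior, and neither depends on the policy, the randomization, the
  horizon or the bound \<rho> on the regret.\<close>

lemma regret_windows:
  fixes \<theta> :: "real^'d"
    and A :: "real^'x^'x" and B :: "real^'d \<Rightarrow> real^'u^'x"
    and L :: "real^'d^('u \<times> 'x)" and B0 :: "real^'u^'x"
    and Q :: "real^'x^'x" and R :: "real^'u^'u"
    and p :: "real^'x \<Rightarrow> real" and \<Sigma> :: "real^'x^'x"
    and \<Gamma> :: "real^'x^'x" and \<Psi> :: "real^'d^'d"
  assumes A1: "prob_density p" "Ck 1 p"
      "has_bochner_integral lborel (\<lambda>z. p z *\<^sub>R z) 0"
      "has_bochner_integral lborel (\<lambda>z. p z *\<^sub>R outer z z) \<Sigma>"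
      "integrable lborel (fisher_integrand p)"
    and A2: "pos_def Q" "pos_def R"
    and A3: "stabilizable A (B \<theta>)"
    and A4: "\<And>t. stack_cols (B t) = L *v t + stack_cols B0"
    and \<Gamma>: "pos_def \<Gamma>" and \<Psi>: "psd \<Psi>"
  defines "W \<equiv> input_weight (B \<theta>) R (riccati A (B \<theta>) Q R)" and "G \<equiv> gain_jacobian A B Q R \<theta>"
  obtains e1 K cD where "0 < e1" "0 \<le> K" "0 \<le> cD"
    "\<And>\<epsilon> \<mu>. 0 < \<epsilon> \<Longrightarrow> \<epsilon> < e1 \<Longrightarrow> prob_density \<mu> \<Longrightarrow> Cc_infinity (ball \<theta> \<epsilon>) \<mu> \<Longrightarrow>
      \<exists>c. \<forall>(N :: 'r measure) (\<pi> :: ('x, 'u, 'r) policy) T \<rho>.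
        prob_space N \<longrightarrow> is_policy N \<pi> \<longrightarrow> info_finite A B L p N \<pi> \<mu> \<longrightarrow> 1 \<le> T \<longrightarrow> 0 \<le> \<rho> \<longrightarrow>
        (\<forall>t\<in>ball \<theta> \<epsilon>. regret A (B t) Q R p N T \<pi> \<le> ereal \<rho>) \<longrightarrow>
        (\<exists>F. (\<forall>j. norm (F j) \<le> cD * \<epsilon>) \<and>
          (\<Sum>j = 1..nat \<lfloor>sqrt (real (T - 1))\<rfloor>. (excited_prob A B p N \<pi> \<mu> \<Gamma> j T)\<^sup>2 *
            trace (kron \<Gamma> W ** (G + F j) ** info_mat A B L p N \<pi> \<mu> \<Psi> j T ** transpose (G + F j)))
          \<le> (1 + K * \<epsilon>) * \<rho> + c)"
proof -
  \<comment> \<open>The linear part of B: the vector L v unstacked into a matrix.\<close>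
  define bl :: "real^'d \<Rightarrow> real^'u^'x" where "bl v = (\<chi> i j. (L *v v) $ (j, i))" for v
  have bl_L: "stack_cols (bl v) = L *v v" for v by (simp add: bl_def stack_cols_def vec_eq_iff)
  have bl: "bounded_linear bl"
    unfolding linear_conv_bounded_linear[symmetric]
    by (intro linearI) (simp_all add: bl_def vec_eq_iff matrix_vector_right_distrib matrix_vector_mult_scaleR)
  have affine: "B s - B t = bl (s - t)" for s t
  proof -
    have "stack_cols (B s - B t) = stack_cols (bl (s - t))"
      unfolding linear_diff[OF linear_stack_cols] A4 bl_L by (simp add: matrix_vector_mult_diff_distrib)
    then show ?thesis by (simp add: stack_cols_eq_iff)
  qed
  have Bm: "B \<in> borel_measurable borel"
  proof -
    have eq: "bl t + B 0 = B t" for t using affine[of t 0] by (simp add: algebra_simps)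
    have "(\<lambda>t. bl t + B 0) \<in> borel_measurable borel"
      by (intro borel_measurable_continuous_onI continuous_on_add linear_continuous_on bl continuous_on_const)
    then show ?thesis unfolding eq .
  qed
  have pm: "p \<in> borel_measurable borel"
    using A1(2) by (intro borel_measurable_continuous_onI continuous_at_imp_continuous_on)
      (auto intro: differentiable_imp_continuous_within simp: One_nat_def)
  note p2 = prob_density_second_moment[OF A1(4)]
  obtain e0 q r C C4 m0 c cD Gj where e0: "0 < e0" and cst: "0 < q" "q \<le> 1" "0 \<le> r" "r < 1" "0 \<le> C" "0 \<le> C4" "0 < m0"
    and c: "0 \<le> c" and cD: "0 \<le> cD" and W: "pos_def W"
    and P_norm: "\<And>t. t \<in> ball \<theta> e0 \<Longrightarrow> norm (riccati A (B t) Q R) \<le> c"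
    and P_nonneg: "\<And>t x. t \<in> ball \<theta> e0 \<Longrightarrow> 0 \<le> qf (riccati A (B t) Q R) x"
    and compl: "\<And>t x u. t \<in> ball \<theta> e0 \<Longrightarrow> qf (riccati A (B t) Q R) (A *v x + B t *v u) + qf R u + qf Q x
      = qf (riccati A (B t) Q R) x + qf (input_weight (B t) R (riccati A (B t) Q R)) (u - opt_gain A (B t) Q R *v x)"
    and q_le: "\<And>t x. t \<in> ball \<theta> e0 \<Longrightarrow> q * qf (riccati A (B t) Q R) x \<le> qf Q x"
    and contract: "\<And>t x u. t \<in> ball \<theta> e0 \<Longrightarrow> qf (riccati A (B t) Q R) (A *v x + B t *v u)
      \<le> r * qf (riccati A (B t) Q R) x + C * qf (input_weight (B t) R (riccati A (B t) Q R)) (u - opt_gain A (B t) Q R *v x)"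
    and step: "\<And>t x u. t \<in> ball \<theta> e0 \<Longrightarrow> qf (riccati A (B t) Q R) (A *v x + B t *v u) \<le> C4 * (qf Q x + qf R u)"
    and P_lower: "\<And>t x. t \<in> ball \<theta> e0 \<Longrightarrow> m0 * (norm x)\<^sup>2 \<le> qf (riccati A (B t) Q R) x"
    and W_le: "\<And>t u. t \<in> ball \<theta> e0 \<Longrightarrow> qf W u \<le> (1 + c * norm (t - \<theta>)) * qf (input_weight (B t) R (riccati A (B t) Q R)) u"
    and conts: "continuous_on (ball \<theta> e0) (\<lambda>t. riccati A (B t) Q R)" "continuous_on (ball \<theta> e0) (\<lambda>t. opt_gain A (B t) Q R)"
      "continuous_on (ball \<theta> e0) Gj"
    and G_lip: "\<And>t. t \<in> ball \<theta> e0 \<Longrightarrow> norm (Gj t - Gj \<theta>) \<le> cD * norm (t - \<theta>)"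
    and K_deriv: "\<And>t. t \<in> ball \<theta> e0 \<Longrightarrow> ((\<lambda>t. stack_cols (opt_gain A (B t) Q R)) has_derivative (\<lambda>h. Gj t *v h)) (at t)"
    unfolding W_def by (rule quadratic_regularity[OF A2 A3 bl affine]) blast
  let ?S = "ball \<theta> e0"
  \<comment> \<open>Cut off outside the ball to obtain functions that are Borel on the whole
    parameter space; the priors considered live inside the ball, where nothing changes.\<close>
  define Pf where "Pf t = indicator ?S t *\<^sub>R riccati A (B t) Q R" for t
  define Kf where "Kf t = indicator ?S t *\<^sub>R opt_gain A (B t) Q R" for t
  define Gf where "Gf t = indicator ?S t *\<^sub>R Gj t" for t
  have on: "Pf t = riccati A (B t) Q R" "Kf t = opt_gain A (B t) Q R" "Gf t = Gj t" if "t \<in> ?S" for t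
    using that by (simp_all add: Pf_def Kf_def Gf_def)
  have meas: "Pf \<in> borel_measurable borel" "Kf \<in> borel_measurable borel" "Gf \<in> borel_measurable borel"
    unfolding Pf_def Kf_def Gf_def using conts by (intro borel_measurable_continuous_on_indicator; simp)+
  have Pf0: "0 \<le> qf (Pf t) x" for t x
    using P_nonneg[of t x] by (cases "t \<in> ?S") (simp_all add: Pf_def del: mem_ball)
  have \<theta>S: "\<theta> \<in> ?S" using e0 by simp
  have G_eq: "G = Gf \<theta>"
  proof -
    have "frechet_derivative (\<lambda>t. stack_cols (opt_gain A (B t) Q R)) (at \<theta>) = (\<lambda>h. Gj \<theta> *v h)"
      by (rule frechet_derivative_at[OF K_deriv[OF \<theta>S], symmetric])
    then show ?thesis by (simp add: G_def gain_jacobian_def on(3)[OF \<theta>S])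
  qed
  have Q0: "0 \<le> qf Q x" and R0: "0 \<le> qf R u" for x u
    using A2 by (cases "x = 0"; cases "u = 0"; simp add: pos_def_def less_imp_le)+
  have Wp: "psd W" "psd \<Gamma>"
    using W \<Gamma> unfolding psd_def pos_def_def by (metis inner_zero_left less_imp_le order_refl)+
  obtain tc where tc: "0 \<le> tc"
    "\<And>(G :: real^'d^('x \<times> 'u)) M b. (\<And>v. 0 \<le> v \<bullet> (M *v v)) \<Longrightarrow> (\<And>v. v \<bullet> (M *v v) \<le> b * (norm v)\<^sup>2) \<Longrightarrow>
      0 \<le> trace (kron \<Gamma> W ** G ** M ** transpose G) \<and> trace (kron \<Gamma> W ** G ** M ** transpose G) \<le> tc * b * (norm G)\<^sup>2"
    using trace_kron_bounds[OF Wp(2,1)] by metis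
  obtain \<gamma> where \<gamma>: "0 < \<gamma>" "\<And>y. \<gamma> * (norm y)\<^sup>2 \<le> qf \<Gamma> y" using coercive_of_pos_def[OF \<Gamma>] by blast
  obtain a where a: "0 < a" "\<And>z. emeasure (density lborel (\<lambda>y. ennreal (p y))) {y. norm (z + y) < a} \<le> ennreal (1 / 2)"
    using anti_concentration[OF A1(1) pm] by blast
  have p0: "0 \<le> p y" for y using A1(1) by (simp add: prob_density_def)
  define s2 where "s2 = (LINT y|lborel. p y * (norm y)\<^sup>2)"
  have s2: "0 \<le> s2" unfolding s2_def using p0 by (intro integral_nonneg_AE) auto
  define \<tau>m where "\<tau>m = c * s2"
  have \<tau>m: "0 \<le> \<tau>m" using c s2 by (simp add: \<tau>m_def)
  obtain Cs where Cs: "0 \<le> Cs" "\<And>T v e c \<tau> \<rho>. balance q r C C4 \<tau> T v e c \<Longrightarrow> 0 \<le> \<tau> \<Longrightarrow> \<tau> \<le> \<tau>m \<Longrightarrow> 0 \<le> \<rho> \<Longrightarrow>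
    (\<Sum>t<T. c t) \<le> \<rho> + real T * \<tau> \<Longrightarrow> (\<Sum>t<T. e t) \<le> Cs * (\<rho> + 1)"
    using balance_total[OF cst(1-6) \<tau>m] by metis
  define cM where "cM = tc * (norm (Gf \<theta>) + cD)\<^sup>2"
  define K1 where "K1 = 4 * C * cM * Cs / (m0 * \<gamma> * (1 - r)) + 128 * (norm \<Gamma> + 1) * (1 + c) * Cs / a\<^sup>2"
  have cM: "0 \<le> cM" using tc(1) by (simp add: cM_def)
  have K1: "0 \<le> K1" unfolding K1_def using cst cM Cs(1) \<gamma>(1) c by (intro add_nonneg_nonneg divide_nonneg_nonneg mult_nonneg_nonneg) auto
  show thesis
  proof (rule that[of "min e0 (1 / 2)" "12 + 7 * c + K1" cD])
    show "0 < min e0 (1 / 2)" "0 \<le> 12 + 7 * c + K1" "0 \<le> cD" using e0 c K1 cD by auto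
    fix \<epsilon> :: real and \<mu> :: "real^'d \<Rightarrow> real"
    assume \<epsilon>: "0 < \<epsilon>" "\<epsilon> < min e0 (1 / 2)" and \<mu>: "prob_density \<mu>" "Cc_infinity (ball \<theta> \<epsilon>) \<mu>"
    have \<epsilon>h: "\<epsilon> \<le> 1 / 2" and sub: "ball \<theta> \<epsilon> \<subseteq> ?S" using \<epsilon> by auto
    have near: "norm (t - \<theta>) \<le> \<epsilon>" if "t \<in> ball \<theta> \<epsilon>" for t using that by (simp add: dist_norm norm_minus_commute)
    \<comment> \<open>The number m of discarded steps is chosen from \<epsilon>, so that
      \<open>balance_prefix\<close> loses only the factor 1 - \<epsilon>.\<close>
    have "(\<lambda>m. (1 - q) ^ m * C) \<longlonglongrightarrow> 0 * C" using cst by (intro tendsto_intros LIMSEQ_power_zero) auto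
    then have "eventually (\<lambda>m. (1 - q) ^ m * C < \<epsilon>) sequentially" using \<epsilon>(1) by (intro order_tendstoD(2)) auto
    then obtain m where m: "(1 - q) ^ m * C \<le> \<epsilon>" by (auto simp: eventually_sequentially intro: less_imp_le)
    define c1 where "c1 = real m * \<tau>m + \<tau>m / (1 - r)"
    define c2 where "c2 = (1 + 1 / \<epsilon>) * (real (m + 2) * (\<tau>m / (1 - r)) / (m0 * \<gamma>))\<^sup>2 * cM + cM"
    have c1: "0 \<le> c1" using \<tau>m cst by (simp add: c1_def)
    let ?co = "(1 + \<epsilon>) / (1 - \<epsilon>)\<^sup>2 * (1 + c * \<epsilon>)"
    interpret \<mu>: fisher_density \<mu> by (rule Cc_infinity_fisher_density[OF \<mu>])
    interpret p: fisher_density p by unfold_locales (fact A1)+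
    show "\<exists>d. \<forall>(N :: 'r measure) (\<pi> :: ('x, 'u, 'r) policy) T \<rho>.
        prob_space N \<longrightarrow> is_policy N \<pi> \<longrightarrow> info_finite A B L p N \<pi> \<mu> \<longrightarrow> 1 \<le> T \<longrightarrow> 0 \<le> \<rho> \<longrightarrow>
        (\<forall>t\<in>ball \<theta> \<epsilon>. regret A (B t) Q R p N T \<pi> \<le> ereal \<rho>) \<longrightarrow>
        (\<exists>F. (\<forall>j. norm (F j) \<le> cD * \<epsilon>) \<and>
          (\<Sum>j = 1..nat \<lfloor>sqrt (real (T - 1))\<rfloor>. (excited_prob A B p N \<pi> \<mu> \<Gamma> j T)\<^sup>2 *
            trace (kron \<Gamma> W ** (G + F j) ** info_mat A B L p N \<pi> \<mu> \<Psi> j T ** transpose (G + F j)))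
          \<le> (1 + (12 + 7 * c + K1) * \<epsilon>) * \<rho> + d)"
    proof (intro exI[of _ "?co * c1 + K1 * \<epsilon> + c2"] allI impI)
      fix N :: "'r measure" and \<pi> :: "('x, 'u, 'r) policy" and T :: nat and \<rho> :: real
      assume N: "prob_space N" and \<pi>: "is_policy N \<pi>" and inf: "info_finite A B L p N \<pi> \<mu>"
        and T: "1 \<le> T" and \<rho>: "0 \<le> \<rho>" and reg: "\<forall>t\<in>ball \<theta> \<epsilon>. regret A (B t) Q R p N T \<pi> \<le> ereal \<rho>"
      let ?Ks = "closure {z. \<mu> z \<noteq> 0}"
      interpret lm: lq_model A B p N \<pi> by (rule lq_model.intro) (fact A1(1) pm N \<pi> Bm A1(3) p2)+
      interpret lb: lq_bayes A B p N \<pi> \<mu> bl 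
        by (intro lq_bayes.intro lq_bayes_axioms.intro)
          (fact lm.lq_model_axioms p.fisher_density_axioms \<mu>.fisher_density_axioms bl affine)+
      interpret li: lq_info A B p N \<pi> \<mu> bl L \<theta> \<epsilon> ?Ks
      proof (intro lq_info.intro lq_info_axioms.intro)
        show "compact ?Ks" "?Ks \<subseteq> ball \<theta> \<epsilon>" using \<mu>(2) by (auto simp: Cc_infinity_def)
        show "\<mu> z = 0" if "z \<notin> ?Ks" for z using that closure_subset[of "{z. \<mu> z \<noteq> 0}"] by blast
      qed (fact lb.lq_bayes_axioms bl_L inf \<epsilon>(1))+
      interpret lw: lq_window A B p N \<pi> \<mu> bl L \<theta> \<epsilon> ?Ks Kf Gf W \<Gamma> cD
      proof (intro lq_window.intro lq_window_axioms.intro)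
        show "continuous_on (ball \<theta> \<epsilon>) Kf"
          by (rule continuous_on_eq[OF continuous_on_subset[OF conts(2) sub]]) (rule on(2)[OF subsetD[OF sub], symmetric])
        show "continuous_on (ball \<theta> \<epsilon>) Gf"
          by (rule continuous_on_eq[OF continuous_on_subset[OF conts(3) sub]]) (rule on(3)[OF subsetD[OF sub], symmetric])
        fix t assume t: "t \<in> ball \<theta> \<epsilon>"
        then have tS: "t \<in> ?S" using sub by blast
        show "norm (Gf t - Gf \<theta>) \<le> cD * \<epsilon>"
          unfolding on(3)[OF tS] on(3)[OF \<theta>S]
          using G_lip[OF tS] mult_left_mono[OF near[OF t] cD] by linarith
        fix v y
        have "((\<lambda>t. stack_cols (Kf t)) has_derivative (\<lambda>h. Gf t *v h)) (at t)"
          unfolding on(3)[OF tS]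
          by (rule has_derivative_transform_within_open[OF K_deriv[OF tS] open_ball tS]) (simp only: on(2))
        then have d: "((\<lambda>t. stack_cols (Kf t)) has_derivative (\<lambda>h. Gf t *v h)) (at (t + 0 *\<^sub>R v))" by simp
        have l: "((\<lambda>s. t + s *\<^sub>R v) has_derivative (\<lambda>s. s *\<^sub>R v)) (at 0)"
          by (auto intro!: derivative_eq_intros)
        have "((\<lambda>s. y \<bullet> stack_cols (Kf (t + s *\<^sub>R v))) has_derivative (\<lambda>s. y \<bullet> (Gf t *v (s *\<^sub>R v)))) (at 0)"
          using has_derivative_inner_right[OF has_derivative_compose[OF l d]] by simp
        then show "line_deriv (\<lambda>\<theta>. y \<bullet> stack_cols (Kf \<theta>)) v t (y \<bullet> (Gf t *v v))"
          by (rule has_derivative_imp_has_field_derivative) (simp add: matrix_vector_mult_scaleR)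
      qed (fact li.lq_info_axioms meas W \<Gamma>)+
      interpret lc: lq_cost A B p N \<pi> \<mu> bl L \<theta> \<epsilon> ?Ks Kf Gf W \<Gamma> cD Pf Q R q r C C4 m0 "1 + c * \<epsilon>" \<tau>m
      proof (intro lq_cost.intro lq_cost_axioms.intro)
        fix t x u assume t: "t \<in> ball \<theta> \<epsilon>"
        then have tS: "t \<in> ?S" using sub by blast
        note on' = on[OF tS]
        show "qf (Pf t) (A *v x + B t *v u) + qf R u + qf Q x = qf (Pf t) x + qf (input_weight (B t) R (Pf t)) (u - Kf t *v x)"
          unfolding on' by (rule compl[OF tS])
        show "q * qf (Pf t) x \<le> qf Q x" unfolding on' by (rule q_le[OF tS])
        show "qf (Pf t) (A *v x + B t *v u) \<le> r * qf (Pf t) x + C * qf (input_weight (B t) R (Pf t)) (u - Kf t *v x)"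
          unfolding on' by (rule contract[OF tS])
        show "qf (Pf t) (A *v x + B t *v u) \<le> C4 * (qf Q x + qf R u)" unfolding on' by (rule step[OF tS])
        show "m0 * (norm x)\<^sup>2 \<le> qf (Pf t) x" unfolding on' by (rule P_lower[OF tS])
        have "qf W u \<le> (1 + c * norm (t - \<theta>)) * qf (input_weight (B t) R (Pf t)) u" unfolding on' by (rule W_le[OF tS])
        also have "\<dots> \<le> (1 + c * \<epsilon>) * qf (input_weight (B t) R (Pf t)) u"
          using mult_left_mono[OF near[OF t] c] R0 Pf0 by (intro mult_right_mono) (simp_all add: input_weight_inner)
        finally show "qf W u \<le> (1 + c * \<epsilon>) * qf (input_weight (B t) R (Pf t)) u" .
        have "lm.noise_cost (Pf t) \<le> norm (Pf t) * s2" unfolding s2_def by (rule lm.noise_cost_le)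
        also have "\<dots> \<le> c * s2" unfolding on' using s2 by (intro mult_right_mono P_norm tS) auto
        finally show "lm.noise_cost (Pf t) \<le> \<tau>m" by (simp add: \<tau>m_def)
      next
        show "0 \<le> 1 + c * \<epsilon>" using c \<epsilon> by simp
      qed (fact lw.lq_window_axioms meas Pf0 Q0 R0 cst)+
      have cost: "cost A (B t) Q R p N T \<pi> \<le> ennreal (\<rho> + real T * lm.noise_cost (Pf t))" if t: "t \<in> ball \<theta> \<epsilon>" for t
      proof (rule lm.cost_le_of_regret[OF _ \<rho>])
        show "regret A (B t) Q R p N T \<pi> \<le> ereal \<rho>" using reg t by blast
        show "opt_cost A (B t) Q R p N T \<le> ennreal (real T * lm.noise_cost (Pf t))"
        proof (rule lm.opt_cost_le[OF Pf0 Q0 R0])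
          show "qf (Pf t) (A *v x + B t *v (Kf t *v x)) + qf R (Kf t *v x) + qf Q x = qf (Pf t) x" for x
            using lc.completion[OF t, of x "Kf t *v x"] by simp
        qed
        show "0 \<le> real T * lm.noise_cost (Pf t)" using lm.noise_cost_nonneg[OF Pf0] by simp
      qed
      obtain v e cc where bal: "balance q r C C4 lc.tau T v e cc" "(\<Sum>t<T. cc t) \<le> \<rho> + real T * lc.tau"
        "\<And>t. t \<le> T \<Longrightarrow> lc.V t = ennreal (v t)" "\<And>t. t < T \<Longrightarrow> lc.Ee t = ennreal (e t)"
        using lc.bayes_balance[OF cost \<rho>] by metis
      interpret ll: lq_lower A B p N \<pi> \<mu> bl L \<theta> \<epsilon> ?Ks Kf Gf W \<Gamma> cD Pf Q R q r C C4 m0 "1 + c * \<epsilon>" \<tau>m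
        \<Psi> tc "norm (Gf \<theta>)" \<gamma> a Cs \<rho> m T v e cc
      proof (intro lq_lower.intro lq_lower_axioms.intro)
        show "(\<Sum>t<T. e t) \<le> Cs * (\<rho> + 1)" by (rule Cs(2)[OF bal(1) lc.tau_bounds \<rho> bal(2)])
      qed (fact lc.lq_cost_axioms \<Psi> tc order_refl \<epsilon>h \<gamma> m a T \<rho> bal Cs(1))+
      obtain F where F: "\<And>j. norm (F j) \<le> cD * \<epsilon>" and le: "(\<Sum>j = 1..ll.kmax. (ll.prb j)\<^sup>2 * ll.tr j (F j))
        \<le> (1 + \<epsilon>) / (1 - \<epsilon>)\<^sup>2 * (1 + c * \<epsilon>) * (\<rho> + ll.c1) + ll.K1 * \<epsilon> * (\<rho> + 1) + ll.c2"
        using ll.windows_sum by blast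
      have c12: "ll.c1 = c1" "ll.c2 = c2" by (simp_all add: ll.c1_def c1_def ll.c2_def c2_def ll.cM_def cM_def)
      \<comment> \<open>The weight ratio 1 + c \<epsilon> is replaced by 1 + c, which removes the
        dependence of the constant on \<epsilon>.\<close>
      have "ll.K1 \<le> K1"
      proof -
        have "128 * (norm \<Gamma> + 1) * (1 + c * \<epsilon>) * Cs / a\<^sup>2 \<le> 128 * (norm \<Gamma> + 1) * (1 + c) * Cs / a\<^sup>2"
          using Cs(1) mult_left_mono[of \<epsilon> 1 c] c \<epsilon>h by (intro divide_right_mono mult_right_mono mult_left_mono) auto
        then show ?thesis unfolding ll.K1_def K1_def ll.cM_def cM_def by linarith
      qed
      then have "ll.K1 * (\<epsilon> * (\<rho> + 1)) \<le> K1 * (\<epsilon> * (\<rho> + 1))" using \<epsilon>(1) \<rho> by (intro mult_right_mono) auto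
      moreover have "?co * \<rho> \<le> (1 + (12 + 7 * c) * \<epsilon>) * \<rho>"
        by (intro mult_right_mono rate_coefficient_le \<epsilon>(1) \<epsilon>h c \<rho>)
      moreover have "(\<Sum>j = 1..ll.kmax. (ll.prb j)\<^sup>2 * ll.tr j (F j)) \<le> ?co * \<rho> + ?co * c1 + ll.K1 * (\<epsilon> * (\<rho> + 1)) + c2"
        using le unfolding c12 by (simp only: distrib_left mult.assoc)
      ultimately have "(\<Sum>j = 1..ll.kmax. (ll.prb j)\<^sup>2 * ll.tr j (F j))
        \<le> (1 + (12 + 7 * c) * \<epsilon>) * \<rho> + ?co * c1 + K1 * (\<epsilon> * (\<rho> + 1)) + c2" by linarith
      also have "\<dots> = (1 + (12 + 7 * c + K1) * \<epsilon>) * \<rho> + (?co * c1 + K1 * \<epsilon> + c2)" by (simp add: algebra_simps)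
      finally have "(\<Sum>j = 1..ll.kmax. (ll.prb j)\<^sup>2 * ll.tr j (F j)) \<le> (1 + (12 + 7 * c + K1) * \<epsilon>) * \<rho> + (?co * c1 + K1 * \<epsilon> + c2)" .
      then show "\<exists>F. (\<forall>j. norm (F j) \<le> cD * \<epsilon>) \<and>
          (\<Sum>j = 1..nat \<lfloor>sqrt (real (T - 1))\<rfloor>. (excited_prob A B p N \<pi> \<mu> \<Gamma> j T)\<^sup>2 *
            trace (kron \<Gamma> W ** (G + F j) ** info_mat A B L p N \<pi> \<mu> \<Psi> j T ** transpose (G + F j)))
          \<le> (1 + (12 + 7 * c + K1) * \<epsilon>) * \<rho> + (?co * c1 + K1 * \<epsilon> + c2)"
        using F unfolding G_eq ll.kmax_def ll.prb_def ll.tr_def by blast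
    qed
  qed
qed

text \<open>What remains after \<open>regret_windows\<close> is to remove the factor 1 + K
  \<epsilon> from the regret, by shrinking the input weight by the same factor, and to cover the
  values of \<epsilon> that are not small. The constant c depends on \<epsilon> and \<mu> only; the
  perturbations E and F may also depend on policy, horizon and window.\<close>

theorem lemma6:
  fixes \<Theta> :: "(real^'d) set" and \<theta> :: "real^'d"
    and A :: "real^'x^'x" and B :: "real^'d \<Rightarrow> real^'u^'x"
    and L :: "real^'d^('u \<times> 'x)" and B\<^sub>0 :: "real^'u^'x"
    and Q :: "real^'x^'x" and R :: "real^'u^'u"
    and p :: "real^'x \<Rightarrow> real" and \<Sigma>\<^sub>w :: "real^'x^'x"
    and \<Gamma> :: "real^'x^'x" and \<Psi> :: "real^'d^'d"
  assumes "open \<Theta>" and "\<theta> \<in> \<Theta>"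
    and A1: "prob_density p" "Ck 1 p"
      "has_bochner_integral lborel (\<lambda>z. p z *\<^sub>R z) 0"
      "has_bochner_integral lborel (\<lambda>z. p z *\<^sub>R outer z z) \<Sigma>\<^sub>w"
      "integrable lborel (fisher_integrand p)"
    and A2: "pos_def Q" "pos_def R"
    and A3: "stabilizable A (B \<theta>)"
    and A4: "\<And>\<theta>'. stack_cols (B \<theta>') = L *v \<theta>' + stack_cols B\<^sub>0"
    and \<Gamma>: "pos_def \<Gamma>" and \<Psi>: "psd \<Psi>"
  shows "\<exists>C. \<forall>\<epsilon>>0. \<forall>\<mu>. prob_density \<mu> \<and> Cc_infinity (ball \<theta> \<epsilon>) \<mu> \<longrightarrow>
    (\<exists>c. \<forall>(N :: 'r measure) (\<pi> :: ('x, 'u, 'r) policy).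
      prob_space N \<and> is_policy N \<pi> \<and> info_finite A B L p N \<pi> \<mu> \<longrightarrow>
      (\<forall>T\<ge>1. \<exists>(E :: nat \<Rightarrow> real^'u^'u) (F :: nat \<Rightarrow> real^'d^('x \<times> 'u)).
        (\<forall>k. norm (E k) \<le> C * \<epsilon> \<and> norm (F k) \<le> C * \<epsilon>) \<and>
        (SUP \<theta>'\<in>ball \<theta> \<epsilon>. regret A (B \<theta>') Q R p N T \<pi>) \<ge>
          ereal ((\<Sum>k = 1..nat \<lfloor>sqrt (real (T - 1))\<rfloor>.
            (excited_prob A B p N \<pi> \<mu> \<Gamma> k T)\<^sup>2 *
            trace (kron \<Gamma> (input_weight (B \<theta>) R (riccati A (B \<theta>) Q R) + E k)
              ** (gain_jacobian A B Q R \<theta> + F k)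
              ** info_mat A B L p N \<pi> \<mu> \<Psi> k T
              ** transpose (gain_jacobian A B Q R \<theta> + F k))) - c)))"
proof -
  let ?W = "input_weight (B \<theta>) R (riccati A (B \<theta>) Q R)" and ?G = "gain_jacobian A B Q R \<theta>"
  obtain e1 K cD where e1: "0 < e1" and K: "0 \<le> K" and cD: "0 \<le> cD"
    and main: "\<And>\<epsilon> \<mu>. 0 < \<epsilon> \<Longrightarrow> \<epsilon> < e1 \<Longrightarrow> prob_density \<mu> \<Longrightarrow> Cc_infinity (ball \<theta> \<epsilon>) \<mu> \<Longrightarrow>
      \<exists>c. \<forall>(N :: 'r measure) (\<pi> :: ('x, 'u, 'r) policy) T \<rho>.
        prob_space N \<longrightarrow> is_policy N \<pi> \<longrightarrow> info_finite A B L p N \<pi> \<mu> \<longrightarrow> 1 \<le> T \<longrightarrow> 0 \<le> \<rho> \<longrightarrow>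
        (\<forall>t\<in>ball \<theta> \<epsilon>. regret A (B t) Q R p N T \<pi> \<le> ereal \<rho>) \<longrightarrow>
        (\<exists>F. (\<forall>j. norm (F j) \<le> cD * \<epsilon>) \<and>
          (\<Sum>j = 1..nat \<lfloor>sqrt (real (T - 1))\<rfloor>. (excited_prob A B p N \<pi> \<mu> \<Gamma> j T)\<^sup>2 *
            trace (kron \<Gamma> ?W ** (?G + F j) ** info_mat A B L p N \<pi> \<mu> \<Psi> j T ** transpose (?G + F j)))
          \<le> (1 + K * \<epsilon>) * \<rho> + c)"
    by (rule regret_windows[OF A1 A2 A3 A4 \<Gamma> \<Psi>]) blast
  \<comment> \<open>The first two summands bound E and F when \<epsilon> is below e1; the third
    makes F = - \<open>?G\<close> admissible when it is not.\<close>
  define C where "C = K * norm ?W + cD + norm ?G / e1"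
  have C: "K * norm ?W \<le> C" "cD \<le> C" "norm ?G / e1 \<le> C" "0 \<le> C" using e1 K cD by (auto simp: C_def)
  show ?thesis
  proof (rule exI[of _ C], intro allI impI, elim conjE)
    fix \<epsilon> :: real and \<mu> :: "real^'d \<Rightarrow> real"
    assume \<epsilon>: "\<epsilon> > 0" and \<mu>: "prob_density \<mu>" "Cc_infinity (ball \<theta> \<epsilon>) \<mu>"
    have nn: "0 \<le> (SUP \<theta>'\<in>ball \<theta> \<epsilon>. regret A (B \<theta>') Q R p N T \<pi>)"
      if "is_policy N \<pi>" for N :: "'r measure" and \<pi> :: "('x, 'u, 'r) policy" and T :: nat
      using \<epsilon> regret_nonneg[OF that] by (intro SUP_upper2[of \<theta>]) auto
    let ?S = "\<lambda>(N :: 'r measure) (\<pi> :: ('x, 'u, 'r) policy) (T :: nat) (E :: nat \<Rightarrow> real^'u^'u) (F :: nat \<Rightarrow> real^'d^('x \<times> 'u)). \<Sum>k = 1..nat \<lfloor>sqrt (real (T - 1))\<rfloor>.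
            (excited_prob A B p N \<pi> \<mu> \<Gamma> k T)\<^sup>2 *
            trace (kron \<Gamma> (?W + E k) ** (?G + F k) ** info_mat A B L p N \<pi> \<mu> \<Psi> k T ** transpose (?G + F k))"
    have "\<exists>c. \<forall>(N :: 'r measure) (\<pi> :: ('x, 'u, 'r) policy) T. prob_space N \<longrightarrow> is_policy N \<pi> \<longrightarrow> info_finite A B L p N \<pi> \<mu> \<longrightarrow> 1 \<le> T \<longrightarrow>
        (\<exists>(E :: nat \<Rightarrow> real^'u^'u) (F :: nat \<Rightarrow> real^'d^('x \<times> 'u)). (\<forall>k. norm (E k) \<le> C * \<epsilon> \<and> norm (F k) \<le> C * \<epsilon>) \<and>
          (SUP \<theta>'\<in>ball \<theta> \<epsilon>. regret A (B \<theta>') Q R p N T \<pi>) \<ge> ereal (?S N \<pi> T E F - c))"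
    proof (cases "\<epsilon> < e1")
      case False
      \<comment> \<open>For \<epsilon> of at least e1 the whole Jacobian is within the allowed
        perturbation. Cancelling it makes every summand zero, and the regret is nonnegative.\<close>
      have "norm ?G = norm ?G / e1 * e1" using e1 by simp
      also have "\<dots> \<le> C * \<epsilon>" using False C e1 by (intro mult_mono) auto
      finally have G: "norm ?G \<le> C * \<epsilon>" .
      show ?thesis
        using nn G C \<epsilon> by (intro exI[of _ 0] allI impI exI[of _ "\<lambda>_. 0"] exI[of _ "\<lambda>_. - ?G"]) (auto simp: trace_def zero_ereal_def)
    next
      case True
      obtain c where c: "\<And>(N :: 'r measure) (\<pi> :: ('x, 'u, 'r) policy) T \<rho>.
        prob_space N \<Longrightarrow> is_policy N \<pi> \<Longrightarrow> info_finite A B L p N \<pi> \<mu> \<Longrightarrow> 1 \<le> T \<Longrightarrow> 0 \<le> \<rho> \<Longrightarrow>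
        (\<forall>t\<in>ball \<theta> \<epsilon>. regret A (B t) Q R p N T \<pi> \<le> ereal \<rho>) \<Longrightarrow>
        (\<exists>F. (\<forall>j. norm (F j) \<le> cD * \<epsilon>) \<and>
          (\<Sum>j = 1..nat \<lfloor>sqrt (real (T - 1))\<rfloor>. (excited_prob A B p N \<pi> \<mu> \<Gamma> j T)\<^sup>2 *
            trace (kron \<Gamma> ?W ** (?G + F j) ** info_mat A B L p N \<pi> \<mu> \<Psi> j T ** transpose (?G + F j)))
          \<le> (1 + K * \<epsilon>) * \<rho> + c)"
        using main[OF \<epsilon> True \<mu>] by blast
      let ?d = "1 + K * \<epsilon>"
      have Ke: "0 \<le> K * \<epsilon>" using K \<epsilon> by simp
      then have d: "1 \<le> ?d" by simp
      show ?thesis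
      proof (intro exI[of _ "\<bar>c\<bar>"] allI impI)
        fix N :: "'r measure" and \<pi> :: "('x, 'u, 'r) policy" and T :: nat
        assume as: "prob_space N" "is_policy N \<pi>" "info_finite A B L p N \<pi> \<mu>" "1 \<le> T"
        let ?U = "SUP \<theta>'\<in>ball \<theta> \<epsilon>. regret A (B \<theta>') Q R p N T \<pi>"
        \<comment> \<open>Chosen so that \<open>?W + E\<close> is \<open>?W\<close> divided by 1 + K
          \<epsilon>.\<close>
        define E where "E = - ((K * \<epsilon> / ?d) *\<^sub>R ?W)"
        have E: "norm E \<le> C * \<epsilon>"
        proof -
          have "K * \<epsilon> / ?d \<le> K * \<epsilon> / 1" using Ke d by (intro divide_left_mono) auto
          then have "K * \<epsilon> / ?d * norm ?W \<le> K * \<epsilon> * norm ?W" by (intro mult_right_mono) auto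
          also have "\<dots> \<le> C * \<epsilon>" using mult_right_mono[OF C(1), of \<epsilon>] \<epsilon> by (simp add: mult_ac)
          finally show ?thesis using Ke d by (simp add: E_def)
        qed
        show "\<exists>E F. (\<forall>k. norm (E k) \<le> C * \<epsilon> \<and> norm (F k) \<le> C * \<epsilon>) \<and> ?U \<ge> ereal (?S N \<pi> T E F - \<bar>c\<bar>)"
        proof (cases "?U = \<infinity>")
          case True
          then show ?thesis using C \<epsilon> by (intro exI[of _ "\<lambda>_. 0"]) auto
        next
          case False
          then obtain \<rho> where \<rho>: "?U = ereal \<rho>" "0 \<le> \<rho>" using nn[OF as(2), of T] by (cases ?U) auto
          have "\<forall>t\<in>ball \<theta> \<epsilon>. regret A (B t) Q R p N T \<pi> \<le> ereal \<rho>" unfolding \<rho>(1)[symmetric] by (intro ballI SUP_upper)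
          from c[OF as \<rho>(2) this] obtain F where F: "\<And>j. norm (F j) \<le> cD * \<epsilon>" and le: "?S N \<pi> T (\<lambda>_. 0) F \<le> ?d * \<rho> + c"
            by auto
          have "?W + E = (1 / ?d) *\<^sub>R ?W"
          proof -
            have "1 = K * \<epsilon> / ?d + 1 / ?d" using d by (simp add: add_divide_distrib[symmetric])
            then have "?W = (K * \<epsilon> / ?d + 1 / ?d) *\<^sub>R ?W" by simp
            then show ?thesis unfolding E_def by (simp add: scaleR_add_left algebra_simps)
          qed
          then have "?S N \<pi> T (\<lambda>_. E) F = 1 / ?d * ?S N \<pi> T (\<lambda>_. 0) F"
            by (simp add: kron_scaleR_right scalar_matrix_assoc[symmetric] trace_scaleR sum_distrib_left mult_ac)
          also have "\<dots> \<le> 1 / ?d * (?d * \<rho> + \<bar>c\<bar>)" using le d by (intro mult_left_mono) auto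
          also have "\<dots> = \<rho> + \<bar>c\<bar> / ?d" using d by (simp add: distrib_left)
          also have "\<bar>c\<bar> / ?d \<le> \<bar>c\<bar> / 1" using d by (intro divide_left_mono) auto
          finally have "ereal (?S N \<pi> T (\<lambda>_. E) F - \<bar>c\<bar>) \<le> ?U" unfolding \<rho>(1) by simp
          moreover have "norm (F k) \<le> C * \<epsilon>" for k using F[of k] mult_right_mono[OF C(2), of \<epsilon>] \<epsilon> by linarith
          ultimately show ?thesis using E by (intro exI[of _ "\<lambda>_. E"] exI[of _ F]) simp
        qed
      qed
    qed
    then show "\<exists>c. \<forall>(N :: 'r measure) (\<pi> :: ('x, 'u, 'r) policy).
      prob_space N \<and> is_policy N \<pi> \<and> info_finite A B L p N \<pi> \<mu> \<longrightarrow>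
      (\<forall>T\<ge>1. \<exists>(E :: nat \<Rightarrow> real^'u^'u) (F :: nat \<Rightarrow> real^'d^('x \<times> 'u)).
        (\<forall>k. norm (E k) \<le> C * \<epsilon> \<and> norm (F k) \<le> C * \<epsilon>) \<and>
        (SUP \<theta>'\<in>ball \<theta> \<epsilon>. regret A (B \<theta>') Q R p N T \<pi>) \<ge> ereal (?S N \<pi> T E F - c))"
      by blast
  qed
qed

end
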